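(* Assume that $u\in H^3(\Omega)$ is the exact solution of $-\nabla\cdot(a\nabla u)=f$ in $\Omega=(0,1)^2$, $u=g$ on $\partial\Omega$. Let $u_h=\{u_0,u_b\}\in V_h$ be the lowest order weak Galerkin approximation, i.e. the solution of $$\sum_{T\in\mathcal T_h}(a\nabla_d u_h,\nabla_d v)_T+s(u_h,v)=(f,v_0)\qquad\forall v=\{v_0,v_b\}\in V_h^0,$$ with the boundary value $u_b|_{\partial\Omega}=Q_b g$. Denote by $e_b=Q_bu-u_b$ the error function. Then $$\Big(\sum_{T\in\mathcal T_h}\|\nabla_d e_b\|_T^2\Big)^{1/2}\le C h^{1.5}\big(\|u\|_3+\|\nabla^2u\|_{0,\partial\Omega}\big).$$
   Context: Problem: $\Omega=(0,1)^2$; $f$, $g$ are given; $a=\{a_{ij}\}_{2\times2}$ is symmetric, uniformly bounded and positive definite in $\Omega$, and is a piecewise constant matrix with respect to the partition $\mathcal T_h$. Partition: $\mathcal T_h=\Delta_x\times\Delta_y$ is the (possibly nonuniform) rectangular partition of $\Omega$ with elements $[x_{i-1},x_i]\times[y_{j-1},y_j]$, where $0=x_0<\dots<x_n=1$, $0=y_0<\dots<y_m=1$. It is shape regular (aspect ratios of elements bounded independently of $h$). $h=\max_T h_T$ with $h_T$ the diameter of $T$. Spaces (lowest order): $V_h$ is the space of $v=\{v_0,v_b\}$ with $v_0|_T\in P_1(T)$ for each $T$ (no continuity imposed) and $v_b$ constant on each edge, single-valued on each edge of $\mathcal T_h$. $V_h^0=\{v\in V_h: v_b|_{\partial\Omega}=0\}$.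 Operators: $Q_b$ is the $L^2$ projection onto constants on each edge (the edge average). The discrete weak gradient $\nabla_d v\in[P_0(T)]^2$ on each $T$ is defined by $(\nabla_d v,\boldsymbol\psi)_T=-(v_0,\nabla\cdot\boldsymbol\psi)_T+\langle v_b,\boldsymbol\psi\cdot\mathbf n\rangle_{\partial T}$ for all $\boldsymbol\psi\in[P_0(T)]^2$, with $\mathbf n$ the unit outward normal (so it depends only on $v_b$, and $\nabla_d v_b$ is written accordingly). For $\rho>0$ a fixed parameter, $s(w,v)=\rho h^{-1}\sum_{T\in\mathcal T_h}\langle w_b-Q_bw_0,v_b-Q_bv_0\rangle_{\partial T}$. Norms: $\|\cdot\|_T$ is the $L^2(T)$ norm, $\|\cdot\|_3$ the $H^3(\Omega)$ norm, and $\|\nabla^2u\|_{0,\partial\Omega}$ the $L^2(\partial\Omega)$ norm of the second order derivatives of $u$. $C$ denotes a generic positive constant independent of $h$ and $u$. *)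

theory Defs
  imports "HOL-Analysis.Analysis"
begin

text \<open>
  Points of the plane are pairs of reals; gradients, normals and the coefficient matrix
  live in \<^typ>\<open>real^2\<close> and \<^typ>\<open>real^2^2\<close>.
\<close>

definition unit_square :: "(real \<times> real) set" where
  "unit_square = {0<..<1} \<times> {0<..<1}"

text \<open>The four sides of the unit square, each given by its end points.\<close>

definition sides :: "((real \<times> real) \<times> (real \<times> real)) set" where
  "sides = {((0,0),(1,0)), ((1,0),(1,1)), ((0,1),(1,1)), ((0,0),(0,1))}"


subsection \<open>Smooth functions and test functions\<close>

definition dx :: "(real \<times> real \<Rightarrow> real) \<Rightarrow> real \<times> real \<Rightarrow> real" where
  "dx \<phi> z = deriv (\<lambda>r. \<phi> (r, snd z)) (fst z)"

definition dy :: "(real \<times> real \<Rightarrow> real) \<Rightarrow> real \<times> real \<Rightarrow> real" where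
  "dy \<phi> z = deriv (\<lambda>r. \<phi> (fst z, r)) (snd z)"

definition partial :: "nat \<Rightarrow> nat \<Rightarrow> (real \<times> real \<Rightarrow> real) \<Rightarrow> real \<times> real \<Rightarrow> real" where
  "partial p q \<phi> = (dx ^^ p) ((dy ^^ q) \<phi>)"

definition gradient :: "(real \<times> real \<Rightarrow> real) \<Rightarrow> real \<times> real \<Rightarrow> real^2" where
  "gradient \<phi> z = vector [dx \<phi> z, dy \<phi> z]"

definition divergence :: "(real \<times> real \<Rightarrow> real^2) \<Rightarrow> real \<times> real \<Rightarrow> real" where
  "divergence \<Psi> z = dx (\<lambda>y. \<Psi> y $ 1) z + dy (\<lambda>y. \<Psi> y $ 2) z"

primrec C_k :: "nat \<Rightarrow> (real \<times> real \<Rightarrow> real) \<Rightarrow> bool" where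
  "C_k 0 \<phi> \<longleftrightarrow> continuous_on UNIV \<phi>"
| "C_k (Suc k) \<phi> \<longleftrightarrow> (\<forall>z. \<phi> differentiable (at z)) \<and> C_k k (dx \<phi>) \<and> C_k k (dy \<phi>)"

definition smooth :: "(real \<times> real \<Rightarrow> real) \<Rightarrow> bool" where
  "smooth \<phi> \<longleftrightarrow> (\<forall>k. C_k k \<phi>)"

definition test_functions :: "(real \<times> real) set \<Rightarrow> (real \<times> real \<Rightarrow> real) set" where
  "test_functions D =
     {\<phi>. smooth \<phi> \<and> compact (closure {z. \<phi> z \<noteq> 0}) \<and> closure {z. \<phi> z \<noteq> 0} \<subseteq> D}"


subsection \<open>Sobolev spaces\<close>

definition L2 :: "'a::euclidean_space set \<Rightarrow> ('a \<Rightarrow> real) set" where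
  "L2 D = {w. w \<in> borel_measurable (lebesgue_on D) \<and> integrable (lebesgue_on D) (\<lambda>z. (w z)\<^sup>2)}"

definition is_weak_deriv ::
    "(real \<times> real) set \<Rightarrow> nat \<Rightarrow> nat \<Rightarrow> (real \<times> real \<Rightarrow> real) \<Rightarrow> (real \<times> real \<Rightarrow> real) \<Rightarrow> bool" where
  "is_weak_deriv D p q w w' \<longleftrightarrow>
     (\<forall>\<phi>\<in>test_functions D.
        (\<integral>z. w z * partial p q \<phi> z \<partial>lebesgue_on D) =
        (-1) ^ (p + q) * (\<integral>z. w' z * \<phi> z \<partial>lebesgue_on D))"

definition sobolev :: "nat \<Rightarrow> (real \<times> real) set \<Rightarrow> (real \<times> real \<Rightarrow> real) set" where
  "sobolev k D =
     {w \<in> L2 D. \<forall>p q. p + q \<le> k \<longrightarrow> (\<exists>w'\<in>L2 D. is_weak_deriv D p q w w')}"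

text \<open>A representative; on an open set it is unique up to a null set.\<close>

definition weak_deriv ::
    "(real \<times> real) set \<Rightarrow> nat \<Rightarrow> nat \<Rightarrow> (real \<times> real \<Rightarrow> real) \<Rightarrow> real \<times> real \<Rightarrow> real" where
  "weak_deriv D p q w = (SOME w'. w' \<in> L2 D \<and> is_weak_deriv D p q w w')"

definition weak_gradient ::
    "(real \<times> real) set \<Rightarrow> (real \<times> real \<Rightarrow> real) \<Rightarrow> real \<times> real \<Rightarrow> real^2" where
  "weak_gradient D w z = vector [weak_deriv D 1 0 w z, weak_deriv D 0 1 w z]"

definition sobolev_norm :: "nat \<Rightarrow> (real \<times> real) set \<Rightarrow> (real \<times> real \<Rightarrow> real) \<Rightarrow> real" where
  "sobolev_norm k D w =
     sqrt (\<Sum>(p, q)\<in>{(p, q). p + q \<le> k}. \<integral>z. (weak_deriv D p q w z)\<^sup>2 \<partial>lebesgue_on D)"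


subsection \<open>Traces on segments\<close>

text \<open>Integral with respect to arc length over the segment with end points \<open>P\<close>, \<open>Q\<close>.\<close>

definition seg_integral ::
    "(real \<times> real) \<times> (real \<times> real) \<Rightarrow> (real \<times> real \<Rightarrow> real) \<Rightarrow> real" where
  "seg_integral S F =
     (case S of (P, Q) \<Rightarrow> dist P Q * (\<integral>t. F (linepath P Q t) \<partial>lebesgue_on {0..1}))"

text \<open>
  The trace of an \<open>H\<^sup>1\<close> function on a segment in the closure of \<open>D\<close> is the extension by
  continuity of the restriction map, from functions smooth up to the boundary: \<open>\<tau>\<close> is the
  limit in \<open>L\<^sup>2\<close> of the segment of restrictions of smooth functions converging to \<open>w\<close> in
  \<open>H\<^sup>1(D)\<close>.  Only the values of \<open>\<tau>\<close> on the segment matter.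
\<close>

definition is_trace ::
    "(real \<times> real) set \<Rightarrow> (real \<times> real) \<times> (real \<times> real) \<Rightarrow> (real \<times> real \<Rightarrow> real)
      \<Rightarrow> (real \<times> real \<Rightarrow> real) \<Rightarrow> bool" where
  "is_trace D S w \<tau> \<longleftrightarrow>
     w \<in> sobolev 1 D \<and> (\<lambda>t. \<tau> (linepath (fst S) (snd S) t)) \<in> L2 {0..1} \<and>
     (\<exists>\<phi>. (\<forall>k. smooth (\<phi> k)) \<and>
          (\<lambda>k. sobolev_norm 1 D (\<lambda>z. \<phi> k z - w z)) \<longlonglongrightarrow> 0 \<and>
          (\<lambda>k. seg_integral S (\<lambda>z. (\<phi> k z - \<tau> z)\<^sup>2)) \<longlonglongrightarrow> 0)"

definition trace_on ::
    "(real \<times> real) set \<Rightarrow> (real \<times> real) \<times> (real \<times> real) \<Rightarrow> (real \<times> real \<Rightarrow> real)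
      \<Rightarrow> real \<times> real \<Rightarrow> real" where
  "trace_on D S w = (SOME \<tau>. is_trace D S w \<tau>)"

text \<open>
  The \<open>L\<^sup>2\<close> norm over the boundary of the unit square of the Hessian of \<open>u\<close>, measured
  pointwise in the Frobenius norm.
\<close>

definition hessian_bdry_norm :: "(real \<times> real \<Rightarrow> real) \<Rightarrow> real" where
  "hessian_bdry_norm u =
     sqrt (\<Sum>S\<in>sides. seg_integral S (\<lambda>z.
        (trace_on unit_square S (weak_deriv unit_square 2 0 u) z)\<^sup>2
        + 2 * (trace_on unit_square S (weak_deriv unit_square 1 1 u) z)\<^sup>2
        + (trace_on unit_square S (weak_deriv unit_square 0 2 u) z)\<^sup>2))"


subsection \<open>The boundary value problem\<close>

definition elliptic_coeff :: "(real \<times> real \<Rightarrow> real^2^2) \<Rightarrow> bool" where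
  "elliptic_coeff a \<longleftrightarrow>
     (\<forall>z\<in>unit_square. transpose (a z) = a z) \<and>
     (\<exists>B. \<forall>z\<in>unit_square. \<forall>i j. \<bar>a z $ i $ j\<bar> \<le> B) \<and>
     (\<exists>\<alpha>>0. \<forall>z\<in>unit_square. \<forall>\<xi>. \<alpha> * (norm \<xi>)\<^sup>2 \<le> \<xi> \<bullet> (a z *v \<xi>))"

text \<open>
  The equation is understood in the sense of distributions, since the coefficient may jump;
  the boundary condition is understood in the sense of traces.
\<close>

definition solves_bvp ::
    "(real \<times> real \<Rightarrow> real^2^2) \<Rightarrow> (real \<times> real \<Rightarrow> real) \<Rightarrow> (real \<times> real \<Rightarrow> real)
      \<Rightarrow> (real \<times> real \<Rightarrow> real) \<Rightarrow> bool" where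
  "solves_bvp a f g u \<longleftrightarrow>
     (\<forall>\<phi>\<in>test_functions unit_square.
        (\<integral>z. (a z *v weak_gradient unit_square u z) \<bullet> gradient \<phi> z \<partial>lebesgue_on unit_square) =
        (\<integral>z. f z * \<phi> z \<partial>lebesgue_on unit_square)) \<and>
     (\<forall>S\<in>sides. is_trace unit_square S u g)"


subsection \<open>Rectangular partitions\<close>

text \<open>Only the nodes \<open>xs 0, \<dots>, xs nx\<close> and \<open>ys 0, \<dots>, ys ny\<close> are relevant.\<close>

record mesh =
  nx :: nat
  ny :: nat
  xs :: "nat \<Rightarrow> real"
  ys :: "nat \<Rightarrow> real"

definition is_mesh :: "mesh \<Rightarrow> bool" where
  "is_mesh M \<longleftrightarrow>
     xs M 0 = 0 \<and> xs M (nx M) = 1 \<and> (\<forall>i<nx M. xs M i < xs M (i + 1)) \<and>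
     ys M 0 = 0 \<and> ys M (ny M) = 1 \<and> (\<forall>j<ny M. ys M j < ys M (j + 1))"

text \<open>The element with index \<open>(i, j)\<close> has lower left corner \<open>(xs i, ys j)\<close>.\<close>

definition cells :: "mesh \<Rightarrow> (nat \<times> nat) set" where
  "cells M = {..<nx M} \<times> {..<ny M}"

definition elem :: "mesh \<Rightarrow> nat \<times> nat \<Rightarrow> (real \<times> real) set" where
  "elem M c = (case c of (i, j) \<Rightarrow> {xs M i..xs M (i + 1)} \<times> {ys M j..ys M (j + 1)})"

definition mesh_size :: "mesh \<Rightarrow> real" where
  "mesh_size M = Max ((\<lambda>c. diameter (elem M c)) ` cells M)"

definition aspect_bounded :: "real \<Rightarrow> mesh \<Rightarrow> bool" where
  "aspect_bounded \<sigma> M \<longleftrightarrow>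
     (\<forall>(i, j)\<in>cells M.
        xs M (i + 1) - xs M i \<le> \<sigma> * (ys M (j + 1) - ys M j) \<and>
        ys M (j + 1) - ys M j \<le> \<sigma> * (xs M (i + 1) - xs M i))"

definition piecewise_const :: "mesh \<Rightarrow> (real \<times> real \<Rightarrow> real^2^2) \<Rightarrow> bool" where
  "piecewise_const M a \<longleftrightarrow> (\<forall>c\<in>cells M. \<exists>A. \<forall>z\<in>interior (elem M c). a z = A)"

text \<open>
  \<open>VEdge i j\<close> is the segment from \<open>(xs i, ys j)\<close> to \<open>(xs i, ys (j + 1))\<close>, and \<open>HEdge i j\<close> the
  one from \<open>(xs i, ys j)\<close> to \<open>(xs (i + 1), ys j)\<close>.
\<close>

datatype edge = VEdge nat nat | HEdge nat nat

fun ends :: "mesh \<Rightarrow> edge \<Rightarrow> (real \<times> real) \<times> (real \<times> real)" where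
  "ends M (VEdge i j) = ((xs M i, ys M j), (xs M i, ys M (j + 1)))"
| "ends M (HEdge i j) = ((xs M i, ys M j), (xs M (i + 1), ys M j))"

definition bdry_edges :: "mesh \<Rightarrow> edge set" where
  "bdry_edges M =
     {VEdge i j |i j. (i = 0 \<or> i = nx M) \<and> j < ny M} \<union>
     {HEdge i j |i j. i < nx M \<and> (j = 0 \<or> j = ny M)}"

text \<open>The edges of an element, paired with the unit outward normals.\<close>

definition elem_edges :: "nat \<times> nat \<Rightarrow> (edge \<times> (real^2)) set" where
  "elem_edges c = (case c of (i, j) \<Rightarrow>
     {(VEdge i j, vector [-1, 0]), (VEdge (i + 1) j, vector [1, 0]),
      (HEdge i j, vector [0, -1]), (HEdge i (j + 1), vector [0, 1])})"


subsection \<open>The weak Galerkin scheme\<close>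

text \<open>
  A weak function \<open>{v_0, v_b}\<close> is a family of functions indexed by the elements together with
  a constant for each edge.  Values at indices outside the partition are irrelevant.
\<close>

type_synonym wfun = "(nat \<times> nat \<Rightarrow> real \<times> real \<Rightarrow> real) \<times> (edge \<Rightarrow> real)"

definition P1 :: "(real \<times> real \<Rightarrow> real) set" where
  "P1 = {p. \<exists>c0 c1 c2. \<forall>z. p z = c0 + c1 * fst z + c2 * snd z}"

definition V_h :: "mesh \<Rightarrow> wfun set" where
  "V_h M = {v. \<forall>c\<in>cells M. fst v c \<in> P1}"

definition V_h0 :: "mesh \<Rightarrow> wfun set" where
  "V_h0 M = {v \<in> V_h M. \<forall>e\<in>bdry_edges M. snd v e = 0}"

text \<open>The \<open>L\<^sup>2\<close> projection onto the constants on an edge.\<close>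

definition Q_b :: "mesh \<Rightarrow> edge \<Rightarrow> (real \<times> real \<Rightarrow> real) \<Rightarrow> real" where
  "Q_b M e w = seg_integral (ends M e) w / dist (fst (ends M e)) (snd (ends M e))"

text \<open>
  The discrete weak gradient is constant on each element and is therefore represented there by
  a vector; likewise the test field \<open>\<psi>\<close> ranges over constant vector fields.
\<close>

definition wgrad :: "mesh \<Rightarrow> wfun \<Rightarrow> nat \<times> nat \<Rightarrow> real^2" where
  "wgrad M v c = (THE G. \<forall>\<psi>::real^2.
     (\<integral>z. G \<bullet> \<psi> \<partial>lebesgue_on (elem M c)) =
     - (\<integral>z. fst v c z * divergence (\<lambda>_. \<psi>) z \<partial>lebesgue_on (elem M c))
     + (\<Sum>(e, n)\<in>elem_edges c. seg_integral (ends M e) (\<lambda>_. snd v e * (\<psi> \<bullet> n))))"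

text \<open>The discrete weak gradient of an edge function; the interior part is immaterial
  (lemma \<open>wgrad_cong\<close>).\<close>

definition wgrad_b :: "mesh \<Rightarrow> (edge \<Rightarrow> real) \<Rightarrow> nat \<times> nat \<Rightarrow> real^2" where
  "wgrad_b M v_b = wgrad M (\<lambda>_ _. 0, v_b)"

definition stabilizer :: "real \<Rightarrow> mesh \<Rightarrow> wfun \<Rightarrow> wfun \<Rightarrow> real" where
  "stabilizer \<rho> M w v =
     \<rho> * inverse (mesh_size M) *
     (\<Sum>c\<in>cells M. \<Sum>(e, n)\<in>elem_edges c.
        seg_integral (ends M e)
          (\<lambda>_. (snd w e - Q_b M e (fst w c)) * (snd v e - Q_b M e (fst v c))))"

definition is_wg_solution ::
    "real \<Rightarrow> mesh \<Rightarrow> (real \<times> real \<Rightarrow> real^2^2) \<Rightarrow> (real \<times> real \<Rightarrow> real)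
      \<Rightarrow> (real \<times> real \<Rightarrow> real) \<Rightarrow> wfun \<Rightarrow> bool" where
  "is_wg_solution \<rho> M a f g u_h \<longleftrightarrow>
     u_h \<in> V_h M \<and>
     (\<forall>e\<in>bdry_edges M. snd u_h e = Q_b M e g) \<and>
     (\<forall>v\<in>V_h0 M.
        (\<Sum>c\<in>cells M. \<integral>z. (a z *v wgrad M u_h c) \<bullet> wgrad M v c \<partial>lebesgue_on (elem M c))
        + stabilizer \<rho> M u_h v =
        (\<Sum>c\<in>cells M. \<integral>z. f z * fst v c z \<partial>lebesgue_on (elem M c)))"

text \<open>\<open>e_b = Q_b u - u_b\<close>, where \<open>Q_b u\<close> is taken from the trace of \<open>u\<close> on the edge.\<close>

definition edge_error :: "mesh \<Rightarrow> (real \<times> real \<Rightarrow> real) \<Rightarrow> wfun \<Rightarrow> edge \<Rightarrow> real" where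
  "edge_error M u u_h e = Q_b M e (trace_on unit_square (ends M e) u) - snd u_h e"

lemma divergence_const [simp]: "divergence (\<lambda>_. \<psi>) z = 0"
  by (simp add: divergence_def dx_def dy_def)

lemma wgrad_cong: "snd v = snd w \<Longrightarrow> wgrad M v c = wgrad M w c"
  by (simp add: wgrad_def)

lemma wgrad_eq:
  assumes "is_mesh M" "(i, j) \<in> cells M"
  shows "wgrad M v (i, j) =
    vector [(snd v (VEdge (i + 1) j) - snd v (VEdge i j)) / (xs M (i + 1) - xs M i),
            (snd v (HEdge i (j + 1)) - snd v (HEdge i j)) / (ys M (j + 1) - ys M j)]"
proof -
  define X where "X = xs M (i + 1) - xs M i"
  define Y where "Y = ys M (j + 1) - ys M j"
  have pos: "X > 0" "Y > 0"
    using assms by (auto simp: is_mesh_def cells_def X_def Y_def)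
  have cb: "elem M (i, j) = cbox (xs M i, ys M j) (xs M (i + 1), ys M (j + 1))"
    by (simp add: elem_def cbox_Pair_eq)
  have area: "measure lebesgue (elem M (i, j)) = X * Y"
  proof -
    have "measure lebesgue (elem M (i, j)) = measure lborel (elem M (i, j))"
      by (simp add: cb)
    also have "\<dots> = X * Y"
      unfolding cb using pos
      by (simp add: content_Pair X_def Y_def)
    finally show ?thesis .
  qed
  have int_const: "(\<integral>z. (k::real) \<partial>lebesgue_on (elem M (i, j))) = X * Y * k" for k
    by (simp add: area cb measure_restrict_space flip: area)
  have sv: "seg_integral (ends M (VEdge i' j)) (\<lambda>_. k) = Y * k" for i' k
    using pos by (simp add: seg_integral_def dist_Pair_Pair dist_real_def Y_def measure_restrict_space)
  have sh: "seg_integral (ends M (HEdge i j')) (\<lambda>_. k) = X * k" for j' k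
    using pos by (simp add: seg_integral_def dist_Pair_Pair dist_real_def X_def measure_restrict_space)
  have *: "(\<integral>z. G \<bullet> \<psi> \<partial>lebesgue_on (elem M (i, j))) =
     - (\<integral>z. fst v (i, j) z * divergence (\<lambda>_. \<psi>) z \<partial>lebesgue_on (elem M (i, j)))
     + (\<Sum>(e, n)\<in>elem_edges (i, j). seg_integral (ends M e) (\<lambda>_. snd v e * (\<psi> \<bullet> n)))
     \<longleftrightarrow> X * Y * (G $ 1 * \<psi> $ 1 + G $ 2 * \<psi> $ 2) =
       Y * (snd v (VEdge (i + 1) j) - snd v (VEdge i j)) * \<psi> $ 1 +
       X * (snd v (HEdge i (j + 1)) - snd v (HEdge i j)) * \<psi> $ 2" for G \<psi> :: "real^2"
    unfolding int_const
    by (simp add: elem_edges_def sv sh inner_vec_def sum_2 algebra_simps del: ends.simps)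
  show ?thesis
    unfolding wgrad_def * X_def [symmetric] Y_def [symmetric]
  proof (rule the_equality)
    fix G :: "real^2"
    assume G: "\<forall>\<psi>::real^2. X * Y * (G $ 1 * \<psi> $ 1 + G $ 2 * \<psi> $ 2) =
       Y * (snd v (VEdge (i + 1) j) - snd v (VEdge i j)) * \<psi> $ 1 +
       X * (snd v (HEdge i (j + 1)) - snd v (HEdge i j)) * \<psi> $ 2"
    have "Y * (X * G $ 1 - (snd v (VEdge (i + 1) j) - snd v (VEdge i j))) = 0"
      (is "_ * ?A = 0")
      using spec [OF G, of "vector [1, 0]"] by (simp add: algebra_simps)
    then have 1: "?A = 0" using pos by (metis less_irrefl mult_eq_0_iff)
    have "X * (Y * G $ 2 - (snd v (HEdge i (j + 1)) - snd v (HEdge i j))) = 0"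
      (is "_ * ?B = 0")
      using spec [OF G, of "vector [0, 1]"] by (simp add: algebra_simps)
    then have 2: "?B = 0" using pos by (metis less_irrefl mult_eq_0_iff)
    show "G = vector [(snd v (VEdge (i + 1) j) - snd v (VEdge i j)) / X,
                      (snd v (HEdge i (j + 1)) - snd v (HEdge i j)) / Y]"
      using pos 1 2 by (simp add: vec_eq_iff forall_2 field_simps)
  qed (use pos in \<open>simp add: field_simps\<close>)
qed

end

theory Submission
  imports Defs
begin

text \<open>
  Testing the scheme with an edge function and its least squares extension into the cells, and
  the differential equation with functions of one variable that are piecewise linear on the
  mesh, yields an error equation for the edge values alone.  Its leading term is, on every
  cell, \<open>\<alpha> - \<gamma>\<close> times the component of the edge function that affine functions do not see;
  \<open>\<alpha>\<close> and \<open>\<gamma>\<close> are cell means of second derivatives of \<open>u\<close>, of order \<open>h\<^sup>2\<close>.  The edge function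
  that equals \<open>- \<alpha> / 2\<close> on horizontal and \<open>- \<gamma> / 2\<close> on vertical edges absorbs this term up to
  differences between neighbouring cells, which the third derivatives of \<open>u\<close> control.  It has to
  vanish on the boundary and on the lines where \<open>a\<close> may jump; these all pass through the nodes
  of one fixed mesh, so their number does not depend on \<open>h\<close>.  On the strip of cells along such
  a line, \<open>\<alpha>\<close> or \<open>\<gamma>\<close> is compared with its mean over the whole square in the direction across the
  line, and this is where half a power of \<open>h\<close> is lost.

  Weak derivatives are tested with bounded pointwise limits of products of test functions of
  one variable.  These include indicator functions of intervals times polynomials, so that no
  density theorem is needed; the trace of \<open>u\<close> on an edge then has an explicit average over
  the adjacent cell.
\<close>

subsection \<open>Smooth functions of one variable\<close>

text \<open>A cell has four edge values, an affine function three parameters: eliminating the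
  interior unknowns leaves the two slopes of the weak gradient and one further mode per cell,
  \<open>beta\<close>. Its consistency error \<alpha> - \<gamma> is of order h^2 on each of about
  h^-2 cells and enters with the bounded weight \<open>kappa\<close> / h, so a direct energy
  argument bounds the squared error by h^2 only. After correction, a cell off the special lines
  contributes h^4 times a local energy. On a special line the corrector is cut off, and the squares
  of \<alpha> or \<gamma> are bounded by h^3 times the energy of the strips crossing the line, which
  add up to h^3 per line. This is the exponent 3/2.

  Edge values of \<open>u\<close> are averages of \<open>trace_on\<close>, a choice operator, so a
  trace must be shown to exist on every edge. The smooth functions converging to \<open>u\<close> in
  the H^1 norm are taken from the boundary condition; the volume formula for edge averages makes
  them converge on every segment parallel to an axis.

  The slopes of the corrector are controlled by quasi-uniformity, which a product mesh inherits from
  bounded aspect ratios.\<close>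

primrec Ck1 :: "nat \<Rightarrow> (real \<Rightarrow> real) \<Rightarrow> bool" where
  "Ck1 0 f \<longleftrightarrow> continuous_on UNIV f"
| "Ck1 (Suc k) f \<longleftrightarrow> (\<forall>x. f differentiable (at x)) \<and> Ck1 k (deriv f)"

text \<open>Only functions of one variable are constructed; \<open>C_k_tensor\<close> makes their
  products smooth in the sense of \<open>smooth\<close>.\<close>

definition smooth1 :: "(real \<Rightarrow> real) \<Rightarrow> bool" where
  "smooth1 f \<longleftrightarrow> (\<forall>k. Ck1 k f)"

lemma differentiable_iff_has_real_derivative:
  "(f :: real \<Rightarrow> real) differentiable (at x) \<longleftrightarrow> (\<exists>d. (f has_real_derivative d) (at x))"
  by (auto simp: real_differentiable_def)

lemma Ck1_SucI:
  assumes "\<And>x. (f has_real_derivative f' x) (at x)" "Ck1 k f'"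
  shows "Ck1 (Suc k) f"
proof -
  have "deriv f = f'" using DERIV_imp_deriv[OF assms(1)] by (intro ext)
  then show ?thesis using assms by (auto simp: differentiable_iff_has_real_derivative)
qed

lemma Ck1_continuous: "Ck1 k f \<Longrightarrow> continuous_on UNIV f"
proof (cases k)
  case (Suc n)
  assume "Ck1 k f"
  then have "\<And>x. f differentiable (at x)" using Suc by simp
  then show ?thesis
    by (simp add: continuous_on_eq_continuous_at differentiable_imp_continuous_within)
qed simp

lemma Ck1_mono: "Ck1 (Suc k) f \<Longrightarrow> Ck1 k f"
proof (induction k arbitrary: f)
  case 0
  from Ck1_continuous[OF this] show ?case by simp
qed auto

lemma Ck1_deriv: "Ck1 (Suc k) f \<Longrightarrow> (f has_real_derivative deriv f x) (at x)"
  by (metis Ck1.simps(2) DERIV_imp_deriv differentiable_iff_has_real_derivative)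

lemma Ck1_add: "Ck1 k f \<Longrightarrow> Ck1 k g \<Longrightarrow> Ck1 k (\<lambda>x. f x + g x)"
proof (induction k arbitrary: f g)
  case (Suc k)
  show ?case
  proof (rule Ck1_SucI)
    show "((\<lambda>x. f x + g x) has_real_derivative deriv f x + deriv g x) (at x)" for x
      using Suc.prems by (intro DERIV_add Ck1_deriv)
  qed (use Suc in auto)
qed (auto intro!: continuous_intros)

lemma Ck1_mult: "Ck1 k f \<Longrightarrow> Ck1 k g \<Longrightarrow> Ck1 k (\<lambda>x. f x * g x)"
proof (induction k arbitrary: f g)
  case (Suc k)
  show ?case
  proof (rule Ck1_SucI)
    show "((\<lambda>x. f x * g x) has_real_derivative deriv f x * g x + deriv g x * f x) (at x)" for x
      using Suc.prems by (intro DERIV_mult Ck1_deriv)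
    show "Ck1 k (\<lambda>x. deriv f x * g x + deriv g x * f x)"
      using Suc.prems Ck1_mono[OF Suc.prems(1)] Ck1_mono[OF Suc.prems(2)] by (intro Ck1_add Suc.IH) auto
  qed
qed (auto intro!: continuous_intros)

lemma smooth1_const: "smooth1 (\<lambda>_. c)"
proof -
  have "Ck1 k (\<lambda>_. c)" for k and c :: real
  proof (induction k arbitrary: c)
    case (Suc k)
    show ?case by (rule Ck1_SucI[OF _ Suc[of 0]]) simp
  qed simp
  then show ?thesis by (simp add: smooth1_def)
qed

lemma smooth1_id: "smooth1 (\<lambda>x. x)"
proof -
  have "Ck1 k (\<lambda>x. x)" for k
  proof (cases k)
    case (Suc n)
    have "Ck1 (Suc n) (\<lambda>x. x)"
      using smooth1_const[of 1] by (intro Ck1_SucI[where f'="\<lambda>_. 1"]) (auto simp: smooth1_def)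
    with Suc show ?thesis by simp
  qed simp
  then show ?thesis by (simp add: smooth1_def)
qed

lemma smooth1_add: "smooth1 f \<Longrightarrow> smooth1 g \<Longrightarrow> smooth1 (\<lambda>x. f x + g x)"
  by (simp add: smooth1_def Ck1_add)

lemma smooth1_mult: "smooth1 f \<Longrightarrow> smooth1 g \<Longrightarrow> smooth1 (\<lambda>x. f x * g x)"
  by (simp add: smooth1_def Ck1_mult)

lemma smooth1_cmult: "smooth1 f \<Longrightarrow> smooth1 (\<lambda>x. c * f x)"
  by (intro smooth1_mult smooth1_const)

lemma smooth1_diff: "smooth1 f \<Longrightarrow> smooth1 g \<Longrightarrow> smooth1 (\<lambda>x. f x - g x)"
  using smooth1_add[of f "\<lambda>x. -1 * g x"] smooth1_cmult[of g "-1"] by simp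

lemmas smooth1_intros = smooth1_const smooth1_id smooth1_add smooth1_mult smooth1_diff

lemma smooth1_Ck1: "smooth1 f \<Longrightarrow> Ck1 k f"
  by (simp add: smooth1_def)

lemma smooth1_DERIV: "smooth1 f \<Longrightarrow> (f has_real_derivative deriv f x) (at x)"
  by (rule Ck1_deriv[OF smooth1_Ck1])

lemma smooth1_deriv: "smooth1 f \<Longrightarrow> smooth1 (deriv f)"
  unfolding smooth1_def using Ck1.simps(2) by blast

lemma smooth1_I: "(\<And>x. (f has_real_derivative f' x) (at x)) \<Longrightarrow> smooth1 f' \<Longrightarrow> smooth1 f"
  unfolding smooth1_def using Ck1_mono Ck1_SucI by blast

lemma smooth1_continuous_on: "smooth1 f \<Longrightarrow> continuous_on S f"
  by (rule continuous_on_subset[OF Ck1_continuous[OF smooth1_Ck1]]) auto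

lemma smooth1_affine:
  assumes "smooth1 f" shows "smooth1 (\<lambda>x. f (c * x + d))"
proof -
  have "Ck1 k f \<Longrightarrow> Ck1 k (\<lambda>x. f (c * x + d))" for k
  proof (induction k arbitrary: f)
    case 0
    then have "continuous_on UNIV f" by simp
    then have "continuous_on UNIV (\<lambda>x. f (c * x + d))"
      by (rule continuous_on_compose2) (auto intro!: continuous_intros)
    then show ?case by simp
  next
    case (Suc k)
    show ?case
    proof (rule Ck1_SucI)
      show "((\<lambda>x. f (c * x + d)) has_real_derivative deriv f (c * x + d) * c) (at x)" for x
        by (rule DERIV_chain2[OF Ck1_deriv[OF Suc.prems]]) (auto intro!: derivative_eq_intros)
      have "Ck1 k (\<lambda>_. c)" using smooth1_const by (rule smooth1_Ck1)
      with Suc show "Ck1 k (\<lambda>x. deriv f (c * x + d) * c)"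
        by (intro Ck1_mult) auto
    qed
  qed
  then show ?thesis using assms by (simp add: smooth1_def)
qed

section \<open>A smooth cutoff that is flat at the origin\<close>

definition exp_inv :: "nat \<Rightarrow> real \<Rightarrow> real" where
  "exp_inv n t = (if t \<le> 0 then 0 else inverse t ^ n * exp (- inverse t))"

lemma exp_inv_tendsto_0: "((\<lambda>t. exp_inv n t) \<longlongrightarrow> 0) (at 0)"
proof (rule filterlim_split_at)
  show "((\<lambda>t. exp_inv n t) \<longlongrightarrow> 0) (at_left 0)"
    by (rule tendsto_eventually) (auto simp: eventually_at_filter exp_inv_def)
  have "((\<lambda>t::real. inverse t ^ n / exp (inverse t)) \<longlongrightarrow> 0) (at_right 0)"
    using filterlim_compose[OF tendsto_power_div_exp_0 filterlim_inverse_at_top_right] by simp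
  then show "((\<lambda>t. exp_inv n t) \<longlongrightarrow> 0) (at_right 0)"
    by (rule Lim_transform_eventually)
       (auto simp: eventually_at_filter exp_inv_def exp_minus divide_inverse intro!: always_eventually)
qed

text \<open>Differentiation stays in the linear span of the family, so the smoothness of all members
  follows from one induction on the order.\<close>

lemma DERIV_exp_inv:
  "(exp_inv n has_real_derivative exp_inv (n + 2) t - of_nat n * exp_inv (n + 1) t) (at t)"
proof (cases t "0::real" rule: linorder_cases)
  case less
  have "((\<lambda>_. 0) has_real_derivative exp_inv (n + 2) t - of_nat n * exp_inv (n + 1) t) (at t)"
    using less by (simp add: exp_inv_def)
  then show ?thesis
    by (rule has_field_derivative_transform_within_open[of _ _ _ "{..<0}"])
       (use less in \<open>auto simp: exp_inv_def\<close>)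
next
  case equal
  \<comment> \<open>The difference quotient of \<open>exp_inv n\<close> at 0 is
    \<open>exp_inv (Suc n)\<close>.\<close>
  have "((\<lambda>y. (exp_inv n y - exp_inv n 0) / (y - 0)) \<longlongrightarrow> 0) (at 0)"
    by (rule Lim_transform_eventually[OF exp_inv_tendsto_0[of "Suc n"]])
       (auto simp: eventually_at_filter exp_inv_def divide_simps intro!: always_eventually)
  then show ?thesis
    using equal by (simp add: has_field_derivative_iff exp_inv_def)
next
  case greater
  have i: "(inverse has_real_derivative - (inverse t * inverse t)) (at t)"
    using DERIV_inverse[of t UNIV] greater by (simp add: power2_eq_square)
  have "((\<lambda>t. inverse t ^ n * exp (- inverse t)) has_real_derivative
      exp_inv (n + 2) t - of_nat n * exp_inv (n + 1) t) (at t)"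
    by (rule DERIV_cong[OF DERIV_mult[OF DERIV_power[OF i] DERIV_fun_exp[OF DERIV_minus[OF i]]]])
       (use greater in \<open>cases n; simp add: exp_inv_def algebra_simps\<close>)
  then show ?thesis
    by (rule has_field_derivative_transform_within_open[of _ _ _ "{0<..}"])
       (use greater in \<open>auto simp: exp_inv_def\<close>)
qed

lemma smooth1_exp_inv: "smooth1 (exp_inv n)"
proof -
  have "Ck1 k (exp_inv n)" for k
  proof (induction k arbitrary: n)
    case 0
    then show ?case
      by (simp add: continuous_on_eq_continuous_at DERIV_isCont[OF DERIV_exp_inv])
  next
    case (Suc k)
    have "Ck1 k (\<lambda>t. exp_inv (n + 2) t + (- of_nat n) * exp_inv (n + 1) t)"
      using smooth1_const by (intro Ck1_add Ck1_mult Suc) (auto simp: smooth1_def)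
    then show ?case by (intro Ck1_SucI[OF DERIV_exp_inv]) simp
  qed
  then show ?thesis by (simp add: smooth1_def)
qed

lemma exp_inv_bounds: "0 \<le> exp_inv 0 t" "exp_inv 0 t \<le> 1"
  by (auto simp: exp_inv_def)

lemma exp_inv_tendsto_1: "((\<lambda>t. exp_inv 0 t) \<longlongrightarrow> 1) at_top"
proof -
  have "((\<lambda>t::real. exp (- inverse t)) \<longlongrightarrow> exp (- 0)) at_top"
    by (intro tendsto_intros tendsto_inverse_0_at_top filterlim_ident)
  then have "((\<lambda>t::real. exp (- inverse t)) \<longlongrightarrow> 1) at_top" by simp
  then show ?thesis
    by (rule Lim_transform_eventually)
       (auto simp: exp_inv_def eventually_at_top_dense intro!: exI[of _ 0])
qed

subsection \<open>Test functions on an interval and their bounded pointwise limits\<close>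

text \<open>The support is enclosed in an explicit closed subinterval instead of being taken as a
  closure, which keeps sums and restrictions elementary. A choice \<open>a' > b'\<close> is allowed
  and leaves only the zero function.\<close>

definition test1 :: "real \<Rightarrow> real \<Rightarrow> (real \<Rightarrow> real) set" where
  "test1 a b = {p. smooth1 p \<and> (\<exists>a' b'. a < a' \<and> b' < b \<and> (\<forall>x. x \<notin> {a'..b'} \<longrightarrow> p x = 0))}"

definition test1_limits :: "real \<Rightarrow> real \<Rightarrow> (real \<Rightarrow> real) set" where
  "test1_limits a b = {g. \<exists>G K. (\<forall>k::nat. G k \<in> test1 a b) \<and> (\<forall>k x. \<bar>G k x\<bar> \<le> K) \<and>
     (\<forall>x. (\<lambda>k. G k x) \<longlonglongrightarrow> g x)}"

lemma test1_smooth: "p \<in> test1 a b \<Longrightarrow> smooth1 p"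
  by (simp add: test1_def)

lemma test1_outside: "p \<in> test1 a b \<Longrightarrow> x \<notin> {a<..<b} \<Longrightarrow> p x = 0"
  by (force simp: test1_def)

lemma test1_add:
  assumes "p \<in> test1 a b" "q \<in> test1 a b" shows "(\<lambda>x. p x + q x) \<in> test1 a b"
proof -
  obtain a1 b1 where 1: "a < a1" "b1 < b" "\<And>x. x \<notin> {a1..b1} \<Longrightarrow> p x = 0"
    using assms by (auto simp: test1_def)
  obtain a2 b2 where 2: "a < a2" "b2 < b" "\<And>x. x \<notin> {a2..b2} \<Longrightarrow> q x = 0"
    using assms by (auto simp: test1_def)
  have "p x + q x = 0" if "x \<notin> {min a1 a2..max b1 b2}" for x
  proof -
    have "x \<notin> {a1..b1}" "x \<notin> {a2..b2}" using that by auto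
    then show ?thesis using 1(3) 2(3) by simp
  qed
  moreover have "a < min a1 a2" "max b1 b2 < b" using 1 2 by auto
  moreover have "smooth1 (\<lambda>x. p x + q x)"
    using assms by (auto simp: test1_def intro: smooth1_add)
  ultimately show ?thesis unfolding test1_def by blast
qed

lemma test1_mult: "smooth1 f \<Longrightarrow> p \<in> test1 a b \<Longrightarrow> (\<lambda>x. f x * p x) \<in> test1 a b"
  by (force simp: test1_def intro: smooth1_mult)

lemma test1_diff: "p \<in> test1 a b \<Longrightarrow> q \<in> test1 a b \<Longrightarrow> (\<lambda>x. p x - q x) \<in> test1 a b"
  using test1_add[of p a b "\<lambda>x. -1 * q x"] test1_mult[OF smooth1_const, of q a b "-1"] by simp

lemma test1_mono:
  assumes "p \<in> test1 c d" "a \<le> c" "d \<le> b" shows "p \<in> test1 a b"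
  using assms by (force simp: test1_def)

lemma test1_deriv:
  assumes "p \<in> test1 a b" shows "deriv p \<in> test1 a b"
proof -
  obtain a1 b1 where 1: "a < a1" "b1 < b" "\<And>x. x \<notin> {a1..b1} \<Longrightarrow> p x = 0"
    using assms by (auto simp: test1_def)
  have "deriv p x = 0" if "x \<notin> {a1..b1}" for x
  proof -
    have "((\<lambda>_. 0) has_real_derivative 0) (at x)" by simp
    then have "(p has_real_derivative 0) (at x)"
      by (rule has_field_derivative_transform_within_open[of _ _ _ "- {a1..b1}"])
         (use that 1 in auto)
    then show ?thesis by (rule DERIV_imp_deriv)
  qed
  then show ?thesis using assms 1 by (auto simp: test1_def smooth1_deriv)
qed

lemma test1_bounded:
  assumes "p \<in> test1 a b" obtains K where "\<And>x. \<bar>p x\<bar> \<le> K"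
proof -
  have "bounded (p ` {a..b})"
    using assms by (intro compact_imp_bounded compact_continuous_image smooth1_continuous_on)
      (auto simp: test1_def)
  then obtain K where K: "\<And>x. x \<in> {a..b} \<Longrightarrow> \<bar>p x\<bar> \<le> K"
    unfolding bounded_iff real_norm_def by blast
  have "\<bar>p x\<bar> \<le> max K 0" for x
    using K[of x] test1_outside[OF assms, of x] by (cases "x \<in> {a<..<b}") auto
  then show ?thesis using that by blast
qed

text \<open>To the right of the support an antiderivative is constant, and the vanishing integral
  makes this constant 0. Zero mean is thus the condition for compact support.\<close>

lemma test1_antiderivative:
  assumes p: "p \<in> test1 a b" and int: "integral {a..b} p = 0"
  shows "(\<lambda>x. integral {a..x} p) \<in> test1 a b"
    and "((\<lambda>x. integral {a..x} p) has_real_derivative p x) (at x)"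
proof -
  obtain a1 b1 where 1: "a < a1" "b1 < b" "\<And>x. x \<notin> {a1..b1} \<Longrightarrow> p x = 0"
    using p by (auto simp: test1_def)
  have cont: "continuous_on S p" for S
    using p by (auto simp: test1_def intro: smooth1_continuous_on)
  have intg: "p integrable_on {c..d}" for c d
    using cont by (rule integrable_continuous_real)
  have left: "integral {a..x} p = 0" if "x < a1" for x
  proof -
    have "integral {a..x} p = integral {a..x} (\<lambda>_. 0)"
      by (rule Henstock_Kurzweil_Integration.integral_cong) (use that 1 in auto)
    then show ?thesis by simp
  qed
  have right: "integral {a..x} p = 0" if "b1 < x" for x
  proof (cases "a \<le> x")
    case True
    show ?thesis
    proof (cases "x \<le> b")
      case xb: True
      have "integral {a..x} p + integral {x..b} p = 0"
        using int True xb intg by (simp add: Henstock_Kurzweil_Integration.integral_combine)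
      moreover have "integral {x..b} p = integral {x..b} (\<lambda>_. 0)"
        by (rule Henstock_Kurzweil_Integration.integral_cong) (use that 1 in auto)
      ultimately show ?thesis by simp
    next
      case xb: False
      show ?thesis
      proof (cases "a \<le> b")
        case ab: True
        have "integral {a..x} p = integral {a..b} p + integral {b..x} p"
          using ab xb intg by (simp add: Henstock_Kurzweil_Integration.integral_combine)
        moreover have "integral {b..x} p = integral {b..x} (\<lambda>_. 0)"
          by (rule Henstock_Kurzweil_Integration.integral_cong) (use that 1 in auto)
        ultimately show ?thesis using int by simp
      next
        case False
        have "integral {a..x} p = integral {a..x} (\<lambda>_. 0)"
          by (rule Henstock_Kurzweil_Integration.integral_cong) (use False 1 in auto)
        then show ?thesis by simp
      qed
    qed
  qed simp
  show D: "((\<lambda>x. integral {a..x} p) has_real_derivative p x) (at x)" for x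
  proof (cases "x < a1")
    case True
    have "((\<lambda>_. 0) has_real_derivative p x) (at x)" using True 1 by simp
    then show ?thesis
      by (rule has_field_derivative_transform_within_open[of _ _ _ "{..<a1}"])
         (use True left in auto)
  next
    case False
    have "((\<lambda>u. integral {a..u} p) has_real_derivative p x) (at x within {a..x+1})"
      by (rule integral_has_real_derivative[OF cont]) (use False 1 in auto)
    moreover have "x \<in> interior {a..x+1}" using False 1 by auto
    ultimately show ?thesis by (metis at_within_interior)
  qed
  have "smooth1 (\<lambda>x. integral {a..x} p)"
    using D test1_smooth[OF p] by (rule smooth1_I)
  moreover have "\<forall>x. x \<notin> {a1..b1} \<longrightarrow> integral {a..x} p = 0"
  proof (intro allI impI)
    fix x assume "x \<notin> {a1..b1}"
    then have "x < a1 \<or> b1 < x" by auto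
    then show "integral {a..x} p = 0" using left right by blast
  qed
  ultimately show "(\<lambda>x. integral {a..x} p) \<in> test1 a b"
    unfolding test1_def using 1(1,2) by blast
qed

lemma test1_limits_I:
  assumes "\<And>k. G k \<in> test1 a b" "\<And>k x. \<bar>G k x\<bar> \<le> K" "\<And>x. (\<lambda>k. G k x) \<longlonglongrightarrow> g x"
  shows "g \<in> test1_limits a b"
  unfolding test1_limits_def by (intro CollectI exI[of _ G] exI[of _ K] conjI allI assms)

lemma test1_limits_E:
  assumes "g \<in> test1_limits a b"
  obtains G K where "\<And>k. G k \<in> test1 a b" "\<And>k x. \<bar>G k x\<bar> \<le> K" "\<And>x. (\<lambda>k. G k x) \<longlonglongrightarrow> g x" "K \<ge> 0"
proof -
  obtain G K where G: "\<And>k. G k \<in> test1 a b" "\<And>k x. \<bar>G k x\<bar> \<le> K" "\<And>x. (\<lambda>k. G k x) \<longlonglongrightarrow> g x"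
    using assms unfolding test1_limits_def by blast
  moreover have "K \<ge> 0" using G(2)[of 0 0] by linarith
  ultimately show ?thesis using that by blast
qed

lemma test1_in_limits: "p \<in> test1 a b \<Longrightarrow> p \<in> test1_limits a b"
proof -
  assume p: "p \<in> test1 a b"
  then obtain K where "\<And>x. \<bar>p x\<bar> \<le> K" by (rule test1_bounded) blast
  with p show ?thesis by (intro test1_limits_I[of "\<lambda>_. p" _ _ K]) simp_all
qed

lemma test1_limits_add:
  assumes "f \<in> test1_limits a b" "g \<in> test1_limits a b"
  shows "(\<lambda>x. f x + g x) \<in> test1_limits a b"
proof -
  obtain F K where F: "\<And>k. F k \<in> test1 a b" "\<And>k x. \<bar>F k x\<bar> \<le> K" "\<And>x. (\<lambda>k. F k x) \<longlonglongrightarrow> f x"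
    using assms(1) by (rule test1_limits_E) blast
  obtain G L where G: "\<And>k. G k \<in> test1 a b" "\<And>k x. \<bar>G k x\<bar> \<le> L" "\<And>x. (\<lambda>k. G k x) \<longlonglongrightarrow> g x"
    using assms(2) by (rule test1_limits_E) blast
  show ?thesis
  proof (rule test1_limits_I[of "\<lambda>k x. F k x + G k x" _ _ "K + L"])
    show "\<bar>F k x + G k x\<bar> \<le> K + L" for k x using F(2)[of k x] G(2)[of k x] by linarith
  qed (use F G in \<open>auto intro: test1_add tendsto_add\<close>)
qed

lemma test1_limits_mult:
  assumes "f \<in> test1_limits a b" "g \<in> test1_limits c d"
  shows "(\<lambda>x. f x * g x) \<in> test1_limits a b"
proof -
  obtain F K where F: "\<And>k. F k \<in> test1 a b" "\<And>k x. \<bar>F k x\<bar> \<le> K" "\<And>x. (\<lambda>k. F k x) \<longlonglongrightarrow> f x" "K \<ge> 0"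
    using assms(1) by (rule test1_limits_E) blast
  obtain G L where G: "\<And>k. G k \<in> test1 c d" "\<And>k x. \<bar>G k x\<bar> \<le> L" "\<And>x. (\<lambda>k. G k x) \<longlonglongrightarrow> g x" "L \<ge> 0"
    using assms(2) by (rule test1_limits_E) blast
  show ?thesis
  proof (rule test1_limits_I[of "\<lambda>k x. F k x * G k x" _ _ "K * L"])
    show "\<bar>F k x * G k x\<bar> \<le> K * L" for k x
      unfolding abs_mult using F G by (intro mult_mono) auto
    show "(\<lambda>x. F k x * G k x) \<in> test1 a b" for k
      using test1_mult[OF test1_smooth[OF G(1)[of k]] F(1)[of k]] by (simp add: mult.commute)
  qed (use F G in \<open>auto intro: tendsto_mult\<close>)
qed

text \<open>A smooth \<open>f\<close> may be unbounded on the line. Its bound on [a, b] suffices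
  because the approximants vanish outside, which is how polynomials on a cell enter the
  class.\<close>

lemma test1_limits_smooth_mult:
  assumes "smooth1 f" "g \<in> test1_limits a b"
  shows "(\<lambda>x. f x * g x) \<in> test1_limits a b"
proof -
  have "bounded (f ` {a..b})"
    using assms by (intro compact_imp_bounded compact_continuous_image smooth1_continuous_on) auto
  then obtain K where K: "\<And>x. x \<in> {a..b} \<Longrightarrow> \<bar>f x\<bar> \<le> K"
    unfolding bounded_iff real_norm_def by blast
  obtain G L where G: "\<And>k. G k \<in> test1 a b" "\<And>k x. \<bar>G k x\<bar> \<le> L" "\<And>x. (\<lambda>k. G k x) \<longlonglongrightarrow> g x" "L \<ge> 0"
    using assms(2) by (rule test1_limits_E) blast
  show ?thesis
  proof (rule test1_limits_I[of "\<lambda>k x. f x * G k x" _ _ "max K 0 * L"])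
    show "\<bar>f x * G k x\<bar> \<le> max K 0 * L" for k x
    proof (cases "x \<in> {a<..<b}")
      case True
      then show ?thesis unfolding abs_mult using G K[of x] by (intro mult_mono) auto
    next
      case False
      then show ?thesis using test1_outside[OF G(1) False] G(4) by simp
    qed
    show "(\<lambda>x. f x * G k x) \<in> test1 a b" for k
      using test1_mult[OF assms(1) G(1)] .
  qed (use G in \<open>auto intro: tendsto_mult\<close>)
qed

lemma test1_limits_cmult: "g \<in> test1_limits a b \<Longrightarrow> (\<lambda>x. c * g x) \<in> test1_limits a b"
  by (intro test1_limits_smooth_mult smooth1_const)

lemma test1_limits_mono:
  assumes "g \<in> test1_limits c d" "a \<le> c" "d \<le> b" shows "g \<in> test1_limits a b"
  using assms unfolding test1_limits_def by (blast intro: test1_mono)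

lemma test1_limits_outside:
  assumes "g \<in> test1_limits a b" "x \<notin> {a<..<b}" shows "g x = 0"
proof -
  obtain G K where G: "\<And>k. G k \<in> test1 a b" "\<And>k x. \<bar>G k x\<bar> \<le> K" "\<And>x. (\<lambda>k. G k x) \<longlonglongrightarrow> g x"
    using assms(1) by (rule test1_limits_E) blast
  have "(\<lambda>k. G k x) = (\<lambda>k. 0)" using test1_outside[OF G(1) assms(2)] by (intro ext)
  then show ?thesis using G(3)[of x] by (simp add: LIMSEQ_const_iff)
qed

text \<open>Each factor vanishes up to distance 1/k from its end point, so the support is compact in
  the open interval. At a fixed interior point both arguments tend to infinity with k, so the
  product tends to 1.\<close>

lemma test1_bump:
  assumes "(k::real) > 0"
  shows "(\<lambda>x. exp_inv 0 (k * (x - a) - 1) * exp_inv 0 (k * (b - x) - 1)) \<in> test1 a b"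
proof -
  have "smooth1 (\<lambda>x. exp_inv 0 (k * x + (- k * a - 1)) * exp_inv 0 ((- k) * x + (k * b - 1)))"
    by (intro smooth1_mult smooth1_affine smooth1_exp_inv)
  then have "smooth1 (\<lambda>x. exp_inv 0 (k * (x - a) - 1) * exp_inv 0 (k * (b - x) - 1))"
    by (simp add: algebra_simps)
  moreover have "a < a + 1 / k" "b - 1 / k < b" using assms by auto
  moreover have "exp_inv 0 (k * (x - a) - 1) * exp_inv 0 (k * (b - x) - 1) = 0"
    if "x \<notin> {a + 1/k..b - 1/k}" for x
  proof -
    have "x < a + 1/k \<or> b - 1/k < x" using that by auto
    then have "k * (x - a) - 1 \<le> 0 \<or> k * (b - x) - 1 \<le> 0" using assms by (auto simp: field_simps)
    then show ?thesis by (auto simp: exp_inv_def)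
  qed
  ultimately show ?thesis unfolding test1_def by blast
qed

lemma indicator_test1_limits: "indicator {a<..<b} \<in> test1_limits a b"
proof (rule test1_limits_I[where K=1 and
    G="\<lambda>k x. exp_inv 0 (real (Suc k) * (x - a) - 1) * exp_inv 0 (real (Suc k) * (b - x) - 1)"])
  show "\<bar>exp_inv 0 (real (Suc k) * (x - a) - 1) * exp_inv 0 (real (Suc k) * (b - x) - 1)\<bar> \<le> 1" for k x
    using exp_inv_bounds by (auto simp: abs_mult intro!: mult_le_one)
  show "(\<lambda>k. exp_inv 0 (real (Suc k) * (x - a) - 1) * exp_inv 0 (real (Suc k) * (b - x) - 1))
      \<longlonglongrightarrow> indicator {a<..<b} x" for x
  proof (cases "x \<in> {a<..<b}")
    case True
    have lim: "(\<lambda>k. exp_inv 0 (real (Suc k) * y - 1)) \<longlonglongrightarrow> 1" if "y > 0" for y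
    proof -
      have "filterlim (\<lambda>k. - 1 + real k * y) at_top sequentially"
        by (intro filterlim_tendsto_add_at_top[OF tendsto_const]
              filterlim_at_top_mult_tendsto_pos[OF tendsto_const that] filterlim_real_sequentially)
      then have "filterlim (\<lambda>k. real k * y - 1) at_top sequentially" by simp
      then have "(\<lambda>k. exp_inv 0 (real k * y - 1)) \<longlonglongrightarrow> 1"
        by (rule filterlim_compose[OF exp_inv_tendsto_1])
      then show ?thesis by (rule LIMSEQ_Suc)
    qed
    have "(\<lambda>k. exp_inv 0 (real (Suc k) * (x - a) - 1) * exp_inv 0 (real (Suc k) * (b - x) - 1))
        \<longlonglongrightarrow> 1 * 1"
      using True by (intro tendsto_mult lim) auto
    then show ?thesis using True by simp
  next
    case False
    have "exp_inv 0 (real (Suc k) * (x - a) - 1) * exp_inv 0 (real (Suc k) * (b - x) - 1) = 0" for k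
      using test1_outside[OF test1_bump False, of "real (Suc k)"] by simp
    moreover have "indicator {a<..<b} x = (0::real)" using False by (simp add: indicator_def)
    ultimately show ?thesis by (simp only: tendsto_const)
  qed
qed (rule test1_bump, simp)

lemma test1_normalized:
  assumes "a < b" obtains \<omega> where "\<omega> \<in> test1 a b" "integral {a..b} \<omega> = 1"
proof -
  \<comment> \<open>With this k both arguments of \<open>exp_inv 0\<close> equal 1 at the midpoint,
    so \<open>w\<close> is positive there.\<close>
  define k where "k = 4 / (b - a)"
  have k: "k > 0" using assms by (simp add: k_def)
  define w where "w = (\<lambda>x. exp_inv 0 (k * (x - a) - 1) * exp_inv 0 (k * (b - x) - 1))"
  have w: "w \<in> test1 a b" unfolding w_def using k by (rule test1_bump)
  have cont: "continuous_on {a..b} w" using w by (auto simp: test1_def intro: smooth1_continuous_on)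
  have nn: "\<And>x. w x \<ge> 0" by (simp add: w_def exp_inv_bounds)
  have "integral {a..b} w \<noteq> 0"
  proof
    assume "integral {a..b} w = 0"
    have "w x = 0" if "x \<in> {a..b}" for x
    proof -
      have "(w has_integral 0) (cbox a b)"
        using integrable_integral[OF integrable_continuous_real[OF cont]]
          \<open>integral {a..b} w = 0\<close> by simp
      then show ?thesis
        using has_integral_0_cbox_imp_0[of a b w x] cont nn assms that by simp
    qed
    moreover have "k * ((a + b) / 2 - a) - 1 = 1" "k * (b - (a + b) / 2) - 1 = 1"
      using assms by (auto simp: k_def field_simps)
    then have "w ((a + b) / 2) > 0" by (simp add: w_def exp_inv_def)
    moreover have "(a + b) / 2 \<in> {a..b}" using assms by auto
    ultimately show False by (metis less_irrefl)
  qed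
  then show ?thesis
    using that[of "\<lambda>x. inverse (integral {a..b} w) * w x"] test1_mult[OF smooth1_const w] by simp
qed

subsection \<open>Square integrable functions on the unit square\<close>

abbreviation mu :: "(real \<times> real) measure" where
  "mu \<equiv> lebesgue_on unit_square"

lemma box_prod_eq: "box (a, c) (b, d) = {a<..<b} \<times> {c<..<d}" for a b c d :: real
  by (auto simp: box_def Basis_prod_def)

lemma unit_square_box: "unit_square = box (0,0) (1,1)"
  by (auto simp: unit_square_def box_prod_eq)

lemma unit_square_lebesgue [simp]: "unit_square \<in> sets lebesgue"
  by (simp add: unit_square_box)

lemma measure_lebesgue_box:
  fixes a b c d :: real
  assumes "a \<le> b" "c \<le> d"
  shows "measure lebesgue (box (a,c) (b,d)) = (b - a) * (d - c)"
proof -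
  have "measure lebesgue (box (a,c) (b,d)) = measure lborel (box (a,c) (b,d))" by simp
  also have "\<dots> = (b - a) * (d - c)"
    using assms by (subst measure_lborel_box_eq) (auto simp: Basis_prod_def inner_Pair_0 prod.union_disjoint)
  finally show ?thesis .
qed

lemma finite_measure_mu: "finite_measure mu"
  by (rule finite_measureI) (simp add: emeasure_restrict_space unit_square_box emeasure_lborel_box_eq)

lemma L2_measurable: "w \<in> L2 D \<Longrightarrow> w \<in> borel_measurable (lebesgue_on D)"
  by (simp add: L2_def)

lemma L2_mult_integrable:
  assumes "v \<in> L2 D" "w \<in> L2 D" shows "integrable (lebesgue_on D) (\<lambda>z. v z * w z)"
proof (rule Bochner_Integration.integrable_bound)
  show "integrable (lebesgue_on D) (\<lambda>z. (v z)\<^sup>2 + (w z)\<^sup>2)"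
    using assms by (auto simp: L2_def)
  show "(\<lambda>z. v z * w z) \<in> borel_measurable (lebesgue_on D)"
    using assms by (auto simp: L2_def)
  have "\<bar>x * y\<bar> \<le> x\<^sup>2 + y\<^sup>2" for x y :: real
  proof -
    have "2 * (\<bar>x\<bar> * \<bar>y\<bar>) \<le> x\<^sup>2 + y\<^sup>2"
      using sum_squares_bound[of "\<bar>x\<bar>" "\<bar>y\<bar>"] by simp
    moreover have "0 \<le> \<bar>x\<bar> * \<bar>y\<bar>" by simp
    ultimately show ?thesis unfolding abs_mult by linarith
  qed
  then show "AE z in lebesgue_on D. norm (v z * w z) \<le> norm ((v z)\<^sup>2 + (w z)\<^sup>2)"
    by simp
qed

lemma L2_add:
  assumes "v \<in> L2 D" "w \<in> L2 D" shows "(\<lambda>z. v z + w z) \<in> L2 D"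
proof -
  have "integrable (lebesgue_on D) (\<lambda>z. (v z)\<^sup>2 + 2 * (v z * w z) + (w z)\<^sup>2)"
    using assms L2_mult_integrable[OF assms] by (auto simp: L2_def)
  then have "integrable (lebesgue_on D) (\<lambda>z. (v z + w z)\<^sup>2)"
    by (simp add: power2_sum algebra_simps)
  then show ?thesis using assms by (auto simp: L2_def)
qed

lemma L2_bounded_mult:
  assumes "w \<in> L2 D" "g \<in> borel_measurable (lebesgue_on D)" "\<And>z. z \<in> D \<Longrightarrow> \<bar>g z\<bar> \<le> K"
    "D \<in> sets lebesgue"
  shows "(\<lambda>z. w z * g z) \<in> L2 D"
proof -
  have "integrable (lebesgue_on D) (\<lambda>z. (w z * g z)\<^sup>2)"
  proof (rule Bochner_Integration.integrable_bound)
    show "integrable (lebesgue_on D) (\<lambda>z. K\<^sup>2 * (w z)\<^sup>2)"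
      using assms by (auto simp: L2_def)
    show "AE z in lebesgue_on D. norm ((w z * g z)\<^sup>2) \<le> norm (K\<^sup>2 * (w z)\<^sup>2)"
    proof (rule AE_I2)
      fix z assume "z \<in> space (lebesgue_on D)"
      then have "\<bar>g z\<bar> \<le> K" using assms(3,4) by simp
      then have "(g z)\<^sup>2 \<le> K\<^sup>2" using power_mono[of "\<bar>g z\<bar>" K 2] by simp
      then show "norm ((w z * g z)\<^sup>2) \<le> norm (K\<^sup>2 * (w z)\<^sup>2)"
        by (simp add: power_mult_distrib mult.commute mult_right_mono)
    qed
  qed (use assms in \<open>auto simp: L2_def\<close>)
  then show ?thesis using assms by (auto simp: L2_def)
qed

lemma L2_cmult: "w \<in> L2 D \<Longrightarrow> (\<lambda>z. c * w z) \<in> L2 D"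
  by (auto simp: L2_def power_mult_distrib)

lemma L2_diff: "v \<in> L2 D \<Longrightarrow> w \<in> L2 D \<Longrightarrow> (\<lambda>z. v z - w z) \<in> L2 D"
  using L2_add[of v D "\<lambda>z. -1 * w z"] L2_cmult[of w D "-1"] by simp

lemma L2_sum: "finite I \<Longrightarrow> (\<And>i. i \<in> I \<Longrightarrow> f i \<in> L2 D) \<Longrightarrow> (\<lambda>z. \<Sum>i\<in>I. f i z) \<in> L2 D"
proof (induction I rule: finite_induct)
  case empty
  then show ?case by (simp add: L2_def)
next
  case (insert i I)
  then show ?case using L2_add[of "f i" D "\<lambda>z. \<Sum>i\<in>I. f i z"] by simp
qed

lemma bounded_in_L2:
  assumes "g \<in> borel_measurable mu" "\<And>z. z \<in> unit_square \<Longrightarrow> \<bar>g z\<bar> \<le> K"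
  shows "g \<in> L2 unit_square"
proof -
  interpret finite_measure mu by (rule finite_measure_mu)
  have "(\<lambda>_. 1) \<in> L2 unit_square" by (simp add: L2_def)
  from L2_bounded_mult[OF this assms(1,2)] show ?thesis by simp
qed

lemma L2_integrable:
  assumes "w \<in> L2 unit_square" shows "integrable mu w"
  using L2_mult_integrable[OF assms bounded_in_L2[of "\<lambda>_. 1" 1]] by simp

lemma L2_Cauchy_Schwarz:
  assumes "v \<in> L2 D" "w \<in> L2 D"
  shows "(\<integral>z. v z * w z \<partial>lebesgue_on D)\<^sup>2 \<le>
    (\<integral>z. (v z)\<^sup>2 \<partial>lebesgue_on D) * (\<integral>z. (w z)\<^sup>2 \<partial>lebesgue_on D)"
proof -
  let ?I = "\<lambda>f. \<integral>z. f z \<partial>lebesgue_on D"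
  define A B C where "A = ?I (\<lambda>z. (v z)\<^sup>2)" and "B = ?I (\<lambda>z. v z * w z)" and "C = ?I (\<lambda>z. (w z)\<^sup>2)"
  have int: "integrable (lebesgue_on D) (\<lambda>z. (v z)\<^sup>2)" "integrable (lebesgue_on D) (\<lambda>z. (w z)\<^sup>2)"
    "integrable (lebesgue_on D) (\<lambda>z. v z * w z)"
    using assms L2_mult_integrable[OF assms] by (auto simp: L2_def)
  \<comment> \<open>The squared norm of x v + y w as a quadratic form. For C > 0 it is evaluated at
    x = C, y = - B; for C = 0 it is affine in y and would reach -1 unless B = 0.\<close>
  have nn: "A * x\<^sup>2 + 2 * (B * (x * y)) + C * y\<^sup>2 \<ge> 0" for x y
  proof -
    have "A * x\<^sup>2 + 2 * (B * (x * y)) + C * y\<^sup>2 =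
        ?I (\<lambda>z. (v z)\<^sup>2 * x\<^sup>2 + v z * w z * (2 * (x * y)) + (w z)\<^sup>2 * y\<^sup>2)"
      unfolding A_def B_def C_def using int by simp
    also have "\<dots> = ?I (\<lambda>z. (v z * x + w z * y)\<^sup>2)"
      by (simp add: power2_sum power_mult_distrib algebra_simps)
    also have "\<dots> \<ge> 0" by simp
    finally show ?thesis .
  qed
  have "A \<ge> 0" "C \<ge> 0" by (simp_all add: A_def C_def)
  show ?thesis unfolding A_def[symmetric] B_def[symmetric] C_def[symmetric]
  proof (cases "C = 0")
    case True
    have "B = 0"
    proof (rule ccontr)
      assume "B \<noteq> 0"
      then show False using nn[of 1 "- (A + 1) / (2 * B)"] True \<open>A \<ge> 0\<close> by (simp add: field_simps)
    qed
    then show "B\<^sup>2 \<le> A * C" using True by simp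
  next
    case False
    have "C * (A * C - B\<^sup>2) \<ge> 0"
      using nn[of C "- B"] by (simp add: algebra_simps power2_eq_square)
    then show "B\<^sup>2 \<le> A * C" using False \<open>C \<ge> 0\<close> by (simp add: zero_le_mult_iff)
  qed
qed

subsection \<open>Weak derivatives tested with bounded pointwise limits of test functions\<close>

text \<open>
  Everything that concerns one direction is proved for a pair of coordinate functions, so that
  it applies to rows and to columns of the mesh alike.
\<close>

locale coordinates =
  fixes s t :: "real \<times> real \<Rightarrow> real"
  assumes coords: "(s = fst \<and> t = snd) \<or> (s = snd \<and> t = fst)"
begin

lemma coord_range: "z \<in> unit_square \<Longrightarrow> s z \<in> {0<..<1} \<and> t z \<in> {0<..<1}"
  using coords by (auto simp: unit_square_def)

lemma coord_measurable [measurable]: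
  "s \<in> borel_measurable (lebesgue_on D)" "t \<in> borel_measurable (lebesgue_on D)"
proof -
  have "fst \<in> borel_measurable (lebesgue_on D)" "snd \<in> borel_measurable (lebesgue_on D)"
    by (intro borel_measurable_continuous_onI measurable_restrict_space1 measurable_completion
        continuous_intros; simp)+
  then show "s \<in> borel_measurable (lebesgue_on D)" "t \<in> borel_measurable (lebesgue_on D)"
    using coords by auto
qed

lemma integral_rect:
  assumes "0 \<le> a" "a \<le> b" "b \<le> 1" "0 \<le> c" "c \<le> d" "d \<le> 1"
  shows "(\<integral>z. indicator {a<..<b} (s z) * indicator {c<..<d} (t z) \<partial>mu) = (b - a) * (d - c)"
proof -
  have *: "(\<integral>z. indicator {a<..<b} (fst z) * indicator {c<..<d} (snd z) \<partial>mu) = (b - a) * (d - c)"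
    if "0 \<le> a" "a \<le> b" "b \<le> 1" "0 \<le> c" "c \<le> d" "d \<le> 1" for a b c d :: real
  proof -
    have sub: "box (a,c) (b,d) \<subseteq> unit_square"
      using that by (auto simp: unit_square_def box_prod_eq)
    have "(\<integral>z. indicator {a<..<b} (fst z) * indicator {c<..<d} (snd z) \<partial>mu) =
        (\<integral>z. (indicator (box (a,c) (b,d)) z :: real) \<partial>mu)"
      by (intro Bochner_Integration.integral_cong) (auto simp: indicator_def box_prod_eq)
    also have "\<dots> = measure mu (box (a,c) (b,d) \<inter> space mu)"
      by (rule Bochner_Integration.integral_indicator)
    also have "\<dots> = measure lebesgue (box (a,c) (b,d))"
      using sub by (simp add: measure_restrict_space Int_absorb2)
    finally show ?thesis using measure_lebesgue_box that by simp
  qed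
  from coords show ?thesis
    using *[of a b c d] *[of c d a b] assms by (auto simp: mult.commute)
qed

end

lemma test1_limits_measurable:
  assumes "g \<in> test1_limits a b" shows "g \<in> borel_measurable borel"
proof -
  obtain G K where G: "\<And>k. G k \<in> test1 a b" "\<And>k x. \<bar>G k x\<bar> \<le> K" "\<And>x. (\<lambda>k. G k x) \<longlonglongrightarrow> g x"
    using assms by (rule test1_limits_E) blast
  have "\<And>k. G k \<in> borel_measurable borel"
    using G(1) by (intro borel_measurable_continuous_onI smooth1_continuous_on test1_smooth)
  then show ?thesis using G(3) by (rule borel_measurable_LIMSEQ_real[rotated])
qed

lemma test1_limits_bounded:
  assumes "g \<in> test1_limits a b" obtains K where "K \<ge> 0" "\<And>x. \<bar>g x\<bar> \<le> K"
proof -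
  obtain G K where G: "\<And>k. G k \<in> test1 a b" "\<And>k x. \<bar>G k x\<bar> \<le> K" "\<And>x. (\<lambda>k. G k x) \<longlonglongrightarrow> g x" "K \<ge> 0"
    using assms by (rule test1_limits_E) blast
  have "\<bar>g x\<bar> \<le> K" for x
    by (rule LIMSEQ_le_const2[OF tendsto_rabs[OF G(3)]]) (use G(2) in auto)
  then show ?thesis using that G(4) by blast
qed

context coordinates
begin

lemma tensor_measurable:
  assumes "f \<in> test1_limits a b" "g \<in> test1_limits c d"
  shows "(\<lambda>z. f (s z) * g (t z)) \<in> borel_measurable (lebesgue_on D)"
  using measurable_compose[OF coord_measurable(1) test1_limits_measurable[OF assms(1)]]
    measurable_compose[OF coord_measurable(2) test1_limits_measurable[OF assms(2)]]
  by (rule borel_measurable_times)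

lemma tensor_bounded:
  assumes "f \<in> test1_limits a b" "g \<in> test1_limits c d"
  obtains K where "\<And>z. \<bar>f (s z) * g (t z)\<bar> \<le> K"
proof -
  obtain K where K: "K \<ge> 0" "\<And>x. \<bar>f x\<bar> \<le> K" by (rule test1_limits_bounded[OF assms(1)]) blast
  obtain L where L: "L \<ge> 0" "\<And>x. \<bar>g x\<bar> \<le> L" by (rule test1_limits_bounded[OF assms(2)]) blast
  have "\<bar>f (s z) * g (t z)\<bar> \<le> K * L" for z
    unfolding abs_mult using K L by (intro mult_mono) auto
  then show ?thesis using that by blast
qed

lemma tensor_L2:
  assumes "f \<in> test1_limits a b" "g \<in> test1_limits c d"
  shows "(\<lambda>z. f (s z) * g (t z)) \<in> L2 unit_square"
  by (rule tensor_bounded[OF assms]) (rule bounded_in_L2[OF tensor_measurable[OF assms]])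

lemma tensor_integrable:
  assumes "H \<in> L2 unit_square" "f \<in> test1_limits a b" "g \<in> test1_limits c d"
  shows "integrable mu (\<lambda>z. H z * (f (s z) * g (t z)))"
  using L2_mult_integrable[OF assms(1) tensor_L2[OF assms(2,3)]] .

lemma tensor_limit:
  assumes H: "H \<in> L2 unit_square"
    and F: "\<And>k. F k \<in> test1 a b" "\<And>k x. \<bar>F k x\<bar> \<le> K" "\<And>x. (\<lambda>k. F k x) \<longlonglongrightarrow> f x"
    and G: "\<And>k. G k \<in> test1 c d" "\<And>k x. \<bar>G k x\<bar> \<le> L" "\<And>x. (\<lambda>k. G k x) \<longlonglongrightarrow> g x"
  shows "(\<lambda>k. \<integral>z. H z * (F k (s z) * G k (t z)) \<partial>mu) \<longlonglongrightarrow> (\<integral>z. H z * (f (s z) * g (t z)) \<partial>mu)"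
proof (rule integral_dominated_convergence[where w="\<lambda>z. \<bar>H z\<bar> * (K * L)"])
  have lim: "f \<in> test1_limits a b" "g \<in> test1_limits c d"
    by (rule test1_limits_I[OF F], rule test1_limits_I[OF G])
  show "(\<lambda>z. H z * (f (s z) * g (t z))) \<in> borel_measurable mu"
    using tensor_integrable[OF H lim] by simp
  show "(\<lambda>z. H z * (F k (s z) * G k (t z))) \<in> borel_measurable mu" for k
    using tensor_integrable[OF H test1_in_limits test1_in_limits, OF F(1) G(1)] by simp
  show "integrable mu (\<lambda>z. \<bar>H z\<bar> * (K * L))"
    using L2_integrable[OF H] by simp
  show "AE z in mu. (\<lambda>k. H z * (F k (s z) * G k (t z))) \<longlonglongrightarrow> H z * (f (s z) * g (t z))"
    using F(3) G(3) by (auto intro!: tendsto_intros)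
  have "K \<ge> 0" using F(2)[of 0 0] by linarith
  have "\<bar>H z\<bar> * \<bar>F k (s z) * G k (t z)\<bar> \<le> \<bar>H z\<bar> * (K * L)" for k z
    using F(2) G(2) \<open>K \<ge> 0\<close> by (intro mult_left_mono) (auto simp: abs_mult intro!: mult_mono)
  then show "AE z in mu. norm (H z * (F k (s z) * G k (t z))) \<le> \<bar>H z\<bar> * (K * L)" for k
    by (simp add: abs_mult)
qed

lemma tensor_zero_extend:
  assumes H: "H \<in> L2 unit_square"
    and zero: "\<And>p q. p \<in> test1 a b \<Longrightarrow> q \<in> test1 c d \<Longrightarrow> (\<integral>z. H z * (p (s z) * q (t z)) \<partial>mu) = 0"
    and "f \<in> test1_limits a b" "g \<in> test1_limits c d"
  shows "(\<integral>z. H z * (f (s z) * g (t z)) \<partial>mu) = 0"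
proof -
  obtain F K where F: "\<And>k. F k \<in> test1 a b" "\<And>k x. \<bar>F k x\<bar> \<le> K" "\<And>x. (\<lambda>k. F k x) \<longlonglongrightarrow> f x"
    using assms(3) by (rule test1_limits_E) blast
  obtain G L where G: "\<And>k. G k \<in> test1 c d" "\<And>k x. \<bar>G k x\<bar> \<le> L" "\<And>x. (\<lambda>k. G k x) \<longlonglongrightarrow> g x"
    using assms(4) by (rule test1_limits_E) blast
  have "(\<lambda>k. 0) \<longlonglongrightarrow> (\<integral>z. H z * (f (s z) * g (t z)) \<partial>mu)"
    using tensor_limit[OF H F G] zero[OF F(1) G(1)] by simp
  then show ?thesis by (simp add: LIMSEQ_const_iff)
qed

text \<open>A weak derivative in the direction \<open>s\<close> on a rectangle, tested with products
  only. It is a directional notion because the flux along a row is to be differentiated across nodes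
  at which its coefficients jump.\<close>

definition tensor_deriv ::
    "real \<Rightarrow> real \<Rightarrow> real \<Rightarrow> real \<Rightarrow> (real \<times> real \<Rightarrow> real) \<Rightarrow> (real \<times> real \<Rightarrow> real) \<Rightarrow> bool" where
  "tensor_deriv a b c d H H' \<longleftrightarrow>
     (\<forall>p\<in>test1 a b. \<forall>q\<in>test1 c d.
        (\<integral>z. H z * (deriv p (s z) * q (t z)) \<partial>mu) = - (\<integral>z. H' z * (p (s z) * q (t z)) \<partial>mu))"

lemma tensor_deriv_mono:
  "tensor_deriv a b c d H H' \<Longrightarrow> a \<le> a' \<Longrightarrow> b' \<le> b \<Longrightarrow> c \<le> c' \<Longrightarrow> d' \<le> d \<Longrightarrow>
    tensor_deriv a' b' c' d' H H'"
  unfolding tensor_deriv_def by (meson test1_mono)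

text \<open>The approximants of \<open>f\<close> need not have mean zero, and without it their
  antiderivatives are no test functions. Subtracting \<open>m k\<close> times a fixed normalized
  \<omega> repairs the mean; since \<open>m k\<close> tends to 0, the bounded pointwise limit is
  unchanged.\<close>

lemma tensor_deriv_extend_integral:
  assumes H: "H \<in> L2 unit_square" "H' \<in> L2 unit_square" and D: "tensor_deriv a b c d H H'"
    and ab: "0 \<le> a" "a < b" "b \<le> 1"
    and f: "f \<in> test1_limits a b" "integral {a..b} f = 0" and g: "g \<in> test1_limits c d"
  shows "(\<integral>z. H z * (f (s z) * g (t z)) \<partial>mu) =
    - (\<integral>z. H' z * (integral {a..s z} f * g (t z)) \<partial>mu)"
proof -
  obtain F K where F: "\<And>k. F k \<in> test1 a b" "\<And>k x. \<bar>F k x\<bar> \<le> K" "\<And>x. (\<lambda>k. F k x) \<longlonglongrightarrow> f x" "K \<ge> 0"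
    using f(1) by (rule test1_limits_E) blast
  obtain G L where G: "\<And>k. G k \<in> test1 c d" "\<And>k x. \<bar>G k x\<bar> \<le> L" "\<And>x. (\<lambda>k. G k x) \<longlonglongrightarrow> g x" "L \<ge> 0"
    using g by (rule test1_limits_E) blast
  obtain \<omega> where \<omega>: "\<omega> \<in> test1 a b" "integral {a..b} \<omega> = 1"
    using ab(2) by (rule test1_normalized)
  obtain W where W: "\<And>x. \<bar>\<omega> x\<bar> \<le> W" using \<omega>(1) by (rule test1_bounded) blast
  have cont: "p \<in> test1 a b \<Longrightarrow> p integrable_on {x..y}" for p x y
    by (intro integrable_continuous_real smooth1_continuous_on test1_smooth)
  have lim: "(\<lambda>k. integral {a..x} (F k)) \<longlonglongrightarrow> integral {a..x} f" for x
    by (rule dominated_convergence(2)[where h="\<lambda>_. K"]) (use F cont in auto)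
  define m where "m k = integral {a..b} (F k)" for k
  have m: "m \<longlonglongrightarrow> 0" using lim[of b] f(2) by (simp add: m_def[abs_def])
  have mb: "\<bar>m k\<bar> \<le> K" for k
  proof -
    have "norm (integral {a..b} (F k)) \<le> K * (b - a)"
      by (rule integral_bound) (use ab F(1,2) in \<open>auto intro: smooth1_continuous_on test1_smooth\<close>)
    also have "\<dots> \<le> K * 1" using ab F(4) by (intro mult_left_mono) auto
    finally show ?thesis by (simp add: m_def)
  qed
  define E where "E k x = F k x - m k * \<omega> x" for k x
  have E: "E k \<in> test1 a b" for k
    unfolding E_def using F(1) \<omega>(1) test1_mult[OF smooth1_const] by (intro test1_diff) auto
  have Eb: "\<bar>E k x\<bar> \<le> K + K * W" for k x
  proof -
    have "\<bar>m k * \<omega> x\<bar> \<le> K * W" unfolding abs_mult using mb W F(4) by (intro mult_mono) auto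
    then show ?thesis using F(2)[of k x] by (simp add: E_def)
  qed
  have Elim: "(\<lambda>k. E k x) \<longlonglongrightarrow> f x" for x
  proof -
    have "(\<lambda>k. F k x - m k * \<omega> x) \<longlonglongrightarrow> f x - 0 * \<omega> x" by (intro tendsto_intros F(3) m)
    then show ?thesis by (simp add: E_def)
  qed
  have Eint: "integral {a..b} (E k) = 0" for k
  proof -
    have "(\<lambda>x. m k * \<omega> x) \<in> test1 a b" using \<omega>(1) by (intro test1_mult smooth1_const)
    then have "integral {a..b} (\<lambda>x. F k x - m k * \<omega> x) =
        integral {a..b} (F k) - integral {a..b} (\<lambda>x. m k * \<omega> x)"
      using cont F(1) by (intro Henstock_Kurzweil_Integration.integral_diff) auto
    then show ?thesis using \<omega>(2) by (simp add: E_def[abs_def] m_def)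
  qed
  define P where "P k x = integral {a..x} (E k)" for k x
  have P: "P k \<in> test1 a b" "deriv (P k) = E k" for k
    using test1_antiderivative[OF E Eint] unfolding P_def
    by (auto intro!: ext DERIV_imp_deriv)
  have Pb: "\<bar>P k x\<bar> \<le> K + K * W" for k x
  proof (cases "x \<in> {a<..<b}")
    case True
    have "norm (P k x) \<le> (K + K * W) * (x - a)"
      unfolding P_def
      by (rule integral_bound) (use True E Eb in \<open>auto intro: smooth1_continuous_on test1_smooth\<close>)
    also have "\<dots> \<le> (K + K * W) * 1"
      using True ab F(4) W[of 0] by (intro mult_left_mono) auto
    finally show ?thesis by simp
  next
    case False
    then show ?thesis using test1_outside[OF P(1) False] F(4) W[of 0] by auto
  qed
  have Plim: "(\<lambda>k. P k x) \<longlonglongrightarrow> integral {a..x} f" for x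
    unfolding P_def
    by (rule dominated_convergence(2)[where h="\<lambda>_. K + K * W"]) (use E Eb Elim cont in auto)
  have 1: "(\<lambda>k. \<integral>z. H z * (E k (s z) * G k (t z)) \<partial>mu) \<longlonglongrightarrow> (\<integral>z. H z * (f (s z) * g (t z)) \<partial>mu)"
    by (rule tensor_limit[OF H(1) E Eb Elim G(1-3)])
  have 2: "(\<lambda>k. - (\<integral>z. H' z * (P k (s z) * G k (t z)) \<partial>mu)) \<longlonglongrightarrow>
      - (\<integral>z. H' z * (integral {a..s z} f * g (t z)) \<partial>mu)"
    by (intro tendsto_minus tensor_limit[OF H(2) P(1) Pb Plim G(1-3)])
  have "(\<integral>z. H z * (E k (s z) * G k (t z)) \<partial>mu) = - (\<integral>z. H' z * (P k (s z) * G k (t z)) \<partial>mu)" for k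
    using D[unfolded tensor_deriv_def, rule_format, OF P(1) G(1), of k k] by (simp only: P(2))
  then show ?thesis using LIMSEQ_unique[OF 1] 2 by simp
qed

text \<open>Integration by parts against a function P with kinks, given by a formula, whose
  derivative off finitely many points is \<open>f\<close>. That P vanishes at both ends is the mean
  zero condition on \<open>f\<close>.\<close>

lemma tensor_deriv_extend:
  assumes H: "H \<in> L2 unit_square" "H' \<in> L2 unit_square" and D: "tensor_deriv a b c d H H'"
    and ab: "0 \<le> a" "a < b" "b \<le> 1"
    and f: "f \<in> test1_limits a b" and g: "g \<in> test1_limits c d"
    and P: "continuous_on {a..b} P" "\<And>x. x \<le> a \<or> b \<le> x \<Longrightarrow> P x = 0"
      "finite S" "\<And>x. x \<in> {a<..<b} - S \<Longrightarrow> (P has_real_derivative f x) (at x)"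
  shows "(\<integral>z. H z * (f (s z) * g (t z)) \<partial>mu) = - (\<integral>z. H' z * (P (s z) * g (t z)) \<partial>mu)"
proof -
  have I: "(f has_integral P x - P a) {a..x}" if "x \<in> {a..b}" for x
  proof (rule fundamental_theorem_of_calculus_interior_strong[OF P(3)])
    show "continuous_on {a..x} P" by (rule continuous_on_subset[OF P(1)]) (use that in auto)
    show "\<And>y. y \<in> {a<..<x} - S \<Longrightarrow> (P has_vector_derivative f y) (at y)"
      using P(4) that by (auto simp: has_real_derivative_iff_has_vector_derivative)
  qed (use that in auto)
  have ib: "integral {a..b} f = 0" using I[of b] P(2)[of a] P(2)[of b] ab by (auto dest: integral_unique)
  have ix: "integral {a..x} f = P x" for x
  proof -
    consider "x < a" | "x \<in> {a..b}" | "b < x" by force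
    then show ?thesis
    proof cases
      case 1 then show ?thesis using P(2)[of x] by simp
    next
      case 2 then show ?thesis using I[of x] P(2)[of a] by (auto dest: integral_unique)
    next
      case 3
      have "(f has_integral 0) {b..x}"
        by (rule has_integral_eq[OF _ has_integral_0]) (use test1_limits_outside[OF f] in auto)
      then have "(f has_integral (0 + 0)) {a..x}"
        using I[of b] P(2)[of a] P(2)[of b] ab 3 by (intro has_integral_combine[of a b x]) auto
      then show ?thesis using P(2)[of x] 3 by (auto dest: integral_unique)
    qed
  qed
  show ?thesis using tensor_deriv_extend_integral[OF H D ab f ib g] unfolding ix .
qed

end

abbreviation iv :: "real \<Rightarrow> real \<Rightarrow> real \<Rightarrow> real" where
  "iv a b \<equiv> indicator {a<..<b}"

lemma AE_mu_fst: "AE z in mu. fst z \<noteq> b" and AE_mu_snd: "AE z in mu. snd z \<noteq> b"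
proof -
  have "negligible {z :: real \<times> real. (1, 0) \<bullet> z = b}"
    by (intro negligible_hyperplane) (simp add: zero_prod_def)
  then have "AE z :: real \<times> real in lebesgue. fst z \<noteq> b"
    by (intro AE_I'[of "{z :: real \<times> real. fst z = b}"]) (auto simp: negligible_iff_null_sets inner_prod_def)
  then show "AE z in mu. fst z \<noteq> b" by (auto simp: AE_restrict_space_iff elim: eventually_mono)
  have "negligible {z :: real \<times> real. (0, 1) \<bullet> z = b}"
    by (intro negligible_hyperplane) (simp add: zero_prod_def)
  then have "AE z :: real \<times> real in lebesgue. snd z \<noteq> b"
    by (intro AE_I'[of "{z :: real \<times> real. snd z = b}"]) (auto simp: negligible_iff_null_sets inner_prod_def)
  then show "AE z in mu. snd z \<noteq> b" by (auto simp: AE_restrict_space_iff elim: eventually_mono)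
qed

context coordinates
begin

lemma AE_coord: "AE z in mu. s z \<noteq> b" "AE z in mu. t z \<noteq> b"
  using coords AE_mu_fst AE_mu_snd by auto

definition pair :: "(real \<times> real \<Rightarrow> real) \<Rightarrow> (real \<Rightarrow> real) \<Rightarrow> (real \<Rightarrow> real) \<Rightarrow> real" where
  "pair H f g = (\<integral>z. H z * (f (s z) * g (t z)) \<partial>mu)"

definition energy :: "(real \<times> real \<Rightarrow> real) \<Rightarrow> real \<Rightarrow> real \<Rightarrow> real \<Rightarrow> real \<Rightarrow> real" where
  "energy H a b c d = (\<integral>z. (H z)\<^sup>2 * (iv a b (s z) * iv c d (t z)) \<partial>mu)"

lemma bounded_tensor_L2:
  assumes "f \<in> borel_measurable borel" "g \<in> borel_measurable borel"
    "\<And>x. x \<in> {0<..<1} \<Longrightarrow> \<bar>f x\<bar> \<le> K" "\<And>x. x \<in> {0<..<1} \<Longrightarrow> \<bar>g x\<bar> \<le> L"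
  shows "(\<lambda>z. f (s z) * g (t z)) \<in> L2 unit_square"
proof (rule bounded_in_L2)
  show "(\<lambda>z. f (s z) * g (t z)) \<in> borel_measurable mu"
    using measurable_compose[OF coord_measurable(1) assms(1)]
      measurable_compose[OF coord_measurable(2) assms(2)] by (rule borel_measurable_times)
  show "\<bar>f (s z) * g (t z)\<bar> \<le> K * L" if "z \<in> unit_square" for z
    unfolding abs_mult using assms(3)[of "s z"] assms(4)[of "t z"] coord_range[OF that]
    by (intro mult_mono) auto
qed

lemma pair_cong_finite:
  assumes "H \<in> L2 unit_square" "f \<in> borel_measurable borel" "f' \<in> borel_measurable borel"
    "g \<in> borel_measurable borel" "finite S" "\<And>x. x \<in> {0<..<1} \<Longrightarrow> x \<notin> S \<Longrightarrow> f x = f' x"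
  shows "pair H f g = pair H f' g"
  unfolding pair_def
proof (rule integral_cong_AE)
  have m: "(\<lambda>z. H z * (h (s z) * g (t z))) \<in> borel_measurable mu" if "h \<in> borel_measurable borel" for h
    using L2_measurable[OF assms(1)] measurable_compose[OF coord_measurable(1) that]
      measurable_compose[OF coord_measurable(2) assms(4)] by measurable
  show "(\<lambda>z. H z * (f (s z) * g (t z))) \<in> borel_measurable mu"
    "(\<lambda>z. H z * (f' (s z) * g (t z))) \<in> borel_measurable mu" using assms m by auto
  have "AE z in mu. \<forall>b\<in>S. s z \<noteq> b"
    using assms(5) by (subst AE_finite_all) (auto intro: AE_coord)
  moreover have "AE z in mu. z \<in> unit_square" by (rule AE_I2) simp
  ultimately show "AE z in mu. H z * (f (s z) * g (t z)) = H z * (f' (s z) * g (t z))"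
  proof eventually_elim
    case (elim z)
    then have "f (s z) = f' (s z)" using coord_range by (intro assms(6)) auto
    then show ?case by simp
  qed
qed

text \<open>Cauchy-Schwarz on the rectangle that supports the test product, whose L2 norm is at most
  K L times the root of the area. Keeping the energy local is what allows summation over cells
  later.\<close>

lemma pair_bound:
  assumes H: "H \<in> L2 unit_square" and ab: "0 \<le> a" "a \<le> b" "b \<le> 1" and cd: "0 \<le> c" "c \<le> d" "d \<le> 1"
    and f: "f \<in> borel_measurable borel" "\<And>x. \<bar>f x\<bar> \<le> K" "\<And>x. x \<notin> {a<..<b} \<Longrightarrow> f x = 0"
    and g: "g \<in> borel_measurable borel" "\<And>x. \<bar>g x\<bar> \<le> L" "\<And>x. x \<notin> {c<..<d} \<Longrightarrow> g x = 0"
  shows "(pair H f g)\<^sup>2 \<le> (K * L)\<^sup>2 * ((b - a) * (d - c)) * energy H a b c d"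
proof -
  let ?R = "\<lambda>z. iv a b (s z) * iv c d (t z)"
  have R: "?R \<in> L2 unit_square"
    by (rule bounded_tensor_L2[where K=1 and L=1]) (auto simp: indicator_def)
  have HR: "(\<lambda>z. H z * ?R z) \<in> L2 unit_square"
    by (rule L2_bounded_mult[OF H L2_measurable[OF R], of 1]) (auto simp: indicator_def)
  have T: "(\<lambda>z. f (s z) * g (t z)) \<in> L2 unit_square"
    by (rule bounded_tensor_L2[OF f(1) g(1)]) (use f(2) g(2) in auto)
  have "pair H f g = (\<integral>z. (H z * ?R z) * (f (s z) * g (t z)) \<partial>mu)"
    unfolding pair_def
    by (intro Bochner_Integration.integral_cong) (use f(3) g(3) in \<open>auto simp: indicator_def\<close>)
  then have "(pair H f g)\<^sup>2 \<le>
      (\<integral>z. (H z * ?R z)\<^sup>2 \<partial>mu) * (\<integral>z. (f (s z) * g (t z))\<^sup>2 \<partial>mu)"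
    using L2_Cauchy_Schwarz[OF HR T] by simp
  also have "(\<integral>z. (H z * ?R z)\<^sup>2 \<partial>mu) = energy H a b c d"
    unfolding energy_def
    by (intro Bochner_Integration.integral_cong) (auto simp: indicator_def)
  also have "energy H a b c d * (\<integral>z. (f (s z) * g (t z))\<^sup>2 \<partial>mu) \<le>
      energy H a b c d * ((K * L)\<^sup>2 * ((b - a) * (d - c)))"
  proof (rule mult_left_mono)
    have "(\<integral>z. (f (s z) * g (t z))\<^sup>2 \<partial>mu) \<le> (\<integral>z. (K * L)\<^sup>2 * ?R z \<partial>mu)"
    proof (rule integral_mono)
      show "integrable mu (\<lambda>z. (f (s z) * g (t z))\<^sup>2)" using T by (simp add: L2_def)
      show "integrable mu (\<lambda>z. (K * L)\<^sup>2 * ?R z)" using L2_integrable[OF R] by simp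
      show "(f (s z) * g (t z))\<^sup>2 \<le> (K * L)\<^sup>2 * ?R z" for z
      proof (cases "s z \<in> {a<..<b} \<and> t z \<in> {c<..<d}")
        case True
        have "K \<ge> 0" "L \<ge> 0" using f(2)[of 0] g(2)[of 0] by linarith+
        then have "\<bar>f (s z) * g (t z)\<bar> \<le> \<bar>K * L\<bar>"
          unfolding abs_mult using f(2) g(2) by (intro mult_mono) auto
        then have "(f (s z) * g (t z))\<^sup>2 \<le> (K * L)\<^sup>2" by (rule abs_le_square_iff[THEN iffD1])
        then show ?thesis using True by simp
      next
        case False
        then have 0: "f (s z) * g (t z) = 0" using f(3) g(3) by auto
        show ?thesis unfolding 0 by simp
      qed
    qed
    also have "\<dots> = (K * L)\<^sup>2 * ((b - a) * (d - c))"
      using integral_rect[OF ab cd] by simp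
    finally show "(\<integral>z. (f (s z) * g (t z))\<^sup>2 \<partial>mu) \<le> (K * L)\<^sup>2 * ((b - a) * (d - c))" .
    show "energy H a b c d \<ge> 0" by (simp add: energy_def)
  qed
  finally show ?thesis by (simp add: mult.commute)
qed

lemma energy_nonneg: "energy H a b c d \<ge> 0"
  by (simp add: energy_def)

lemma iv_limits: "0 \<le> a \<Longrightarrow> b \<le> 1 \<Longrightarrow> iv a b \<in> test1_limits 0 1"
  by (rule test1_limits_mono[OF indicator_test1_limits])

lemma pair_linear_first:
  assumes "H \<in> L2 unit_square" "f1 \<in> test1_limits a b" "f2 \<in> test1_limits a' b'" "g \<in> test1_limits c d"
  shows "pair H (\<lambda>x. k1 * f1 x + k2 * f2 x) g = k1 * pair H f1 g + k2 * pair H f2 g"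
proof -
  have "pair H (\<lambda>x. k1 * f1 x + k2 * f2 x) g =
     (\<integral>z. k1 * (H z * (f1 (s z) * g (t z))) + k2 * (H z * (f2 (s z) * g (t z))) \<partial>mu)"
    unfolding pair_def by (intro Bochner_Integration.integral_cong) (auto simp: algebra_simps)
  also have "\<dots> = k1 * pair H f1 g + k2 * pair H f2 g"
    unfolding pair_def
    using tensor_integrable[OF assms(1,2,4)] tensor_integrable[OF assms(1,3,4)] by simp
  finally show ?thesis .
qed

lemma pair_linear_fun:
  assumes "H1 \<in> L2 unit_square" "H2 \<in> L2 unit_square" "f \<in> test1_limits a b" "g \<in> test1_limits c d"
  shows "pair (\<lambda>z. k1 * H1 z + k2 * H2 z) f g = k1 * pair H1 f g + k2 * pair H2 f g"
proof -
  have "pair (\<lambda>z. k1 * H1 z + k2 * H2 z) f g =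
     (\<integral>z. k1 * (H1 z * (f (s z) * g (t z))) + k2 * (H2 z * (f (s z) * g (t z))) \<partial>mu)"
    unfolding pair_def by (intro Bochner_Integration.integral_cong) (auto simp: algebra_simps)
  also have "\<dots> = k1 * pair H1 f g + k2 * pair H2 f g"
    unfolding pair_def
    using tensor_integrable[OF assms(1,3,4)] tensor_integrable[OF assms(2,3,4)] by simp
  finally show ?thesis .
qed

end

section \<open>Means over neighbouring intervals, first moments and strips\<close>

definition hat :: "real \<Rightarrow> real \<Rightarrow> real \<Rightarrow> real \<Rightarrow> real" where
  "hat a b c x = max 0 (min ((x - a) / (b - a)) ((c - x) / (c - b)))"

lemma hat_continuous: "a < b \<Longrightarrow> b < c \<Longrightarrow> continuous_on S (hat a b c)"
  unfolding hat_def[abs_def] by (intro continuous_intros) auto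

lemma hat_outside:
  assumes "a < b" "b < c" "x \<le> a \<or> c \<le> x" shows "hat a b c x = 0"
proof -
  have "(x - a) / (b - a) \<le> 0 \<or> (c - x) / (c - b) \<le> 0"
    using assms by (auto simp: divide_le_0_iff)
  moreover have "max 0 (min y z) = 0" if "y \<le> 0 \<or> z \<le> 0" for y z :: real
    using that by auto
  ultimately show ?thesis unfolding hat_def by blast
qed

lemma hat_left: 
  assumes "a < b" "b < c" "a < x" "x \<le> b" shows "hat a b c x = (x - a) / (b - a)"
proof -
  have "(x - a) / (b - a) \<le> 1" "1 \<le> (c - x) / (c - b)" "0 \<le> (x - a) / (b - a)" 
    using assms by (auto simp: divide_simps)
  then show ?thesis by (simp add: hat_def)
qed

lemma hat_right: 
  assumes "a < b" "b < c" "b \<le> x" "x < c" shows "hat a b c x = (c - x) / (c - b)"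
proof -
  have "1 \<le> (x - a) / (b - a)" "(c - x) / (c - b) \<le> 1" "0 \<le> (c - x) / (c - b)" 
    using assms by (auto simp: divide_simps)
  then show ?thesis by (simp add: hat_def)
qed

lemma hat_bounds: 
  assumes "a < b" "b < c" shows "\<bar>hat a b c x\<bar> \<le> 1"
proof -
  consider "x \<le> a \<or> c \<le> x" | "a < x" "x \<le> b" | "b \<le> x" "x < c" by linarith
  then show ?thesis
  proof cases
    case 1 then show ?thesis using hat_outside[OF assms] by simp
  next
    case 2
    then have "0 \<le> (x - a) / (b - a)" "(x - a) / (b - a) \<le> 1" using assms by (auto simp: divide_simps)
    then show ?thesis using hat_left[OF assms 2] by linarith
  next
    case 3
    then have "0 \<le> (c - x) / (c - b)" "(c - x) / (c - b) \<le> 1" using assms by (auto simp: divide_simps)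
    then show ?thesis using hat_right[OF assms 3] by linarith
  qed
qed

context coordinates
begin

text \<open>The derivative of the hat function is 1/(b - a) on the left and -1/(e - b) on the right,
  so the difference of the two means is \<open>H\<close> tested with this derivative.\<close>

lemma pair_hat:
  assumes H: "H \<in> L2 unit_square" "H' \<in> L2 unit_square" and D: "tensor_deriv a e c d H H'"
    and ab: "0 \<le> a" "a < b" "b < e" "e \<le> 1" and g: "g \<in> test1_limits c d"
  shows "pair H (iv a b) g / (b - a) - pair H (iv b e) g / (e - b) = - pair H' (hat a b e) g"
proof -
  let ?f = "\<lambda>x. 1 / (b - a) * iv a b x + (- 1 / (e - b)) * iv b e x"
  have lim: "iv a b \<in> test1_limits a e" "iv b e \<in> test1_limits a e"
    using ab by (auto intro!: test1_limits_mono[OF indicator_test1_limits])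
  have "(\<integral>z. H z * (?f (s z) * g (t z)) \<partial>mu) = - (\<integral>z. H' z * (hat a b e (s z) * g (t z)) \<partial>mu)"
  proof (rule tensor_deriv_extend[OF H D _ _ _ _ g, where S="{b}"])
    show "?f \<in> test1_limits a e"
      using lim by (intro test1_limits_add test1_limits_cmult)
    show "continuous_on {a..e} (hat a b e)" using ab by (intro hat_continuous) auto
    show "hat a b e x = 0" if "x \<le> a \<or> e \<le> x" for x using ab that by (intro hat_outside) auto
    show "(hat a b e has_real_derivative ?f x) (at x)" if "x \<in> {a<..<e} - {b}" for x
    proof (cases "x < b")
      case True
      have "((\<lambda>x. (x - a) / (b - a)) has_real_derivative 1 / (b - a)) (at x)"
        using ab by (auto intro!: derivative_eq_intros)
      then have "(hat a b e has_real_derivative 1 / (b - a)) (at x)"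
        by (rule has_field_derivative_transform_within_open[of _ _ _ "{a<..<b}"])
           (use ab True that in \<open>auto simp: hat_left\<close>)
      then show ?thesis using True that by simp
    next
      case False
      have "((\<lambda>x. (e - x) / (e - b)) has_real_derivative - 1 / (e - b)) (at x)"
        using ab by (auto intro!: derivative_eq_intros simp: divide_simps)
      then have "(hat a b e has_real_derivative - 1 / (e - b)) (at x)"
        by (rule has_field_derivative_transform_within_open[of _ _ _ "{b<..<e}"])
           (use ab False that in \<open>auto simp: hat_right\<close>)
      then show ?thesis using False that by simp
    qed
  qed (use ab in auto)
  then have "pair H ?f g = - pair H' (hat a b e) g" by (simp add: pair_def)
  then show ?thesis unfolding pair_linear_first[OF H(1) lim g] by simp
qed

lemma pair_difference_bound:
  assumes H: "H \<in> L2 unit_square" "H' \<in> L2 unit_square" and D: "tensor_deriv 0 1 0 1 H H'"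
    and ab: "0 \<le> a" "a < b" "b < e" "e \<le> 1" and cd: "0 \<le> c" "c \<le> d" "d \<le> 1"
    and g: "g \<in> test1_limits c d" "\<And>x. \<bar>g x\<bar> \<le> L"
  shows "(pair H (iv a b) g / (b - a) - pair H (iv b e) g / (e - b))\<^sup>2
    \<le> L\<^sup>2 * ((e - a) * (d - c)) * energy H' a e c d"
proof -
  have "(pair H' (hat a b e) g)\<^sup>2 \<le> (1 * L)\<^sup>2 * ((e - a) * (d - c)) * energy H' a e c d"
    using ab cd g test1_limits_outside[OF g(1)] test1_limits_measurable[OF g(1)]
      borel_measurable_continuous_onI[OF hat_continuous]
    by (intro pair_bound[OF H(2)]) (auto intro: hat_outside hat_bounds)
  moreover have "tensor_deriv a e c d H H'"
    using D ab cd by (intro tensor_deriv_mono[OF D]) auto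
  ultimately show ?thesis using pair_hat[OF H _ ab g(1)] by simp
qed

text \<open>The parabola (x - a)(b - x) vanishes at both ends and has derivative -2 (x - (a + b)/2).
  A centred moment therefore costs one derivative and gains the square of the length.\<close>

lemma pair_first_moment:
  assumes H: "H \<in> L2 unit_square" "H' \<in> L2 unit_square" and D: "tensor_deriv 0 1 c d H H'"
    and ab: "0 \<le> a" "a < b" "b \<le> 1" and g: "g \<in> test1_limits c d"
  shows "pair H (\<lambda>x. (x - (a + b) / 2) * iv a b x) g =
    1 / 2 * pair H' (\<lambda>x. (x - a) * (b - x) * iv a b x) g"
proof -
  let ?P = "\<lambda>x. (x - a) * (b - x) / 2 * iv a b x"
  let ?f = "\<lambda>x. ((a + b) / 2 - x) * iv a b x"
  have D': "tensor_deriv a b c d H H'" using ab by (intro tensor_deriv_mono[OF D]) auto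
  have P_eq: "?P x = (x - a) * (b - x) / 2" if "x \<in> {a..b}" for x
    using that by (cases "x = a \<or> x = b") (auto simp: indicator_def)
  have "(\<integral>z. H z * (?f (s z) * g (t z)) \<partial>mu) = - (\<integral>z. H' z * (?P (s z) * g (t z)) \<partial>mu)"
  proof (rule tensor_deriv_extend[OF H D' ab _ g, where S="{}"])
    show "?f \<in> test1_limits a b"
      by (intro test1_limits_smooth_mult smooth1_intros indicator_test1_limits)
    have "continuous_on {a..b} (\<lambda>x. (x - a) * (b - x) / 2)" by (intro continuous_intros) auto
    then show "continuous_on {a..b} ?P"
      by (rule continuous_on_eq) (simp only: P_eq)
    show "(?P has_real_derivative ?f x) (at x)" if "x \<in> {a<..<b} - {}" for x
    proof -
      have "((\<lambda>x. (x - a) * (b - x) / 2) has_real_derivative ?f x) (at x)"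
        using that by (auto intro!: derivative_eq_intros simp: field_simps)
      then show ?thesis
        by (rule has_field_derivative_transform_within_open[of _ _ _ "{a<..<b}"])
           (use that P_eq in auto)
    qed
  qed auto
  then have "(\<integral>z. H z * (?f (s z) * g (t z)) \<partial>mu) = - pair H' ?P g" by (simp add: pair_def)
  moreover have "(\<integral>z. H z * (?f (s z) * g (t z)) \<partial>mu) =
      - pair H (\<lambda>x. (x - (a + b) / 2) * iv a b x) g"
    unfolding pair_def Bochner_Integration.integral_minus[symmetric]
    by (intro Bochner_Integration.integral_cong) (auto simp: algebra_simps)
  moreover have "pair H' ?P g = 1 / 2 * pair H' (\<lambda>x. (x - a) * (b - x) * iv a b x) g"
    unfolding pair_def integral_mult_right_zero[symmetric]
    by (intro Bochner_Integration.integral_cong) simp_all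
  ultimately show ?thesis by simp
qed

lemma parabola_bound:
  fixes a b x :: real assumes "a \<le> b" shows "\<bar>(x - a) * (b - x) * iv a b x\<bar> \<le> (b - a)\<^sup>2"
proof (cases "x \<in> {a<..<b}")
  case True
  then have "\<bar>x - a\<bar> * \<bar>b - x\<bar> \<le> (b - a) * (b - a)" by (intro mult_mono) auto
  then show ?thesis using True by (simp add: abs_mult power2_eq_square)
qed simp

lemma pair_first_moment_bound:
  assumes H: "H \<in> L2 unit_square" "H' \<in> L2 unit_square" and D: "tensor_deriv 0 1 0 1 H H'"
    and ab: "0 \<le> a" "a < b" "b \<le> 1" and cd: "0 \<le> c" "c < d" "d \<le> 1"
  shows "(pair H (\<lambda>x. (x - (a + b) / 2) * iv a b x) (iv c d))\<^sup>2
    \<le> (b - a) ^ 4 * ((b - a) * (d - c)) * energy H' a b c d"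
proof -
  have "(pair H' (\<lambda>x. (x - a) * (b - x) * iv a b x) (iv c d))\<^sup>2
    \<le> ((b - a)\<^sup>2 * 1)\<^sup>2 * ((b - a) * (d - c)) * energy H' a b c d"
  proof (rule pair_bound[OF H(2)])
    show "\<bar>(x - a) * (b - x) * iv a b x\<bar> \<le> (b - a)\<^sup>2" for x
      using ab by (intro parabola_bound) auto
  qed (use ab cd in \<open>auto simp: indicator_def\<close>)
  moreover have "pair H (\<lambda>x. (x - (a + b) / 2) * iv a b x) (iv c d) =
    1 / 2 * pair H' (\<lambda>x. (x - a) * (b - x) * iv a b x) (iv c d)"
    by (rule pair_first_moment[OF H tensor_deriv_mono[OF D] ab indicator_test1_limits]) (use cd in auto)
  moreover have "0 \<le> (pair H' (\<lambda>x. (x - a) * (b - x) * iv a b x) (iv c d))\<^sup>2" by simp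
  moreover have "((b - a)\<^sup>2 * 1)\<^sup>2 = (b - a) ^ 4"
    by (simp add: power2_eq_square power4_eq_xxxx)
  moreover have "x\<^sup>2 \<le> B" if "y\<^sup>2 \<le> A * R" "x = 1 / 2 * y" "0 \<le> y\<^sup>2" "A * R = B" for x y A R B :: real
  proof -
    have "x\<^sup>2 = y\<^sup>2 / 4" unfolding that(2) by (simp add: power2_eq_square)
    then show ?thesis using that by linarith
  qed
  ultimately show ?thesis by (simp only: mult.assoc)
qed

text \<open>The mean over the short interval is compared with the mean over (0, 1). No negative
  power of b - a appears, and the width d - c of the strip is the only small factor.\<close>

lemma pair_strip_bound:
  assumes H: "H \<in> L2 unit_square" "H' \<in> L2 unit_square" and D: "tensor_deriv 0 1 0 1 H H'"
    and ab: "0 \<le> a" "a < b" "b \<le> 1" and cd: "0 \<le> c" "c \<le> d" "d \<le> 1"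
    and g: "g \<in> test1_limits c d" "\<And>x. \<bar>g x\<bar> \<le> L"
  shows "(pair H (iv a b) g / (b - a))\<^sup>2
    \<le> 2 * L\<^sup>2 * (d - c) * (energy H 0 1 c d + energy H' 0 1 c d)"
proof -
  let ?f = "\<lambda>x. 1 / (b - a) * iv a b x + (- 1) * iv 0 1 x"
  \<comment> \<open>The difference of the distribution functions of the uniform densities on (a, b)
    and on (0, 1): it is bounded by 1 and vanishes at 0 and 1.\<close>
  let ?Q = "\<lambda>x. max 0 (min 1 ((x - a) / (b - a))) - x"
  define P where "P x = (if x \<in> {0..1} then ?Q x else 0)" for x
  have lim: "iv a b \<in> test1_limits 0 1" "iv 0 1 \<in> test1_limits 0 1"
    using ab by (auto intro!: iv_limits)
  have D': "tensor_deriv 0 1 c d H H'" using cd by (intro tensor_deriv_mono[OF D]) auto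
  have Pc: "continuous_on {0..1} P"
  proof -
    have "continuous_on {0..1} ?Q" using ab by (intro continuous_intros) auto
    then show ?thesis by (rule continuous_on_eq) (simp add: P_def)
  qed
  have P0: "P x = 0" if "x \<le> 0 \<or> 1 \<le> x" for x
  proof -
    have "(0 - a) / (b - a) \<le> 0" "1 \<le> (1 - a) / (b - a)" using ab by (auto simp: divide_simps)
    then have "?Q 0 = 0" "?Q 1 = 0" by auto
    moreover have "x < 0 \<or> x = 0 \<or> x = 1 \<or> 1 < x" using that by linarith
    ultimately show ?thesis by (auto simp: P_def simp del: diff_0)
  qed
  have "(\<integral>z. H z * (?f (s z) * g (t z)) \<partial>mu) = - (\<integral>z. H' z * (P (s z) * g (t z)) \<partial>mu)"
  proof (rule tensor_deriv_extend[OF H D' _ _ _ _ g(1) Pc, where S="{a, b}"])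
    show "?f \<in> test1_limits 0 1" using lim by (intro test1_limits_add test1_limits_cmult)
    show "P x = 0" if "x \<le> 0 \<or> 1 \<le> x" for x using that by (rule P0)
    fix x assume x: "x \<in> {0<..<1} - {a, b}"
    consider "x < a" | "a < x" "x < b" | "b < x" using x by force
    then show "(P has_real_derivative ?f x) (at x)"
    proof cases
      case 1
      have "((\<lambda>x. 0 - x) has_real_derivative - 1) (at x)" by (auto intro!: derivative_eq_intros)
      then have "(P has_real_derivative - 1) (at x)"
        by (rule has_field_derivative_transform_within_open[of _ _ _ "{0<..<a}"])
           (use 1 x ab in \<open>auto simp: P_def max_def min_def divide_simps\<close>)
      then show ?thesis using 1 x by simp
    next
      case 2
      have "((\<lambda>x. (x - a) / (b - a) - x) has_real_derivative 1 / (b - a) - 1) (at x)"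
        using ab by (auto intro!: derivative_eq_intros)
      then have "(P has_real_derivative 1 / (b - a) - 1) (at x)"
        by (rule has_field_derivative_transform_within_open[of _ _ _ "{a<..<b}"])
           (use 2 x ab in \<open>auto simp: P_def max_def min_def divide_simps\<close>)
      then show ?thesis using 2 x by simp
    next
      case 3
      have "((\<lambda>x. 1 - x) has_real_derivative - 1) (at x)" by (auto intro!: derivative_eq_intros)
      then have "(P has_real_derivative - 1) (at x)"
        by (rule has_field_derivative_transform_within_open[of _ _ _ "{b<..<1}"])
           (use 3 x ab in \<open>auto simp: P_def max_def min_def divide_simps\<close>)
      then show ?thesis using 3 x by simp
    qed
  qed auto
  then have "pair H ?f g = - pair H' P g" by (simp add: pair_def)
  then have eq: "pair H (iv a b) g / (b - a) = pair H (iv 0 1) g - pair H' P g"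
    unfolding pair_linear_first[OF H(1) lim g(1)] by simp
  have gm: "g \<in> borel_measurable borel" "\<And>x. x \<notin> {c<..<d} \<Longrightarrow> g x = 0"
    using test1_limits_measurable[OF g(1)] test1_limits_outside[OF g(1)] by auto
  have "(pair H (iv 0 1) g)\<^sup>2 \<le> (1 * L)\<^sup>2 * ((1 - 0) * (d - c)) * energy H 0 1 c d"
    by (rule pair_bound[OF H(1)]) (use cd g gm in \<open>auto simp: indicator_def\<close>)
  moreover have "(pair H' P g)\<^sup>2 \<le> (1 * L)\<^sup>2 * ((1 - 0) * (d - c)) * energy H' 0 1 c d"
  proof (rule pair_bound[OF H(2)])
    have "P = (\<lambda>x. indicator {0..1} x * ?Q x)" by (auto simp: P_def)
    moreover have "?Q \<in> borel_measurable borel"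
      using ab by (intro borel_measurable_continuous_onI continuous_intros) auto
    ultimately show "P \<in> borel_measurable borel" by simp
    show "\<bar>P x\<bar> \<le> 1" for x by (auto simp: P_def)
    show "P x = 0" if "x \<notin> {0<..<1}" for x using that by (intro P0) auto
  qed (use cd g gm in auto)
  moreover have "(pair H (iv a b) g / (b - a))\<^sup>2 \<le> 2 * (pair H (iv 0 1) g)\<^sup>2 + 2 * (pair H' P g)\<^sup>2"
    unfolding eq using sum_squares_bound[of "pair H (iv 0 1) g" "- pair H' P g"]
    by (simp add: power2_diff)
  ultimately show ?thesis by (simp add: algebra_simps)
qed

end

interpretation xy: coordinates fst snd by unfold_locales simp
interpretation yx: coordinates snd fst by unfold_locales simp

lemma pair_swap: "yx.pair H g f = xy.pair H f g"
  by (simp add: yx.pair_def xy.pair_def mult.commute)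

lemma energy_swap: "yx.energy H c d a b = xy.energy H a b c d"
  by (simp add: yx.energy_def xy.energy_def mult.commute)

subsection \<open>Products of test functions\<close>

lemma dx_tensor:
  assumes "smooth1 p" shows "dx (\<lambda>z. p (fst z) * q (snd z)) = (\<lambda>z. deriv p (fst z) * q (snd z))"
proof
  fix z :: "real \<times> real"
  have "((\<lambda>r. p r * q (snd z)) has_real_derivative deriv p (fst z) * q (snd z)) (at (fst z))"
    by (rule DERIV_cmult_right[OF smooth1_DERIV[OF assms]])
  then show "dx (\<lambda>z. p (fst z) * q (snd z)) z = deriv p (fst z) * q (snd z)"
    by (simp add: dx_def DERIV_imp_deriv)
qed

lemma dy_tensor:
  assumes "smooth1 q" shows "dy (\<lambda>z. p (fst z) * q (snd z)) = (\<lambda>z. p (fst z) * deriv q (snd z))"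
proof
  fix z :: "real \<times> real"
  have "((\<lambda>r. p (fst z) * q r) has_real_derivative p (fst z) * deriv q (snd z)) (at (snd z))"
    by (rule DERIV_cmult[OF smooth1_DERIV[OF assms]])
  then show "dy (\<lambda>z. p (fst z) * q (snd z)) z = p (fst z) * deriv q (snd z)"
    by (simp add: dy_def DERIV_imp_deriv)
qed

lemma smooth1_deriv_funpow: "smooth1 p \<Longrightarrow> smooth1 ((deriv ^^ n) p)"
  by (induction n) (auto intro: smooth1_deriv)

lemma partial_tensor:
  assumes "smooth1 p" "smooth1 q"
  shows "partial m n (\<lambda>z. p (fst z) * q (snd z)) =
    (\<lambda>z. (deriv ^^ m) p (fst z) * (deriv ^^ n) q (snd z))"
proof -
  have y: "(dy ^^ n) (\<lambda>z. p (fst z) * q (snd z)) = (\<lambda>z. p (fst z) * (deriv ^^ n) q (snd z))" for n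
    using assms by (induction n) (auto simp: dy_tensor smooth1_deriv_funpow)
  have x: "(dx ^^ m) (\<lambda>z. p (fst z) * r (snd z)) = (\<lambda>z. (deriv ^^ m) p (fst z) * r (snd z))" for m r
    using assms by (induction m) (auto simp: dx_tensor smooth1_deriv_funpow)
  show ?thesis unfolding partial_def y by (rule x)
qed

lemma smooth1_differentiable: "smooth1 p \<Longrightarrow> p differentiable (at x)"
  using smooth1_DERIV by (metis differentiable_iff_has_real_derivative)

lemma C_k_tensor:
  "smooth1 p \<Longrightarrow> smooth1 q \<Longrightarrow> C_k k (\<lambda>z. p (fst z) * q (snd z))"
proof (induction k arbitrary: p q)
  case 0
  have "continuous_on UNIV (\<lambda>z :: real \<times> real. p (fst z))"
    by (rule continuous_on_compose2[OF smooth1_continuous_on[OF 0(1), of UNIV]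
          continuous_on_fst[OF continuous_on_id]]) simp
  moreover have "continuous_on UNIV (\<lambda>z :: real \<times> real. q (snd z))"
    by (rule continuous_on_compose2[OF smooth1_continuous_on[OF 0(2), of UNIV]
          continuous_on_snd[OF continuous_on_id]]) simp
  ultimately show ?case by (simp add: continuous_on_mult)
next
  case (Suc k)
  have "(\<lambda>z. p (fst z) * q (snd z)) differentiable (at z)" for z :: "real \<times> real"
  proof -
    have "(\<lambda>z :: real \<times> real. p (fst z)) differentiable (at z)" "(\<lambda>z :: real \<times> real. q (snd z)) differentiable (at z)"
      using differentiable_chain_at[OF bounded_linear_imp_differentiable[OF bounded_linear_fst]
          smooth1_differentiable[OF Suc.prems(1)]]
        differentiable_chain_at[OF bounded_linear_imp_differentiable[OF bounded_linear_snd]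
          smooth1_differentiable[OF Suc.prems(2)]] by (simp_all only: o_def)
    then show ?thesis by simp
  qed
  then show ?case using Suc by (simp add: dx_tensor dy_tensor smooth1_deriv)
qed

lemma tensor_test_functions:
  assumes p: "p \<in> test1 a b" and q: "q \<in> test1 c d" and "0 \<le> a" "b \<le> 1" "0 \<le> c" "d \<le> 1"
  shows "(\<lambda>z. p (fst z) * q (snd z)) \<in> test_functions unit_square"
proof -
  obtain a1 b1 where 1: "a < a1" "b1 < b" "\<And>x. x \<notin> {a1..b1} \<Longrightarrow> p x = 0"
    using p by (auto simp: test1_def)
  obtain c1 d1 where 2: "c < c1" "d1 < d" "\<And>x. x \<notin> {c1..d1} \<Longrightarrow> q x = 0"
    using q by (auto simp: test1_def)
  have "{z. p (fst z) * q (snd z) \<noteq> 0} \<subseteq> cbox (a1, c1) (b1, d1)"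
  proof
    fix z assume "z \<in> {z. p (fst z) * q (snd z) \<noteq> 0}"
    then have "fst z \<in> {a1..b1}" "snd z \<in> {c1..d1}" using 1(3) 2(3) by force+
    then show "z \<in> cbox (a1, c1) (b1, d1)" by (cases z) (auto simp: cbox_Pair_eq)
  qed
  then have sub: "closure {z. p (fst z) * q (snd z) \<noteq> 0} \<subseteq> cbox (a1, c1) (b1, d1)"
    by (rule closure_minimal) (rule closed_cbox)
  have "compact (closure {z. p (fst z) * q (snd z) \<noteq> 0})"
    using bounded_subset[OF bounded_cbox sub] by (simp add: compact_eq_bounded_closed)
  moreover have "cbox (a1, c1) (b1, d1) \<subseteq> unit_square"
    using 1 2 assms by (auto simp: unit_square_def cbox_Pair_eq)
  moreover have "smooth (\<lambda>z. p (fst z) * q (snd z))"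
    using p q by (auto simp: smooth_def test1_smooth intro: C_k_tensor)
  ultimately show ?thesis using sub unfolding test_functions_def by blast
qed

lemma gradient_tensor:
  assumes "smooth1 p" "smooth1 q"
  shows "gradient (\<lambda>z. p (fst z) * q (snd z)) z =
    vector [deriv p (fst z) * q (snd z), p (fst z) * deriv q (snd z)]"
  using assms by (simp add: gradient_def dx_tensor dy_tensor)

subsection \<open>Weak derivatives of a Sobolev function\<close>

abbreviation wd :: "(real \<times> real \<Rightarrow> real) \<Rightarrow> nat \<Rightarrow> nat \<Rightarrow> real \<times> real \<Rightarrow> real" where
  "wd u m n \<equiv> weak_deriv unit_square m n u"

lemma weak_deriv_sobolev:
  assumes "u \<in> sobolev k D" "m + n \<le> k"
  shows "weak_deriv D m n u \<in> L2 D" "is_weak_deriv D m n u (weak_deriv D m n u)"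
proof -
  have "\<exists>w'. w' \<in> L2 D \<and> is_weak_deriv D m n u w'" using assms by (auto simp: sobolev_def)
  from someI_ex[OF this] show "weak_deriv D m n u \<in> L2 D" "is_weak_deriv D m n u (weak_deriv D m n u)"
    by (auto simp: weak_deriv_def)
qed

lemma is_weak_deriv_tensor:
  assumes "is_weak_deriv unit_square m n u w" "p \<in> test1 0 1" "q \<in> test1 0 1"
  shows "(\<integral>z. u z * ((deriv ^^ m) p (fst z) * (deriv ^^ n) q (snd z)) \<partial>mu) =
    (-1) ^ (m + n) * (\<integral>z. w z * (p (fst z) * q (snd z)) \<partial>mu)"
  using assms(1)[unfolded is_weak_deriv_def, rule_format, OF tensor_test_functions[OF assms(2,3)]]
    partial_tensor[OF test1_smooth test1_smooth, OF assms(2,3)] by simp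

text \<open>The representatives of the two derivatives are chosen independently of each other. They
  are linked through \<open>u\<close>, since both are equal to \<open>u\<close> tested with the same
  derivative of the product.\<close>

lemma wd_tensor_deriv:
  assumes "u \<in> sobolev k unit_square" "m + n < k"
  shows "xy.tensor_deriv 0 1 0 1 (wd u m n) (wd u (Suc m) n)"
    and "yx.tensor_deriv 0 1 0 1 (wd u m n) (wd u m (Suc n))"
proof -
  note W = weak_deriv_sobolev(2)[OF assms(1), THEN is_weak_deriv_tensor]
  show "xy.tensor_deriv 0 1 0 1 (wd u m n) (wd u (Suc m) n)"
    unfolding xy.tensor_deriv_def
  proof (intro ballI)
    fix p q :: "real \<Rightarrow> real" assume p: "p \<in> test1 0 1" and q: "q \<in> test1 0 1"
    have "(-1) ^ (m + n) * (\<integral>z. wd u m n z * (deriv p (fst z) * q (snd z)) \<partial>mu) =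
      (-1) ^ (Suc m + n) * (\<integral>z. wd u (Suc m) n z * (p (fst z) * q (snd z)) \<partial>mu)"
      using W[OF _ test1_deriv[OF p] q, of m n] W[OF _ p q, of "Suc m" n] assms(2)
      by (simp add: funpow_swap1)
    then show "(\<integral>z. wd u m n z * (deriv p (fst z) * q (snd z)) \<partial>mu) =
      - (\<integral>z. wd u (Suc m) n z * (p (fst z) * q (snd z)) \<partial>mu)"
      by (cases "even (m + n)") auto
  qed
  show "yx.tensor_deriv 0 1 0 1 (wd u m n) (wd u m (Suc n))"
    unfolding yx.tensor_deriv_def
  proof (intro ballI)
    fix p q :: "real \<Rightarrow> real" assume p: "p \<in> test1 0 1" and q: "q \<in> test1 0 1"
    have "(-1) ^ (m + n) * (\<integral>z. wd u m n z * (q (fst z) * deriv p (snd z)) \<partial>mu) =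
      (-1) ^ (m + Suc n) * (\<integral>z. wd u m (Suc n) z * (q (fst z) * p (snd z)) \<partial>mu)"
      using W[OF _ q test1_deriv[OF p], of m n] W[OF _ q p, of m "Suc n"] assms(2)
      by (simp add: funpow_swap1)
    then show "(\<integral>z. wd u m n z * (deriv p (snd z) * q (fst z)) \<partial>mu) =
      - (\<integral>z. wd u m (Suc n) z * (p (snd z) * q (fst z)) \<partial>mu)"
      by (cases "even (m + n)") (auto simp: mult.commute)
  qed
qed

subsection \<open>Uniqueness of weak derivatives\<close>

text \<open>Provides Borel representatives, so that level sets and restrictions to lines parallel to
  the axes are Borel again; a Lebesgue measurable function gives no such control on a line.\<close>

lemma borel_version:
  assumes "w \<in> borel_measurable (lebesgue_on S)" "S \<in> sets lebesgue"
  obtains v :: "'a :: euclidean_space \<Rightarrow> real"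
  where "v \<in> borel_measurable borel" "AE z in lebesgue_on S. w z = v z"
proof -
  have "(\<lambda>z. if z \<in> S then w z else 0) \<in> borel_measurable lebesgue"
    using assms by (subst borel_measurable_if) auto
  then obtain v where v: "v \<in> borel_measurable lborel"
    "AE z in lborel. (if z \<in> S then w z else 0) = v z"
    using completion_ex_borel_measurable_real by blast
  then have "AE z in lebesgue. (if z \<in> S then w z else 0) = v z" by (intro AE_completion)
  then have "AE z in lebesgue_on S. w z = v z"
    using assms(2) by (auto simp: AE_restrict_space_iff elim: eventually_mono)
  then show ?thesis by (rule that[rotated]) (use v in simp)
qed

lemma mu_sets: "S \<in> sets borel \<Longrightarrow> S \<inter> unit_square \<in> sets mu"
  unfolding sets_restrict_space by (rule image_eqI[of _ _ S]) (simp_all add: Int_commute)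

lemma borel_measurable_mu: "f \<in> borel_measurable borel \<Longrightarrow> f \<in> borel_measurable mu"
  by (rule measurable_restrict_space1, rule measurable_completion) simp

text \<open>Products of indicators are admissible, so \<open>H\<close> integrates to 0 over every
  box. Boxes are stable under intersection and generate the Borel sets, hence the integral over
  every Borel set vanishes, in particular over the sets where \<open>H\<close> has a sign.\<close>

lemma AE_zero_if_tensor_zero:
  assumes H: "H \<in> L2 unit_square"
    and zero: "\<And>p q. p \<in> test1 0 1 \<Longrightarrow> q \<in> test1 0 1 \<Longrightarrow> (\<integral>z. H z * (p (fst z) * q (snd z)) \<partial>mu) = 0"
  shows "AE z in mu. H z = 0"
proof -
  let ?I = "\<lambda>S. \<integral>z. indicator S z * H z \<partial>mu"
  have intH: "integrable mu (\<lambda>z. indicator S z * H z)" if "S \<in> sets borel" for S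
    using integrable_real_mult_indicator[OF mu_sets[OF that] L2_integrable[OF H]]
    by (rule Bochner_Integration.integrable_cong[THEN iffD1, rotated -1]) (auto simp: indicator_def)
  have box: "?I (box p q) = 0" for p q
  proof -
    obtain a c b d where [simp]: "p = (a, c)" "q = (b, d)" by (cases p, cases q)
    have "?I (box p q) = (\<integral>z. H z * (iv (max a 0) (min b 1) (fst z) * iv (max c 0) (min d 1) (snd z)) \<partial>mu)"
      by (intro Bochner_Integration.integral_cong) (auto simp: box_prod_eq unit_square_def indicator_def)
    also have "\<dots> = 0"
      by (rule xy.tensor_zero_extend[OF H zero xy.iv_limits xy.iv_limits]) auto
    finally show ?thesis .
  qed
  have all: "?I S = 0" if "S \<in> sets borel" for S
  proof -
    have "Int_stable (range (\<lambda>(a, b :: real \<times> real). box a b))"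
      by (auto simp: Int_stable_def box_Int_box)
    moreover have "range (\<lambda>(a, b :: real \<times> real). box a b) \<subseteq> Pow UNIV" by simp
    moreover have "S \<in> sigma_sets UNIV (range (\<lambda>(a, b). box a b))"
      using that by (subst (asm) borel_eq_box) simp
    ultimately show ?thesis
    proof (induction rule: sigma_sets_induct_disjoint)
      case (compl A)
      have A: "A \<in> sets borel" using compl(1) by (subst borel_eq_box) simp
      have "?I (UNIV - A) = (\<integral>z. indicator (box (0,0) (1,1)) z * H z - indicator A z * H z \<partial>mu)"
        by (intro Bochner_Integration.integral_cong)
           (auto simp: unit_square_box[symmetric] indicator_def)
      also have "\<dots> = ?I (box (0,0) (1,1)) - ?I A"
        using intH A by (intro Bochner_Integration.integral_diff) auto
      finally show ?case using compl box by simp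
    next
      case (union A)
      have A: "A i \<in> sets borel" for i using union(2) by (subst borel_eq_box) auto
      have *: "(LINT z:S \<inter> unit_square|mu. H z) = ?I S" for S
        unfolding set_lebesgue_integral_def
        by (intro Bochner_Integration.integral_cong) (auto simp: indicator_def)
      have "(LINT z:(\<Union>i. A i \<inter> unit_square)|mu. H z) = (\<Sum>i. (LINT z:A i \<inter> unit_square|mu. H z))"
      proof (rule lebesgue_integral_countable_add)
        show "A i \<inter> unit_square \<in> sets mu" for i using mu_sets[OF A] .
        then have "(\<Union>i. A i \<inter> unit_square) \<in> sets mu" by blast
        then show "set_integrable mu (\<Union>i. A i \<inter> unit_square) H"
          unfolding set_integrable_def using integrable_mult_indicator L2_integrable[OF H] by blast
        show "i \<noteq> j \<Longrightarrow> A i \<inter> unit_square \<inter> (A j \<inter> unit_square) = {}" for i j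
          using union(1) by (auto simp: disjoint_family_on_def)
      qed
      then show ?case using union(3) *[of "\<Union>i. A i"] by (simp add: * Int_UN_distrib2)
    qed (use box in auto)
  qed
  obtain v where v: "v \<in> borel_measurable borel" "AE z in mu. H z = v z"
    using borel_version[OF L2_measurable[OF H] unit_square_lebesgue] by blast
  \<comment> \<open>On the set where c v is nonnegative its integral is 0, so v = 0 almost
    everywhere there. The cases c = 1 and c = -1 together leave no sign for v.\<close>
  have sgn: "AE z in mu. v z = 0 \<or> c * v z < 0" if "c \<noteq> 0" for c :: real
  proof -
    let ?S = "{z. 0 \<le> c * v z}"
    have S: "?S \<in> sets borel" using v(1) by measurable
    have eq: "AE z in mu. indicator ?S z * H z * c = indicator ?S z * v z * c"
      using v(2) by eventually_elim simp
    have m: "(\<lambda>z. indicator ?S z * v z * c) \<in> borel_measurable mu"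
      by (intro borel_measurable_mu borel_measurable_times borel_measurable_indicator
          borel_measurable_const S v(1))
    have i: "integrable mu (\<lambda>z. indicator ?S z * v z * c)"
      using intH[OF S] by (intro integrable_cong_AE_imp[OF _ m eq]) auto
    have "(\<integral>z. indicator ?S z * v z * c \<partial>mu) = (\<integral>z. indicator ?S z * H z * c \<partial>mu)"
      using intH[OF S] by (intro integral_cong_AE[OF _ m eq, symmetric]) auto
    also have "\<dots> = ?I ?S * c" by simp
    finally have "(\<integral>z. indicator ?S z * v z * c \<partial>mu) = ?I ?S * c" .
    then have i0: "(\<integral>z. indicator ?S z * v z * c \<partial>mu) = 0" using all[OF S] by simp
    have "AE z in mu. 0 \<le> indicator ?S z * v z * c"
      by (rule AE_I2) (simp add: indicator_def mult.commute)
    from integral_nonneg_eq_0_iff_AE[OF i this] i0 have "AE z in mu. indicator ?S z * v z * c = 0"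
      by (rule iffD1)
    then show ?thesis
      by eventually_elim (use that in \<open>auto simp: indicator_def not_le split: if_splits\<close>)
  qed
  show ?thesis using v(2) sgn[of 1, simplified] sgn[of "-1", simplified] by eventually_elim auto
qed

text \<open>\<open>weak_deriv\<close> picks an arbitrary representative; this is how a concrete
  function is identified with it, and with the terms of \<open>sobolev_norm\<close>.\<close>

lemma weak_deriv_unique:
  assumes w: "w1 \<in> L2 unit_square" "w2 \<in> L2 unit_square"
    and D: "is_weak_deriv unit_square m n v w1" "is_weak_deriv unit_square m n v w2"
  shows "AE z in mu. w1 z = w2 z"
proof -
  have "AE z in mu. w1 z - w2 z = 0"
  proof (rule AE_zero_if_tensor_zero[OF L2_diff[OF w]])
    fix p q :: "real \<Rightarrow> real" assume pq: "p \<in> test1 0 1" "q \<in> test1 0 1"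
    have "(-1) ^ (m + n) * (\<integral>z. w1 z * (p (fst z) * q (snd z)) \<partial>mu) =
      (-1) ^ (m + n) * (\<integral>z. w2 z * (p (fst z) * q (snd z)) \<partial>mu)"
      using is_weak_deriv_tensor[OF D(1) pq] is_weak_deriv_tensor[OF D(2) pq] by simp
    then have e: "(\<integral>z. w1 z * (p (fst z) * q (snd z)) \<partial>mu) = (\<integral>z. w2 z * (p (fst z) * q (snd z)) \<partial>mu)"
      by simp
    note I = xy.tensor_integrable[OF _ test1_in_limits[OF pq(1)] test1_in_limits[OF pq(2)]]
    show "(\<integral>z. (w1 z - w2 z) * (p (fst z) * q (snd z)) \<partial>mu) = 0"
      unfolding left_diff_distrib using I[OF w(1)] I[OF w(2)] e by simp
  qed
  then show ?thesis by eventually_elim simp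
qed

subsection \<open>Smooth functions on the unit square\<close>

lemma smooth_C_k: "smooth \<phi> \<Longrightarrow> C_k k \<phi>"
  by (simp add: smooth_def)

lemma smooth_continuous:
  assumes "smooth \<phi>"
  shows "continuous_on S \<phi>" "continuous_on S (dx \<phi>)" "continuous_on S (dy \<phi>)"
proof -
  have *: "\<phi> differentiable (at z) \<and> dx \<phi> differentiable (at z) \<and> dy \<phi> differentiable (at z)" for z
    using smooth_C_k[OF assms, of 2] by (cases z) (simp add: numeral_2_eq_2)
  show "continuous_on S \<phi>" "continuous_on S (dx \<phi>)" "continuous_on S (dy \<phi>)"
    using * by (auto intro!: continuous_at_imp_continuous_on differentiable_imp_continuous_within)
qed

lemma smooth_differentiable: "smooth \<phi> \<Longrightarrow> \<phi> differentiable (at z)"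
  using smooth_C_k[of \<phi> 1] by (cases z) simp

lemma smooth_DERIV_x:
  assumes "smooth \<phi>" shows "((\<lambda>r. \<phi> (r, y)) has_real_derivative dx \<phi> (x, y)) (at x)"
proof -
  have "((\<lambda>r. (r, y)) has_derivative (\<lambda>h. (h, 0))) (at x)"
    by (auto intro!: derivative_eq_intros)
  then have "(\<lambda>r. (r, y)) differentiable (at x)" by (rule differentiableI)
  from differentiable_chain_at[OF this smooth_differentiable[OF assms]]
  have "(\<lambda>r. \<phi> (r, y)) differentiable (at x)" by (simp only: o_def)
  then obtain d where d: "((\<lambda>r. \<phi> (r, y)) has_real_derivative d) (at x)"
    by (auto simp: differentiable_iff_has_real_derivative)
  then show ?thesis by (simp add: dx_def DERIV_imp_deriv)
qed

lemma smooth_DERIV_y: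
  assumes "smooth \<phi>" shows "((\<lambda>r. \<phi> (x, r)) has_real_derivative dy \<phi> (x, y)) (at y)"
proof -
  have "((\<lambda>r. (x, r)) has_derivative (\<lambda>h. (0, h))) (at y)"
    by (auto intro!: derivative_eq_intros)
  then have "(\<lambda>r. (x, r)) differentiable (at y)" by (rule differentiableI)
  from differentiable_chain_at[OF this smooth_differentiable[OF assms]]
  have "(\<lambda>r. \<phi> (x, r)) differentiable (at y)" by (simp only: o_def)
  then obtain d where d: "((\<lambda>r. \<phi> (x, r)) has_real_derivative d) (at y)"
    by (auto simp: differentiable_iff_has_real_derivative)
  then show ?thesis by (simp add: dy_def DERIV_imp_deriv)
qed

lemma continuous_in_L2:
  assumes "continuous_on UNIV F" shows "F \<in> L2 unit_square"
proof -
  have "bounded (F ` cbox (0,0) (1,1))"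
    by (intro compact_imp_bounded compact_continuous_image continuous_on_subset[OF assms]) auto
  then obtain K where K: "\<And>z. z \<in> cbox (0,0) (1,1) \<Longrightarrow> \<bar>F z\<bar> \<le> K"
    unfolding bounded_iff real_norm_def by blast
  show ?thesis
  proof (rule bounded_in_L2)
    show "F \<in> borel_measurable mu"
      using assms by (intro borel_measurable_mu borel_measurable_continuous_onI)
    show "\<bar>F z\<bar> \<le> K" if "z \<in> unit_square" for z
      using K box_subset_cbox that unfolding unit_square_box by blast
  qed
qed

context coordinates
begin

definition pt :: "real \<Rightarrow> real \<Rightarrow> real \<times> real" where
  "pt x y = (if s = fst \<and> t = snd then (x, y) else (y, x))"

lemma fst_neq_snd: "(fst :: real \<times> real \<Rightarrow> real) \<noteq> snd"
  by (metis fst_conv snd_conv zero_neq_one)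

lemma pt_coords [simp]: "s (pt x y) = x" "t (pt x y) = y" "pt (s z) (t z) = z"
  using coords fst_neq_snd by (auto simp: pt_def)

definition ds :: "(real \<times> real \<Rightarrow> real) \<Rightarrow> real \<times> real \<Rightarrow> real" where
  "ds \<phi> = (if s = fst \<and> t = snd then dx \<phi> else dy \<phi>)"

lemma smooth_DERIV_s:
  assumes "smooth \<phi>" shows "((\<lambda>r. \<phi> (pt r y)) has_real_derivative ds \<phi> (pt x y)) (at x)"
  using smooth_DERIV_x[OF assms] smooth_DERIV_y[OF assms] coords fst_neq_snd
  by (auto simp: pt_def ds_def)

lemma smooth_continuous_ds: "smooth \<phi> \<Longrightarrow> continuous_on S (ds \<phi>)"
  by (simp add: ds_def smooth_continuous)

lemma continuous_pt: 
  assumes "continuous_on UNIV f" "continuous_on UNIV g"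
  shows "continuous_on UNIV (\<lambda>x. pt (f x) (g x))"
proof (cases "s = fst \<and> t = snd")
  case True
  show ?thesis unfolding pt_def if_P[OF True] by (intro continuous_on_Pair assms)
next
  case False
  show ?thesis unfolding pt_def if_not_P[OF False] by (intro continuous_on_Pair assms)
qed

lemma continuous_s: "continuous_on S s" and continuous_t: "continuous_on S t"
  using coords by (auto intro!: continuous_intros)

lemma integral_rect_continuous:
  assumes F: "continuous_on UNIV F" and ab: "0 \<le> a" "a \<le> b" "b \<le> 1" and cd: "0 \<le> c" "c \<le> d" "d \<le> 1"
  shows "(\<integral>z. F z * (iv a b (s z) * iv c d (t z)) \<partial>mu) =
    integral {c..d} (\<lambda>y. integral {a..b} (\<lambda>x. F (pt x y)))"
proof -
  have base: "(\<integral>z. F z * (iv a b (fst z) * iv c d (snd z)) \<partial>mu) = integral (cbox (a,c) (b,d)) F"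
    if "0 \<le> a" "a \<le> b" "b \<le> 1" "0 \<le> c" "c \<le> d" "d \<le> 1" for a b c d
  proof -
    have sub: "box (a,c) (b,d) \<subseteq> unit_square"
      using that by (auto simp: unit_square_def box_prod_eq)
    have int: "set_integrable lebesgue (box (a,c) (b,d)) F"
      by (rule set_integrable_subset[OF absolutely_integrable_continuous[OF continuous_on_subset[OF F]]])
         (auto intro: subsetD[OF box_subset_cbox])
    have "(\<integral>z. F z * (iv a b (fst z) * iv c d (snd z)) \<partial>mu) =
      (\<integral>z. indicator unit_square z *\<^sub>R (F z * (iv a b (fst z) * iv c d (snd z))) \<partial>lebesgue)"
      by (rule integral_restrict_space) simp
    also have "\<dots> = (LINT z:box (a,c) (b,d)|lebesgue. F z)"
      unfolding set_lebesgue_integral_def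
      by (intro Bochner_Integration.integral_cong)
         (use sub in \<open>auto simp: indicator_def box_prod_eq\<close>)
    also have "\<dots> = integral (box (a,c) (b,d)) F"
      by (rule set_lebesgue_integral_eq_integral(2)[OF int])
    finally show ?thesis by (simp only: integral_open_interval)
  qed
  show ?thesis
  proof (cases "s = fst \<and> t = snd")
    case True
    have "integral (cbox (a,c) (b,d)) F = integral (cbox a b) (\<lambda>x. integral (cbox c d) (\<lambda>y. F (x, y)))"
      by (rule integral_prod_continuous[OF continuous_on_subset[OF F]]) simp
    also have "\<dots> = integral (cbox c d) (\<lambda>y. integral (cbox a b) (\<lambda>x. F (x, y)))"
      by (rule integral_swap_continuous) (use continuous_on_subset[OF F] in auto)
    finally show ?thesis using base[OF ab cd] True unfolding pt_def by simp
  next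
    case False
    then have st: "s = snd" "t = fst" using coords by auto
    have "integral (cbox (c,a) (d,b)) F = integral (cbox c d) (\<lambda>y. integral (cbox a b) (\<lambda>x. F (y, x)))"
      by (rule integral_prod_continuous[OF continuous_on_subset[OF F]]) simp
    then show ?thesis using base[OF cd ab] False st unfolding pt_def by (simp add: mult.commute)
  qed
qed

lemma integration_by_parts:
  assumes "smooth \<phi>" "\<psi> \<in> test_functions unit_square"
  shows "(\<integral>z. \<phi> z * ds \<psi> z \<partial>mu) = - (\<integral>z. ds \<phi> z * \<psi> z \<partial>mu)"
proof -
  have psi: "smooth \<psi>" and supp: "closure {z. \<psi> z \<noteq> 0} \<subseteq> unit_square"
    using assms(2) by (auto simp: test_functions_def)
  have zero: "\<psi> z = 0" if "z \<notin> unit_square" for z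
  proof (rule ccontr)
    assume "\<psi> z \<noteq> 0"
    then have "z \<in> closure {z. \<psi> z \<noteq> 0}" by (intro subsetD[OF closure_subset]) simp
    then show False using supp that by blast
  qed
  define F where "F z = ds \<phi> z * \<psi> z + ds \<psi> z * \<phi> z" for z
  have F: "continuous_on UNIV F"
    unfolding F_def[abs_def] using assms(1) psi
    by (intro continuous_intros smooth_continuous smooth_continuous_ds)
  have "integral {0..1} (\<lambda>x. F (pt x y)) = 0" for y
  proof -
    have "((\<lambda>x. F (pt x y)) has_integral (\<phi> (pt 1 y) * \<psi> (pt 1 y) - \<phi> (pt 0 y) * \<psi> (pt 0 y))) {0..1}"
    proof (rule fundamental_theorem_of_calculus)
      fix x :: real
      have "((\<lambda>x. \<phi> (pt x y) * \<psi> (pt x y)) has_real_derivative F (pt x y)) (at x)"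
        unfolding F_def by (rule DERIV_mult[OF smooth_DERIV_s[OF assms(1)] smooth_DERIV_s[OF psi]])
      then show "((\<lambda>x. \<phi> (pt x y) * \<psi> (pt x y)) has_vector_derivative F (pt x y)) (at x within {0..1})"
        by (simp add: has_real_derivative_iff_has_vector_derivative has_vector_derivative_at_within)
    qed simp
    moreover have "\<psi> (pt 1 y) = 0" "\<psi> (pt 0 y) = 0"
      using coord_range[of "pt 1 y"] coord_range[of "pt 0 y"] by (auto intro: zero)
    ultimately show ?thesis by (auto dest: integral_unique)
  qed
  then have "(\<integral>z. F z * (iv 0 1 (s z) * iv 0 1 (t z)) \<partial>mu) = 0"
    by (subst integral_rect_continuous[OF F]) auto
  moreover have "(\<integral>z. F z * (iv 0 1 (s z) * iv 0 1 (t z)) \<partial>mu) = (\<integral>z. F z \<partial>mu)"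
    by (intro Bochner_Integration.integral_cong) (use coord_range in auto)
  moreover have "(\<integral>z. F z \<partial>mu) = (\<integral>z. ds \<phi> z * \<psi> z \<partial>mu) + (\<integral>z. \<phi> z * ds \<psi> z \<partial>mu)"
    unfolding F_def mult.commute[of "ds \<psi> _"] using assms(1) psi
    by (intro Bochner_Integration.integral_add L2_mult_integrable continuous_in_L2
        smooth_continuous smooth_continuous_ds)
  ultimately show ?thesis by simp
qed

end

lemma xy_pt [simp]: "xy.pt x y = (x, y)" and xy_ds [simp]: "xy.ds \<phi> = dx \<phi>"
  by (simp_all add: xy.pt_def xy.ds_def)

lemma yx_pt [simp]: "yx.pt x y = (y, x)" and yx_ds [simp]: "yx.ds \<phi> = dy \<phi>"
  using xy.fst_neq_snd by (simp_all add: yx.pt_def yx.ds_def)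

lemma partial_simps: "partial 0 0 \<phi> = \<phi>" "partial 1 0 \<phi> = dx \<phi>" "partial 0 1 \<phi> = dy \<phi>"
  by (simp_all add: partial_def)

lemma test_function_smooth: "\<psi> \<in> test_functions D \<Longrightarrow> smooth \<psi>"
  by (simp add: test_functions_def)

lemma is_weak_deriv_smooth_diff:
  assumes phi: "smooth \<phi>" and u: "u \<in> L2 unit_square" "w \<in> L2 unit_square"
    and D: "is_weak_deriv unit_square m n u w"
    and e: "(m, n, d) = (1, 0, dx \<phi>) \<or> (m, n, d) = (0, 1, dy \<phi>)"
  shows "is_weak_deriv unit_square m n (\<lambda>z. \<phi> z - u z) (\<lambda>z. d z - w z)"
  unfolding is_weak_deriv_def
proof
  fix \<psi> assume psi: "\<psi> \<in> test_functions unit_square"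
  note sm = test_function_smooth[OF psi]
  have L: "partial m n \<psi> \<in> L2 unit_square" "d \<in> L2 unit_square" "\<psi> \<in> L2 unit_square" "\<phi> \<in> L2 unit_square"
    using e sm phi by (auto simp: partial_simps[simplified] smooth_continuous intro!: continuous_in_L2)
  have "(\<integral>z. (\<phi> z - u z) * partial m n \<psi> z \<partial>mu) =
    (\<integral>z. \<phi> z * partial m n \<psi> z \<partial>mu) - (\<integral>z. u z * partial m n \<psi> z \<partial>mu)"
    unfolding left_diff_distrib using L u
    by (intro Bochner_Integration.integral_diff L2_mult_integrable)
  also have "(\<integral>z. \<phi> z * partial m n \<psi> z \<partial>mu) = - (\<integral>z. d z * \<psi> z \<partial>mu)"
    using e xy.integration_by_parts[OF phi psi] yx.integration_by_parts[OF phi psi]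
    by (auto simp: partial_simps[simplified])
  also have "(\<integral>z. u z * partial m n \<psi> z \<partial>mu) = - (\<integral>z. w z * \<psi> z \<partial>mu)"
    using D psi e unfolding is_weak_deriv_def by auto
  also have "- (\<integral>z. d z * \<psi> z \<partial>mu) - - (\<integral>z. w z * \<psi> z \<partial>mu) = - (\<integral>z. (d z - w z) * \<psi> z \<partial>mu)"
    unfolding left_diff_distrib using L u
    by (subst Bochner_Integration.integral_diff) (auto intro!: L2_mult_integrable)
  finally show "(\<integral>z. (\<phi> z - u z) * partial m n \<psi> z \<partial>mu) =
      (-1) ^ (m + n) * (\<integral>z. (d z - w z) * \<psi> z \<partial>mu)"
    using e by auto
qed

lemma finite_order: "finite {(p, q). p + q \<le> (k :: nat)}"
  by (rule finite_subset[of _ "{..k} \<times> {..k}"]) auto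

lemma sobolev_norm_term:
  assumes "m + n \<le> k"
  shows "(\<integral>z. (weak_deriv D m n w z)\<^sup>2 \<partial>lebesgue_on D) \<le> (sobolev_norm k D w)\<^sup>2"
proof -
  let ?f = "\<lambda>(p, q). \<integral>z. (weak_deriv D p q w z)\<^sup>2 \<partial>lebesgue_on D"
  have "?f (m, n) \<le> sum ?f {(p, q). p + q \<le> k}"
    using assms finite_order by (intro member_le_sum) auto
  also have "\<dots> = (sobolev_norm k D w)\<^sup>2"
    unfolding sobolev_norm_def by (rule real_sqrt_pow2[symmetric]) (auto intro!: sum_nonneg)
  finally show ?thesis by simp
qed

text \<open>Convergence in \<open>sobolev_norm\<close> speaks of the representatives chosen for the
  derivatives of the difference. Uniqueness replaces them by the differences of the classical
  derivatives of \<phi> k and the chosen derivatives of \<open>u\<close>.\<close>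

lemma is_trace_approx:
  assumes tr: "is_trace unit_square S u \<tau>" and u: "u \<in> sobolev k unit_square" "1 \<le> k"
  obtains \<phi> where "\<And>k. smooth (\<phi> k)" "(\<lambda>k. seg_integral S (\<lambda>z. (\<phi> k z - \<tau> z)\<^sup>2)) \<longlonglongrightarrow> 0"
    "(\<lambda>k. sobolev_norm 1 unit_square (\<lambda>z. \<phi> k z - u z)) \<longlonglongrightarrow> 0"
    "(\<lambda>k. \<integral>z. (\<phi> k z - u z)\<^sup>2 \<partial>mu) \<longlonglongrightarrow> 0"
    "(\<lambda>k. \<integral>z. (dx (\<phi> k) z - wd u 1 0 z)\<^sup>2 \<partial>mu) \<longlonglongrightarrow> 0"
    "(\<lambda>k. \<integral>z. (dy (\<phi> k) z - wd u 0 1 z)\<^sup>2 \<partial>mu) \<longlonglongrightarrow> 0"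
proof -
  obtain \<phi> where \<phi>: "\<And>k. smooth (\<phi> k)" "(\<lambda>k. seg_integral S (\<lambda>z. (\<phi> k z - \<tau> z)\<^sup>2)) \<longlonglongrightarrow> 0"
    "(\<lambda>k. sobolev_norm 1 unit_square (\<lambda>z. \<phi> k z - u z)) \<longlonglongrightarrow> 0"
    using tr unfolding is_trace_def by blast
  have uL: "u \<in> L2 unit_square" using u by (simp add: sobolev_def)
  have w: "wd u 1 0 \<in> L2 unit_square" "is_weak_deriv unit_square 1 0 u (wd u 1 0)"
    "wd u 0 1 \<in> L2 unit_square" "is_weak_deriv unit_square 0 1 u (wd u 0 1)"
    using weak_deriv_sobolev[OF u(1)] u(2) by auto
  have lim: "(\<lambda>k. \<integral>z. (e k z)\<^sup>2 \<partial>mu) \<longlonglongrightarrow> 0"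
    if e: "\<And>k. e k \<in> L2 unit_square" "\<And>k. is_weak_deriv unit_square m n (\<lambda>z. \<phi> k z - u z) (e k)"
      and mn: "m + n \<le> 1" for m n e
  proof (rule tendsto_sandwich[OF _ _ tendsto_const])
    show "(\<lambda>k. (sobolev_norm 1 unit_square (\<lambda>z. \<phi> k z - u z))\<^sup>2) \<longlonglongrightarrow> 0"
      using tendsto_power[OF \<phi>(3), of 2] by simp
    show "eventually (\<lambda>k. (\<integral>z. (e k z)\<^sup>2 \<partial>mu) \<le> (sobolev_norm 1 unit_square (\<lambda>z. \<phi> k z - u z))\<^sup>2) sequentially"
    proof (rule always_eventually, rule allI)
      fix k
      let ?W = "weak_deriv unit_square m n (\<lambda>z. \<phi> k z - u z)"
      have "\<exists>w'. w' \<in> L2 unit_square \<and> is_weak_deriv unit_square m n (\<lambda>z. \<phi> k z - u z) w'"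
        using e by blast
      from someI_ex[OF this] have W: "?W \<in> L2 unit_square"
        "is_weak_deriv unit_square m n (\<lambda>z. \<phi> k z - u z) ?W"
        by (auto simp: weak_deriv_def)
      have "AE z in mu. e k z = ?W z" by (rule weak_deriv_unique[OF e(1) W(1) e(2) W(2)])
      then have "(\<integral>z. (e k z)\<^sup>2 \<partial>mu) = (\<integral>z. (?W z)\<^sup>2 \<partial>mu)"
        using L2_measurable[OF e(1)] L2_measurable[OF W(1)]
        by (intro integral_cong_AE) (auto elim: eventually_mono)
      then show "(\<integral>z. (e k z)\<^sup>2 \<partial>mu) \<le> (sobolev_norm 1 unit_square (\<lambda>z. \<phi> k z - u z))\<^sup>2"
        using sobolev_norm_term[OF mn] by simp
    qed
  qed simp
  have L: "\<phi> k \<in> L2 unit_square" "dx (\<phi> k) \<in> L2 unit_square" "dy (\<phi> k) \<in> L2 unit_square" for k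
    using \<phi>(1) by (auto intro!: continuous_in_L2 simp: smooth_continuous)
  have "(\<lambda>k. \<integral>z. (\<phi> k z - u z)\<^sup>2 \<partial>mu) \<longlonglongrightarrow> 0"
    by (rule lim[of _ 0 0]) (auto intro!: L2_diff L uL simp: is_weak_deriv_def partial_simps)
  moreover have "(\<lambda>k. \<integral>z. (dx (\<phi> k) z - wd u 1 0 z)\<^sup>2 \<partial>mu) \<longlonglongrightarrow> 0"
    by (rule lim[of _ 1 0]) (use \<phi>(1) uL w L in \<open>auto intro!: L2_diff is_weak_deriv_smooth_diff\<close>)
  moreover have "(\<lambda>k. \<integral>z. (dy (\<phi> k) z - wd u 0 1 z)\<^sup>2 \<partial>mu) \<longlonglongrightarrow> 0"
    by (rule lim[of _ 0 1]) (use \<phi>(1) uL w L in \<open>auto intro!: L2_diff is_weak_deriv_smooth_diff\<close>)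
  ultimately show ?thesis using that \<phi> by blast
qed

subsection \<open>Traces on segments parallel to the axes\<close>

lemma lebesgue_on_affine:
  fixes q :: "real \<Rightarrow> real"
  assumes "c < d"
  shows "(\<integral>r. q (c + r * (d - c)) \<partial>lebesgue_on {0..1}) = (\<integral>y. q y \<partial>lebesgue_on {c..d}) / (d - c)"
    and "integrable (lebesgue_on {0..1}) (\<lambda>r. q (c + r * (d - c))) \<longleftrightarrow> integrable (lebesgue_on {c..d}) q"
proof -
  let ?f = "\<lambda>y. indicator {c..d} y *\<^sub>R q y"
  have eq: "indicator {0..1} r *\<^sub>R q (c + r * (d - c)) = ?f (c + (d - c) * r)" for r
  proof -
    have "c \<le> c + (d - c) * r \<longleftrightarrow> 0 \<le> r" using assms by (simp add: zero_le_mult_iff)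
    moreover have "c + (d - c) * r \<le> d \<longleftrightarrow> r \<le> 1"
      using assms mult_le_cancel_left_pos[of "d - c" r 1] by (simp add: algebra_simps)
    ultimately show ?thesis by (simp add: indicator_def mult.commute)
  qed
  show "(\<integral>r. q (c + r * (d - c)) \<partial>lebesgue_on {0..1}) = (\<integral>y. q y \<partial>lebesgue_on {c..d}) / (d - c)"
  proof -
    have "(\<integral>r. q (c + r * (d - c)) \<partial>lebesgue_on {0..1}) = (\<integral>r. ?f (c + (d - c) * r) \<partial>lebesgue)"
      unfolding eq[symmetric] by (rule integral_restrict_space) simp
    moreover have "(\<integral>y. q y \<partial>lebesgue_on {c..d}) = (\<integral>y. ?f y \<partial>lebesgue)"
      by (rule integral_restrict_space) simp
    moreover have "(\<integral>y. ?f y \<partial>lebesgue) = \<bar>d - c\<bar> *\<^sub>R (\<integral>r. ?f (c + (d - c) * r) \<partial>lebesgue)"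
      by (rule lebesgue_integral_real_affine) (use assms in simp)
    ultimately show ?thesis using assms by (simp only: real_scaleR_def) simp
  qed
  show "integrable (lebesgue_on {0..1}) (\<lambda>r. q (c + r * (d - c))) \<longleftrightarrow> integrable (lebesgue_on {c..d}) q"
    using lebesgue_integrable_real_affine_iff[of "d - c" ?f c] assms
    by (simp add: integrable_restrict_space eq del: real_scaleR_def)
qed

lemma lebesgue_on_affine_measurable:
  fixes q :: "real \<Rightarrow> real"
  assumes "c < d" "(\<lambda>r. q (r)) \<in> borel_measurable (lebesgue_on {0..1})" "0 \<le> c" "d \<le> 1"
  shows "(\<lambda>r. q (c + r * (d - c))) \<in> borel_measurable (lebesgue_on {0..1})"
proof -
  have q: "(\<lambda>r. if r \<in> {0..1} then q r else 0) \<in> borel_measurable lebesgue"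
    using assms(2) by (subst borel_measurable_if) auto
  have T: "(\<lambda>r. c + (d - c) * r) \<in> lebesgue \<rightarrow>\<^sub>M lebesgue"
    using lebesgue_affine_measurable[where c= "\<lambda>x::real. d - c" and t=c] assms(1) by simp
  have m: "(\<lambda>r. if c + (d - c) * r \<in> {0..1} then q (c + (d - c) * r) else 0) \<in> borel_measurable (lebesgue_on {0..1})"
    using measurable_compose[OF T q] by (rule measurable_restrict_space1)
  have e: "(if c + (d - c) * r \<in> {0..1} then q (c + (d - c) * r) else 0) = q (c + r * (d - c))"
    if "r \<in> space (lebesgue_on {0..1})" for r
  proof -
    have r: "0 \<le> r" "r \<le> 1" using that by auto
    have "(d - c) * r \<le> d - c" "0 \<le> (d - c) * r"
      using r assms(1) by (auto intro!: mult_left_le)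
    then have "0 \<le> c + (d - c) * r" "c + (d - c) * r \<le> 1" using assms(3,4) by linarith+
    then have "c + (d - c) * r \<in> {0..1}" by (intro atLeastAtMost_iff[THEN iffD2] conjI)
    then show ?thesis by (simp add: mult.commute)
  qed
  show ?thesis by (rule measurable_cong[THEN iffD1, OF e m])
qed

context coordinates
begin

lemma pair_tendsto:
  assumes H: "\<And>k. Hk k \<in> L2 unit_square" "H \<in> L2 unit_square"
    and lim: "(\<lambda>k::nat. \<integral>z. (Hk k z - H z)\<^sup>2 \<partial>mu) \<longlonglongrightarrow> 0"
    and f: "f \<in> test1_limits a b" "g \<in> test1_limits c d"
  shows "(\<lambda>k. pair (Hk k) f g) \<longlonglongrightarrow> pair H f g"
proof -
  let ?D = "\<lambda>k. pair (\<lambda>z. 1 * Hk k z + (-1) * H z) f g"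
  let ?N = "\<integral>z. (f (s z) * g (t z))\<^sup>2 \<partial>mu"
  have "(\<lambda>k. (?D k)\<^sup>2) \<longlonglongrightarrow> 0"
  proof (rule tendsto_sandwich[OF _ _ tendsto_const])
    show "(\<lambda>k. (\<integral>z. (Hk k z - H z)\<^sup>2 \<partial>mu) * ?N) \<longlonglongrightarrow> 0"
      using tendsto_mult_left_zero[OF lim] .
    have "(?D k)\<^sup>2 \<le> (\<integral>z. (Hk k z - H z)\<^sup>2 \<partial>mu) * ?N" for k
      using L2_Cauchy_Schwarz[OF L2_diff[OF H(1)[of k] H(2)] tensor_L2[OF f]]
      by (simp add: pair_def)
    then show "eventually (\<lambda>k. (?D k)\<^sup>2 \<le> (\<integral>z. (Hk k z - H z)\<^sup>2 \<partial>mu) * ?N) sequentially" by simp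
  qed simp
  then have "(\<lambda>k. sqrt ((?D k)\<^sup>2)) \<longlonglongrightarrow> sqrt 0" by (rule tendsto_real_sqrt)
  then have "(\<lambda>k. \<bar>?D k\<bar>) \<longlonglongrightarrow> 0" by simp
  then have "?D \<longlonglongrightarrow> 0" by (simp add: tendsto_rabs_zero_iff)
  then have "(\<lambda>k. ?D k + pair H f g) \<longlonglongrightarrow> 0 + pair H f g" by (intro tendsto_intros)
  then show ?thesis unfolding pair_linear_fun[OF H(1) H(2) f] by simp
qed

text \<open>The average over the edge \<open>{\<xi>} \<times> [c, d]\<close> of a cell \<open>[a, b] \<times> [c, d]\<close>, \<open>\<xi> \<in> {a, b}\<close>,
  as a volume integral over the cell.\<close>

definition edge_average ::
  "(real \<times> real \<Rightarrow> real) \<Rightarrow> (real \<times> real \<Rightarrow> real) \<Rightarrow> real \<Rightarrow> real \<Rightarrow> real \<Rightarrow> real \<Rightarrow> real \<Rightarrow> real" where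
  "edge_average w w' a b c d \<xi> =
     (pair w (iv a b) (iv c d) + pair w' (\<lambda>x. (x - (a + b - \<xi>)) * iv a b x) (iv c d)) /
     ((b - a) * (d - c))"

lemma affine_iv_limits: "0 \<le> a \<Longrightarrow> b \<le> 1 \<Longrightarrow> (\<lambda>x. (x - k) * iv a b x) \<in> test1_limits 0 1"
  by (intro test1_limits_smooth_mult smooth1_intros iv_limits)

lemma smooth_line:
  assumes "smooth \<phi>" shows "continuous_on UNIV (\<lambda>y. \<phi> (pt \<xi> y))"
  by (rule continuous_on_compose2[OF smooth_continuous(1)[OF assms, of UNIV] continuous_pt])
     (auto intro!: continuous_intros)

text \<open>The integrand is the x-derivative of (x - (a + b - \<xi>)) \<phi>, a product that
  vanishes at the end point other than \<xi>. This turns a value on an edge into an integral over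
  the cell.\<close>

lemma smooth_fundamental:
  assumes phi: "smooth \<phi>" and ab: "a < b" "\<xi> = a \<or> \<xi> = b"
  shows "((\<lambda>x. \<phi> (pt x y) + (x - (a + b - \<xi>)) * ds \<phi> (pt x y)) has_integral (b - a) * \<phi> (pt \<xi> y)) {a..b}"
proof -
  let ?k = "a + b - \<xi>"
  have "((\<lambda>x. \<phi> (pt x y) + (x - ?k) * ds \<phi> (pt x y)) has_integral
      ((b - ?k) * \<phi> (pt b y) - (a - ?k) * \<phi> (pt a y))) {a..b}"
  proof (rule fundamental_theorem_of_calculus)
    fix x :: real
    have "((\<lambda>x. (x - ?k) * \<phi> (pt x y)) has_real_derivative
        1 * \<phi> (pt x y) + ds \<phi> (pt x y) * (x - ?k)) (at x)"
      by (intro DERIV_mult smooth_DERIV_s[OF phi]) (auto intro!: derivative_eq_intros)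
    then show "((\<lambda>x. (x - ?k) * \<phi> (pt x y)) has_vector_derivative
        \<phi> (pt x y) + (x - ?k) * ds \<phi> (pt x y)) (at x within {a..b})"
      by (simp add: has_real_derivative_iff_has_vector_derivative has_vector_derivative_at_within
          mult.commute)
  qed (use ab in auto)
  then show ?thesis using ab(2) by (auto simp: algebra_simps)
qed

lemma smooth_edge_average:
  assumes phi: "smooth \<phi>" and ab: "0 \<le> a" "a < b" "b \<le> 1" "\<xi> = a \<or> \<xi> = b"
    and cd: "0 \<le> c" "c < d" "d \<le> 1"
  shows "(\<integral>r. \<phi> (pt \<xi> (c + r * (d - c))) \<partial>lebesgue_on {0..1}) = edge_average \<phi> (ds \<phi>) a b c d \<xi>"
proof -
  let ?k = "a + b - \<xi>"
  let ?F = "\<lambda>z. \<phi> z + (s z - ?k) * ds \<phi> z"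
  have F: "continuous_on UNIV ?F"
    by (intro continuous_intros smooth_continuous smooth_continuous_ds phi continuous_s)
  have cont: "continuous_on {c..d} (\<lambda>y. \<phi> (pt \<xi> y))"
    using smooth_line[OF phi] by (rule continuous_on_subset) simp
  have lim: "iv a b \<in> test1_limits 0 1" "iv c d \<in> test1_limits 0 1"
    using ab cd by (auto intro!: iv_limits)
  have "pair \<phi> (iv a b) (iv c d) + pair (ds \<phi>) (\<lambda>x. (x - ?k) * iv a b x) (iv c d) =
    (\<integral>z. ?F z * (iv a b (s z) * iv c d (t z)) \<partial>mu)"
  proof -
    have "integrable mu (\<lambda>z. \<phi> z * (iv a b (s z) * iv c d (t z)))"
      by (rule tensor_integrable[OF continuous_in_L2[OF smooth_continuous(1)[OF phi]] lim])
    moreover have "integrable mu (\<lambda>z. ds \<phi> z * ((s z - ?k) * iv a b (s z) * iv c d (t z)))"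
      by (rule tensor_integrable[OF continuous_in_L2[OF smooth_continuous_ds[OF phi]]
            affine_iv_limits[OF ab(1,3)] lim(2)])
    ultimately show ?thesis
      unfolding pair_def
      by (subst Bochner_Integration.integral_add[symmetric])
         (auto intro!: Bochner_Integration.integral_cong simp: algebra_simps)
  qed
  also have "\<dots> = integral {c..d} (\<lambda>y. integral {a..b} (\<lambda>x. ?F (pt x y)))"
    using ab cd by (intro integral_rect_continuous[OF F]) auto
  also have "\<dots> = integral {c..d} (\<lambda>y. (b - a) * \<phi> (pt \<xi> y))"
    using smooth_fundamental[OF phi ab(2,4)]
    by (intro Henstock_Kurzweil_Integration.integral_cong) (auto intro: integral_unique)
  also have "\<dots> = (b - a) * integral {c..d} (\<lambda>y. \<phi> (pt \<xi> y))" by simp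
  also have "integral {c..d} (\<lambda>y. \<phi> (pt \<xi> y)) = (\<integral>y. \<phi> (pt \<xi> y) \<partial>lebesgue_on {c..d})"
    using continuous_imp_integrable_real[OF cont] by (subst lebesgue_integral_eq_integral) auto
  finally have "pair \<phi> (iv a b) (iv c d) + pair (ds \<phi>) (\<lambda>x. (x - ?k) * iv a b x) (iv c d) =
    (b - a) * (\<integral>y. \<phi> (pt \<xi> y) \<partial>lebesgue_on {c..d})" .
  then show ?thesis
    using ab cd lebesgue_on_affine(1)[of c d "\<lambda>y. \<phi> (pt \<xi> y)"] by (simp add: edge_average_def)
qed

text \<open>The identity holds for smooth functions and both sides pass to the limit: the left one
  by L2 convergence on the segment, the right one because it involves only the function and its
  s-derivative in L2 of the square.\<close>

lemma trace_edge_average: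
  assumes phi: "\<And>k. smooth (\<phi> k)" and w: "w \<in> L2 unit_square" "w' \<in> L2 unit_square"
    and lim: "(\<lambda>k. \<integral>z. (\<phi> k z - w z)\<^sup>2 \<partial>mu) \<longlonglongrightarrow> 0" "(\<lambda>k. \<integral>z. (ds (\<phi> k) z - w' z)\<^sup>2 \<partial>mu) \<longlonglongrightarrow> 0"
    and ab: "0 \<le> a" "a < b" "b \<le> 1" "\<xi> = a \<or> \<xi> = b" and cd: "0 \<le> c" "c < d" "d \<le> 1"
    and tau: "(\<lambda>r. \<tau> (pt \<xi> (c + r * (d - c)))) \<in> L2 {0..1}"
      "(\<lambda>k. \<integral>r. (\<phi> k (pt \<xi> (c + r * (d - c))) - \<tau> (pt \<xi> (c + r * (d - c))))\<^sup>2 \<partial>lebesgue_on {0..1}) \<longlonglongrightarrow> 0"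
  shows "(\<integral>r. \<tau> (pt \<xi> (c + r * (d - c))) \<partial>lebesgue_on {0..1}) = edge_average w w' a b c d \<xi>"
proof -
  let ?l = "\<lambda>r. pt \<xi> (c + r * (d - c))"
  have lims: "iv a b \<in> test1_limits 0 1" "iv c d \<in> test1_limits 0 1"
    "(\<lambda>x. (x - (a + b - \<xi>)) * iv a b x) \<in> test1_limits 0 1"
    using ab cd by (auto intro!: iv_limits affine_iv_limits)
  have 1: "(\<lambda>k. edge_average (\<phi> k) (ds (\<phi> k)) a b c d \<xi>) \<longlonglongrightarrow> edge_average w w' a b c d \<xi>"
  proof -
    have "\<phi> k \<in> L2 unit_square" "ds (\<phi> k) \<in> L2 unit_square" for k
      using phi by (simp_all add: continuous_in_L2 smooth_continuous smooth_continuous_ds)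
    note p = pair_tendsto[OF this(1) w(1) lim(1) lims(1,2)] pair_tendsto[OF this(2) w(2) lim(2) lims(3,2)]
    show ?thesis unfolding edge_average_def
      by (intro tendsto_divide tendsto_add tendsto_const p) (use ab cd in auto)
  qed
  have L: "(\<lambda>r. \<phi> k (?l r)) \<in> L2 {0..1}" for k
  proof -
    have "continuous_on {0..1} (\<lambda>r. \<phi> k (?l r))"
      by (rule continuous_on_compose2[OF smooth_line[OF phi]]) (auto intro!: continuous_intros)
    then have "integrable (lebesgue_on {0..1}) (\<lambda>r. \<phi> k (?l r))"
      "integrable (lebesgue_on {0..1}) (\<lambda>r. (\<phi> k (?l r))\<^sup>2)"
      by (auto intro!: continuous_imp_integrable_real continuous_intros)
    then show ?thesis by (simp add: L2_def borel_measurable_integrable)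
  qed
  have one: "(\<lambda>r. 1) \<in> L2 {0..1::real}" by (simp add: L2_def finite_measure.integrable_const finite_measureI emeasure_restrict_space)
  have int: "integrable (lebesgue_on {0..1}) h" if "h \<in> L2 {0..1::real}" for h
    using L2_mult_integrable[OF that one] by simp
  let ?D = "\<lambda>k. (\<integral>r. \<phi> k (?l r) - \<tau> (?l r) \<partial>lebesgue_on {0..1})"
  have "(\<lambda>k. (?D k)\<^sup>2) \<longlonglongrightarrow> 0"
  proof (rule tendsto_sandwich[OF _ _ tendsto_const])
    have "(?D k)\<^sup>2 \<le> (\<integral>r. (\<phi> k (?l r) - \<tau> (?l r))\<^sup>2 \<partial>lebesgue_on {0..1})" for k
      using L2_Cauchy_Schwarz[OF L2_diff[OF L[of k] tau(1)] one] by (simp add: measure_restrict_space)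
    then show "eventually (\<lambda>k. (?D k)\<^sup>2 \<le> (\<integral>r. (\<phi> k (?l r) - \<tau> (?l r))\<^sup>2 \<partial>lebesgue_on {0..1})) sequentially"
      by simp
  qed (use tau(2) in auto)
  then have "(\<lambda>k. sqrt ((?D k)\<^sup>2)) \<longlonglongrightarrow> sqrt 0" by (rule tendsto_real_sqrt)
  then have "(\<lambda>k. \<bar>?D k\<bar>) \<longlonglongrightarrow> 0" by simp
  then have D0: "?D \<longlonglongrightarrow> 0" by (simp add: tendsto_rabs_zero_iff)
  have D: "?D k = edge_average (\<phi> k) (ds (\<phi> k)) a b c d \<xi> - (\<integral>r. \<tau> (?l r) \<partial>lebesgue_on {0..1})" for k
    using smooth_edge_average[OF phi ab cd, of k] int[OF L[of k]] int[OF tau(1)] by simp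
  have "?D \<longlonglongrightarrow> edge_average w w' a b c d \<xi> - (\<integral>r. \<tau> (?l r) \<partial>lebesgue_on {0..1})"
    unfolding D by (intro tendsto_intros 1)
  from LIMSEQ_unique[OF this D0] show ?thesis by simp
qed

lemma nn_integral_coords:
  assumes "G \<in> borel_measurable borel"
  shows "(\<integral>\<^sup>+z. G z \<partial>lborel) = (\<integral>\<^sup>+y. \<integral>\<^sup>+x. G (pt x y) \<partial>lborel \<partial>lborel)"
proof -
  have G: "G \<in> borel_measurable (lborel \<Otimes>\<^sub>M lborel)" using assms by (simp add: lborel_prod)
  show ?thesis
  proof (cases "s = fst \<and> t = snd")
    case True
    show ?thesis unfolding pt_def if_P[OF True] using lborel_pair.nn_integral_snd[OF G]
      by (simp add: lborel_prod)
  next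
    case False
    show ?thesis unfolding pt_def if_not_P[OF False] using lborel.nn_integral_fst[OF G]
      by (simp add: lborel_prod)
  qed
qed

lemma pt_measurable: "x \<in> borel_measurable M \<Longrightarrow> y \<in> borel_measurable M \<Longrightarrow> (\<lambda>r. pt (x r) (y r)) \<in> borel_measurable M"
proof (cases "s = fst \<and> t = snd")
  case True
  assume "x \<in> borel_measurable M" "y \<in> borel_measurable M"
  then show ?thesis unfolding pt_def if_P[OF True] by (rule borel_measurable_Pair)
next
  case False
  assume "x \<in> borel_measurable M" "y \<in> borel_measurable M"
  then show ?thesis unfolding pt_def if_not_P[OF False] by (intro borel_measurable_Pair)
qed

lemma square_integrable_imp_integrable_lborel:
  fixes F :: "real \<Rightarrow> real"
  assumes F: "F \<in> borel_measurable borel" "\<And>x. x \<notin> {a<..<b} \<Longrightarrow> F x = 0"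
    and fin: "(\<integral>\<^sup>+x. ennreal ((F x)\<^sup>2) \<partial>lborel) < \<infinity>"
  shows "integrable lborel F"
proof (rule Bochner_Integration.integrable_bound)
  have "integrable lborel (\<lambda>x. (F x)\<^sup>2)" using F(1) fin by (intro integrableI_nonneg) auto
  moreover have "integrable lborel (iv a b)" by (cases "a \<le> b") auto
  ultimately show "integrable lborel (\<lambda>x. iv a b x + (F x)\<^sup>2)" by (intro Bochner_Integration.integrable_add)
  have "\<bar>F x\<bar> \<le> \<bar>iv a b x + (F x)\<^sup>2\<bar>" for x
  proof (cases "x \<in> {a<..<b}")
    case True
    have "\<bar>F x\<bar> * 1 \<le> (F x)\<^sup>2 + 1"
      using sum_squares_bound[of "\<bar>F x\<bar>" 1] by simp
    then show ?thesis using True by simp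
  next
    case False
    then show ?thesis using F(2) by simp
  qed
  then show "AE x in lborel. norm (F x) \<le> norm (iv a b x + (F x)\<^sup>2)" by simp
qed (use F in simp)

lemma Jensen_interval:
  fixes F :: "real \<Rightarrow> real"
  assumes F: "F \<in> borel_measurable borel" "\<And>x. x \<notin> {a<..<b} \<Longrightarrow> F x = 0" and ab: "a < b"
    and fin: "(\<integral>\<^sup>+x. ennreal ((F x)\<^sup>2) \<partial>lborel) < \<infinity>"
  shows "ennreal ((\<integral>x. F x \<partial>lborel)\<^sup>2 / (b - a)) \<le> (\<integral>\<^sup>+x. ennreal ((F x)\<^sup>2) \<partial>lborel)"
proof -
  have i: "integrable lborel F" by (rule square_integrable_imp_integrable_lborel[OF F fin])
  have i2: "integrable lborel (\<lambda>x. (F x)\<^sup>2)" using F(1) fin by (intro integrableI_nonneg) auto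
  have iI: "integrable lborel (iv a b)" using ab by simp
  define A B where "A = (\<integral>x. F x \<partial>lborel)" and "B = (\<integral>x. (F x)\<^sup>2 \<partial>lborel)"
  have "0 \<le> (\<integral>x. (F x - A / (b - a) * iv a b x)\<^sup>2 \<partial>lborel)" by simp
  also have "(\<lambda>x. (F x - A / (b - a) * iv a b x)\<^sup>2) =
      (\<lambda>x. (F x)\<^sup>2 - 2 * (A / (b - a)) * F x + (A / (b - a))\<^sup>2 * iv a b x)"
    using F(2) by (intro ext) (auto simp: power2_diff indicator_def power_mult_distrib)
  also have "(\<integral>x. (F x)\<^sup>2 - 2 * (A / (b - a)) * F x + (A / (b - a))\<^sup>2 * iv a b x \<partial>lborel) =
      B - 2 * (A / (b - a)) * A + (A / (b - a))\<^sup>2 * (b - a)"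
    using i i2 iI ab by (simp add: A_def B_def)
  also have "\<dots> = B - A\<^sup>2 / (b - a)"
  proof -
    have "B - 2 * (A / D) * A + (A / D)\<^sup>2 * D = B - A\<^sup>2 / D" if "D \<noteq> 0" for D
      using that by (simp add: field_simps power2_eq_square)
    then show ?thesis using ab by simp
  qed
  finally have "A\<^sup>2 / (b - a) \<le> B" by simp
  moreover have "(\<integral>\<^sup>+x. ennreal ((F x)\<^sup>2) \<partial>lborel) = ennreal B"
    unfolding B_def by (rule nn_integral_eq_integral[OF i2]) simp
  ultimately show ?thesis by (simp add: A_def ennreal_leI)
qed

lemma smooth_fundamental_lborel:
  assumes phi: "smooth \<phi>" and ab: "a < b" "\<xi> = a \<or> \<xi> = b"
  shows "integrable lborel (\<lambda>x. iv a b x * (\<phi> (pt x y) + (x - (a + b - \<xi>)) * ds \<phi> (pt x y)))"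
    and "(\<integral>x. iv a b x * (\<phi> (pt x y) + (x - (a + b - \<xi>)) * ds \<phi> (pt x y)) \<partial>lborel) = (b - a) * \<phi> (pt \<xi> y)"
proof -
  let ?f = "\<lambda>x. \<phi> (pt x y) + (x - (a + b - \<xi>)) * ds \<phi> (pt x y)"
  have cp: "continuous_on UNIV (\<lambda>x. pt x y)" by (intro continuous_pt continuous_intros)
  have cont: "continuous_on UNIV ?f"
    by (intro continuous_intros continuous_on_compose2[OF smooth_continuous(1)[OF phi, of UNIV] cp]
        continuous_on_compose2[OF smooth_continuous_ds[OF phi, of UNIV] cp]) auto
  have "set_integrable lborel {a..b} ?f"
    by (rule borel_integrable_atLeastAtMost'[OF continuous_on_subset[OF cont]]) simp
  then have so: "set_integrable lborel {a<..<b} ?f"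
    by (rule set_integrable_subset) auto
  show "integrable lborel (\<lambda>x. iv a b x * ?f x)" using so by (simp add: set_integrable_def)
  have "(\<integral>x. iv a b x * ?f x \<partial>lborel) = (LINT x:{a<..<b}|lborel. ?f x)"
    by (simp add: set_lebesgue_integral_def)
  also have "\<dots> = integral {a<..<b} ?f" by (rule set_borel_integral_eq_integral(2)[OF so])
  also have "\<dots> = integral {a..b} ?f" by (simp only: integral_open_interval_real)
  also have "\<dots> = (b - a) * \<phi> (pt \<xi> y)"
    by (rule integral_unique[OF smooth_fundamental[OF phi ab]])
  finally show "(\<integral>x. iv a b x * ?f x \<partial>lborel) = (b - a) * \<phi> (pt \<xi> y)" .
qed

text \<open>The trace is written down: \<open>T y\<close> is the mean over (a, b) of w + (s - m) w',
  the formula that reproduces the edge value of a smooth function. Jensen's inequality in x followed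
  by integration in y bounds the error of \<phi> k on the segment by the L2 errors of \<phi> k and
  its derivative.\<close>

lemma trace_exists:
  assumes phi: "\<And>k. smooth (\<phi> k)" and w: "w \<in> L2 unit_square" "w' \<in> L2 unit_square"
    and lim: "(\<lambda>k. \<integral>z. (\<phi> k z - w z)\<^sup>2 \<partial>mu) \<longlonglongrightarrow> 0" "(\<lambda>k. \<integral>z. (ds (\<phi> k) z - w' z)\<^sup>2 \<partial>mu) \<longlonglongrightarrow> 0"
    and ab: "0 \<le> a" "a < b" "b \<le> 1" "\<xi> = a \<or> \<xi> = b" and cd: "0 \<le> c" "c < d" "d \<le> 1"
  obtains \<tau> where "(\<lambda>r. \<tau> (pt \<xi> (c + r * (d - c)))) \<in> L2 {0..1}"
    "(\<lambda>k. \<integral>r. (\<phi> k (pt \<xi> (c + r * (d - c))) - \<tau> (pt \<xi> (c + r * (d - c))))\<^sup>2 \<partial>lebesgue_on {0..1}) \<longlonglongrightarrow> 0"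
proof -
  \<comment> \<open>The end point of the interval opposite to \<xi>.\<close>
  define m where "m = a + b - \<xi>"
  obtain v where v: "v \<in> borel_measurable borel" "AE z in mu. w z = v z"
    using borel_version[OF L2_measurable[OF w(1)] unit_square_lebesgue] by blast
  obtain v' where v': "v' \<in> borel_measurable borel" "AE z in mu. w' z = v' z"
    using borel_version[OF L2_measurable[OF w(2)] unit_square_lebesgue] by blast
  define h where "h z = v z + (s z - m) * v' z" for z
  define p where "p k z = \<phi> k z + (s z - m) * ds (\<phi> k) z" for k z
  define T where "T y = (\<integral>x. iv a b x * h (pt x y) \<partial>lborel) / (b - a)" for y
  define F where "F k y x = iv a b x * (p k (pt x y) - h (pt x y))" for k y x
  define e where "e k = (\<integral>z. (p k z - h z)\<^sup>2 * (iv a b (s z) * iv c d (t z)) \<partial>mu)" for k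
  have s_borel: "s \<in> borel_measurable borel" "t \<in> borel_measurable borel"
    by (intro borel_measurable_continuous_onI continuous_s continuous_t)+
  have h_borel: "h \<in> borel_measurable borel"
    unfolding h_def[abs_def] using v(1) v'(1) s_borel by measurable
  have phi_borel: "\<phi> k \<in> borel_measurable borel" "ds (\<phi> k) \<in> borel_measurable borel" for k
    using phi by (auto intro!: borel_measurable_continuous_onI smooth_continuous_ds simp: smooth_continuous)
  have p_borel: "p k \<in> borel_measurable borel" for k
    unfolding p_def[abs_def] using phi_borel s_borel by measurable
  have ptx: "(\<lambda>x. pt x y) \<in> borel_measurable borel" for y by (intro pt_measurable) auto
  have pty: "(\<lambda>y. pt x y) \<in> borel_measurable borel" for x by (intro pt_measurable) auto
  have F_borel: "F k y \<in> borel_measurable borel" for k y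
    unfolding F_def[abs_def]
    using measurable_compose[OF ptx p_borel] measurable_compose[OF ptx h_borel] by measurable
  have R_meas: "(\<lambda>z. iv a b (s z) * iv c d (t z)) \<in> borel_measurable borel"
    using s_borel by measurable
  have L: "\<phi> k \<in> L2 unit_square" "ds (\<phi> k) \<in> L2 unit_square" for k
    using phi by (simp_all add: continuous_in_L2 smooth_continuous smooth_continuous_ds)
  have sm: "\<bar>s z - m\<bar> \<le> 1" if "z \<in> unit_square" for z
    using coord_range[OF that] ab by (auto simp: m_def)
  have diffL: "(\<lambda>z. \<phi> k z - w z) \<in> L2 unit_square" "(\<lambda>z. ds (\<phi> k) z - w' z) \<in> L2 unit_square" for k
    by (intro L2_diff L w)+
  have AEeq: "AE z in mu. p k z - h z = (\<phi> k z - w z) + (s z - m) * (ds (\<phi> k) z - w' z)" for k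
    using v(2) v'(2) by eventually_elim (simp add: p_def h_def algebra_simps)
  have e_int: "integrable mu (\<lambda>z. (p k z - h z)\<^sup>2 * (iv a b (s z) * iv c d (t z)))"
    and e_le: "e k \<le> 2 * (\<integral>z. (\<phi> k z - w z)\<^sup>2 \<partial>mu) + 2 * (\<integral>z. (ds (\<phi> k) z - w' z)\<^sup>2 \<partial>mu)" for k
  proof -
    let ?B = "\<lambda>z. 2 * (\<phi> k z - w z)\<^sup>2 + 2 * (ds (\<phi> k) z - w' z)\<^sup>2"
    have B: "integrable mu ?B" using diffL[of k] by (simp add: L2_def)
    have m: "(\<lambda>z. (p k z - h z)\<^sup>2 * (iv a b (s z) * iv c d (t z))) \<in> borel_measurable mu"
      using p_borel h_borel R_meas by (intro borel_measurable_mu) measurable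
    have "AE z in mu. z \<in> unit_square" by (rule AE_I2) simp
    with AEeq[of k] have le: "AE z in mu. (p k z - h z)\<^sup>2 * (iv a b (s z) * iv c d (t z)) \<le> ?B z"
    proof eventually_elim
      case (elim z)
      let ?x = "\<phi> k z - w z" and ?y = "ds (\<phi> k) z - w' z"
      have "((s z - m) * ?y)\<^sup>2 \<le> ?y\<^sup>2"
        using sm[OF elim(2)] mult_right_mono[of "(s z - m)\<^sup>2" 1 "?y\<^sup>2"] abs_square_le_1[of "s z - m"]
        by (simp add: power_mult_distrib)
      moreover have "(?x + (s z - m) * ?y)\<^sup>2 \<le> 2 * ?x\<^sup>2 + 2 * ((s z - m) * ?y)\<^sup>2"
        using sum_squares_bound[of ?x "(s z - m) * ?y"] by (simp add: power2_sum)
      ultimately have "(p k z - h z)\<^sup>2 \<le> ?B z" unfolding elim(1) by linarith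
      moreover have "0 \<le> ?B z" by simp
      ultimately show ?case by (auto simp: indicator_def)
    qed
    show "integrable mu (\<lambda>z. (p k z - h z)\<^sup>2 * (iv a b (s z) * iv c d (t z)))"
      by (rule Bochner_Integration.integrable_bound[OF B m]) (use le in eventually_elim, auto)
    then have "e k \<le> (\<integral>z. ?B z \<partial>mu)"
      unfolding e_def by (rule integral_mono_AE[OF _ B le])
    also have "\<dots> = 2 * (\<integral>z. (\<phi> k z - w z)\<^sup>2 \<partial>mu) + 2 * (\<integral>z. (ds (\<phi> k) z - w' z)\<^sup>2 \<partial>mu)"
      using diffL[of k] by (simp add: L2_def)
    finally show "e k \<le> 2 * (\<integral>z. (\<phi> k z - w z)\<^sup>2 \<partial>mu) + 2 * (\<integral>z. (ds (\<phi> k) z - w' z)\<^sup>2 \<partial>mu)" .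
  qed
  have e_nonneg: "0 \<le> e k" for k by (simp add: e_def)
  have e_lim: "e \<longlonglongrightarrow> 0"
  proof (rule tendsto_sandwich[OF _ _ tendsto_const])
    show "(\<lambda>k. 2 * (\<integral>z. (\<phi> k z - w z)\<^sup>2 \<partial>mu) + 2 * (\<integral>z. (ds (\<phi> k) z - w' z)\<^sup>2 \<partial>mu)) \<longlonglongrightarrow> 0"
      using tendsto_add[OF tendsto_mult_right_zero[OF lim(1)] tendsto_mult_right_zero[OF lim(2)]] by simp
  qed (use e_le e_nonneg in auto)
  have iter: "(\<integral>\<^sup>+y. (\<integral>\<^sup>+x. ennreal ((F k y x)\<^sup>2) \<partial>lborel) * indicator {c<..<d} y \<partial>lborel) = ennreal (e k)" for k
  proof -
    let ?G = "\<lambda>z. (p k z - h z)\<^sup>2 * (iv a b (s z) * iv c d (t z))"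
    have Gm: "?G \<in> borel_measurable borel" using p_borel h_borel R_meas by measurable
    have "ennreal (e k) = (\<integral>\<^sup>+z. ennreal (?G z) \<partial>mu)"
      unfolding e_def by (rule nn_integral_eq_integral[OF e_int, symmetric]) simp
    also have "\<dots> = (\<integral>\<^sup>+z. ennreal (?G z) * indicator unit_square z \<partial>lebesgue)"
      by (rule nn_integral_restrict_space) simp
    also have "\<dots> = (\<integral>\<^sup>+z. ennreal (?G z) \<partial>lebesgue)"
    proof (rule nn_integral_cong)
      fix z
      have "z \<in> unit_square" if "s z \<in> {a<..<b}" "t z \<in> {c<..<d}"
        using that ab cd coords by (cases z) (auto simp: unit_square_def)
      then show "ennreal (?G z) * indicator unit_square z = ennreal (?G z)"
        by (auto simp: indicator_def)
    qed
    also have "\<dots> = (\<integral>\<^sup>+z. ennreal (?G z) \<partial>lborel)" by (rule nn_integral_completion)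
    also have "\<dots> = (\<integral>\<^sup>+y. \<integral>\<^sup>+x. ennreal (?G (pt x y)) \<partial>lborel \<partial>lborel)"
      by (rule nn_integral_coords) (use Gm in measurable)
    also have "\<dots> = (\<integral>\<^sup>+y. (\<integral>\<^sup>+x. ennreal ((F k y x)\<^sup>2) \<partial>lborel) * indicator {c<..<d} y \<partial>lborel)"
    proof (rule nn_integral_cong)
      fix y
      show "(\<integral>\<^sup>+x. ennreal (?G (pt x y)) \<partial>lborel) =
          (\<integral>\<^sup>+x. ennreal ((F k y x)\<^sup>2) \<partial>lborel) * indicator {c<..<d} y"
        by (cases "y \<in> {c<..<d}")
           (auto intro!: nn_integral_cong simp: F_def split: split_indicator)
    qed
    finally show ?thesis ..
  qed
  have meas2: "(\<lambda>y. \<integral>\<^sup>+x. ennreal ((F k y x)\<^sup>2) \<partial>lborel) \<in> borel_measurable borel" for k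
  proof -
    have "(\<lambda>q. pt (snd q) (fst q)) \<in> borel_measurable (lborel \<Otimes>\<^sub>M lborel)" by (intro pt_measurable) auto
    note c = measurable_compose[OF this p_borel[of k]] measurable_compose[OF this h_borel]
    have "(\<lambda>(y, x). ennreal ((F k y x)\<^sup>2)) \<in> borel_measurable (lborel \<Otimes>\<^sub>M lborel)"
      unfolding F_def split_def using c by measurable
    from lborel.borel_measurable_nn_integral_fst[OF this] show ?thesis by simp
  qed
  have T_borel: "T \<in> borel_measurable borel"
  proof -
    have "(\<lambda>q. pt (snd q) (fst q)) \<in> borel_measurable (lborel \<Otimes>\<^sub>M lborel)" by (intro pt_measurable) auto
    note c = measurable_compose[OF this h_borel]
    have "(\<lambda>(y, x). iv a b x * h (pt x y)) \<in> borel_measurable (lborel \<Otimes>\<^sub>M lborel)"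
      unfolding split_def using c by measurable
    from lborel.borel_measurable_lebesgue_integral[OF this] show ?thesis
      unfolding T_def[abs_def] by simp
  qed
  define \<delta> where "\<delta> k y = \<phi> k (pt \<xi> y) - T y" for k y
  have delta_borel: "\<delta> k \<in> borel_measurable borel" for k
    unfolding \<delta>_def[abs_def] using measurable_compose[OF pty phi_borel(1)[of k]] T_borel by measurable
  \<comment> \<open>Finiteness on almost every line comes first: only there is \<open>F k y\<close>
    integrable, and only then may the integral of \<open>h\<close> along the line be split
    off.\<close>
  have fin: "AE y in lborel. (\<integral>\<^sup>+x. ennreal ((F k y x)\<^sup>2) \<partial>lborel) * indicator {c<..<d} y \<noteq> \<infinity>" for k
    by (rule nn_integral_PInf_AE) (use meas2 iter in auto)
  have bound: "AE y in lborel. ennreal ((b - a) * (\<delta> k y)\<^sup>2) * indicator {c<..<d} y \<le>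
      (\<integral>\<^sup>+x. ennreal ((F k y x)\<^sup>2) \<partial>lborel) * indicator {c<..<d} y" for k
    using fin[of k]
  proof eventually_elim
    case (elim y)
    show ?case
    proof (cases "y \<in> {c<..<d}")
      case True
      then have fy: "(\<integral>\<^sup>+x. ennreal ((F k y x)\<^sup>2) \<partial>lborel) < \<infinity>" using elim by (simp add: less_top)
      have F0: "F k y x = 0" if "x \<notin> {a<..<b}" for x using that by (simp add: F_def)
      have iF: "integrable lborel (F k y)"
        by (rule square_integrable_imp_integrable_lborel[OF F_borel F0 fy])
      have ip: "integrable lborel (\<lambda>x. iv a b x * p k (pt x y))"
        using smooth_fundamental_lborel(1)[OF phi ab(2,4), of k y] by (simp add: p_def m_def)
      have "(\<integral>x. F k y x \<partial>lborel) = (\<integral>x. iv a b x * p k (pt x y) \<partial>lborel) - (\<integral>x. iv a b x * h (pt x y) \<partial>lborel)"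
      proof -
        have "integrable lborel (\<lambda>x. iv a b x * p k (pt x y) - F k y x)"
          by (rule Bochner_Integration.integrable_diff[OF ip iF])
        then have "integrable lborel (\<lambda>x. iv a b x * h (pt x y))"
          by (simp add: F_def algebra_simps)
        from Bochner_Integration.integral_diff[OF ip this] show ?thesis
          by (simp add: F_def algebra_simps)
      qed
      also have "(\<integral>x. iv a b x * p k (pt x y) \<partial>lborel) = (b - a) * \<phi> k (pt \<xi> y)"
        using smooth_fundamental_lborel(2)[OF phi ab(2,4), of k y] by (simp add: p_def m_def)
      also have "(\<integral>x. iv a b x * h (pt x y) \<partial>lborel) = (b - a) * T y" using ab by (simp add: T_def)
      finally have "(\<integral>x. F k y x \<partial>lborel)\<^sup>2 / (b - a) = (b - a) * (\<delta> k y)\<^sup>2"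
        using ab by (simp add: \<delta>_def right_diff_distrib[symmetric] power_mult_distrib power2_eq_square)
      then show ?thesis using Jensen_interval[OF F_borel F0 ab(2) fy] True by simp
    qed simp
  qed
  have nn: "(\<integral>\<^sup>+y. ennreal ((b - a) * (\<delta> k y)\<^sup>2 * iv c d y) \<partial>lborel) \<le> ennreal (e k)" for k
  proof -
    have "(\<integral>\<^sup>+y. ennreal ((b - a) * (\<delta> k y)\<^sup>2 * iv c d y) \<partial>lborel) =
        (\<integral>\<^sup>+y. ennreal ((b - a) * (\<delta> k y)\<^sup>2) * indicator {c<..<d} y \<partial>lborel)"
      by (intro nn_integral_cong) (auto simp: indicator_def)
    also have "\<dots> \<le> ennreal (e k)" unfolding iter[symmetric] by (rule nn_integral_mono_AE[OF bound])
    finally show ?thesis .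
  qed
  have dm: "(\<lambda>y. (b - a) * (\<delta> k y)\<^sup>2 * iv c d y) \<in> borel_measurable borel" for k
    using delta_borel by measurable
  have int1: "integrable lborel (\<lambda>y. (b - a) * (\<delta> k y)\<^sup>2 * iv c d y)" for k
    using dm[of k] le_less_trans[OF nn[of k], of \<infinity>] ab by (intro integrableI_nonneg) auto
  have int1_le: "(\<integral>y. (b - a) * (\<delta> k y)\<^sup>2 * iv c d y \<partial>lborel) \<le> e k" for k
  proof -
    have "ennreal (\<integral>y. (b - a) * (\<delta> k y)\<^sup>2 * iv c d y \<partial>lborel) \<le> ennreal (e k)"
      using nn[of k] ab by (subst nn_integral_eq_integral[OF int1, symmetric]) auto
    then show ?thesis using e_nonneg by simp
  qed
  have int2: "integrable (lebesgue_on {c..d}) (\<lambda>y. (\<delta> k y)\<^sup>2)"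
    and int2_le: "(\<integral>y. (\<delta> k y)\<^sup>2 \<partial>lebesgue_on {c..d}) \<le> e k / (b - a)" for k
  proof -
    have dm2: "(\<lambda>y. indicator {c..d} y *\<^sub>R (\<delta> k y)\<^sup>2) \<in> borel_measurable lborel"
      using delta_borel[of k] by measurable
    have dm3: "(\<lambda>y. 1 / (b - a) * ((b - a) * (\<delta> k y)\<^sup>2 * iv c d y)) \<in> borel_measurable lborel"
      using dm[of k] by measurable
    have ae: "AE y in lborel. 1 / (b - a) * ((b - a) * (\<delta> k y)\<^sup>2 * iv c d y) = indicator {c..d} y *\<^sub>R (\<delta> k y)\<^sup>2"
      using AE_lborel_singleton[of c] AE_lborel_singleton[of d]
      by eventually_elim (use ab in \<open>auto simp: indicator_def\<close>)
    have i3: "integrable lborel (\<lambda>y. 1 / (b - a) * ((b - a) * (\<delta> k y)\<^sup>2 * iv c d y))"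
      by (rule integrable_mult_right[OF int1])
    have "integrable lborel (\<lambda>y. indicator {c..d} y *\<^sub>R (\<delta> k y)\<^sup>2)"
      by (rule integrable_cong_AE_imp[OF i3 dm2]) (use ae in eventually_elim, simp)
    then show "integrable (lebesgue_on {c..d}) (\<lambda>y. (\<delta> k y)\<^sup>2)"
      using dm2 by (subst integrable_restrict_space) (auto simp: integrable_completion)
    have "(\<integral>y. (\<delta> k y)\<^sup>2 \<partial>lebesgue_on {c..d}) = (\<integral>y. indicator {c..d} y *\<^sub>R (\<delta> k y)\<^sup>2 \<partial>lborel)"
      using dm2 by (subst integral_restrict_space) (auto simp: integral_completion)
    also have "\<dots> = (\<integral>y. 1 / (b - a) * ((b - a) * (\<delta> k y)\<^sup>2 * iv c d y) \<partial>lborel)"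
      by (rule integral_cong_AE[OF dm2 dm3]) (use ae in eventually_elim, simp)
    also have "\<dots> = 1 / (b - a) * (\<integral>y. (b - a) * (\<delta> k y)\<^sup>2 * iv c d y \<partial>lborel)"
      by (rule integral_mult_right_zero)
    also have "\<dots> \<le> 1 / (b - a) * e k" using int1_le ab by (intro mult_left_mono) auto
    finally show "(\<integral>y. (\<delta> k y)\<^sup>2 \<partial>lebesgue_on {c..d}) \<le> e k / (b - a)" by simp
  qed
  show ?thesis
  \<comment> \<open>Only values on the segment matter, so \<open>T\<close> is continued as a
    constant in the direction \<open>s\<close>.\<close>
  proof (rule that[of "\<lambda>z. T (t z)"])
    let ?l = "\<lambda>r. pt \<xi> (c + r * (d - c))"
    have d: "\<phi> k (?l r) - T (t (?l r)) = \<delta> k (c + r * (d - c))" for k r by (simp add: \<delta>_def)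
    show "(\<lambda>k. \<integral>r. (\<phi> k (?l r) - T (t (?l r)))\<^sup>2 \<partial>lebesgue_on {0..1}) \<longlonglongrightarrow> 0"
      unfolding d
    proof (rule tendsto_sandwich[OF _ _ tendsto_const])
      show "(\<lambda>k. e k / (b - a) / (d - c)) \<longlonglongrightarrow> 0"
        using tendsto_divide_zero[OF tendsto_divide_zero[OF e_lim]] .
      show "eventually (\<lambda>k. (\<integral>r. (\<delta> k (c + r * (d - c)))\<^sup>2 \<partial>lebesgue_on {0..1}) \<le> e k / (b - a) / (d - c)) sequentially"
        using int2_le cd(2) unfolding lebesgue_on_affine(1)[OF cd(2), of "\<lambda>y. (\<delta> _ y)\<^sup>2"]
        by (intro always_eventually allI divide_right_mono) auto
    qed simp
    have 1: "(\<lambda>r. \<phi> 0 (?l r)) \<in> L2 {0..1}" 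
    proof -
      have "continuous_on {0..1} (\<lambda>r. \<phi> 0 (?l r))"
        by (rule continuous_on_compose2[OF smooth_line[OF phi]]) (auto intro!: continuous_intros)
      then have "integrable (lebesgue_on {0..1}) (\<lambda>r. \<phi> 0 (?l r))"
        "integrable (lebesgue_on {0..1}) (\<lambda>r. (\<phi> 0 (?l r))\<^sup>2)"
        by (auto intro!: continuous_imp_integrable_real continuous_intros)
      then show ?thesis by (simp add: L2_def borel_measurable_integrable)
    qed
    have 2: "(\<lambda>r. \<delta> 0 (c + r * (d - c))) \<in> L2 {0..1}"
    proof -
      have "(\<lambda>r. \<delta> 0 (c + r * (d - c))) \<in> borel_measurable borel"
        by (rule measurable_compose[OF _ delta_borel]) measurable
      then have "(\<lambda>r. \<delta> 0 (c + r * (d - c))) \<in> borel_measurable (lebesgue_on {0..1})"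
        by (intro measurable_restrict_space1[OF measurable_completion]) simp
      then show ?thesis
        using int2[of 0] lebesgue_on_affine(2)[OF cd(2), of "\<lambda>y. (\<delta> 0 y)\<^sup>2"] by (simp add: L2_def)
    qed
    show "(\<lambda>r. T (t (?l r))) \<in> L2 {0..1}"
      using L2_diff[OF 1 2] by (simp add: \<delta>_def)
  qed
qed

end

lemma dist_Pair_const: "dist (x, y) (x, y') = \<bar>y - y'\<bar>" "dist (y, x) (y', x) = \<bar>y - y'\<bar>" for x y y' :: real
  by (simp_all add: dist_Pair_Pair dist_real_def)

context coordinates
begin

lemma linepath_pt: "linepath (pt \<xi> c) (pt \<xi> d) r = pt \<xi> (c + r * (d - c))"
proof (cases "s = fst \<and> t = snd")
  case True
  show ?thesis unfolding pt_def if_P[OF True] by (simp add: linepath_def algebra_simps)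
next
  case False
  show ?thesis unfolding pt_def if_not_P[OF False] by (simp add: linepath_def algebra_simps)
qed

lemma dist_pt: "dist (pt \<xi> c) (pt \<xi> d) = \<bar>d - c\<bar>"
  by (simp add: pt_def dist_Pair_const abs_minus_commute)

lemma seg_integral_pt:
  "c < d \<Longrightarrow> seg_integral (pt \<xi> c, pt \<xi> d) F = (d - c) * (\<integral>r. F (pt \<xi> (c + r * (d - c))) \<partial>lebesgue_on {0..1})"
  by (simp add: seg_integral_def linepath_pt dist_pt)

definition wds :: "(real \<times> real \<Rightarrow> real) \<Rightarrow> real \<times> real \<Rightarrow> real" where
  "wds u = (if s = fst \<and> t = snd then wd u 1 0 else wd u 0 1)"

lemma wds_L2: "u \<in> sobolev k unit_square \<Longrightarrow> 1 \<le> k \<Longrightarrow> wds u \<in> L2 unit_square"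
  unfolding wds_def by (auto intro: weak_deriv_sobolev)

lemma is_trace_approx_s:
  assumes tr: "is_trace unit_square S u \<tau>" and u: "u \<in> sobolev k unit_square" "1 \<le> k"
  obtains \<phi> where "\<And>k. smooth (\<phi> k)" "(\<lambda>k. seg_integral S (\<lambda>z. (\<phi> k z - \<tau> z)\<^sup>2)) \<longlonglongrightarrow> 0"
    "(\<lambda>k. sobolev_norm 1 unit_square (\<lambda>z. \<phi> k z - u z)) \<longlonglongrightarrow> 0"
    "(\<lambda>k. \<integral>z. (\<phi> k z - u z)\<^sup>2 \<partial>mu) \<longlonglongrightarrow> 0"
    "(\<lambda>k. \<integral>z. (ds (\<phi> k) z - wds u z)\<^sup>2 \<partial>mu) \<longlonglongrightarrow> 0"
proof -
  obtain \<phi> where \<phi>: "\<And>k. smooth (\<phi> k)" "(\<lambda>k. seg_integral S (\<lambda>z. (\<phi> k z - \<tau> z)\<^sup>2)) \<longlonglongrightarrow> 0"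
    "(\<lambda>k. sobolev_norm 1 unit_square (\<lambda>z. \<phi> k z - u z)) \<longlonglongrightarrow> 0"
    "(\<lambda>k. \<integral>z. (\<phi> k z - u z)\<^sup>2 \<partial>mu) \<longlonglongrightarrow> 0"
    "(\<lambda>k. \<integral>z. (dx (\<phi> k) z - wd u 1 0 z)\<^sup>2 \<partial>mu) \<longlonglongrightarrow> 0"
    "(\<lambda>k. \<integral>z. (dy (\<phi> k) z - wd u 0 1 z)\<^sup>2 \<partial>mu) \<longlonglongrightarrow> 0"
    by (rule is_trace_approx[OF tr u]) blast
  have "(\<lambda>k. \<integral>z. (ds (\<phi> k) z - wds u z)\<^sup>2 \<partial>mu) \<longlonglongrightarrow> 0"
  proof (cases "s = fst \<and> t = snd")
    case True
    show ?thesis unfolding ds_def wds_def if_P[OF True] by (rule \<phi>(5))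
  next
    case False
    show ?thesis unfolding ds_def wds_def if_not_P[OF False] by (rule \<phi>(6))
  qed
  then show ?thesis using that \<phi>(1-4) by blast
qed

lemma average_of_trace:
  assumes tr: "is_trace unit_square (pt \<xi> c, pt \<xi> d) u \<tau>" and u: "u \<in> sobolev k unit_square" "1 \<le> k"
    and ab: "0 \<le> a" "a < b" "b \<le> 1" "\<xi> = a \<or> \<xi> = b" and cd: "0 \<le> c" "c < d" "d \<le> 1"
  shows "(\<integral>r. \<tau> (pt \<xi> (c + r * (d - c))) \<partial>lebesgue_on {0..1}) = edge_average u (wds u) a b c d \<xi>"
proof -
  obtain \<phi> where \<phi>: "\<And>k. smooth (\<phi> k)" "(\<lambda>k. seg_integral (pt \<xi> c, pt \<xi> d) (\<lambda>z. (\<phi> k z - \<tau> z)\<^sup>2)) \<longlonglongrightarrow> 0"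
    "(\<lambda>k. \<integral>z. (\<phi> k z - u z)\<^sup>2 \<partial>mu) \<longlonglongrightarrow> 0"
    "(\<lambda>k. \<integral>z. (ds (\<phi> k) z - wds u z)\<^sup>2 \<partial>mu) \<longlonglongrightarrow> 0"
    by (rule is_trace_approx_s[OF tr u]) blast
  have uL: "u \<in> L2 unit_square" using u by (simp add: sobolev_def)
  show ?thesis
  proof (rule trace_edge_average[OF \<phi>(1) uL wds_L2[OF u] \<phi>(3,4) ab cd])
    show "(\<lambda>r. \<tau> (pt \<xi> (c + r * (d - c)))) \<in> L2 {0..1}"
      using tr by (simp add: is_trace_def linepath_pt)
    have "(\<lambda>k. 1 / (d - c) * seg_integral (pt \<xi> c, pt \<xi> d) (\<lambda>z. (\<phi> k z - \<tau> z)\<^sup>2)) \<longlonglongrightarrow> 1 / (d - c) * 0"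
      by (intro tendsto_intros \<phi>(2))
    then show "(\<lambda>k. \<integral>r. (\<phi> k (pt \<xi> (c + r * (d - c))) - \<tau> (pt \<xi> (c + r * (d - c))))\<^sup>2 \<partial>lebesgue_on {0..1}) \<longlonglongrightarrow> 0"
      using cd by (simp add: seg_integral_pt)
  qed
qed

text \<open>The trace on \<open>S\<close> serves to supply smooth functions converging to
  \<open>u\<close> in the H^1 norm. The same sequence converges on any segment parallel to the axis,
  so a trace exists there and the choice in \<open>trace_on\<close> selects one.\<close>

lemma trace_on_is_trace:
  assumes tr: "is_trace unit_square S u g" and u: "u \<in> sobolev k unit_square" "1 \<le> k"
    and ab: "0 \<le> a" "a < b" "b \<le> 1" "\<xi> = a \<or> \<xi> = b" and cd: "0 \<le> c" "c < d" "d \<le> 1"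
  shows "is_trace unit_square (pt \<xi> c, pt \<xi> d) u (trace_on unit_square (pt \<xi> c, pt \<xi> d) u)"
proof -
  obtain \<phi> where \<phi>: "\<And>k. smooth (\<phi> k)"
    "(\<lambda>k. sobolev_norm 1 unit_square (\<lambda>z. \<phi> k z - u z)) \<longlonglongrightarrow> 0"
    "(\<lambda>k. \<integral>z. (\<phi> k z - u z)\<^sup>2 \<partial>mu) \<longlonglongrightarrow> 0"
    "(\<lambda>k. \<integral>z. (ds (\<phi> k) z - wds u z)\<^sup>2 \<partial>mu) \<longlonglongrightarrow> 0"
    by (rule is_trace_approx_s[OF tr u]) blast
  have uL: "u \<in> L2 unit_square" using u by (simp add: sobolev_def)
  obtain \<tau> where \<tau>: "(\<lambda>r. \<tau> (pt \<xi> (c + r * (d - c)))) \<in> L2 {0..1}"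
    "(\<lambda>k. \<integral>r. (\<phi> k (pt \<xi> (c + r * (d - c))) - \<tau> (pt \<xi> (c + r * (d - c))))\<^sup>2 \<partial>lebesgue_on {0..1}) \<longlonglongrightarrow> 0"
    by (rule trace_exists[OF \<phi>(1) uL wds_L2[OF u] \<phi>(3,4) ab cd]) blast
  have "(\<lambda>k. seg_integral (pt \<xi> c, pt \<xi> d) (\<lambda>z. (\<phi> k z - \<tau> z)\<^sup>2)) \<longlonglongrightarrow> 0"
    using tendsto_mult_right_zero[OF \<tau>(2), of "d - c"] cd by (simp add: seg_integral_pt)
  moreover have "u \<in> sobolev 1 unit_square" using tr by (simp add: is_trace_def)
  ultimately have "is_trace unit_square (pt \<xi> c, pt \<xi> d) u \<tau>"
    unfolding is_trace_def using \<tau>(1) \<phi>(1,2) by (auto simp: linepath_pt)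
  then show ?thesis unfolding trace_on_def by (rule someI[of "is_trace unit_square _ u"])
qed

text \<open>The boundary condition is given on whole sides, whereas the scheme takes averages of
  \<open>g\<close> over single boundary edges.\<close>

lemma is_trace_subsegment:
  assumes tr: "is_trace unit_square (pt \<xi> 0, pt \<xi> 1) u g" and cd: "0 \<le> c" "c < d" "d \<le> 1"
  shows "is_trace unit_square (pt \<xi> c, pt \<xi> d) u g"
proof -
  obtain \<phi> where \<phi>: "\<And>k. smooth (\<phi> k)"
    "(\<lambda>k. sobolev_norm 1 unit_square (\<lambda>z. \<phi> k z - u z)) \<longlonglongrightarrow> 0"
    "(\<lambda>k. seg_integral (pt \<xi> 0, pt \<xi> 1) (\<lambda>z. (\<phi> k z - g z)\<^sup>2)) \<longlonglongrightarrow> 0"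
    and u: "u \<in> sobolev 1 unit_square" and gL: "(\<lambda>r. g (pt \<xi> r)) \<in> L2 {0..1}"
    using tr unfolding is_trace_def by (auto simp: linepath_pt)
  have lim: "(\<lambda>k. \<integral>r. (\<phi> k (pt \<xi> r) - g (pt \<xi> r))\<^sup>2 \<partial>lebesgue_on {0..1}) \<longlonglongrightarrow> 0"
    using \<phi>(3) by (simp add: seg_integral_pt)
  have sub: "integrable (lebesgue_on {c..d}) f \<and> (\<integral>y. f y \<partial>lebesgue_on {c..d}) \<le> (\<integral>y. f y \<partial>lebesgue_on {0..1})"
    if f: "integrable (lebesgue_on {0..1}) f" "\<And>y. 0 \<le> f y" for f :: "real \<Rightarrow> real"
  proof -
    have i1: "set_integrable lebesgue {0..1} f"
      using f(1) by (simp add: integrable_restrict_space set_integrable_def)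
    have i2: "set_integrable lebesgue {c..d} f" using cd by (intro set_integrable_subset[OF i1]) auto
    have "(LINT y:{c..d}|lebesgue. f y) \<le> (LINT y:{0..1}|lebesgue. f y)"
      unfolding set_lebesgue_integral_def
      by (rule integral_mono[OF i2[unfolded set_integrable_def] i1[unfolded set_integrable_def]])
         (use f(2) cd in \<open>auto simp: indicator_def\<close>)
    then show ?thesis using i2
      by (simp add: integrable_restrict_space integral_restrict_space set_integrable_def set_lebesgue_integral_def)
  qed
  have L: "(\<lambda>r. \<phi> k (pt \<xi> r)) \<in> L2 {0..1}" for k
  proof -
    have "continuous_on {0..1} (\<lambda>r. \<phi> k (pt \<xi> r))"
      by (rule continuous_on_subset[OF smooth_line[OF \<phi>(1)]]) simp
    then have "integrable (lebesgue_on {0..1}) (\<lambda>r. \<phi> k (pt \<xi> r))"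
      "integrable (lebesgue_on {0..1}) (\<lambda>r. (\<phi> k (pt \<xi> r))\<^sup>2)"
      by (auto intro!: continuous_imp_integrable_real continuous_intros)
    then show ?thesis by (simp add: L2_def borel_measurable_integrable)
  qed
  have d: "integrable (lebesgue_on {0..1}) (\<lambda>r. (\<phi> k (pt \<xi> r) - g (pt \<xi> r))\<^sup>2)" for k
    using L2_diff[OF L gL] by (simp add: L2_def)
  have "(\<lambda>k. \<integral>r. (\<phi> k (pt \<xi> r) - g (pt \<xi> r))\<^sup>2 \<partial>lebesgue_on {c..d}) \<longlonglongrightarrow> 0"
    by (rule tendsto_sandwich[OF _ _ tendsto_const lim]) (use sub[OF d] in auto)
  then have "(\<lambda>k. seg_integral (pt \<xi> c, pt \<xi> d) (\<lambda>z. (\<phi> k z - g z)\<^sup>2)) \<longlonglongrightarrow> 0"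
    using cd(2) lebesgue_on_affine(1)[OF cd(2), of "\<lambda>y. (\<phi> _ (pt \<xi> y) - g (pt \<xi> y))\<^sup>2"]
    by (simp add: seg_integral_pt)
  moreover have "(\<lambda>r. g (pt \<xi> (c + r * (d - c)))) \<in> L2 {0..1}"
  proof -
    have "integrable (lebesgue_on {c..d}) (\<lambda>r. (g (pt \<xi> r))\<^sup>2)" using sub gL by (auto simp: L2_def)
    then show ?thesis
      using lebesgue_on_affine_measurable[OF cd(2), of "\<lambda>y. g (pt \<xi> y)"] gL cd
        lebesgue_on_affine(2)[OF cd(2), of "\<lambda>y. (g (pt \<xi> y))\<^sup>2"] by (simp add: L2_def)
  qed
  ultimately show ?thesis unfolding is_trace_def using u \<phi>(1,2) by (auto simp: linepath_pt)
qed

end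

lemma wds_simps [simp]: "xy.wds u = wd u 1 0" "yx.wds u = wd u 0 1"
  using xy.fst_neq_snd by (auto simp: xy.wds_def yx.wds_def)

subsection \<open>Meshes\<close>

locale rect_mesh =
  fixes M :: mesh
  assumes mesh: "is_mesh M"
begin

lemma xs_mono: "i \<le> i' \<Longrightarrow> i' \<le> nx M \<Longrightarrow> xs M i \<le> xs M i'"
  by (induction i' rule: nat_induct_at_least) (use mesh in \<open>auto simp: is_mesh_def Suc_le_eq intro: order.trans less_imp_le\<close>)

lemma ys_mono: "j \<le> j' \<Longrightarrow> j' \<le> ny M \<Longrightarrow> ys M j \<le> ys M j'"
  by (induction j' rule: nat_induct_at_least) (use mesh in \<open>auto simp: is_mesh_def Suc_le_eq intro: order.trans less_imp_le\<close>)

lemma xs_less: "i < nx M \<Longrightarrow> xs M i < xs M (Suc i)" and ys_less: "j < ny M \<Longrightarrow> ys M j < ys M (Suc j)"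
  using mesh by (auto simp: is_mesh_def)

lemma xs_bounds: "i \<le> nx M \<Longrightarrow> 0 \<le> xs M i \<and> xs M i \<le> 1"
  using xs_mono[of 0 i] xs_mono[of i "nx M"] mesh by (auto simp: is_mesh_def)

lemma ys_bounds: "j \<le> ny M \<Longrightarrow> 0 \<le> ys M j \<and> ys M j \<le> 1"
  using ys_mono[of 0 j] ys_mono[of j "ny M"] mesh by (auto simp: is_mesh_def)

lemma nx_pos: "0 < nx M" and ny_pos: "0 < ny M"
  using mesh by (auto simp: is_mesh_def intro!: gr0I)

lemma xs_inj: "i \<le> nx M \<Longrightarrow> i' \<le> nx M \<Longrightarrow> xs M i = xs M i' \<Longrightarrow> i = i'"
  by (metis linorder_neqE_nat not_less_eq_eq Suc_leI dual_order.strict_trans2 xs_less xs_mono less_irrefl order.strict_trans2)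

lemma ys_inj: "j \<le> ny M \<Longrightarrow> j' \<le> ny M \<Longrightarrow> ys M j = ys M j' \<Longrightarrow> j = j'"
  by (metis linorder_neqE_nat not_less_eq_eq Suc_leI dual_order.strict_trans2 ys_less ys_mono less_irrefl order.strict_trans2)

lemma Q_b_VEdge:
  "j < ny M \<Longrightarrow> Q_b M (VEdge i j) w = (\<integral>r. w (xs M i, ys M j + r * (ys M (Suc j) - ys M j)) \<partial>lebesgue_on {0..1})"
  using ys_less[of j] xy.seg_integral_pt[of "ys M j" "ys M (Suc j)" "xs M i" w]
  by (simp add: Q_b_def dist_Pair_const)

lemma Q_b_HEdge:
  "i < nx M \<Longrightarrow> Q_b M (HEdge i j) w = (\<integral>r. w (xs M i + r * (xs M (Suc i) - xs M i), ys M j) \<partial>lebesgue_on {0..1})"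
  using xs_less[of i] yx.seg_integral_pt[of "xs M i" "xs M (Suc i)" "ys M j" w]
  by (simp add: Q_b_def dist_Pair_const)

text \<open>An edge average may be computed from either adjacent cell. The free choice of
  \<open>l\<close> lets \<open>U_values\<close> express all edges of a cell by integrals over that
  cell.\<close>

lemma trace_average_VEdge:
  assumes tr: "is_trace unit_square S u g" and u: "u \<in> sobolev k unit_square" "1 \<le> k"
    and ij: "i < nx M" "j < ny M" "l = i \<or> l = Suc i"
  shows "Q_b M (VEdge l j) (trace_on unit_square (ends M (VEdge l j)) u) =
    xy.edge_average u (wd u 1 0) (xs M i) (xs M (Suc i)) (ys M j) (ys M (Suc j)) (xs M l)"
proof -
  have b: "0 \<le> xs M i" "xs M i < xs M (Suc i)" "xs M (Suc i) \<le> 1"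
    "0 \<le> ys M j" "ys M j < ys M (Suc j)" "ys M (Suc j) \<le> 1"
    using ij xs_bounds[of i] xs_bounds[of "Suc i"] ys_bounds[of j] ys_bounds[of "Suc j"] xs_less ys_less by auto
  have l: "xs M l = xs M i \<or> xs M l = xs M (Suc i)" using ij by auto
  have "is_trace unit_square (ends M (VEdge l j)) u (trace_on unit_square (ends M (VEdge l j)) u)"
    using xy.trace_on_is_trace[OF tr u b(1-3) l b(4-6)] by simp
  then show ?thesis
    using xy.average_of_trace[OF _ u b(1-3) l b(4-6)] ij by (simp add: Q_b_VEdge)
qed

lemma trace_average_HEdge:
  assumes tr: "is_trace unit_square S u g" and u: "u \<in> sobolev k unit_square" "1 \<le> k"
    and ij: "i < nx M" "j < ny M" "l = j \<or> l = Suc j"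
  shows "Q_b M (HEdge i l) (trace_on unit_square (ends M (HEdge i l)) u) =
    yx.edge_average u (wd u 0 1) (ys M j) (ys M (Suc j)) (xs M i) (xs M (Suc i)) (ys M l)"
proof -
  have b: "0 \<le> xs M i" "xs M i < xs M (Suc i)" "xs M (Suc i) \<le> 1"
    "0 \<le> ys M j" "ys M j < ys M (Suc j)" "ys M (Suc j) \<le> 1"
    using ij xs_bounds[of i] xs_bounds[of "Suc i"] ys_bounds[of j] ys_bounds[of "Suc j"] xs_less ys_less by auto
  have l: "ys M l = ys M j \<or> ys M l = ys M (Suc j)" using ij by auto
  have "is_trace unit_square (ends M (HEdge i l)) u (trace_on unit_square (ends M (HEdge i l)) u)"
    using yx.trace_on_is_trace[OF tr u b(4-6) l b(1-3)] by simp
  then show ?thesis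
    using yx.average_of_trace[OF _ u b(4-6) l b(1-3)] ij by (simp add: Q_b_HEdge)
qed

text \<open>Both \<open>g\<close> and the chosen trace are traces of \<open>u\<close> on the edge,
  and the average of any trace is the same volume integral.\<close>

lemma trace_average_boundary:
  assumes tr: "\<And>S. S \<in> sides \<Longrightarrow> is_trace unit_square S u g" and u: "u \<in> sobolev k unit_square" "1 \<le> k"
    and e: "e \<in> bdry_edges M"
  shows "Q_b M e (trace_on unit_square (ends M e) u) = Q_b M e g"
proof -
  have S: "is_trace unit_square ((0,0),(1,0)) u g" "is_trace unit_square ((1,0),(1,1)) u g"
    "is_trace unit_square ((0,1),(1,1)) u g" "is_trace unit_square ((0,0),(0,1)) u g"
    using tr by (auto simp: sides_def)
  have ends: "xs M 0 = 0" "xs M (nx M) = 1" "ys M 0 = 0" "ys M (ny M) = 1"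
    using mesh by (auto simp: is_mesh_def)
  have n: "nx M = Suc (nx M - 1)" "ny M = Suc (ny M - 1)" using nx_pos ny_pos by auto
  consider j l where "e = VEdge l j" "l = 0 \<or> l = nx M" "j < ny M"
    | i l where "e = HEdge i l" "l = 0 \<or> l = ny M" "i < nx M"
    using e by (auto simp: bdry_edges_def)
  then show ?thesis
  proof cases
    case 1
    \<comment> \<open>The column of cells that touches the boundary line: the first for l = 0,
      otherwise the last.\<close>
    define i where "i = (if l = 0 then 0 else nx M - 1)"
    have i: "i < nx M" "l = i \<or> l = Suc i" using 1(2) nx_pos by (auto simp: i_def)
    have b: "0 \<le> xs M i" "xs M i < xs M (Suc i)" "xs M (Suc i) \<le> 1"
      "0 \<le> ys M j" "ys M j < ys M (Suc j)" "ys M (Suc j) \<le> 1"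
      using i 1 xs_bounds[of i] xs_bounds[of "Suc i"] ys_bounds[of j] ys_bounds[of "Suc j"] xs_less ys_less by auto
    have l: "xs M l = xs M i \<or> xs M l = xs M (Suc i)" using i by auto
    have "is_trace unit_square (xy.pt (xs M l) 0, xy.pt (xs M l) 1) u g"
      using 1(2) S ends by auto
    then have "is_trace unit_square (xy.pt (xs M l) (ys M j), xy.pt (xs M l) (ys M (Suc j))) u g"
      by (rule xy.is_trace_subsegment[OF _ b(4-6)])
    from xy.average_of_trace[OF this u b(1-3) l b(4-6)]
    show ?thesis using trace_average_VEdge[OF S(1) u i(1) 1(3) i(2)] 1(3) unfolding 1(1)
      by (simp add: Q_b_VEdge)
  next
    case 2
    define j where "j = (if l = 0 then 0 else ny M - 1)"
    have j: "j < ny M" "l = j \<or> l = Suc j" using 2(2) ny_pos by (auto simp: j_def)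
    have b: "0 \<le> xs M i" "xs M i < xs M (Suc i)" "xs M (Suc i) \<le> 1"
      "0 \<le> ys M j" "ys M j < ys M (Suc j)" "ys M (Suc j) \<le> 1"
      using j 2 xs_bounds[of i] xs_bounds[of "Suc i"] ys_bounds[of j] ys_bounds[of "Suc j"] xs_less ys_less by auto
    have l: "ys M l = ys M j \<or> ys M l = ys M (Suc j)" using j by auto
    have "is_trace unit_square (yx.pt (ys M l) 0, yx.pt (ys M l) 1) u g"
      using 2(2) S ends by auto
    then have "is_trace unit_square (yx.pt (ys M l) (xs M i), yx.pt (ys M l) (xs M (Suc i))) u g"
      by (rule yx.is_trace_subsegment[OF _ b(1-3)])
    from yx.average_of_trace[OF this u b(4-6) l b(1-3)]
    show ?thesis using trace_average_HEdge[OF S(1) u 2(3) j(1) j(2)] 2(3) unfolding 2(1)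
      by (simp add: Q_b_HEdge)
  qed
qed

end

subsection \<open>The equation on a row of cells\<close>

context coordinates
begin

lemma pair_cong:
  assumes "\<And>z. z \<in> unit_square \<Longrightarrow> H z * (f (s z) * g (t z)) = H' z * (f' (s z) * g' (t z))"
  shows "pair H f g = pair H' f' g'"
  unfolding pair_def by (intro Bochner_Integration.integral_cong) (use assms in auto)

lemma pair_sum:
  assumes "finite I" "\<And>i. i \<in> I \<Longrightarrow> w i \<in> L2 unit_square" "\<And>i. i \<in> I \<Longrightarrow> h i \<in> test1_limits 0 1"
    "f \<in> test1_limits a b" "g \<in> test1_limits c d"
  shows "pair (\<lambda>z. \<Sum>i\<in>I. h i (s z) * w i z) f g = (\<Sum>i\<in>I. pair (w i) (\<lambda>x. f x * h i x) g)"
proof -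
  have "pair (\<lambda>z. \<Sum>i\<in>I. h i (s z) * w i z) f g = (\<integral>z. (\<Sum>i\<in>I. w i z * (f (s z) * h i (s z) * g (t z))) \<partial>mu)"
    unfolding pair_def
    by (intro Bochner_Integration.integral_cong) (simp_all add: sum_distrib_left sum_distrib_right mult_ac)
  also have "\<dots> = (\<Sum>i\<in>I. pair (w i) (\<lambda>x. f x * h i x) g)"
    unfolding pair_def
    by (intro Bochner_Integration.integral_sum tensor_integrable[OF assms(2) test1_limits_mult[OF assms(4,3)] assms(5)])
  finally show ?thesis .
qed

lemma step_L2:
  assumes "finite I" "\<And>i. i \<in> I \<Longrightarrow> w i \<in> L2 unit_square" "\<And>i. i \<in> I \<Longrightarrow> h i \<in> test1_limits 0 1"
  shows "(\<lambda>z. \<Sum>i\<in>I. h i (s z) * w i z) \<in> L2 unit_square"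
proof (rule L2_sum[OF assms(1)])
  fix i assume i: "i \<in> I"
  obtain K where K: "\<And>x. \<bar>h i x\<bar> \<le> K" by (rule test1_limits_bounded[OF assms(3)[OF i]]) blast
  have "(\<lambda>z. w i z * h i (s z)) \<in> L2 unit_square"
    by (rule L2_bounded_mult[OF assms(2)[OF i] measurable_compose[OF coord_measurable(1) test1_limits_measurable[OF assms(3)[OF i]]]])
       (use K in auto)
  then show "(\<lambda>z. h i (s z) * w i z) \<in> L2 unit_square" by (simp add: mult.commute)
qed

lemma tensor_deriv_pair:
  "tensor_deriv a b c d H H' \<longleftrightarrow>
    (\<forall>p\<in>test1 a b. \<forall>q\<in>test1 c d. pair H (deriv p) q = - pair H' p q)"
  by (simp add: tensor_deriv_def pair_def)

end

text \<open>Covers rows and columns alike: \<sigma> are the nodes in the direction \<open>s\<close>,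
  and (c, d) is the range of \<open>t\<close>. On cell i the s-component of the flux is k1 us + k2
  ut and the t-component is k3 us + k4 ut.\<close>

locale row_equation = coordinates +
  fixes \<sigma> :: "nat \<Rightarrow> real" and n :: nat and c d :: real
    and k1 k2 k3 k4 :: "nat \<Rightarrow> real" and us ut uss ust utt f :: "real \<times> real \<Rightarrow> real"
  assumes nodes: "\<And>i. i < n \<Longrightarrow> \<sigma> i < \<sigma> (Suc i)" "\<And>i. i \<le> n \<Longrightarrow> 0 \<le> \<sigma> i \<and> \<sigma> i \<le> 1"
      "\<And>i i'. i \<le> i' \<Longrightarrow> i' \<le> n \<Longrightarrow> \<sigma> i \<le> \<sigma> i'"
    and cd: "0 \<le> c" "c < d" "d \<le> 1"
    and L2s: "us \<in> L2 unit_square" "ut \<in> L2 unit_square" "uss \<in> L2 unit_square"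
      "ust \<in> L2 unit_square" "utt \<in> L2 unit_square" "f \<in> L2 unit_square"
    and derivs: "tensor_deriv 0 1 0 1 us uss" "tensor_deriv 0 1 0 1 ut ust"
      "coordinates.tensor_deriv t s 0 1 0 1 us ust" "coordinates.tensor_deriv t s 0 1 0 1 ut utt"
    and equation: "\<And>p q. p \<in> test1 0 1 \<Longrightarrow> q \<in> test1 c d \<Longrightarrow>
      (\<Sum>i<n. pair (\<lambda>z. k1 i * us z + k2 i * ut z) (\<lambda>x. deriv p x * iv (\<sigma> i) (\<sigma> (Suc i)) x) q +
             pair (\<lambda>z. k3 i * us z + k4 i * ut z) (\<lambda>x. p x * iv (\<sigma> i) (\<sigma> (Suc i)) x) (deriv q)) =
      pair f p q"
begin

abbreviation I :: "nat \<Rightarrow> real \<Rightarrow> real" where "I i \<equiv> iv (\<sigma> i) (\<sigma> (Suc i))"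

definition H :: "real \<times> real \<Rightarrow> real" where
  "H z = (\<Sum>i<n. I i (s z) * (k1 i * us z + k2 i * ut z))"

text \<open>The s-derivative of \<open>H\<close> that the equation predicts: - f minus the
  t-derivative of the other flux component. Within the row the coefficients depend on
  \<open>s\<close> only, so this t-derivative falls on \<open>u\<close> and the result is square
  integrable.\<close>

definition H' :: "real \<times> real \<Rightarrow> real" where
  "H' z = - f z - (\<Sum>i<n. I i (s z) * (k3 i * ust z + k4 i * utt z))"

lemma I_limits: "i < n \<Longrightarrow> I i \<in> test1_limits 0 1"
  using nodes(2)[of i] nodes(2)[of "Suc i"] by (intro iv_limits) auto

lemma L2_combination: "v \<in> L2 D \<Longrightarrow> w \<in> L2 D \<Longrightarrow> (\<lambda>z. k * v z + l * w z) \<in> L2 D"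
  by (intro L2_add L2_cmult)

lemma H_L2: "H \<in> L2 unit_square"
  unfolding H_def[abs_def] by (intro step_L2 L2_combination I_limits L2s) auto

lemma H'_L2: "H' \<in> L2 unit_square"
proof -
  have "(\<lambda>z. -1 * f z) \<in> L2 unit_square" by (intro L2_cmult L2s)
  then have "(\<lambda>z. -1 * f z - (\<Sum>i<n. I i (s z) * (k3 i * ust z + k4 i * utt z))) \<in> L2 unit_square"
    by (intro L2_diff step_L2 L2_combination I_limits L2s) auto
  then show ?thesis by (simp add: H'_def[abs_def])
qed

lemma I_disjoint: "i < n \<Longrightarrow> l < n \<Longrightarrow> i \<noteq> l \<Longrightarrow> I i x * I l x = 0"
  using nodes(3)[of "Suc i" l] nodes(3)[of "Suc l" i] by (cases "i < l") (auto simp: indicator_def)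

lemma sum_I: 
  assumes "i < n" "x \<in> {\<sigma> i<..<\<sigma> (Suc i)}" shows "(\<Sum>l<n. I l x * v l) = v i"
proof -
  have Ii: "I i x = 1" using assms(2) by simp
  have "I l x * v l = (if l = i then v i else 0)" if "l < n" for l
    using I_disjoint[OF assms(1) that, of x] Ii by (cases "l = i") (simp_all only: if_True if_False mult_1 mult_zero_left not_sym not_False_eq_True simp_thms)
  then have "(\<Sum>l<n. I l x * v l) = (\<Sum>l<n. if l = i then v i else 0)"
    by (intro sum.cong) auto
  then show ?thesis using assms by (simp only: sum.delta finite_lessThan lessThan_iff if_True)
qed

lemma pair_H:
  assumes "i < n" "\<And>x. x \<notin> {\<sigma> i<..<\<sigma> (Suc i)} \<Longrightarrow> \<phi> x = 0"
  shows "pair H \<phi> r = pair (\<lambda>z. k1 i * us z + k2 i * ut z) \<phi> r"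
proof (rule pair_cong)
  fix z
  show "H z * (\<phi> (s z) * r (t z)) = (k1 i * us z + k2 i * ut z) * (\<phi> (s z) * r (t z))"
  proof (cases "s z \<in> {\<sigma> i<..<\<sigma> (Suc i)}")
    case True
    show ?thesis unfolding H_def sum_I[OF assms(1) True] ..
  next
    case False
    show ?thesis unfolding assms(2)[OF False] by simp
  qed
qed

lemma pair_H':
  assumes "i < n" "\<And>x. x \<notin> {\<sigma> i<..<\<sigma> (Suc i)} \<Longrightarrow> \<phi> x = 0"
  shows "pair H' \<phi> r = pair (\<lambda>z. - f z - (k3 i * ust z + k4 i * utt z)) \<phi> r"
proof (rule pair_cong)
  fix z
  show "H' z * (\<phi> (s z) * r (t z)) = (- f z - (k3 i * ust z + k4 i * utt z)) * (\<phi> (s z) * r (t z))"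
  proof (cases "s z \<in> {\<sigma> i<..<\<sigma> (Suc i)}")
    case True
    show ?thesis unfolding H'_def sum_I[OF assms(1) True] ..
  next
    case False
    show ?thesis unfolding assms(2)[OF False] by simp
  qed
qed

lemma pair_H'_split:
  assumes "\<phi> \<in> test1_limits a b" "r \<in> test1_limits a' b'"
  shows "pair (\<lambda>z. - f z - (k3 i * ust z + k4 i * utt z)) \<phi> r =
    - pair f \<phi> r - pair (\<lambda>z. k3 i * ust z + k4 i * utt z) \<phi> r"
proof -
  have eq: "(\<lambda>z. - f z - (k3 i * ust z + k4 i * utt z)) = (\<lambda>z. (-1) * f z + (-1) * (k3 i * ust z + k4 i * utt z))"
    by (simp add: fun_eq_iff)
  show ?thesis
    unfolding eq pair_linear_fun[OF L2s(6) L2_combination[OF L2s(4,5)] assms]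
    by simp
qed

text \<open>The s-flux is weakly differentiable across nodes even where the coefficients jump: the
  equation moves the derivative to the direction \<open>t\<close>, in which they are constant. This
  is the weak form of continuity of the normal flux.\<close>

lemma row_tensor_deriv: "tensor_deriv 0 1 c d H H'"
  unfolding tensor_deriv_pair
proof (intro ballI)
  fix p q assume p: "p \<in> test1 0 1" and q: "q \<in> test1 c d"
  interpret sw: coordinates t s using coords by unfold_locales auto
  have sw: "sw.pair w g h = pair w h g" for w g h by (simp add: sw.pair_def pair_def mult.commute)
  have q01: "q \<in> test1 0 1" using q cd by (auto intro: test1_mono)
  note pl = test1_in_limits[OF p] and ql = test1_in_limits[OF q]
    and p'l = test1_in_limits[OF test1_deriv[OF p]] and q'l = test1_in_limits[OF test1_deriv[OF q]]
  \<comment> \<open>The factor in \<open>s\<close> is cut off discontinuously at the cell, which is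
    admissible because the integration by parts takes place in \<open>t\<close>.\<close>
  have t1: "pair w (\<lambda>x. p x * I i x) (deriv q) = - pair w' (\<lambda>x. p x * I i x) q"
    if i: "i < n" and D: "sw.tensor_deriv 0 1 0 1 w w'" and w: "w \<in> L2 unit_square" "w' \<in> L2 unit_square" for w w' i
  proof -
    have "(\<integral>z. w z * (deriv q (t z) * (p (s z) * I i (s z))) \<partial>mu) =
        - (\<integral>z. w' z * (q (t z) * (p (s z) * I i (s z))) \<partial>mu)"
    proof (rule sw.tensor_deriv_extend[OF w D, where S="{}" and g="\<lambda>x. p x * I i x"])
      show "deriv q \<in> test1_limits 0 1" using q01 by (intro test1_in_limits test1_deriv)
      show "(\<lambda>x. p x * I i x) \<in> test1_limits 0 1" by (rule test1_limits_mult[OF pl I_limits[OF i]])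
      show "continuous_on {0..1} q" by (rule smooth1_continuous_on[OF test1_smooth[OF q]])
      show "q x = 0" if "x \<le> 0 \<or> 1 \<le> x" for x using test1_outside[OF q01, of x] that by auto
      show "(q has_real_derivative deriv q x) (at x)" for x by (rule smooth1_DERIV[OF test1_smooth[OF q]])
    qed auto
    then show ?thesis by (simp add: pair_def mult.commute)
  qed
  have t2: "pair (\<lambda>z. k3 i * us z + k4 i * ut z) (\<lambda>x. p x * I i x) (deriv q) =
      - pair (\<lambda>z. k3 i * ust z + k4 i * utt z) (\<lambda>x. p x * I i x) q" if "i < n" for i
    unfolding pair_linear_fun[OF L2s(1,2) test1_limits_mult[OF pl I_limits[OF that]] q'l]
      pair_linear_fun[OF L2s(4,5) test1_limits_mult[OF pl I_limits[OF that]] ql]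
    using t1[OF that derivs(3) L2s(1,4)] t1[OF that derivs(4) L2s(2,5)] by (simp add: algebra_simps)
  have "pair H (deriv p) q = (\<Sum>i<n. pair (\<lambda>z. k1 i * us z + k2 i * ut z) (\<lambda>x. deriv p x * I i x) q)"
    unfolding H_def[abs_def] by (rule pair_sum[OF _ _ _ p'l ql]) (auto intro!: L2_combination I_limits L2s)
  also have "\<dots> = pair f p q + (\<Sum>i<n. pair (\<lambda>z. k3 i * ust z + k4 i * utt z) (\<lambda>x. p x * I i x) q)"
  proof -
    have "(\<Sum>i<n. pair (\<lambda>z. k3 i * us z + k4 i * ut z) (\<lambda>x. p x * I i x) (deriv q)) =
        - (\<Sum>i<n. pair (\<lambda>z. k3 i * ust z + k4 i * utt z) (\<lambda>x. p x * I i x) q)"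
      unfolding sum_negf[symmetric] by (intro sum.cong t2) auto
    then show ?thesis using equation[OF p q] by (simp add: sum.distrib)
  qed
  also have "(\<Sum>i<n. pair (\<lambda>z. k3 i * ust z + k4 i * utt z) (\<lambda>x. p x * I i x) q) =
      pair (\<lambda>z. \<Sum>i<n. I i (s z) * (k3 i * ust z + k4 i * utt z)) p q"
    by (rule pair_sum[OF _ _ _ pl ql, symmetric]) (auto intro!: L2_combination I_limits L2s)
  also have "pair f p q + \<dots> = - pair H' p q"
  proof -
    have S: "(\<lambda>z. \<Sum>i<n. I i (s z) * (k3 i * ust z + k4 i * utt z)) \<in> L2 unit_square"
      by (intro step_L2 L2_combination I_limits L2s) auto
    show ?thesis
      using pair_linear_fun[OF L2s(6) S pl ql, of "-1" "-1"] by (simp add: H'_def[abs_def])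
  qed
  finally show "pair H (deriv p) q = - pair H' p q" .
qed

text \<open>Inside a cell the derivative of \<open>H\<close> can be computed in two ways, from
  \<open>u\<close> and from the equation. Comparing them gives the differential equation on the
  cell, tested with bounded limits and hence with polynomials cut off at the cell.\<close>

lemma cell_equation:
  assumes i: "i < n" and "\<phi> \<in> test1_limits (\<sigma> i) (\<sigma> (Suc i))" "r \<in> test1_limits c d"
  shows "pair f \<phi> r = - pair (\<lambda>z. k1 i * uss z + k2 i * ust z) \<phi> r - pair (\<lambda>z. k3 i * ust z + k4 i * utt z) \<phi> r"
proof -
  let ?F1 = "\<lambda>z. k1 i * uss z + k2 i * ust z" and ?F2 = "\<lambda>z. k3 i * ust z + k4 i * utt z"
  have F: "?F1 \<in> L2 unit_square" "?F2 \<in> L2 unit_square" by (intro L2_combination L2s)+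
  have L: "(\<lambda>z. 1 * f z + 1 * (1 * ?F1 z + 1 * ?F2 z)) \<in> L2 unit_square"
    by (intro L2_combination L2s F)
  have s: "0 \<le> \<sigma> i" "\<sigma> (Suc i) \<le> 1" using nodes(2)[of i] nodes(2)[of "Suc i"] i by auto
  have "(\<integral>z. (1 * f z + 1 * (1 * ?F1 z + 1 * ?F2 z)) * (\<phi> (s z) * r (t z)) \<partial>mu) = 0"
  proof (rule tensor_zero_extend[OF L _ assms(2,3)])
    fix p q assume p: "p \<in> test1 (\<sigma> i) (\<sigma> (Suc i))" and q: "q \<in> test1 c d"
    note pl = test1_in_limits[OF p] and ql = test1_in_limits[OF q]
      and p'l = test1_in_limits[OF test1_deriv[OF p]]
    have p01: "p \<in> test1 0 1" by (rule test1_mono[OF p s])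
    have q01: "q \<in> test1 0 1" using q cd by (auto intro: test1_mono)
    have "pair H (deriv p) q = pair (\<lambda>z. k1 i * us z + k2 i * ut z) (deriv p) q"
      by (rule pair_H[OF i test1_outside[OF test1_deriv[OF p]]])
    also have "\<dots> = k1 i * pair us (deriv p) q + k2 i * pair ut (deriv p) q"
      by (rule pair_linear_fun[OF L2s(1,2) p'l ql])
    also have "\<dots> = - pair ?F1 p q"
      using derivs(1,2) p01 q01 pair_linear_fun[OF L2s(3,4) pl ql, of "k1 i" "k2 i"]
      by (simp add: tensor_deriv_pair)
    finally have "pair ?F1 p q = pair H' p q"
      using row_tensor_deriv p01 q unfolding tensor_deriv_pair by auto
    also have "\<dots> = pair (\<lambda>z. - f z - ?F2 z) p q" by (rule pair_H'[OF i test1_outside[OF p]])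
    also have "\<dots> = - pair f p q - pair ?F2 p q" by (rule pair_H'_split[OF pl ql])
    finally have "pair (\<lambda>z. 1 * f z + 1 * (1 * ?F1 z + 1 * ?F2 z)) p q = 0"
      unfolding pair_linear_fun[OF L2s(6) L2_combination[OF F] pl ql] pair_linear_fun[OF F pl ql] by simp
    then show "(\<integral>z. (1 * f z + 1 * (1 * ?F1 z + 1 * ?F2 z)) * (p (s z) * q (t z)) \<partial>mu) = 0"
      by (simp add: pair_def)
  qed
  then have "pair (\<lambda>z. 1 * f z + 1 * (1 * ?F1 z + 1 * ?F2 z)) \<phi> r = 0" by (simp add: pair_def)
  then show ?thesis
    unfolding pair_linear_fun[OF L2s(6) L2_combination[OF F] assms(2,3)] pair_linear_fun[OF F assms(2,3)]
    by simp
qed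

text \<open>\<open>pair_hat\<close> for the flux \<open>H\<close>; each half of the hat function
  lives on one cell, where \<open>cell_equation\<close> replaces the predicted derivative
  \<open>H'\<close> by the derivative of the flux there.\<close>

lemma flux_jump:
  assumes i: "Suc i < n"
  shows "pair (\<lambda>z. k1 i * us z + k2 i * ut z) (I i) (iv c d) / (\<sigma> (Suc i) - \<sigma> i) -
      pair (\<lambda>z. k1 (Suc i) * us z + k2 (Suc i) * ut z) (I (Suc i)) (iv c d) / (\<sigma> (Suc (Suc i)) - \<sigma> (Suc i)) =
    - (pair (\<lambda>z. k1 i * uss z + k2 i * ust z) (\<lambda>x. (x - \<sigma> i) * I i x) (iv c d) / (\<sigma> (Suc i) - \<sigma> i) +
       pair (\<lambda>z. k1 (Suc i) * uss z + k2 (Suc i) * ust z) (\<lambda>x. (\<sigma> (Suc (Suc i)) - x) * I (Suc i) x) (iv c d) /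
         (\<sigma> (Suc (Suc i)) - \<sigma> (Suc i)))"
proof -
  define a b e where "a = \<sigma> i" and "b = \<sigma> (Suc i)" and "e = \<sigma> (Suc (Suc i))"
  have ab: "0 \<le> a" "a < b" "b < e" "e \<le> 1"
    using nodes(1)[of i] nodes(1)[of "Suc i"] nodes(2)[of i] nodes(2)[of "Suc (Suc i)"] i
    by (auto simp: a_def b_def e_def)
  have i1: "i < n" and i2: "Suc i < n" using i by auto
  let ?r = "iv c d"
  have r: "?r \<in> test1_limits c d" by (rule indicator_test1_limits)
  let ?h1 = "\<lambda>x. (x - a) * iv a b x" and ?h2 = "\<lambda>x. (e - x) * iv b e x"
  have h1: "?h1 \<in> test1_limits (\<sigma> i) (\<sigma> (Suc i))" and h2: "?h2 \<in> test1_limits (\<sigma> (Suc i)) (\<sigma> (Suc (Suc i)))"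
    unfolding a_def b_def e_def by (intro test1_limits_smooth_mult smooth1_intros indicator_test1_limits)+
  have D: "tensor_deriv a e c d H H'"
    by (rule tensor_deriv_mono[OF row_tensor_deriv]) (use ab in auto)
  have jump: "pair H (iv a b) ?r / (b - a) - pair H (iv b e) ?r / (e - b) = - pair H' (hat a b e) ?r"
    by (rule pair_hat[OF H_L2 H'_L2 D ab r])
  \<comment> \<open>The two cut-off halves reproduce the hat function except at the node b, a null
    set after integration.\<close>
  have "pair H' (hat a b e) ?r = pair H' (\<lambda>x. 1 / (b - a) * ?h1 x + 1 / (e - b) * ?h2 x) ?r"
  proof (rule pair_cong_finite[OF H'_L2, where S="{b}"])
    show "hat a b e \<in> borel_measurable borel"
      using ab by (intro borel_measurable_continuous_onI hat_continuous) auto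
    show "(\<lambda>x. 1 / (b - a) * ?h1 x + 1 / (e - b) * ?h2 x) \<in> borel_measurable borel" by measurable
    show "hat a b e x = 1 / (b - a) * ?h1 x + 1 / (e - b) * ?h2 x" if x: "x \<notin> {b}" for x
    proof -
      consider "x \<le> a \<or> e \<le> x" | "a < x" "x < b" | "b < x" "x < e" using x by force
      then show ?thesis
      proof cases
        case 1 then show ?thesis using hat_outside[OF ab(2,3) 1] ab by auto
      next
        case 2 then show ?thesis using hat_left[OF ab(2,3), of x] ab by auto
      next
        case 3 then show ?thesis using hat_right[OF ab(2,3), of x] ab by auto
      qed
    qed
  qed auto
  also have "\<dots> = 1 / (b - a) * pair H' ?h1 ?r + 1 / (e - b) * pair H' ?h2 ?r"
    by (rule pair_linear_first[OF H'_L2 h1 h2 r])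
  also have "pair H' ?h1 ?r = pair (\<lambda>z. k1 i * uss z + k2 i * ust z) ?h1 ?r"
    using pair_H'[OF i1, of ?h1 ?r] pair_H'_split[OF h1 r, of i] cell_equation[OF i1 h1 r]
      test1_limits_outside[OF h1] by simp
  also have "pair H' ?h2 ?r = pair (\<lambda>z. k1 (Suc i) * uss z + k2 (Suc i) * ust z) ?h2 ?r"
    using pair_H'[OF i2, of ?h2 ?r] pair_H'_split[OF h2 r, of "Suc i"] cell_equation[OF i2 h2 r]
      test1_limits_outside[OF h2] by simp
  finally have rhs: "pair H' (hat a b e) ?r =
      1 / (b - a) * pair (\<lambda>z. k1 i * uss z + k2 i * ust z) ?h1 ?r +
      1 / (e - b) * pair (\<lambda>z. k1 (Suc i) * uss z + k2 (Suc i) * ust z) ?h2 ?r" .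
  have "pair H (iv a b) ?r = pair (\<lambda>z. k1 i * us z + k2 i * ut z) (iv a b) ?r"
    "pair H (iv b e) ?r = pair (\<lambda>z. k1 (Suc i) * us z + k2 (Suc i) * ut z) (iv b e) ?r"
    using pair_H[OF i1, of "iv a b" ?r] pair_H[OF i2, of "iv b e" ?r] by (auto simp: a_def b_def e_def)
  then show ?thesis
    using jump rhs unfolding a_def b_def e_def by simp
qed

end

subsection \<open>The error equation\<close>

text \<open>No measurability is needed: on a complete measure space, functions that agree almost
  everywhere are both measurable or both non-integrable.\<close>

lemma lebesgue_integral_cong_AE:
  fixes f g :: "'a :: euclidean_space \<Rightarrow> real"
  assumes "AE x in lebesgue. f x = g x" shows "integral\<^sup>L lebesgue f = integral\<^sup>L lebesgue g"
proof (cases "f \<in> borel_measurable lebesgue")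
  case True
  moreover from this have "g \<in> borel_measurable lebesgue" using assms by (rule borel_measurable_AE)
  ultimately show ?thesis using assms by (intro integral_cong_AE)
next
  case False
  have "AE x in lebesgue. g x = f x" using assms by eventually_elim simp
  with False have "g \<notin> borel_measurable lebesgue" using borel_measurable_AE[of g f] by blast
  then have "\<not> integrable lebesgue g" by (auto dest: borel_measurable_integrable)
  moreover have "\<not> integrable lebesgue f" using False by (auto dest: borel_measurable_integrable)
  ultimately show ?thesis by (simp add: not_integrable_integral_eq)
qed

lemma mu_integral_cong_AE:
  fixes f g :: "real \<times> real \<Rightarrow> real"
  assumes "AE z in mu. f z = g z" shows "integral\<^sup>L mu f = integral\<^sup>L mu g"
proof -
  have "AE z in lebesgue. indicator unit_square z *\<^sub>R f z = indicator unit_square z *\<^sub>R g z"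
    using assms by (auto simp: AE_restrict_space_iff indicator_def elim: eventually_mono)
  moreover have "integral\<^sup>L mu h = (\<integral>z. indicator unit_square z *\<^sub>R h z \<partial>lebesgue)" for h :: "real \<times> real \<Rightarrow> real"
    by (rule integral_restrict_space) simp
  ultimately show ?thesis using lebesgue_integral_cong_AE by metis
qed

text \<open>Summation by parts in which the jump of Q at a node is charged to the cell on its left
  by L and to the cell on its right by R. The induction carries the end term b (Q + L), which
  disappears at the last node.\<close>

lemma sum_by_parts_zero_ends:
  fixes b Q L R :: "nat \<Rightarrow> real"
  assumes "b 0 = 0" "b n = 0" "\<And>i. Suc i < n \<Longrightarrow> Q i - Q (Suc i) = - (L i + R (Suc i))"
  shows "(\<Sum>i<n. (b (Suc i) - b i) * Q i) = - (\<Sum>i<n. b (Suc i) * L i + b i * R i)"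
proof -
  have *: "m < n \<Longrightarrow> (\<Sum>i<Suc m. (b (Suc i) - b i) * Q i + (b (Suc i) * L i + b i * R i)) =
    b (Suc m) * (Q m + L m)" for m
  proof (induction m)
    case 0
    then show ?case using assms(1) by (simp add: algebra_simps)
  next
    case (Suc m)
    have L: "L m = Q (Suc m) - Q m - R (Suc m)" using assms(3)[of m] Suc.prems by simp
    have IH: "(\<Sum>i<Suc m. (b (Suc i) - b i) * Q i + (b (Suc i) * L i + b i * R i)) = b (Suc m) * (Q m + L m)"
      by (rule Suc.IH) (use Suc.prems in simp)
    show ?case unfolding sum.lessThan_Suc[of _ "Suc m"] IH L by (simp add: algebra_simps)
  qed
  show ?thesis
  proof (cases n)
    case (Suc m)
    then show ?thesis using *[of m] assms(2) by (simp add: sum.distrib)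
  qed simp
qed

section \<open>Edge functions and their extension into the cells\<close>

context rect_mesh
begin

abbreviation X :: "nat \<Rightarrow> real" where "X i \<equiv> xs M (Suc i) - xs M i"
abbreviation Y :: "nat \<Rightarrow> real" where "Y j \<equiv> ys M (Suc j) - ys M j"
abbreviation ix :: "nat \<Rightarrow> real \<Rightarrow> real" where "ix i \<equiv> iv (xs M i) (xs M (Suc i))"
abbreviation iy :: "nat \<Rightarrow> real \<Rightarrow> real" where "iy j \<equiv> iv (ys M j) (ys M (Suc j))"
abbreviation mx :: "nat \<Rightarrow> real \<Rightarrow> real" where "mx i x \<equiv> (x - (xs M i + xs M (Suc i)) / 2) * ix i x"
abbreviation my :: "nat \<Rightarrow> real \<Rightarrow> real" where "my j y \<equiv> (y - (ys M j + ys M (Suc j)) / 2) * iy j y"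
abbreviation px :: "nat \<Rightarrow> real \<Rightarrow> real" where "px i x \<equiv> (x - xs M i) * (xs M (Suc i) - x) * ix i x"
abbreviation py :: "nat \<Rightarrow> real \<Rightarrow> real" where "py j y \<equiv> (y - ys M j) * (ys M (Suc j) - y) * iy j y"

lemma ix_limits: "ix i \<in> test1_limits (xs M i) (xs M (Suc i))"
  and iy_limits: "iy j \<in> test1_limits (ys M j) (ys M (Suc j))"
  and mx_limits: "mx i \<in> test1_limits (xs M i) (xs M (Suc i))"
  and my_limits: "my j \<in> test1_limits (ys M j) (ys M (Suc j))"
  by (intro test1_limits_smooth_mult smooth1_intros indicator_test1_limits)+

lemma cell_bounds:
  assumes "i < nx M" "j < ny M"
  shows "0 \<le> xs M i" "xs M i < xs M (Suc i)" "xs M (Suc i) \<le> 1"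
    "0 \<le> ys M j" "ys M j < ys M (Suc j)" "ys M (Suc j) \<le> 1"
  using assms xs_bounds[of i] xs_bounds[of "Suc i"] ys_bounds[of j] ys_bounds[of "Suc j"] xs_less ys_less
  by auto

lemma interior_elem: "interior (elem M (i, j)) = {xs M i<..<xs M (Suc i)} \<times> {ys M j<..<ys M (Suc j)}"
  by (simp add: elem_def interior_Times)

lemma interior_elem_subset: "i < nx M \<Longrightarrow> j < ny M \<Longrightarrow> interior (elem M (i, j)) \<subseteq> unit_square"
  using cell_bounds[of i j] by (auto simp: interior_elem unit_square_def)

lemma elem_integral:
  fixes F :: "real \<times> real \<Rightarrow> real"
  assumes "i < nx M" "j < ny M"
  shows "(\<integral>z. F z \<partial>lebesgue_on (elem M (i, j))) = (\<integral>z. F z * (ix i (fst z) * iy j (snd z)) \<partial>mu)"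
proof -
  have fr: "AE z in lebesgue. z \<notin> elem M (i, j) - interior (elem M (i, j))"
  proof -
    have cv: "convex (elem M (i, j))" by (auto simp: elem_def intro!: convex_Times)
    have "closed (elem M (i, j))" by (auto simp: elem_def intro!: closed_Times)
    then have "elem M (i, j) - interior (elem M (i, j)) = frontier (elem M (i, j))"
      by (simp add: frontier_def)
    moreover have "negligible (frontier (elem M (i, j)))" by (rule negligible_convex_frontier[OF cv])
    ultimately have "elem M (i, j) - interior (elem M (i, j)) \<in> null_sets lebesgue"
      by (simp add: negligible_iff_null_sets)
    then show ?thesis by (rule AE_not_in)
  qed
  have el: "elem M (i, j) \<in> sets lebesgue"
  proof -
    have "elem M (i, j) = cbox (xs M i, ys M j) (xs M (Suc i), ys M (Suc j))"
      by (simp add: elem_def cbox_Pair_eq)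
    then show ?thesis by simp
  qed
  have "(\<integral>z. F z \<partial>lebesgue_on (elem M (i, j))) = (\<integral>z. indicator (elem M (i, j)) z *\<^sub>R F z \<partial>lebesgue)"
    by (rule integral_restrict_space) (use el in simp)
  also have "\<dots> = (\<integral>z. indicator unit_square z *\<^sub>R (F z * (ix i (fst z) * iy j (snd z))) \<partial>lebesgue)"
  proof (rule lebesgue_integral_cong_AE)
    show "AE z in lebesgue. indicator (elem M (i, j)) z *\<^sub>R F z =
        indicator unit_square z *\<^sub>R (F z * (ix i (fst z) * iy j (snd z)))"
      using fr
    proof eventually_elim
      case (elim z)
      show ?case
      proof (cases "z \<in> interior (elem M (i, j))")
        case True
        then have "z \<in> unit_square" "z \<in> elem M (i, j)"
          using interior_elem_subset[OF assms] interior_subset by blast+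
        moreover have "ix i (fst z) = 1" "iy j (snd z) = 1" using True by (auto simp: interior_elem)
        ultimately show ?thesis by simp
      next
        case False
        then have "z \<notin> elem M (i, j)" using elim by simp
        moreover have "ix i (fst z) * iy j (snd z) = 0"
          using False by (cases z) (auto simp: interior_elem indicator_def)
        ultimately show ?thesis by simp
      qed
    qed
  qed
  also have "\<dots> = (\<integral>z. F z * (ix i (fst z) * iy j (snd z)) \<partial>mu)"
    by (rule integral_restrict_space[symmetric]) simp
  finally show ?thesis .
qed

text \<open>The mode that affine functions do not see: for their edge averages the two vertical and
  the two horizontal values both add up to twice the value at the centre.\<close>

definition beta :: "(edge \<Rightarrow> real) \<Rightarrow> nat \<Rightarrow> nat \<Rightarrow> real" where
  "beta b i j = b (VEdge i j) + b (VEdge (Suc i) j) - b (HEdge i j) - b (HEdge i (Suc j))"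

definition gx :: "(edge \<Rightarrow> real) \<Rightarrow> nat \<Rightarrow> nat \<Rightarrow> real" where
  "gx b i j = (b (VEdge (Suc i) j) - b (VEdge i j)) / X i"

definition gy :: "(edge \<Rightarrow> real) \<Rightarrow> nat \<Rightarrow> nat \<Rightarrow> real" where
  "gy b i j = (b (HEdge i (Suc j)) - b (HEdge i j)) / Y j"

text \<open>The weight for which \<open>kappa\<close> times the square of \<open>beta b\<close> is
  the squared L2 norm, over the cell boundary, of \<open>b\<close> minus the edge averages of its
  extension.\<close>

definition kappa :: "nat \<Rightarrow> nat \<Rightarrow> real" where
  "kappa i j = X i * Y j / (2 * (X i + Y j))"

text \<open>The least squares extension of an edge function into the cells; it is chosen such that its
  edge averages differ from the edge function by the one mode that is orthogonal to the
  affine functions, which \<open>beta\<close> measures.\<close>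

definition ext0 :: "(edge \<Rightarrow> real) \<Rightarrow> nat \<Rightarrow> nat \<Rightarrow> real" where
  "ext0 b i j = (Y j * (b (VEdge i j) + b (VEdge (Suc i) j)) +
     X i * (b (HEdge i j) + b (HEdge i (Suc j)))) / (2 * (X i + Y j))"

definition ext :: "(edge \<Rightarrow> real) \<Rightarrow> nat \<times> nat \<Rightarrow> real \<times> real \<Rightarrow> real" where
  "ext b = (\<lambda>(i, j) z. ext0 b i j + gx b i j * (fst z - (xs M i + xs M (Suc i)) / 2) +
     gy b i j * (snd z - (ys M j + ys M (Suc j)) / 2))"

lemma ext_in_P1: "ext b c \<in> P1"
proof -
  obtain i j where c: "c = (i, j)" by (cases c)
  show ?thesis unfolding P1_def ext_def c
    by (intro CollectI exI[of _ "ext0 b i j - gx b i j * ((xs M i + xs M (Suc i)) / 2) - gy b i j * ((ys M j + ys M (Suc j)) / 2)"]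
        exI[of _ "gx b i j"] exI[of _ "gy b i j"]) (simp add: algebra_simps)
qed

lemma wgrad_cell:
  assumes "i < nx M" "j < ny M" shows "wgrad M v (i, j) = vector [gx (snd v) i j, gy (snd v) i j]"
  using wgrad_eq[OF mesh, of i j v] assms by (simp add: cells_def gx_def gy_def)

lemma integral_affine: "(\<integral>r. p + q * r \<partial>lebesgue_on {0..1}) = p + q / 2" for p q :: real
proof -
  have "((\<lambda>r. p + q * r) has_integral (p + q / 2)) {0..1}"
  proof -
    have "((\<lambda>r. p + q * r) has_integral ((p * 1 + q * 1\<^sup>2 / 2) - (p * 0 + q * 0\<^sup>2 / 2))) {0..1}"
      by (rule fundamental_theorem_of_calculus)
         (auto intro!: derivative_eq_intros simp: has_real_derivative_iff_has_vector_derivative[symmetric])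
    then show ?thesis by simp
  qed
  moreover have "integrable (lebesgue_on {0..1}) (\<lambda>r. p + q * r)"
    by (intro continuous_imp_integrable_real continuous_intros)
  ultimately show ?thesis by (simp add: lebesgue_integral_eq_integral integral_unique)
qed

lemma Q_b_affine:
  assumes "\<And>z. w z = k0 + k1 * fst z + k2 * snd z"
  shows "j < ny M \<Longrightarrow> Q_b M (VEdge l j) w = k0 + k1 * xs M l + k2 * ((ys M j + ys M (Suc j)) / 2)"
    and "i < nx M \<Longrightarrow> Q_b M (HEdge i l) w = k0 + k1 * ((xs M i + xs M (Suc i)) / 2) + k2 * ys M l"
proof -
  have 1: "w (xs M l, ys M j + r * Y j) = (k0 + k1 * xs M l + k2 * ys M j) + (k2 * Y j) * r" for r
    by (simp add: assms algebra_simps)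
  show "j < ny M \<Longrightarrow> Q_b M (VEdge l j) w = k0 + k1 * xs M l + k2 * ((ys M j + ys M (Suc j)) / 2)"
    by (simp add: Q_b_VEdge 1 integral_affine del: Q_b_def) (simp add: field_simps)
  have 2: "w (xs M i + r * X i, ys M l) = (k0 + k1 * xs M i + k2 * ys M l) + (k1 * X i) * r" for r
    by (simp add: assms algebra_simps)
  show "i < nx M \<Longrightarrow> Q_b M (HEdge i l) w = k0 + k1 * ((xs M i + xs M (Suc i)) / 2) + k2 * ys M l"
    by (simp add: Q_b_HEdge 2 integral_affine) (simp add: field_simps)
qed

lemma seg_integral_const:
  "j < ny M \<Longrightarrow> seg_integral (ends M (VEdge l j)) (\<lambda>_. k) = Y j * k"
  "i < nx M \<Longrightarrow> seg_integral (ends M (HEdge i l)) (\<lambda>_. k) = X i * k"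
  using xy.seg_integral_pt[of "ys M j" "ys M (Suc j)" "xs M l" "\<lambda>_. k"] ys_less[of j]
    yx.seg_integral_pt[of "xs M i" "xs M (Suc i)" "ys M l" "\<lambda>_. k"] xs_less[of i]
    integral_affine[of k 0] by auto

lemma sum_elem_edges:
  "(\<Sum>(e, n)\<in>elem_edges (i, j). F e) = F (VEdge i j) + F (VEdge (Suc i) j) + F (HEdge i j) + (F (HEdge i (Suc j)) :: real)"
  by (simp add: elem_edges_def)

text \<open>The extension misses \<open>b\<close> by X beta / (2 (X + Y)) on both vertical edges and
  by - Y beta / (2 (X + Y)) on both horizontal ones. Weighted by the lengths Y and X this residual
  is orthogonal to edge averages of affine functions, so the interior part \<open>w\<close> drops
  out.\<close>

lemma stabilizer_cell:
  assumes ij: "i < nx M" "j < ny M" and w: "w \<in> P1"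
  shows "(\<Sum>(e, n)\<in>elem_edges (i, j). seg_integral (ends M e)
      (\<lambda>_. (wb e - Q_b M e w) * (b e - Q_b M e (ext b (i, j))))) = kappa i j * beta wb i j * beta b i j"
proof -
  obtain k0 k1 k2 where k: "\<And>z. w z = k0 + k1 * fst z + k2 * snd z" using w by (auto simp: P1_def)
  define x y where "x = X i" and "y = Y j"
  have pos: "x > 0" "y > 0" using cell_bounds[OF ij] by (auto simp: x_def y_def)
  define b1 b2 b3 b4 where "b1 = b (VEdge i j)" and "b2 = b (VEdge (Suc i) j)"
    and "b3 = b (HEdge i j)" and "b4 = b (HEdge i (Suc j))"
  define bt where "bt = b1 + b2 - b3 - b4"
  have e: "ext b (i, j) z = (ext0 b i j - gx b i j * ((xs M i + xs M (Suc i)) / 2) - gy b i j * ((ys M j + ys M (Suc j)) / 2))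
      + gx b i j * fst z + gy b i j * snd z" for z
    by (simp add: ext_def algebra_simps)
  have gxx: "gx b i j * x = b2 - b1" and gyy: "gy b i j * y = b4 - b3"
    using pos by (simp_all add: gx_def gy_def b1_def b2_def b3_def b4_def x_def y_def)
  have c0: "ext0 b i j * (2 * (x + y)) = y * (b1 + b2) + x * (b3 + b4)"
    using pos by (simp add: ext0_def b1_def b2_def b3_def b4_def x_def[symmetric] y_def[symmetric])
  have q: "Q_b M (VEdge i j) (ext b (i, j)) = ext0 b i j - gx b i j * x / 2"
    "Q_b M (VEdge (Suc i) j) (ext b (i, j)) = ext0 b i j + gx b i j * x / 2"
    "Q_b M (HEdge i j) (ext b (i, j)) = ext0 b i j - gy b i j * y / 2"
    "Q_b M (HEdge i (Suc j)) (ext b (i, j)) = ext0 b i j + gy b i j * y / 2"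
    using ij by (simp_all add: Q_b_affine[OF e] x_def y_def field_simps)
  have minus: "(b - (E - D / 2)) * (2 * z) = (2 * b + D) * z - E * (2 * z)"
    and plus: "(b - (E + D / 2)) * (2 * z) = (2 * b - D) * z - E * (2 * z)" for b E D z :: real
    by (simp_all add: algebra_simps)
  have d: "(b1 - (ext0 b i j - gx b i j * x / 2)) * (2 * (x + y)) = x * bt"
    "(b2 - (ext0 b i j + gx b i j * x / 2)) * (2 * (x + y)) = x * bt"
    "(b3 - (ext0 b i j - gy b i j * y / 2)) * (2 * (x + y)) = - y * bt"
    "(b4 - (ext0 b i j + gy b i j * y / 2)) * (2 * (x + y)) = - y * bt"
    unfolding minus plus gxx gyy c0 bt_def by (simp_all add: algebra_simps)
  have div: "z = v / (2 * (x + y))" if "z * (2 * (x + y)) = v" for z v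
    using that pos by (auto simp: eq_divide_eq)
  note d' = d[THEN div]
  define w1 w2 w3 w4 where "w1 = Q_b M (VEdge i j) w" and "w2 = Q_b M (VEdge (Suc i) j) w"
    and "w3 = Q_b M (HEdge i j) w" and "w4 = Q_b M (HEdge i (Suc j)) w"
  have w0: "w1 + w2 = w3 + w4"
    unfolding w1_def w2_def w3_def w4_def using ij by (simp add: Q_b_affine[OF k] algebra_simps)
  have "(\<Sum>(e, n)\<in>elem_edges (i, j). seg_integral (ends M e)
      (\<lambda>_. (wb e - Q_b M e w) * (b e - Q_b M e (ext b (i, j))))) =
    y * ((wb (VEdge i j) - w1) * (x * bt / (2 * (x + y)))) +
    y * ((wb (VEdge (Suc i) j) - w2) * (x * bt / (2 * (x + y)))) +
    x * ((wb (HEdge i j) - w3) * (- y * bt / (2 * (x + y)))) +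
    x * ((wb (HEdge i (Suc j)) - w4) * (- y * bt / (2 * (x + y))))"
    unfolding sum_elem_edges seg_integral_const(1)[OF ij(2)] seg_integral_const(2)[OF ij(1)]
    unfolding q b1_def[symmetric] b2_def[symmetric] b3_def[symmetric] b4_def[symmetric] d'
    unfolding x_def y_def w1_def w2_def w3_def w4_def by simp
  also have "\<dots> = x * y * bt / (2 * (x + y)) * (wb (VEdge i j) + wb (VEdge (Suc i) j) - wb (HEdge i j) - wb (HEdge i (Suc j))
      - (w1 + w2 - w3 - w4))"
    by (simp add: algebra_simps add_divide_distrib diff_divide_distrib)
  also have "\<dots> = kappa i j * beta wb i j * beta b i j"
    using w0 by (simp add: kappa_def beta_def x_def y_def bt_def b1_def b2_def b3_def b4_def)
  finally show ?thesis .
qed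

end

lemma mult_vec_inner2:
  fixes A :: "real^2^2" and v w :: "real^2"
  shows "(A *v v) \<bullet> w = (A $ 1 $ 1 * v $ 1 + A $ 1 $ 2 * v $ 2) * w $ 1 + (A $ 2 $ 1 * v $ 1 + A $ 2 $ 2 * v $ 2) * w $ 2"
  by (simp add: matrix_vector_mult_def inner_vec_def sum_2)

context rect_mesh
begin

lemma sum_ix:
  assumes "n \<le> nx M" "\<forall>i\<le>nx M. r \<noteq> xs M i" shows "(\<Sum>i<n. ix i r) = iv (xs M 0) (xs M n) r"
  using assms(1)
proof (induction n)
  case (Suc n)
  have "xs M 0 \<le> xs M n" "xs M n < xs M (Suc n)" "r \<noteq> xs M n"
    using Suc.prems assms(2) xs_mono[of 0 n] xs_less[of n] by auto
  moreover have "(\<Sum>i<n. ix i r) = iv (xs M 0) (xs M n) r" using Suc by simp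
  ultimately show ?case unfolding sum.lessThan_Suc by (auto simp: indicator_def)
qed simp

lemma sum_iy:
  assumes "n \<le> ny M" "\<forall>j\<le>ny M. r \<noteq> ys M j" shows "(\<Sum>j<n. iy j r) = iv (ys M 0) (ys M n) r"
  using assms(1)
proof (induction n)
  case (Suc n)
  have "ys M 0 \<le> ys M n" "ys M n < ys M (Suc n)" "r \<noteq> ys M n"
    using Suc.prems assms(2) ys_mono[of 0 n] ys_less[of n] by auto
  moreover have "(\<Sum>j<n. iy j r) = iv (ys M 0) (ys M n) r" using Suc by simp
  ultimately show ?case unfolding sum.lessThan_Suc by (auto simp: indicator_def)
qed simp

lemma ends01: "xs M 0 = 0" "xs M (nx M) = 1" "ys M 0 = 0" "ys M (ny M) = 1"
  using mesh by (auto simp: is_mesh_def)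

end

section \<open>The differential equation on the rows and columns of the mesh\<close>

locale wg_problem = rect_mesh +
  fixes a :: "real \<times> real \<Rightarrow> real^2^2" and f g u :: "real \<times> real \<Rightarrow> real"
    and A :: "nat \<times> nat \<Rightarrow> real^2^2"
  assumes coeff: "\<And>c z. c \<in> cells M \<Longrightarrow> z \<in> interior (elem M c) \<Longrightarrow> a z = A c"
    and f: "f \<in> L2 unit_square" and u: "u \<in> sobolev 3 unit_square" and bvp: "solves_bvp a f g u"
begin

abbreviation F1 :: "nat \<Rightarrow> nat \<Rightarrow> real \<times> real \<Rightarrow> real" where
  "F1 i j z \<equiv> A (i, j) $ 1 $ 1 * wd u 2 0 z + A (i, j) $ 1 $ 2 * wd u 1 1 z"

abbreviation F2 :: "nat \<Rightarrow> nat \<Rightarrow> real \<times> real \<Rightarrow> real" where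
  "F2 i j z \<equiv> A (i, j) $ 2 $ 1 * wd u 1 1 z + A (i, j) $ 2 $ 2 * wd u 0 2 z"

lemma wd_L2: "m + n \<le> 3 \<Longrightarrow> wd u m n \<in> L2 unit_square"
  by (rule weak_deriv_sobolev(1)[OF u])

lemma wd_x: "m + n < 3 \<Longrightarrow> xy.tensor_deriv 0 1 0 1 (wd u m n) (wd u (Suc m) n)"
  and wd_y: "m + n < 3 \<Longrightarrow> yx.tensor_deriv 0 1 0 1 (wd u m n) (wd u m (Suc n))"
  using wd_tensor_deriv[OF u] by auto

lemma L2_comb: "v \<in> L2 D \<Longrightarrow> w \<in> L2 D \<Longrightarrow> (\<lambda>z. k * v z + l * w z) \<in> L2 D"
  by (intro L2_add L2_cmult)

lemma F_L2: "F1 i j \<in> L2 unit_square" "F2 i j \<in> L2 unit_square"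
  by (intro L2_comb wd_L2; simp)+

lemma PDE_tensor:
  assumes p: "p \<in> test1 0 1" and q: "q \<in> test1 0 1"
  shows "(\<integral>z. (a z *v weak_gradient unit_square u z) \<bullet> vector [deriv p (fst z) * q (snd z), p (fst z) * deriv q (snd z)] \<partial>mu) =
    xy.pair f p q"
proof -
  have "(\<lambda>z. p (fst z) * q (snd z)) \<in> test_functions unit_square"
    by (rule tensor_test_functions[OF p q]) auto
  with bvp have "(\<integral>z. (a z *v weak_gradient unit_square u z) \<bullet> gradient (\<lambda>z. p (fst z) * q (snd z)) z \<partial>mu) =
      (\<integral>z. f z * (p (fst z) * q (snd z)) \<partial>mu)"
    unfolding solves_bvp_def by blast
  then show ?thesis
    unfolding gradient_tensor[OF test1_smooth[OF p] test1_smooth[OF q]] xy.pair_def .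
qed

lemma AE_fst_nodes: "AE z in mu. \<forall>i\<le>nx M. fst z \<noteq> xs M i"
  and AE_snd_nodes: "AE z in mu. \<forall>j\<le>ny M. snd z \<noteq> ys M j"
proof -
  have "AE z in mu. \<forall>i\<in>{..nx M}. fst z \<noteq> xs M i" by (subst AE_finite_all) (auto intro: AE_mu_fst)
  then show "AE z in mu. \<forall>i\<le>nx M. fst z \<noteq> xs M i" by eventually_elim auto
  have "AE z in mu. \<forall>j\<in>{..ny M}. snd z \<noteq> ys M j" by (subst AE_finite_all) (auto intro: AE_mu_snd)
  then show "AE z in mu. \<forall>j\<le>ny M. snd z \<noteq> ys M j" by eventually_elim auto
qed

abbreviation flux :: "nat \<Rightarrow> nat \<Rightarrow> real^2 \<Rightarrow> real \<times> real \<Rightarrow> real" where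
  "flux i j w z \<equiv> (A (i, j) *v weak_gradient unit_square u z) \<bullet> w"

lemma weak_gradient_components:
  "weak_gradient unit_square u z $ 1 = wd u 1 0 z" "weak_gradient unit_square u z $ 2 = wd u 0 1 z"
  by (simp_all add: weak_gradient_def)

lemma row_split:
  assumes j: "j < ny M" and z: "z \<in> unit_square" "\<forall>i\<le>nx M. fst z \<noteq> xs M i"
    and w: "snd z \<notin> {ys M j<..<ys M (Suc j)} \<Longrightarrow> w = 0"
  shows "(a z *v weak_gradient unit_square u z) \<bullet> w = (\<Sum>i<nx M. ix i (fst z) * flux i j w z)"
proof (cases "snd z \<in> {ys M j<..<ys M (Suc j)}")
  case True
  have "(\<Sum>i<nx M. ix i (fst z) * flux i j w z) =
      (\<Sum>i<nx M. ix i (fst z) * ((a z *v weak_gradient unit_square u z) \<bullet> w))"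
  proof (rule sum.cong[OF refl])
    fix i assume i: "i \<in> {..<nx M}"
    show "ix i (fst z) * flux i j w z = ix i (fst z) * ((a z *v weak_gradient unit_square u z) \<bullet> w)"
    proof (cases "fst z \<in> {xs M i<..<xs M (Suc i)}")
      case inside: True
      then have "a z = A (i, j)"
        using True i j by (intro coeff) (auto simp: cells_def interior_elem mem_Times_iff)
      then show ?thesis by simp
    qed simp
  qed
  also have "\<dots> = iv 0 1 (fst z) * ((a z *v weak_gradient unit_square u z) \<bullet> w)"
    using sum_ix[OF order_refl z(2)] unfolding sum_distrib_right[symmetric] ends01 by (simp only:)
  also have "iv 0 1 (fst z) = (1 :: real)" using xy.coord_range[OF z(1)] by simp
  finally show ?thesis by simp
next
  case False
  then show ?thesis using w by simp
qed

lemma column_split: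
  assumes i: "i < nx M" and z: "z \<in> unit_square" "\<forall>j\<le>ny M. snd z \<noteq> ys M j"
    and w: "fst z \<notin> {xs M i<..<xs M (Suc i)} \<Longrightarrow> w = 0"
  shows "(a z *v weak_gradient unit_square u z) \<bullet> w = (\<Sum>j<ny M. iy j (snd z) * flux i j w z)"
proof (cases "fst z \<in> {xs M i<..<xs M (Suc i)}")
  case True
  have "(\<Sum>j<ny M. iy j (snd z) * flux i j w z) =
      (\<Sum>j<ny M. iy j (snd z) * ((a z *v weak_gradient unit_square u z) \<bullet> w))"
  proof (rule sum.cong[OF refl])
    fix j assume j: "j \<in> {..<ny M}"
    show "iy j (snd z) * flux i j w z = iy j (snd z) * ((a z *v weak_gradient unit_square u z) \<bullet> w)"
    proof (cases "snd z \<in> {ys M j<..<ys M (Suc j)}")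
      case inside: True
      then have "a z = A (i, j)"
        using True i j by (intro coeff) (auto simp: cells_def interior_elem mem_Times_iff)
      then show ?thesis by simp
    qed simp
  qed
  also have "\<dots> = iv 0 1 (snd z) * ((a z *v weak_gradient unit_square u z) \<bullet> w)"
    using sum_iy[OF order_refl z(2)] unfolding sum_distrib_right[symmetric] ends01 by (simp only:)
  also have "iv 0 1 (snd z) = (1 :: real)" using xy.coord_range[OF z(1)] by simp
  finally show ?thesis by simp
next
  case False
  then show ?thesis using w by simp
qed

lemma AE_in_unit_square: "AE z in mu. z \<in> unit_square"
  by (rule AE_I2) simp

lemma zero_vec2: "vector [0, 0] = (0 :: real^2)"
  by (simp add: vec_eq_iff forall_2)

lemma row_equation:
  assumes j: "j < ny M"
  shows "row_equation fst snd (xs M) (nx M) (ys M j) (ys M (Suc j))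
    (\<lambda>i. A (i, j) $ 1 $ 1) (\<lambda>i. A (i, j) $ 1 $ 2) (\<lambda>i. A (i, j) $ 2 $ 1) (\<lambda>i. A (i, j) $ 2 $ 2)
    (wd u 1 0) (wd u 0 1) (wd u 2 0) (wd u 1 1) (wd u 0 2) f"
proof
  fix p q assume p: "p \<in> test1 0 1" and q: "q \<in> test1 (ys M j) (ys M (Suc j))"
  have yb: "0 \<le> ys M j" "ys M (Suc j) \<le> 1" using ys_bounds[of j] ys_bounds[of "Suc j"] j by auto
  have q01: "q \<in> test1 0 1" by (rule test1_mono[OF q yb])
  note pl = test1_in_limits[OF p] and ql = test1_in_limits[OF q01]
    and p'l = test1_in_limits[OF test1_deriv[OF p]] and q'l = test1_in_limits[OF test1_deriv[OF q01]]
  have il: "i < nx M \<Longrightarrow> ix i \<in> test1_limits 0 1" for i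
    using xs_bounds[of i] xs_bounds[of "Suc i"] by (intro xy.iv_limits) auto
  let ?q1 = "\<lambda>i z. A (i, j) $ 1 $ 1 * wd u 1 0 z + A (i, j) $ 1 $ 2 * wd u 0 1 z"
  let ?q2 = "\<lambda>i z. A (i, j) $ 2 $ 1 * wd u 1 0 z + A (i, j) $ 2 $ 2 * wd u 0 1 z"
  have qL: "?q1 i \<in> L2 unit_square" "?q2 i \<in> L2 unit_square" for i by (intro L2_comb wd_L2; simp)+
  have "AE z in mu. (a z *v weak_gradient unit_square u z) \<bullet> vector [deriv p (fst z) * q (snd z), p (fst z) * deriv q (snd z)] =
      (\<Sum>i<nx M. ?q1 i z * (deriv p (fst z) * ix i (fst z) * q (snd z)) + ?q2 i z * (p (fst z) * ix i (fst z) * deriv q (snd z)))"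
    using AE_fst_nodes AE_in_unit_square
  proof eventually_elim
    case (elim z)
    have "vector [deriv p (fst z) * q (snd z), p (fst z) * deriv q (snd z)] = (0 :: real^2)"
      if "snd z \<notin> {ys M j<..<ys M (Suc j)}"
      using test1_outside[OF q that] test1_outside[OF test1_deriv[OF q] that] by (simp add: zero_vec2)
    from row_split[OF j elim(2,1) this] show ?case
      by (simp add: mult_vec_inner2 weak_gradient_components algebra_simps)
  qed
  then have "xy.pair f p q = (\<integral>z. (\<Sum>i<nx M. ?q1 i z * (deriv p (fst z) * ix i (fst z) * q (snd z)) +
      ?q2 i z * (p (fst z) * ix i (fst z) * deriv q (snd z))) \<partial>mu)"
    unfolding PDE_tensor[OF p q01, symmetric] by (rule mu_integral_cong_AE)
  also have "\<dots> = (\<Sum>i<nx M. xy.pair (?q1 i) (\<lambda>x. deriv p x * ix i x) q + xy.pair (?q2 i) (\<lambda>x. p x * ix i x) (deriv q))"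
    unfolding xy.pair_def
    using xy.tensor_integrable[OF qL(1) test1_limits_mult[OF p'l il] ql]
      xy.tensor_integrable[OF qL(2) test1_limits_mult[OF pl il] q'l]
    by simp
  finally show "(\<Sum>i<nx M. xy.pair (?q1 i) (\<lambda>x. deriv p x * ix i x) q + xy.pair (?q2 i) (\<lambda>x. p x * ix i x) (deriv q)) =
      xy.pair f p q" ..
next
  show "xy.tensor_deriv 0 1 0 1 (wd u 1 0) (wd u 2 0)" "xy.tensor_deriv 0 1 0 1 (wd u 0 1) (wd u 1 1)"
    "yx.tensor_deriv 0 1 0 1 (wd u 1 0) (wd u 1 1)" "yx.tensor_deriv 0 1 0 1 (wd u 0 1) (wd u 0 2)"
    using wd_x[of 1 0] wd_x[of 0 1] wd_y[of 1 0] wd_y[of 0 1] by (simp_all add: numeral_2_eq_2)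
qed (use j xs_less xs_bounds xs_mono ys_less ys_bounds f in \<open>auto intro: wd_L2\<close>)

text \<open>Exchanging the coordinates exchanges the indices of the matrix as well, hence its
  entries in the order 22, 21, 12, 11.\<close>

lemma column_equation:
  assumes i: "i < nx M"
  shows "row_equation snd fst (ys M) (ny M) (xs M i) (xs M (Suc i))
    (\<lambda>j. A (i, j) $ 2 $ 2) (\<lambda>j. A (i, j) $ 2 $ 1) (\<lambda>j. A (i, j) $ 1 $ 2) (\<lambda>j. A (i, j) $ 1 $ 1)
    (wd u 0 1) (wd u 1 0) (wd u 0 2) (wd u 1 1) (wd u 2 0) f"
proof
  fix p q assume p: "p \<in> test1 0 1" and q: "q \<in> test1 (xs M i) (xs M (Suc i))"
  have xb: "0 \<le> xs M i" "xs M (Suc i) \<le> 1" using xs_bounds[of i] xs_bounds[of "Suc i"] i by auto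
  have q01: "q \<in> test1 0 1" by (rule test1_mono[OF q xb])
  note pl = test1_in_limits[OF p] and ql = test1_in_limits[OF q01]
    and p'l = test1_in_limits[OF test1_deriv[OF p]] and q'l = test1_in_limits[OF test1_deriv[OF q01]]
  have il: "j < ny M \<Longrightarrow> iy j \<in> test1_limits 0 1" for j
    using ys_bounds[of j] ys_bounds[of "Suc j"] by (intro xy.iv_limits) auto
  let ?q1 = "\<lambda>j z. A (i, j) $ 2 $ 2 * wd u 0 1 z + A (i, j) $ 2 $ 1 * wd u 1 0 z"
  let ?q2 = "\<lambda>j z. A (i, j) $ 1 $ 2 * wd u 0 1 z + A (i, j) $ 1 $ 1 * wd u 1 0 z"
  have qL: "?q1 j \<in> L2 unit_square" "?q2 j \<in> L2 unit_square" for j by (intro L2_comb wd_L2; simp)+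
  have "AE z in mu. (a z *v weak_gradient unit_square u z) \<bullet> vector [deriv q (fst z) * p (snd z), q (fst z) * deriv p (snd z)] =
      (\<Sum>j<ny M. ?q1 j z * (deriv p (snd z) * iy j (snd z) * q (fst z)) + ?q2 j z * (p (snd z) * iy j (snd z) * deriv q (fst z)))"
    using AE_snd_nodes AE_in_unit_square
  proof eventually_elim
    case (elim z)
    have "vector [deriv q (fst z) * p (snd z), q (fst z) * deriv p (snd z)] = (0 :: real^2)"
      if "fst z \<notin> {xs M i<..<xs M (Suc i)}"
      using test1_outside[OF q that] test1_outside[OF test1_deriv[OF q] that] by (simp add: zero_vec2)
    from column_split[OF i elim(2,1) this] show ?case
      by (simp add: mult_vec_inner2 weak_gradient_components algebra_simps)
  qed
  then have "xy.pair f q p = (\<integral>z. (\<Sum>j<ny M. ?q1 j z * (deriv p (snd z) * iy j (snd z) * q (fst z)) +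
      ?q2 j z * (p (snd z) * iy j (snd z) * deriv q (fst z))) \<partial>mu)"
    unfolding PDE_tensor[OF q01 p, symmetric] by (rule mu_integral_cong_AE)
  also have "\<dots> = (\<Sum>j<ny M. yx.pair (?q1 j) (\<lambda>x. deriv p x * iy j x) q + yx.pair (?q2 j) (\<lambda>x. p x * iy j x) (deriv q))"
    unfolding yx.pair_def
    using yx.tensor_integrable[OF qL(1) test1_limits_mult[OF p'l il] ql]
      yx.tensor_integrable[OF qL(2) test1_limits_mult[OF pl il] q'l]
    by simp
  finally show "(\<Sum>j<ny M. yx.pair (?q1 j) (\<lambda>x. deriv p x * iy j x) q + yx.pair (?q2 j) (\<lambda>x. p x * iy j x) (deriv q)) =
      yx.pair f p q" unfolding pair_swap ..
next
  show "yx.tensor_deriv 0 1 0 1 (wd u 0 1) (wd u 0 2)" "yx.tensor_deriv 0 1 0 1 (wd u 1 0) (wd u 1 1)"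
    "xy.tensor_deriv 0 1 0 1 (wd u 0 1) (wd u 1 1)" "xy.tensor_deriv 0 1 0 1 (wd u 1 0) (wd u 2 0)"
    using wd_x[of 1 0] wd_x[of 0 1] wd_y[of 1 0] wd_y[of 0 1] by (simp_all add: numeral_2_eq_2)
qed (use i xs_less xs_bounds ys_mono ys_less ys_bounds f in \<open>auto intro: wd_L2\<close>)

end

text \<open>Moments about the two ends of an interval of length x, with end values p and q of the
  edge function, rewritten with the integral v and the moment k about the midpoint.\<close>

lemma endpoint_moments:
  "x \<noteq> 0 \<Longrightarrow> q * ((k + x / 2 * v) / x) + p * ((x / 2 * v - k) / x) = v * ((p + q) / 2) + (q - p) / x * k"
  for x q k v p :: real
  by (simp add: field_simps)

lemma midpoint_difference:
  "x \<noteq> 0 \<Longrightarrow> ((p + x / 2 * g) / d - (p - x / 2 * g) / d) / x = g / d" for x p g d :: real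
  by (simp add: diff_divide_distrib[symmetric])

lemma midpoint_sum:
  "(p + k - x) / d + (p + k + x) / d - (p + l - y) / d - (p + l + y) / d = 2 * (k - l) / d"
  for p k x d l y :: real
  by (simp add: add_divide_distrib[symmetric] diff_divide_distrib[symmetric])

context rect_mesh
begin

lemma diameter_elem:
  assumes "i < nx M" "j < ny M" shows "diameter (elem M (i, j)) = sqrt ((X i)\<^sup>2 + (Y j)\<^sup>2)"
proof -
  have "elem M (i, j) = cbox (xs M i, ys M j) (xs M (Suc i), ys M (Suc j))"
    by (simp add: elem_def cbox_Pair_eq)
  moreover have "(xs M i, ys M j) \<in> cbox (xs M i, ys M j) (xs M (Suc i), ys M (Suc j))"
    using cell_bounds[OF assms] by (simp add: cbox_Pair_eq)
  ultimately have "diameter (elem M (i, j)) = dist (xs M i, ys M j) (xs M (Suc i), ys M (Suc j))"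
    using diameter_cbox[of "(xs M i, ys M j)" "(xs M (Suc i), ys M (Suc j))"] cell_bounds[OF assms]
    by (auto simp: Basis_prod_def)
  then show ?thesis by (simp add: dist_Pair_Pair dist_real_def power2_commute)
qed

lemma finite_cells: "finite (cells M)" and cells_nonempty: "cells M \<noteq> {}"
  using nx_pos ny_pos by (auto simp: cells_def lessThan_empty_iff)

lemma mesh_size_ge:
  assumes "i < nx M" "j < ny M" shows "X i \<le> mesh_size M" "Y j \<le> mesh_size M"
proof -
  have "diameter (elem M (i, j)) \<le> mesh_size M"
    unfolding mesh_size_def using finite_cells assms by (intro Max_ge) (auto simp: cells_def)
  then have "sqrt ((X i)\<^sup>2 + (Y j)\<^sup>2) \<le> mesh_size M" by (simp add: diameter_elem[OF assms])
  moreover have "X i \<le> sqrt ((X i)\<^sup>2 + (Y j)\<^sup>2)" "Y j \<le> sqrt ((X i)\<^sup>2 + (Y j)\<^sup>2)"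
    using cell_bounds[OF assms] by (auto intro!: real_le_rsqrt)
  ultimately show "X i \<le> mesh_size M" "Y j \<le> mesh_size M" by linarith+
qed

lemma mesh_size_attained:
  obtains i j where "i < nx M" "j < ny M" "mesh_size M = sqrt ((X i)\<^sup>2 + (Y j)\<^sup>2)"
proof -
  have "mesh_size M \<in> (\<lambda>c. diameter (elem M c)) ` cells M"
    unfolding mesh_size_def using finite_cells cells_nonempty by (intro Max_in) auto
  then show ?thesis using that diameter_elem by (auto simp: cells_def)
qed

lemma mesh_size_pos: "0 < mesh_size M"
  using mesh_size_ge(1)[OF nx_pos ny_pos] xs_less[OF nx_pos] by linarith

lemma sum_cells_rows: "(\<Sum>(i, j)\<in>cells M. F i j) = (\<Sum>j<ny M. \<Sum>i<nx M. F i j)"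
  by (simp add: cells_def sum.cartesian_product[symmetric] sum.swap[of _ "{..<nx M}"])

lemma sum_cells_columns: "(\<Sum>(i, j)\<in>cells M. F i j) = (\<Sum>i<nx M. \<Sum>j<ny M. F i j)"
  by (simp add: cells_def sum.cartesian_product[symmetric])

lemma sum_cells_cong: "(\<And>i j. i < nx M \<Longrightarrow> j < ny M \<Longrightarrow> F i j = G i j) \<Longrightarrow>
    (\<Sum>(i, j)\<in>cells M. F i j) = (\<Sum>(i, j)\<in>cells M. G i j)"
  by (intro sum.cong) (auto simp: cells_def)

lemma gx_diff: "gx (\<lambda>e. b e - b' e) i j = gx b i j - gx b' i j"
  and gy_diff: "gy (\<lambda>e. b e - b' e) i j = gy b i j - gy b' i j"
  and beta_diff: "beta (\<lambda>e. b e - b' e) i j = beta b i j - beta b' i j"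
  by (simp_all add: gx_def gy_def beta_def diff_divide_distrib)

lemma pair_moment_expand:
  assumes "H \<in> L2 unit_square" "r \<in> test1_limits c d"
  shows "xy.pair H (\<lambda>x. (x - xs M i) * ix i x) r = xy.pair H (mx i) r + X i / 2 * xy.pair H (ix i) r"
    and "xy.pair H (\<lambda>x. (x - xs M (Suc i)) * ix i x) r = xy.pair H (mx i) r - X i / 2 * xy.pair H (ix i) r"
    and "xy.pair H (\<lambda>x. (xs M (Suc i) - x) * ix i x) r = X i / 2 * xy.pair H (ix i) r - xy.pair H (mx i) r"
proof -
  note lin = xy.pair_linear_first[OF assms(1) mx_limits ix_limits assms(2)]
  have "xy.pair H (\<lambda>x. (x - xs M i) * ix i x) r = xy.pair H (\<lambda>x. 1 * mx i x + X i / 2 * ix i x) r"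
    by (rule xy.pair_cong) (simp add: field_simps)
  then show "xy.pair H (\<lambda>x. (x - xs M i) * ix i x) r = xy.pair H (mx i) r + X i / 2 * xy.pair H (ix i) r"
    unfolding lin by simp
  have "xy.pair H (\<lambda>x. (x - xs M (Suc i)) * ix i x) r = xy.pair H (\<lambda>x. 1 * mx i x + (- (X i / 2)) * ix i x) r"
    by (rule xy.pair_cong) (simp add: field_simps)
  then show "xy.pair H (\<lambda>x. (x - xs M (Suc i)) * ix i x) r = xy.pair H (mx i) r - X i / 2 * xy.pair H (ix i) r"
    unfolding lin by simp
  have "xy.pair H (\<lambda>x. (xs M (Suc i) - x) * ix i x) r = xy.pair H (\<lambda>x. (-1) * mx i x + X i / 2 * ix i x) r"
    by (rule xy.pair_cong) (simp add: field_simps)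
  then show "xy.pair H (\<lambda>x. (xs M (Suc i) - x) * ix i x) r = X i / 2 * xy.pair H (ix i) r - xy.pair H (mx i) r"
    unfolding lin by simp
qed

lemma pair_moment_expand_y:
  assumes "H \<in> L2 unit_square" "r \<in> test1_limits c d"
  shows "yx.pair H (\<lambda>y. (y - ys M j) * iy j y) r = yx.pair H (my j) r + Y j / 2 * yx.pair H (iy j) r"
    and "yx.pair H (\<lambda>y. (y - ys M (Suc j)) * iy j y) r = yx.pair H (my j) r - Y j / 2 * yx.pair H (iy j) r"
    and "yx.pair H (\<lambda>y. (ys M (Suc j) - y) * iy j y) r = Y j / 2 * yx.pair H (iy j) r - yx.pair H (my j) r"
proof -
  note lin = yx.pair_linear_first[OF assms(1) my_limits iy_limits assms(2)]
  have "yx.pair H (\<lambda>y. (y - ys M j) * iy j y) r = yx.pair H (\<lambda>y. 1 * my j y + Y j / 2 * iy j y) r"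
    by (rule yx.pair_cong) (simp add: field_simps)
  then show "yx.pair H (\<lambda>y. (y - ys M j) * iy j y) r = yx.pair H (my j) r + Y j / 2 * yx.pair H (iy j) r"
    unfolding lin by simp
  have "yx.pair H (\<lambda>y. (y - ys M (Suc j)) * iy j y) r = yx.pair H (\<lambda>y. 1 * my j y + (- (Y j / 2)) * iy j y) r"
    by (rule yx.pair_cong) (simp add: field_simps)
  then show "yx.pair H (\<lambda>y. (y - ys M (Suc j)) * iy j y) r = yx.pair H (my j) r - Y j / 2 * yx.pair H (iy j) r"
    unfolding lin by simp
  have "yx.pair H (\<lambda>y. (ys M (Suc j) - y) * iy j y) r = yx.pair H (\<lambda>y. (-1) * my j y + Y j / 2 * iy j y) r"
    by (rule yx.pair_cong) (simp add: field_simps)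
  then show "yx.pair H (\<lambda>y. (ys M (Suc j) - y) * iy j y) r = Y j / 2 * yx.pair H (iy j) r - yx.pair H (my j) r"
    unfolding lin by simp
qed

end

context wg_problem
begin

text \<open>\<open>F1\<close> and \<open>F2\<close> are the two parts of the divergence of the flux.
  The letter I stands for their cell integrals, K for first moments in the direction of
  differentiation, which will cancel, and J for moments in the other direction, which will remain; G
  are the integrals of the gradient of \<open>u\<close>.\<close>

definition "I1 i j = xy.pair (F1 i j) (ix i) (iy j)"
definition "I2 i j = xy.pair (F2 i j) (ix i) (iy j)"
definition "K1 i j = xy.pair (F1 i j) (mx i) (iy j)"
definition "K2 i j = xy.pair (F2 i j) (ix i) (my j)"
definition "J1 i j = xy.pair (F1 i j) (ix i) (my j)"
definition "J2 i j = xy.pair (F2 i j) (mx i) (iy j)"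
definition "G1 i j = xy.pair (wd u 1 0) (ix i) (iy j)"
definition "G2 i j = xy.pair (wd u 0 1) (ix i) (iy j)"

text \<open>Summation by parts moves the difference from the edge values to the mean fluxes, whose
  jumps \<open>flux_jump\<close> turns into integrals over the adjacent cells. In effect the
  equation is tested with a function piecewise linear in x times the indicator of the row.\<close>

lemma row_flux_identity:
  assumes j: "j < ny M" and b: "b (VEdge 0 j) = 0" "b (VEdge (nx M) j) = 0"
  shows "(\<Sum>i<nx M. gx b i j * (A (i, j) $ 1 $ 1 * G1 i j + A (i, j) $ 1 $ 2 * G2 i j)) =
    - (\<Sum>i<nx M. I1 i j * ((b (VEdge i j) + b (VEdge (Suc i) j)) / 2) + gx b i j * K1 i j)"
proof -
  interpret r: row_equation fst snd "xs M" "nx M" "ys M j" "ys M (Suc j)"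
    "\<lambda>i. A (i, j) $ 1 $ 1" "\<lambda>i. A (i, j) $ 1 $ 2" "\<lambda>i. A (i, j) $ 2 $ 1" "\<lambda>i. A (i, j) $ 2 $ 2"
    "wd u 1 0" "wd u 0 1" "wd u 2 0" "wd u 1 1" "wd u 0 2" f by (rule row_equation[OF j])
  let ?Q = "\<lambda>i. (A (i, j) $ 1 $ 1 * G1 i j + A (i, j) $ 1 $ 2 * G2 i j) / X i"
  let ?L = "\<lambda>i. xy.pair (F1 i j) (\<lambda>x. (x - xs M i) * ix i x) (iy j) / X i"
  let ?R = "\<lambda>i. xy.pair (F1 i j) (\<lambda>x. (xs M (Suc i) - x) * ix i x) (iy j) / X i"
  have Q: "xy.pair (\<lambda>z. A (i, j) $ 1 $ 1 * wd u 1 0 z + A (i, j) $ 1 $ 2 * wd u 0 1 z) (ix i) (iy j) / X i = ?Q i" for i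
    using xy.pair_linear_fun[OF wd_L2 wd_L2 ix_limits iy_limits, of 1 0 0 1 "A (i, j) $ 1 $ 1" "A (i, j) $ 1 $ 2" i j]
    by (simp add: G1_def G2_def)
  have jump: "?Q i - ?Q (Suc i) = - (?L i + ?R (Suc i))" if "Suc i < nx M" for i
    using r.flux_jump[OF that] unfolding Q .
  have "(\<Sum>i<nx M. (b (VEdge (Suc i) j) - b (VEdge i j)) * ?Q i) =
      - (\<Sum>i<nx M. b (VEdge (Suc i) j) * ?L i + b (VEdge i j) * ?R i)"
    using sum_by_parts_zero_ends[of "\<lambda>i. b (VEdge i j)" "nx M" ?Q ?L ?R] b jump by simp
  moreover have "b (VEdge (Suc i) j) * ?L i + b (VEdge i j) * ?R i =
      I1 i j * ((b (VEdge i j) + b (VEdge (Suc i) j)) / 2) + gx b i j * K1 i j" if "i < nx M" for i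
  proof -
    have "X i \<noteq> 0" using xs_less[OF that] by simp
    then show ?thesis
      unfolding pair_moment_expand[OF F_L2(1) iy_limits] I1_def[symmetric] K1_def[symmetric] gx_def
      by (rule endpoint_moments)
  qed
  ultimately show ?thesis by (simp add: gx_def)
qed

lemma column_flux_identity:
  assumes i: "i < nx M" and b: "b (HEdge i 0) = 0" "b (HEdge i (ny M)) = 0"
  shows "(\<Sum>j<ny M. gy b i j * (A (i, j) $ 2 $ 1 * G1 i j + A (i, j) $ 2 $ 2 * G2 i j)) =
    - (\<Sum>j<ny M. I2 i j * ((b (HEdge i j) + b (HEdge i (Suc j))) / 2) + gy b i j * K2 i j)"
proof -
  interpret r: row_equation snd fst "ys M" "ny M" "xs M i" "xs M (Suc i)"
    "\<lambda>j. A (i, j) $ 2 $ 2" "\<lambda>j. A (i, j) $ 2 $ 1" "\<lambda>j. A (i, j) $ 1 $ 2" "\<lambda>j. A (i, j) $ 1 $ 1"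
    "wd u 0 1" "wd u 1 0" "wd u 0 2" "wd u 1 1" "wd u 2 0" f by (rule column_equation[OF i])
  let ?Q = "\<lambda>j. (A (i, j) $ 2 $ 1 * G1 i j + A (i, j) $ 2 $ 2 * G2 i j) / Y j"
  let ?F = "\<lambda>j z. A (i, j) $ 2 $ 2 * wd u 0 2 z + A (i, j) $ 2 $ 1 * wd u 1 1 z"
  let ?L = "\<lambda>j. yx.pair (?F j) (\<lambda>y. (y - ys M j) * iy j y) (ix i) / Y j"
  let ?R = "\<lambda>j. yx.pair (?F j) (\<lambda>y. (ys M (Suc j) - y) * iy j y) (ix i) / Y j"
  have F: "?F j = F2 i j" for j by (simp add: fun_eq_iff)
  have Q: "yx.pair (\<lambda>z. A (i, j) $ 2 $ 2 * wd u 0 1 z + A (i, j) $ 2 $ 1 * wd u 1 0 z) (iy j) (ix i) / Y j = ?Q j" for j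
    using yx.pair_linear_fun[OF wd_L2 wd_L2 iy_limits ix_limits, of 0 1 1 0 "A (i, j) $ 2 $ 2" "A (i, j) $ 2 $ 1" j i]
    by (simp add: G1_def G2_def pair_swap add.commute)
  have jump: "?Q j - ?Q (Suc j) = - (?L j + ?R (Suc j))" if "Suc j < ny M" for j
    using r.flux_jump[OF that] unfolding Q .
  have "(\<Sum>j<ny M. (b (HEdge i (Suc j)) - b (HEdge i j)) * ?Q j) =
      - (\<Sum>j<ny M. b (HEdge i (Suc j)) * ?L j + b (HEdge i j) * ?R j)"
    using sum_by_parts_zero_ends[of "\<lambda>j. b (HEdge i j)" "ny M" ?Q ?L ?R] b jump by simp
  moreover have "b (HEdge i (Suc j)) * ?L j + b (HEdge i j) * ?R j =
      I2 i j * ((b (HEdge i j) + b (HEdge i (Suc j))) / 2) + gy b i j * K2 i j" if "j < ny M" for j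
  proof -
    have "Y j \<noteq> 0" using ys_less[OF that] by simp
    then show ?thesis
      unfolding F pair_moment_expand_y[OF F_L2(2) ix_limits] unfolding pair_swap I2_def[symmetric] K2_def[symmetric] gy_def
      by (rule endpoint_moments)
  qed
  ultimately show ?thesis by (simp add: gy_def)
qed

text \<open>On a cell the source is - (F1 + F2) by \<open>cell_equation\<close>, and the extension
  is affine, so only integrals and centred first moments of \<open>F1\<close> and \<open>F2\<close>
  occur.\<close>

lemma source_cell:
  assumes ij: "i < nx M" "j < ny M"
  shows "(\<integral>z. f z * ext b (i, j) z \<partial>lebesgue_on (elem M (i, j))) =
    - (ext0 b i j * (I1 i j + I2 i j) + gx b i j * (K1 i j + J2 i j) + gy b i j * (J1 i j + K2 i j))"
proof -
  interpret r: row_equation fst snd "xs M" "nx M" "ys M j" "ys M (Suc j)"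
    "\<lambda>i. A (i, j) $ 1 $ 1" "\<lambda>i. A (i, j) $ 1 $ 2" "\<lambda>i. A (i, j) $ 2 $ 1" "\<lambda>i. A (i, j) $ 2 $ 2"
    "wd u 1 0" "wd u 0 1" "wd u 2 0" "wd u 1 1" "wd u 0 2" f by (rule row_equation[OF ij(2)])
  note ce = r.cell_equation[OF ij(1)]
  let ?xm = "(xs M i + xs M (Suc i)) / 2" and ?ym = "(ys M j + ys M (Suc j)) / 2"
  have int: "integrable mu (\<lambda>z. f z * (ix i (fst z) * iy j (snd z)))"
    "integrable mu (\<lambda>z. f z * (mx i (fst z) * iy j (snd z)))"
    "integrable mu (\<lambda>z. f z * (ix i (fst z) * my j (snd z)))"
    by (rule xy.tensor_integrable[OF f ix_limits iy_limits] xy.tensor_integrable[OF f mx_limits iy_limits]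
        xy.tensor_integrable[OF f ix_limits my_limits])+
  have "(\<integral>z. f z * ext b (i, j) z \<partial>lebesgue_on (elem M (i, j))) =
      (\<integral>z. ext0 b i j * (f z * (ix i (fst z) * iy j (snd z))) + gx b i j * (f z * (mx i (fst z) * iy j (snd z))) +
        gy b i j * (f z * (ix i (fst z) * my j (snd z))) \<partial>mu)"
    unfolding elem_integral[OF ij] by (intro Bochner_Integration.integral_cong) (auto simp: ext_def algebra_simps)
  also have "\<dots> = ext0 b i j * xy.pair f (ix i) (iy j) + gx b i j * xy.pair f (mx i) (iy j) + gy b i j * xy.pair f (ix i) (my j)"
    unfolding xy.pair_def using int by simp
  also have "xy.pair f (ix i) (iy j) = - (I1 i j + I2 i j)"
    using ce[OF ix_limits iy_limits] by (simp add: I1_def I2_def)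
  also have "xy.pair f (mx i) (iy j) = - (K1 i j + J2 i j)"
    using ce[OF mx_limits iy_limits] by (simp add: K1_def J2_def)
  also have "xy.pair f (ix i) (my j) = - (J1 i j + K2 i j)"
    using ce[OF ix_limits my_limits] by (simp add: J1_def K2_def)
  finally show ?thesis by (simp add: algebra_simps)
qed

definition U :: "edge \<Rightarrow> real" where
  "U e = Q_b M e (trace_on unit_square (ends M e) u)"

lemma is_trace_side: "S \<in> sides \<Longrightarrow> is_trace unit_square S u g"
  using bvp by (simp add: solves_bvp_def)

text \<open>All four values come from \<open>edge_average\<close> on this one cell, with the moment
  of the derivative recentred at the midpoint: opposite edges then differ only in the sign of the
  last term.\<close>

lemma U_values:
  assumes ij: "i < nx M" "j < ny M"
  defines "P \<equiv> xy.pair u (ix i) (iy j)"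
    and "mX \<equiv> xy.pair (wd u 1 0) (mx i) (iy j)" and "mY \<equiv> xy.pair (wd u 0 1) (ix i) (my j)"
  shows "U (VEdge i j) = (P + mX - X i / 2 * G1 i j) / (X i * Y j)"
    "U (VEdge (Suc i) j) = (P + mX + X i / 2 * G1 i j) / (X i * Y j)"
    "U (HEdge i j) = (P + mY - Y j / 2 * G2 i j) / (X i * Y j)"
    "U (HEdge i (Suc j)) = (P + mY + Y j / 2 * G2 i j) / (X i * Y j)"
proof -
  have S: "is_trace unit_square ((0,0),(1,0)) u g" by (rule is_trace_side) (simp add: sides_def)
  note V = trace_average_VEdge[OF S u _ ij] and Hh = trace_average_HEdge[OF S u _ ij]
  have w: "wd u 1 0 \<in> L2 unit_square" "wd u 0 1 \<in> L2 unit_square" by (intro wd_L2; simp)+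
  show "U (VEdge i j) = (P + mX - X i / 2 * G1 i j) / (X i * Y j)"
    "U (VEdge (Suc i) j) = (P + mX + X i / 2 * G1 i j) / (X i * Y j)"
    using V[of i] V[of "Suc i"] pair_moment_expand[OF w(1) iy_limits, of i j]
    by (simp_all add: U_def xy.edge_average_def P_def mX_def G1_def)
  show "U (HEdge i j) = (P + mY - Y j / 2 * G2 i j) / (X i * Y j)"
    "U (HEdge i (Suc j)) = (P + mY + Y j / 2 * G2 i j) / (X i * Y j)"
    using Hh[of j] Hh[of "Suc j"] pair_moment_expand_y[OF w(2) ix_limits, of j i]
    by (simp_all add: U_def yx.edge_average_def P_def mY_def G2_def pair_swap mult.commute)
qed

text \<open>Commutation of the weak gradient with projection: the weak gradient of the edge averages
  is the cell mean of the gradient.\<close>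

lemma gx_U:
  assumes ij: "i < nx M" "j < ny M" shows "gx U i j = G1 i j / (X i * Y j)"
  unfolding gx_def U_values[OF ij] by (rule midpoint_difference) (use cell_bounds[OF ij] in simp)

lemma gy_U:
  assumes ij: "i < nx M" "j < ny M" shows "gy U i j = G2 i j / (X i * Y j)"
  unfolding gy_def U_values[OF ij] by (rule midpoint_difference) (use cell_bounds[OF ij] in simp)

definition "dx2 i j = xy.pair (wd u 2 0) (px i) (iy j)"
definition "dy2 i j = xy.pair (wd u 0 2) (ix i) (py j)"

text \<open>The cell integral of \<open>u\<close> cancels between the two pairs of edges. What is
  left are centred moments of first derivatives, and \<open>pair_first_moment\<close> turns them
  into second derivatives.\<close>

lemma beta_U:
  assumes ij: "i < nx M" "j < ny M"
  shows "beta U i j = (dx2 i j - dy2 i j) / (X i * Y j)"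
proof -
  note cb = cell_bounds[OF ij]
  have "xy.tensor_deriv 0 1 (ys M j) (ys M (Suc j)) (wd u 1 0) (wd u 2 0)"
  proof (rule xy.tensor_deriv_mono)
    show "xy.tensor_deriv 0 1 0 1 (wd u 1 0) (wd u 2 0)" using wd_x[of 1 0] by (simp add: numeral_2_eq_2)
  qed (use cb in auto)
  from xy.pair_first_moment[OF _ _ this cb(1-3) iy_limits]
  have "xy.pair (wd u 1 0) (mx i) (iy j) = 1 / 2 * dx2 i j"
    unfolding dx2_def by (simp add: wd_L2)
  moreover have "yx.tensor_deriv 0 1 (xs M i) (xs M (Suc i)) (wd u 0 1) (wd u 0 2)"
  proof (rule yx.tensor_deriv_mono)
    show "yx.tensor_deriv 0 1 0 1 (wd u 0 1) (wd u 0 2)" using wd_y[of 0 1] by (simp add: numeral_2_eq_2)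
  qed (use cb in auto)
  from yx.pair_first_moment[OF _ _ this cb(4-6) ix_limits]
  have "xy.pair (wd u 0 1) (ix i) (my j) = 1 / 2 * dy2 i j"
    unfolding dy2_def pair_swap by (simp add: wd_L2)
  ultimately show ?thesis unfolding beta_def U_values[OF ij] midpoint_sum by simp
qed

end

section \<open>The scheme reduced to edge values, and the error equation\<close>

locale wg_approximation = wg_problem +
  fixes \<rho> :: real and u_h :: wfun
  assumes rho: "\<rho> > 0" and wg: "is_wg_solution \<rho> M a f g u_h"
begin

abbreviation h :: real where "h \<equiv> mesh_size M"

definition err :: "edge \<Rightarrow> real" where "err e = U e - snd u_h e"

lemma err_eq: "edge_error M u u_h = err"
  by (simp add: fun_eq_iff edge_error_def err_def U_def)

lemma err_boundary: "e \<in> bdry_edges M \<Longrightarrow> err e = 0"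
  using wg trace_average_boundary[OF is_trace_side u, of e] by (simp add: err_def U_def is_wg_solution_def)

lemma coefficient_cell:
  assumes ij: "i < nx M" "j < ny M"
  shows "(\<integral>z. (a z *v v) \<bullet> w \<partial>lebesgue_on (elem M (i, j))) = X i * Y j * ((A (i, j) *v v) \<bullet> w)"
proof -
  have "(\<integral>z. (a z *v v) \<bullet> w \<partial>lebesgue_on (elem M (i, j))) =
      (\<integral>z. (A (i, j) *v v) \<bullet> w * (ix i (fst z) * iy j (snd z)) \<partial>mu)"
    unfolding elem_integral[OF ij]
  proof (rule Bochner_Integration.integral_cong[OF refl])
    fix z
    show "(a z *v v) \<bullet> w * (ix i (fst z) * iy j (snd z)) = (A (i, j) *v v) \<bullet> w * (ix i (fst z) * iy j (snd z))"
    proof (cases "z \<in> interior (elem M (i, j))")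
      case True
      then have "a z = A (i, j)" using ij by (intro coeff) (auto simp: cells_def)
      then show ?thesis by simp
    next
      case False
      then have 0: "ix i (fst z) * iy j (snd z) = 0" by (auto simp: interior_elem mem_Times_iff indicator_def)
      show ?thesis unfolding 0 by simp
    qed
  qed
  also have "\<dots> = (A (i, j) *v v) \<bullet> w * (X i * Y j)"
    using xy.integral_rect[of "xs M i" "xs M (Suc i)" "ys M j" "ys M (Suc j)"] cell_bounds[OF ij] by simp
  finally show ?thesis by simp
qed

text \<open>One cell's share of the bilinear form that remains on edge functions once the interior
  unknowns are eliminated.\<close>

definition form :: "(edge \<Rightarrow> real) \<Rightarrow> (edge \<Rightarrow> real) \<Rightarrow> nat \<Rightarrow> nat \<Rightarrow> real" where
  "form v b i j = X i * Y j * ((A (i, j) *v vector [gx v i j, gy v i j]) \<bullet> vector [gx b i j, gy b i j]) +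
     \<rho> / h * kappa i j * beta v i j * beta b i j"

text \<open>The scheme is tested with the pair \<open>(ext b, b)\<close>; by
  \<open>stabilizer_cell\<close> the interior part of \<open>u_h\<close> then disappears.\<close>

lemma discrete_equation:
  assumes b: "\<forall>e\<in>bdry_edges M. b e = 0"
  shows "(\<Sum>(i, j)\<in>cells M. form (snd u_h) b i j) =
    - (\<Sum>(i, j)\<in>cells M. ext0 b i j * (I1 i j + I2 i j) + gx b i j * (K1 i j + J2 i j) + gy b i j * (J1 i j + K2 i j))"
proof -
  have "(ext b, b) \<in> V_h0 M" using b ext_in_P1 by (simp add: V_h0_def V_h_def)
  with wg have "(\<Sum>c\<in>cells M. \<integral>z. (a z *v wgrad M u_h c) \<bullet> wgrad M (ext b, b) c \<partial>lebesgue_on (elem M c)) +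
      stabilizer \<rho> M u_h (ext b, b) = (\<Sum>c\<in>cells M. \<integral>z. f z * fst (ext b, b) c z \<partial>lebesgue_on (elem M c))"
    unfolding is_wg_solution_def by blast
  also have "stabilizer \<rho> M u_h (ext b, b) = (\<Sum>(i, j)\<in>cells M. \<rho> / h * kappa i j * beta (snd u_h) i j * beta b i j)"
  proof -
    have "(\<Sum>c\<in>cells M. \<Sum>(e, n)\<in>elem_edges c. seg_integral (ends M e)
        (\<lambda>_. (snd u_h e - Q_b M e (fst u_h c)) * (b e - Q_b M e (ext b c)))) =
      (\<Sum>(i, j)\<in>cells M. kappa i j * beta (snd u_h) i j * beta b i j)"
    proof (rule sum.cong[OF refl])
      fix c assume c: "c \<in> cells M"
      obtain i j where ij: "c = (i, j)" by (cases c)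
      have "fst u_h c \<in> P1" using wg c by (simp add: is_wg_solution_def V_h_def)
      then show "(\<Sum>(e, n)\<in>elem_edges c. seg_integral (ends M e)
          (\<lambda>_. (snd u_h e - Q_b M e (fst u_h c)) * (b e - Q_b M e (ext b c)))) =
        (case c of (i, j) \<Rightarrow> kappa i j * beta (snd u_h) i j * beta b i j)"
        using stabilizer_cell[of i j] c unfolding ij by (simp add: cells_def)
    qed
    then show ?thesis
      unfolding stabilizer_def
      by (simp add: sum_distrib_left divide_inverse mult.assoc split_def)
  qed
  also have "(\<Sum>c\<in>cells M. \<integral>z. (a z *v wgrad M u_h c) \<bullet> wgrad M (ext b, b) c \<partial>lebesgue_on (elem M c)) =
      (\<Sum>(i, j)\<in>cells M. X i * Y j * ((A (i, j) *v vector [gx (snd u_h) i j, gy (snd u_h) i j]) \<bullet> vector [gx b i j, gy b i j]))"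
    by (rule sum.cong) (auto simp: cells_def coefficient_cell wgrad_cell)
  also have "(\<Sum>c\<in>cells M. \<integral>z. f z * fst (ext b, b) c z \<partial>lebesgue_on (elem M c)) =
      (\<Sum>(i, j)\<in>cells M. - (ext0 b i j * (I1 i j + I2 i j) + gx b i j * (K1 i j + J2 i j) + gy b i j * (J1 i j + K2 i j)))"
    by (rule sum.cong) (auto simp: cells_def source_cell)
  finally show ?thesis by (simp add: form_def sum.distrib[symmetric] sum_negf[symmetric] split_def)
qed

text \<open>The first component of the flux is summed by parts along rows, the second along columns;
  this is where \<open>b\<close> has to vanish on the boundary.\<close>

lemma interpolant_equation:
  assumes b: "\<forall>e\<in>bdry_edges M. b e = 0"
  shows "(\<Sum>(i, j)\<in>cells M. X i * Y j * ((A (i, j) *v vector [gx U i j, gy U i j]) \<bullet> vector [gx b i j, gy b i j])) =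
    - (\<Sum>(i, j)\<in>cells M. I1 i j * ((b (VEdge i j) + b (VEdge (Suc i) j)) / 2) + gx b i j * K1 i j +
        (I2 i j * ((b (HEdge i j) + b (HEdge i (Suc j))) / 2) + gy b i j * K2 i j))"
proof -
  have "(\<Sum>(i, j)\<in>cells M. X i * Y j * ((A (i, j) *v vector [gx U i j, gy U i j]) \<bullet> vector [gx b i j, gy b i j])) =
      (\<Sum>(i, j)\<in>cells M. gx b i j * (A (i, j) $ 1 $ 1 * G1 i j + A (i, j) $ 1 $ 2 * G2 i j) +
        gy b i j * (A (i, j) $ 2 $ 1 * G1 i j + A (i, j) $ 2 $ 2 * G2 i j))"
  proof (rule sum_cells_cong)
    fix i j assume ij: "i < nx M" "j < ny M"
    have "X i * Y j * gx U i j = G1 i j" "X i * Y j * gy U i j = G2 i j"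
      using gx_U[OF ij] gy_U[OF ij] cell_bounds[OF ij] by auto
    moreover have "p * ((x * v + y * w) * q + (z * v + t * w) * r) =
        q * (x * (p * v) + y * (p * w)) + r * (z * (p * v) + t * (p * w))" for p q r x y z t v w :: real
      by (simp add: algebra_simps)
    ultimately show "X i * Y j * ((A (i, j) *v vector [gx U i j, gy U i j]) \<bullet> vector [gx b i j, gy b i j]) =
        gx b i j * (A (i, j) $ 1 $ 1 * G1 i j + A (i, j) $ 1 $ 2 * G2 i j) +
        gy b i j * (A (i, j) $ 2 $ 1 * G1 i j + A (i, j) $ 2 $ 2 * G2 i j)"
      by (simp only: mult_vec_inner2 vector_2)
  qed
  also have "\<dots> = (\<Sum>(i, j)\<in>cells M. gx b i j * (A (i, j) $ 1 $ 1 * G1 i j + A (i, j) $ 1 $ 2 * G2 i j)) +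
      (\<Sum>(i, j)\<in>cells M. gy b i j * (A (i, j) $ 2 $ 1 * G1 i j + A (i, j) $ 2 $ 2 * G2 i j))"
    by (simp add: sum.distrib split_def)
  also have "(\<Sum>(i, j)\<in>cells M. gx b i j * (A (i, j) $ 1 $ 1 * G1 i j + A (i, j) $ 1 $ 2 * G2 i j)) =
      - (\<Sum>(i, j)\<in>cells M. I1 i j * ((b (VEdge i j) + b (VEdge (Suc i) j)) / 2) + gx b i j * K1 i j)"
    unfolding sum_cells_rows sum_negf[symmetric]
    by (intro sum.cong refl row_flux_identity[simplified sum_negf[symmetric]])
       (use b in \<open>auto simp: bdry_edges_def\<close>)
  also have "(\<Sum>(i, j)\<in>cells M. gy b i j * (A (i, j) $ 2 $ 1 * G1 i j + A (i, j) $ 2 $ 2 * G2 i j)) =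
      - (\<Sum>(i, j)\<in>cells M. I2 i j * ((b (HEdge i j) + b (HEdge i (Suc j))) / 2) + gy b i j * K2 i j)"
    unfolding sum_cells_columns sum_negf[symmetric]
    by (intro sum.cong refl column_flux_identity[simplified sum_negf[symmetric]])
       (use b in \<open>auto simp: bdry_edges_def\<close>)
  finally show ?thesis by (simp add: sum.distrib split_def)
qed

text \<open>\<open>dx2\<close> and \<open>dy2\<close> come from \<open>beta U\<close>. The terms
  with \<open>I1\<close> and \<open>I2\<close> come from the gap between \<open>ext0\<close> in the
  source and the mean of two opposite edge values in the flux identities; h / \<rho> compensates the
  factor \<rho> / h in front. The difference is split so that \<alpha> has the x-derivative of the
  flux and \<gamma> the y-derivative.\<close>

definition "\<alpha> i j = (dx2 i j - h / \<rho> * X i * I1 i j) / (X i * Y j)"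
definition "\<gamma> i j = (dy2 i j - h / \<rho> * Y j * I2 i j) / (X i * Y j)"

text \<open>The moments \<open>K1\<close> and \<open>K2\<close> cancel. Since \<open>ext0\<close>
  differs from the mean of the vertical edge values by - X beta / (2 (X + Y)) and from that of the
  horizontal ones by Y beta / (2 (X + Y)), every integral \<open>I1\<close>, \<open>I2\<close>
  becomes a multiple of \<open>beta b\<close>, leaving \<open>J1\<close> and \<open>J2\<close> as
  the other terms.\<close>

lemma error_equation:
  assumes b: "\<forall>e\<in>bdry_edges M. b e = 0"
  shows "(\<Sum>(i, j)\<in>cells M. form err b i j) =
    (\<Sum>(i, j)\<in>cells M. \<rho> / h * kappa i j * (\<alpha> i j - \<gamma> i j) * beta b i j + gx b i j * J2 i j + gy b i j * J1 i j)"
proof -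
  have "(\<Sum>(i, j)\<in>cells M. form err b i j) = (\<Sum>(i, j)\<in>cells M. form U b i j) - (\<Sum>(i, j)\<in>cells M. form (snd u_h) b i j)"
    unfolding sum_subtractf[symmetric]
    by (rule sum.cong)
       (auto simp: form_def err_def[abs_def] gx_diff gy_diff beta_diff mult_vec_inner2 algebra_simps)
  also have "(\<Sum>(i, j)\<in>cells M. form U b i j) =
      (\<Sum>(i, j)\<in>cells M. X i * Y j * ((A (i, j) *v vector [gx U i j, gy U i j]) \<bullet> vector [gx b i j, gy b i j])) +
      (\<Sum>(i, j)\<in>cells M. \<rho> / h * kappa i j * beta U i j * beta b i j)"
    by (simp add: form_def sum.distrib split_def)
  also have "\<dots> - (\<Sum>(i, j)\<in>cells M. form (snd u_h) b i j) =
      (\<Sum>(i, j)\<in>cells M. \<rho> / h * kappa i j * beta U i j * beta b i j -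
        (I1 i j * ((b (VEdge i j) + b (VEdge (Suc i) j)) / 2) + gx b i j * K1 i j +
          (I2 i j * ((b (HEdge i j) + b (HEdge i (Suc j))) / 2) + gy b i j * K2 i j)) +
        (ext0 b i j * (I1 i j + I2 i j) + gx b i j * (K1 i j + J2 i j) + gy b i j * (J1 i j + K2 i j)))"
    unfolding interpolant_equation[OF b] discrete_equation[OF b]
    by (simp add: sum.distrib sum_subtractf sum_negf split_def)
  also have "\<dots> = (\<Sum>(i, j)\<in>cells M. \<rho> / h * kappa i j * (\<alpha> i j - \<gamma> i j) * beta b i j + gx b i j * J2 i j + gy b i j * J1 i j)"
  proof (rule sum_cells_cong)
    fix i j assume ij: "i < nx M" "j < ny M"
    define x y where "x = X i" and "y = Y j"
    have pos: "x > 0" "y > 0" using cell_bounds[OF ij] by (auto simp: x_def y_def)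
    define k where "k = kappa i j"
    define bt where "bt = beta b i j"
    have k: "k / (x * y) = 1 / (2 * (x + y))"
      using pos by (simp add: k_def kappa_def x_def[symmetric] y_def[symmetric])
    have e1: "ext0 b i j - (b (VEdge i j) + b (VEdge (Suc i) j)) / 2 = - x * bt / (2 * (x + y))"
      and e2: "ext0 b i j - (b (HEdge i j) + b (HEdge i (Suc j))) / 2 = y * bt / (2 * (x + y))"
    proof -
      have c0: "ext0 b i j = (y * (b (VEdge i j) + b (VEdge (Suc i) j)) + x * (b (HEdge i j) + b (HEdge i (Suc j)))) / (2 * (x + y))"
        by (simp add: ext0_def x_def y_def)
      have n: "2 * (x + y) \<noteq> 0" using pos by simp
      have "(y * v + x * w) / (2 * (x + y)) - v / 2 = - x * (v - w) / (2 * (x + y))"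
        "(y * v + x * w) / (2 * (x + y)) - w / 2 = y * (v - w) / (2 * (x + y))" for v w
        using n by (simp_all add: field_simps)
      note this[of "b (VEdge i j) + b (VEdge (Suc i) j)" "b (HEdge i j) + b (HEdge i (Suc j))"]
      then show "ext0 b i j - (b (VEdge i j) + b (VEdge (Suc i) j)) / 2 = - x * bt / (2 * (x + y))"
        "ext0 b i j - (b (HEdge i j) + b (HEdge i (Suc j))) / 2 = y * bt / (2 * (x + y))"
        unfolding c0 by (simp_all add: bt_def beta_def algebra_simps)
    qed
    have hr: "\<rho> / h * (h / \<rho>) = 1" using rho mesh_size_pos by simp
    have t: "\<alpha> i j - \<gamma> i j = beta U i j - h / \<rho> * (x * I1 i j - y * I2 i j) / (x * y)"
    proof -
      have "(p - r * x * v) / d - (q - r * y * w) / d = (p - q) / d - r * (x * v - y * w) / d"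
        for p q r x y v w d :: real
        by (simp add: diff_divide_distrib right_diff_distrib mult.assoc)
      then show ?thesis unfolding beta_U[OF ij] \<alpha>_def \<gamma>_def x_def y_def .
    qed
    have "\<rho> / h * k * (\<alpha> i j - \<gamma> i j) * bt =
        \<rho> / h * k * beta U i j * bt - (\<rho> / h * (h / \<rho>)) * (k / (x * y)) * (x * I1 i j - y * I2 i j) * bt"
      unfolding t by (simp add: algebra_simps diff_divide_distrib)
    also have "\<dots> = \<rho> / h * k * beta U i j * bt + I1 i j * (- x * bt / (2 * (x + y))) + I2 i j * (y * bt / (2 * (x + y)))"
      unfolding hr k by (simp add: algebra_simps diff_divide_distrib)
    finally have main: "\<rho> / h * k * (\<alpha> i j - \<gamma> i j) * bt = \<rho> / h * k * beta U i j * bt +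
        I1 i j * (ext0 b i j - (b (VEdge i j) + b (VEdge (Suc i) j)) / 2) +
        I2 i j * (ext0 b i j - (b (HEdge i j) + b (HEdge i (Suc j))) / 2)"
      unfolding e1 e2 .
    show "\<rho> / h * kappa i j * beta U i j * beta b i j -
        (I1 i j * ((b (VEdge i j) + b (VEdge (Suc i) j)) / 2) + gx b i j * K1 i j +
          (I2 i j * ((b (HEdge i j) + b (HEdge i (Suc j))) / 2) + gy b i j * K2 i j)) +
        (ext0 b i j * (I1 i j + I2 i j) + gx b i j * (K1 i j + J2 i j) + gy b i j * (J1 i j + K2 i j)) =
      \<rho> / h * kappa i j * (\<alpha> i j - \<gamma> i j) * beta b i j + gx b i j * J2 i j + gy b i j * J1 i j"
      using main unfolding k_def bt_def by (simp add: algebra_simps)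
  qed
  finally show ?thesis .
qed

end

subsection \<open>Consistency estimates\<close>

lemma square_sum3: "(x + y + z)\<^sup>2 \<le> 3 * (x\<^sup>2 + y\<^sup>2 + z\<^sup>2)" for x y z :: real
proof -
  have "0 \<le> (x - y)\<^sup>2 + (y - z)\<^sup>2 + (x - z)\<^sup>2" by simp
  then show ?thesis by (simp add: power2_eq_square algebra_simps)
qed

lemma square_sum2: "(x + y)\<^sup>2 \<le> 2 * (x\<^sup>2 + y\<^sup>2)" for x y :: real
  using sum_squares_bound[of x y] by (simp add: power2_sum)

text \<open>Serves differences and strips at once, with w the cell width: p carries the parabola
  weight, which is bounded by w^2 and is then divided by w; q and r are plain means multiplied by k
  = h / \<rho>.\<close>

lemma combination_bound:
  fixes p q r E1 E2 D w k k1 k2 B L :: real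
  assumes "p\<^sup>2 \<le> L\<^sup>2 * D * E1" "q\<^sup>2 \<le> D * E1" "r\<^sup>2 \<le> D * E2" "\<bar>k1\<bar> \<le> B" "\<bar>k2\<bar> \<le> B" "w > 0" "L = w\<^sup>2"
    "0 \<le> D" "0 \<le> E1" "0 \<le> E2"
  shows "(p / w - k * (k1 * q + k2 * r))\<^sup>2 \<le> 3 * (w\<^sup>2 + k\<^sup>2 * B\<^sup>2) * D * (E1 + E2)"
proof -
  have kB: "k1\<^sup>2 \<le> B\<^sup>2" "k2\<^sup>2 \<le> B\<^sup>2" using assms(4,5) abs_le_square_iff[of _ B] by auto
  have "(p / w - k * (k1 * q + k2 * r))\<^sup>2 = (p / w + (- k * k1 * q) + (- k * k2 * r))\<^sup>2"
    by (simp add: algebra_simps)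
  also have "\<dots> \<le> 3 * ((p / w)\<^sup>2 + (- k * k1 * q)\<^sup>2 + (- k * k2 * r)\<^sup>2)" by (rule square_sum3)
  also have "\<dots> \<le> 3 * (w\<^sup>2 * (D * E1) + k\<^sup>2 * B\<^sup>2 * (D * E1) + k\<^sup>2 * B\<^sup>2 * (D * E2))"
  proof -
    have "(p / w)\<^sup>2 \<le> w\<^sup>2 * (D * E1)"
    proof -
      have "p\<^sup>2 \<le> w\<^sup>2 * (w\<^sup>2 * (D * E1))" using assms(1,7) by (simp add: power2_eq_square mult.assoc)
      then show ?thesis using assms(6) by (simp add: power_divide pos_divide_le_eq mult.commute)
    qed
    moreover have "(- k * k1 * q)\<^sup>2 \<le> k\<^sup>2 * B\<^sup>2 * (D * E1)"
    proof -
      have "k1\<^sup>2 * q\<^sup>2 \<le> B\<^sup>2 * (D * E1)" using kB assms by (intro mult_mono) auto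
      from mult_left_mono[OF this, of "k\<^sup>2"] show ?thesis by (simp add: power_mult_distrib mult.assoc)
    qed
    moreover have "(- k * k2 * r)\<^sup>2 \<le> k\<^sup>2 * B\<^sup>2 * (D * E2)"
    proof -
      have "k2\<^sup>2 * r\<^sup>2 \<le> B\<^sup>2 * (D * E2)" using kB assms by (intro mult_mono) auto
      from mult_left_mono[OF this, of "k\<^sup>2"] show ?thesis by (simp add: power_mult_distrib mult.assoc)
    qed
    ultimately show ?thesis by (intro mult_left_mono add_mono) auto
  qed
  also have "\<dots> \<le> 3 * (w\<^sup>2 + k\<^sup>2 * B\<^sup>2) * D * (E1 + E2)"
  proof -
    have "0 \<le> w\<^sup>2 * (D * E2)" using assms by (intro mult_nonneg_nonneg) auto
    then show ?thesis by (simp add: algebra_simps)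
  qed
  finally show ?thesis .
qed

section \<open>Variation of weighted cell means in one direction\<close>

context coordinates
begin

abbreviation para :: "real \<Rightarrow> real \<Rightarrow> real \<Rightarrow> real" where
  "para c d x \<equiv> (x - c) * (d - x) * iv c d x"

lemma para_limits: "para c d \<in> test1_limits c d"
  by (intro test1_limits_smooth_mult smooth1_intros indicator_test1_limits)

text \<open>The common form of \<alpha> and \<gamma>, arranged as means over (a, b) in the direction
  \<open>s\<close>. Cells are compared in that direction only, so the weights in \<open>t\<close>
  stay fixed.\<close>

definition local_mean ::
    "(real \<times> real \<Rightarrow> real) \<Rightarrow> (real \<times> real \<Rightarrow> real) \<Rightarrow> real \<Rightarrow> real \<Rightarrow> real \<Rightarrow> real \<Rightarrow> real \<Rightarrow> real \<Rightarrow> real \<Rightarrow> real" where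
  "local_mean H1 H2 k k1 k2 c d a b =
     pair H1 (iv a b) (para c d) / (b - a) / (d - c) -
     k * (k1 * (pair H1 (iv a b) (iv c d) / (b - a)) + k2 * (pair H2 (iv a b) (iv c d) / (b - a)))"

text \<open>The same k1, k2 on both intervals reduce everything to differences of means of one
  function. This is the step that fails on a line where the coefficient jumps.\<close>

lemma local_mean_difference:
  assumes H: "H1 \<in> L2 unit_square" "H1' \<in> L2 unit_square" "H2 \<in> L2 unit_square" "H2' \<in> L2 unit_square"
    and D: "tensor_deriv 0 1 0 1 H1 H1'" "tensor_deriv 0 1 0 1 H2 H2'"
    and k: "\<bar>k1\<bar> \<le> B" "\<bar>k2\<bar> \<le> B"
    and ab: "0 \<le> a" "a < b" "b < e" "e \<le> 1" and cd: "0 \<le> c" "c < d" "d \<le> 1"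
  shows "(local_mean H1 H2 k k1 k2 c d a b - local_mean H1 H2 k k1 k2 c d b e)\<^sup>2
    \<le> 3 * ((d - c)\<^sup>2 + k\<^sup>2 * B\<^sup>2) * ((e - a) * (d - c)) * (energy H1' a e c d + energy H2' a e c d)"
proof -
  let ?p = "pair H1 (iv a b) (para c d) / (b - a) - pair H1 (iv b e) (para c d) / (e - b)"
  let ?q = "pair H1 (iv a b) (iv c d) / (b - a) - pair H1 (iv b e) (iv c d) / (e - b)"
  let ?r = "pair H2 (iv a b) (iv c d) / (b - a) - pair H2 (iv b e) (iv c d) / (e - b)"
  note b1 = pair_difference_bound[OF _ _ _ ab cd(1) less_imp_le[OF cd(2)] cd(3)]
  have "?p\<^sup>2 \<le> ((d - c)\<^sup>2)\<^sup>2 * ((e - a) * (d - c)) * energy H1' a e c d"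
    by (rule b1[OF H(1,2) D(1) para_limits parabola_bound]) (use cd in simp)
  moreover have "?q\<^sup>2 \<le> 1\<^sup>2 * ((e - a) * (d - c)) * energy H1' a e c d"
    by (rule b1[OF H(1,2) D(1) indicator_test1_limits]) (simp add: indicator_def)
  moreover have "?r\<^sup>2 \<le> 1\<^sup>2 * ((e - a) * (d - c)) * energy H2' a e c d"
    by (rule b1[OF H(3,4) D(2) indicator_test1_limits]) (simp add: indicator_def)
  ultimately have "(?p / (d - c) - k * (k1 * ?q + k2 * ?r))\<^sup>2 \<le>
      3 * ((d - c)\<^sup>2 + k\<^sup>2 * B\<^sup>2) * ((e - a) * (d - c)) * (energy H1' a e c d + energy H2' a e c d)"
    using k ab cd by (intro combination_bound[where L="(d - c)\<^sup>2"]) (auto simp: energy_nonneg)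
  moreover have "local_mean H1 H2 k k1 k2 c d a b - local_mean H1 H2 k k1 k2 c d b e =
      ?p / (d - c) - k * (k1 * ?q + k2 * ?r)"
    unfolding local_mean_def by (simp add: right_diff_distrib diff_divide_distrib distrib_left)
  ultimately show ?thesis by simp
qed

text \<open>In place of the area of two cells only the width of the strip remains as a small factor:
  this is the loss of one power of h in the square.\<close>

lemma local_mean_strip:
  assumes H: "H1 \<in> L2 unit_square" "H1' \<in> L2 unit_square" "H2 \<in> L2 unit_square" "H2' \<in> L2 unit_square"
    and D: "tensor_deriv 0 1 0 1 H1 H1'" "tensor_deriv 0 1 0 1 H2 H2'"
    and k: "\<bar>k1\<bar> \<le> B" "\<bar>k2\<bar> \<le> B"
    and ab: "0 \<le> a" "a < b" "b \<le> 1" and cd: "0 \<le> c" "c < d" "d \<le> 1"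
  shows "(local_mean H1 H2 k k1 k2 c d a b)\<^sup>2
    \<le> 3 * ((d - c)\<^sup>2 + k\<^sup>2 * B\<^sup>2) * (2 * (d - c)) *
      (energy H1 0 1 c d + energy H1' 0 1 c d + (energy H2 0 1 c d + energy H2' 0 1 c d))"
proof -
  let ?p = "pair H1 (iv a b) (para c d) / (b - a)"
  let ?q = "pair H1 (iv a b) (iv c d) / (b - a)"
  let ?r = "pair H2 (iv a b) (iv c d) / (b - a)"
  note b1 = pair_strip_bound[OF _ _ _ ab cd(1) less_imp_le[OF cd(2)] cd(3)]
  have "?p\<^sup>2 \<le> 2 * ((d - c)\<^sup>2)\<^sup>2 * (d - c) * (energy H1 0 1 c d + energy H1' 0 1 c d)"
    by (rule b1[OF H(1,2) D(1) para_limits parabola_bound]) (use cd in simp)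
  moreover have "2 * L * D * E = L * (2 * D) * E" for L D E :: real by simp
  ultimately have 1: "?p\<^sup>2 \<le> ((d - c)\<^sup>2)\<^sup>2 * (2 * (d - c)) * (energy H1 0 1 c d + energy H1' 0 1 c d)"
    by (simp only:)
  have 2: "?q\<^sup>2 \<le> 2 * 1\<^sup>2 * (d - c) * (energy H1 0 1 c d + energy H1' 0 1 c d)"
    by (rule b1[OF H(1,2) D(1) indicator_test1_limits]) (simp add: indicator_def)
  have 3: "?r\<^sup>2 \<le> 2 * 1\<^sup>2 * (d - c) * (energy H2 0 1 c d + energy H2' 0 1 c d)"
    by (rule b1[OF H(3,4) D(2) indicator_test1_limits]) (simp add: indicator_def)
  show ?thesis unfolding local_mean_def
    by (rule combination_bound[where L="(d - c)\<^sup>2"])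
       (use 1 2 3 k ab cd energy_nonneg in \<open>auto intro!: add_nonneg_nonneg\<close>)
qed

lemma energy_integrable:
  assumes "H \<in> L2 unit_square" shows "integrable mu (\<lambda>z. (H z)\<^sup>2 * (iv a b (s z) * iv c d (t z)))"
proof -
  have R: "(\<lambda>z. iv a b (s z) * iv c d (t z)) \<in> L2 unit_square"
    by (rule bounded_tensor_L2[where K=1 and L=1]) (auto simp: indicator_def)
  have HR: "(\<lambda>z. H z * (iv a b (s z) * iv c d (t z))) \<in> L2 unit_square"
    by (rule L2_bounded_mult[OF assms L2_measurable[OF R], of 1]) (auto simp: indicator_def)
  have "(\<lambda>z. (H z)\<^sup>2 * (iv a b (s z) * iv c d (t z))) = (\<lambda>z. (H z * (iv a b (s z) * iv c d (t z)))\<^sup>2)"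
    by (auto simp: indicator_def)
  then show ?thesis using HR by (simp add: L2_def)
qed

lemma energy_combine:
  assumes "H \<in> L2 unit_square" "a < b" "b < e"
  shows "energy H a e c d = energy H a b c d + energy H b e c d"
proof -
  have "energy H a e c d = (\<integral>z. (H z)\<^sup>2 * (iv a b (s z) * iv c d (t z)) + (H z)\<^sup>2 * (iv b e (s z) * iv c d (t z)) \<partial>mu)"
    unfolding energy_def
  proof (rule mu_integral_cong_AE)
    show "AE z in mu. (H z)\<^sup>2 * (iv a e (s z) * iv c d (t z)) =
        (H z)\<^sup>2 * (iv a b (s z) * iv c d (t z)) + (H z)\<^sup>2 * (iv b e (s z) * iv c d (t z))"
      using AE_coord(1)[of b]
    proof eventually_elim
      case (elim z)
      then have "iv a e (s z) = iv a b (s z) + (iv b e (s z) :: real)"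
        using assms by (auto simp: indicator_def)
      then show ?case by (simp add: algebra_simps)
    qed
  qed
  then show ?thesis
    unfolding energy_def by (simp add: energy_integrable[OF assms(1)])
qed

lemma sum_energy_le:
  assumes H: "H \<in> L2 unit_square" and I: "finite I"
    and le: "\<And>x. (\<Sum>i\<in>I. iv (\<sigma> i) (\<tau> i) x) \<le> (iv 0 1 x :: real)"
  shows "(\<Sum>i\<in>I. energy H (\<sigma> i) (\<tau> i) c d) \<le> energy H 0 1 c d"
proof -
  have "(\<Sum>i\<in>I. energy H (\<sigma> i) (\<tau> i) c d) =
      (\<integral>z. (\<Sum>i\<in>I. (H z)\<^sup>2 * (iv (\<sigma> i) (\<tau> i) (s z) * iv c d (t z))) \<partial>mu)"
    unfolding energy_def by (intro Bochner_Integration.integral_sum[symmetric] energy_integrable H)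
  also have "\<dots> \<le> energy H 0 1 c d"
    unfolding energy_def
  proof (rule integral_mono)
    show "integrable mu (\<lambda>z. \<Sum>i\<in>I. (H z)\<^sup>2 * (iv (\<sigma> i) (\<tau> i) (s z) * iv c d (t z)))"
      by (intro Bochner_Integration.integrable_sum energy_integrable H)
    show "integrable mu (\<lambda>z. (H z)\<^sup>2 * (iv 0 1 (s z) * iv c d (t z)))" by (rule energy_integrable[OF H])
    fix z
    have "(H z)\<^sup>2 * ((\<Sum>i\<in>I. iv (\<sigma> i) (\<tau> i) (s z)) * iv c d (t z)) \<le> (H z)\<^sup>2 * (iv 0 1 (s z) * iv c d (t z))"
      using le by (intro mult_left_mono mult_right_mono) auto
    then show "(\<Sum>i\<in>I. (H z)\<^sup>2 * (iv (\<sigma> i) (\<tau> i) (s z) * iv c d (t z))) \<le> (H z)\<^sup>2 * (iv 0 1 (s z) * iv c d (t z))"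
      by (simp add: sum_distrib_left sum_distrib_right)
  qed
  finally show ?thesis .
qed

end

context rect_mesh
begin

lemma sum_ix_le: "(\<Sum>i<nx M. ix i x) \<le> (iv 0 1 x :: real)"
proof -
  have "n \<le> nx M \<Longrightarrow> (\<Sum>i<n. ix i x) \<le> (iv (xs M 0) (xs M n) x :: real)" for n
  proof (induction n)
    case (Suc n)
    have "xs M 0 \<le> xs M n" "xs M n < xs M (Suc n)"
      using Suc.prems xs_mono[of 0 n] xs_less[of n] by auto
    then have "iv (xs M 0) (xs M n) x + ix n x \<le> (iv (xs M 0) (xs M (Suc n)) x :: real)"
      by (auto simp: indicator_def)
    moreover have "(\<Sum>i<n. ix i x) \<le> (iv (xs M 0) (xs M n) x :: real)" by (rule Suc.IH) (use Suc.prems in simp)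
    ultimately show ?case unfolding sum.lessThan_Suc by linarith
  qed simp
  from this[of "nx M"] show ?thesis using mesh by (simp add: is_mesh_def)
qed

lemma sum_iy_le: "(\<Sum>j<ny M. iy j x) \<le> (iv 0 1 x :: real)"
proof -
  have "n \<le> ny M \<Longrightarrow> (\<Sum>j<n. iy j x) \<le> (iv (ys M 0) (ys M n) x :: real)" for n
  proof (induction n)
    case (Suc n)
    have "ys M 0 \<le> ys M n" "ys M n < ys M (Suc n)"
      using Suc.prems ys_mono[of 0 n] ys_less[of n] by auto
    then have "iv (ys M 0) (ys M n) x + iy n x \<le> (iv (ys M 0) (ys M (Suc n)) x :: real)"
      by (auto simp: indicator_def)
    moreover have "(\<Sum>j<n. iy j x) \<le> (iv (ys M 0) (ys M n) x :: real)" by (rule Suc.IH) (use Suc.prems in simp)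
    ultimately show ?case unfolding sum.lessThan_Suc by linarith
  qed simp
  from this[of "ny M"] show ?thesis using mesh by (simp add: is_mesh_def)
qed

end

section \<open>Local energies of all derivatives up to third order\<close>

context wg_problem
begin

abbreviation orders :: "(nat \<times> nat) set" where "orders \<equiv> {(p, q). p + q \<le> 3}"

definition energy3 :: "real \<Rightarrow> real \<Rightarrow> real \<Rightarrow> real \<Rightarrow> real" where
  "energy3 x0 x1 y0 y1 = (\<Sum>(p, q)\<in>orders. xy.energy (wd u p q) x0 x1 y0 y1)"

abbreviation N :: "nat \<Rightarrow> nat \<Rightarrow> real" where
  "N i j \<equiv> energy3 (xs M i) (xs M (Suc i)) (ys M j) (ys M (Suc j))"

lemma energy3_nonneg: "0 \<le> energy3 x0 x1 y0 y1"
  unfolding energy3_def by (intro sum_nonneg) (auto simp: xy.energy_nonneg)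

lemma energy_le_energy3:
  assumes "S \<subseteq> orders" shows "(\<Sum>(p, q)\<in>S. xy.energy (wd u p q) x0 x1 y0 y1) \<le> energy3 x0 x1 y0 y1"
  unfolding energy3_def by (intro sum_mono2 finite_order assms) (auto simp: xy.energy_nonneg)

lemma energy3_square: "energy3 0 1 0 1 = (sobolev_norm 3 unit_square u)\<^sup>2"
proof -
  have "xy.energy w 0 1 0 1 = (\<integral>z. (w z)\<^sup>2 \<partial>mu)" for w
    unfolding xy.energy_def
    by (intro Bochner_Integration.integral_cong refl) (use xy.coord_range in auto)
  then show ?thesis
    unfolding energy3_def sobolev_norm_def
    by (subst real_sqrt_pow2) (auto intro!: sum_nonneg)
qed

lemma sum_rows_energy3: "(\<Sum>i<nx M. energy3 (xs M i) (xs M (Suc i)) y0 y1) \<le> energy3 0 1 y0 y1"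
proof -
  have "(\<Sum>i<nx M. energy3 (xs M i) (xs M (Suc i)) y0 y1) =
      (\<Sum>(p, q)\<in>orders. \<Sum>i<nx M. xy.energy (wd u p q) (xs M i) (xs M (Suc i)) y0 y1)"
    unfolding energy3_def by (subst sum.swap) (simp add: split_def)
  also have "\<dots> \<le> energy3 0 1 y0 y1"
    unfolding energy3_def
    by (intro sum_mono) (auto intro!: xy.sum_energy_le sum_ix_le wd_L2)
  finally show ?thesis .
qed

lemma sum_columns_energy3: "(\<Sum>j<ny M. energy3 x0 x1 (ys M j) (ys M (Suc j))) \<le> energy3 x0 x1 0 1"
proof -
  have "(\<Sum>j<ny M. energy3 x0 x1 (ys M j) (ys M (Suc j))) =
      (\<Sum>(p, q)\<in>orders. \<Sum>j<ny M. xy.energy (wd u p q) x0 x1 (ys M j) (ys M (Suc j)))"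
    unfolding energy3_def by (subst sum.swap) (simp add: split_def)
  also have "\<dots> \<le> energy3 x0 x1 0 1"
    unfolding energy3_def energy_swap[symmetric]
    by (intro sum_mono) (auto intro!: yx.sum_energy_le sum_iy_le wd_L2)
  finally show ?thesis .
qed

lemma sum_N: "(\<Sum>(i, j)\<in>cells M. N i j) \<le> energy3 0 1 0 1"
proof -
  have "(\<Sum>(i, j)\<in>cells M. N i j) \<le> (\<Sum>i<nx M. energy3 (xs M i) (xs M (Suc i)) 0 1)"
    unfolding sum_cells_columns by (intro sum_mono sum_columns_energy3)
  also have "\<dots> \<le> energy3 0 1 0 1" by (rule sum_rows_energy3)
  finally show ?thesis .
qed

lemma derivs3:
  "xy.tensor_deriv 0 1 0 1 (wd u 2 0) (wd u 3 0)" "xy.tensor_deriv 0 1 0 1 (wd u 1 1) (wd u 2 1)"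
  "xy.tensor_deriv 0 1 0 1 (wd u 0 2) (wd u 1 2)" "yx.tensor_deriv 0 1 0 1 (wd u 2 0) (wd u 2 1)"
  "yx.tensor_deriv 0 1 0 1 (wd u 1 1) (wd u 1 2)" "yx.tensor_deriv 0 1 0 1 (wd u 0 2) (wd u 0 3)"
  using wd_x[of 2 0] wd_x[of 1 1] wd_x[of 0 2] wd_y[of 2 0] wd_y[of 1 1] wd_y[of 0 2]
  by (simp_all add: eval_nat_numeral)

lemma wd_L2_high:
  "wd u 2 0 \<in> L2 unit_square" "wd u 1 1 \<in> L2 unit_square" "wd u 0 2 \<in> L2 unit_square"
  "wd u 3 0 \<in> L2 unit_square" "wd u 2 1 \<in> L2 unit_square" "wd u 1 2 \<in> L2 unit_square" "wd u 0 3 \<in> L2 unit_square"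
  by (intro wd_L2; simp)+

end

text \<open>\<open>Zx\<close> and \<open>Zy\<close> hold the coordinates of the sides of the square
  and of the lines on which the coefficient may jump; their sizes enter the final constant.
  \<open>r\<close> expresses quasi-uniformity.\<close>

locale wg_estimate = wg_approximation +
  fixes \<alpha>0 B r :: real and Zx Zy :: "real set"
  assumes alpha0: "\<alpha>0 > 0" "\<And>c \<xi>. c \<in> cells M \<Longrightarrow> \<alpha>0 * (norm \<xi>)\<^sup>2 \<le> \<xi> \<bullet> (A c *v \<xi>)"
    and B: "\<And>c p q. c \<in> cells M \<Longrightarrow> \<bar>A c $ p $ q\<bar> \<le> B"
    and r: "r > 0" "\<And>i. i < nx M \<Longrightarrow> h \<le> r * X i" "\<And>j. j < ny M \<Longrightarrow> h \<le> r * Y j"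
    and Z: "finite Zx" "finite Zy" "0 \<in> Zx" "1 \<in> Zx" "0 \<in> Zy" "1 \<in> Zy"
    and Zx: "\<And>i j. Suc i < nx M \<Longrightarrow> j < ny M \<Longrightarrow> xs M (Suc i) \<notin> Zx \<Longrightarrow> A (Suc i, j) = A (i, j)"
    and Zy: "\<And>i j. i < nx M \<Longrightarrow> Suc j < ny M \<Longrightarrow> ys M (Suc j) \<notin> Zy \<Longrightarrow> A (i, Suc j) = A (i, j)"
begin

text \<open>The 6 is 3 from the square of a sum of three terms times 2 from the bound on D in
  \<open>factor_bound\<close>.\<close>

definition CA :: real where "CA = 6 * (1 + B\<^sup>2 / \<rho>\<^sup>2)"

lemma CA_nonneg: "0 \<le> CA"
  by (simp add: CA_def)

text \<open>Averaged in y, the direction in which the horizontal edges of a column follow one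
  another; the weights in x are the same along the whole column. For \<gamma> the roles are
  exchanged.\<close>

lemma alpha_local_mean:
  assumes "i < nx M" "j < ny M"
  shows "\<alpha> i j = yx.local_mean (wd u 2 0) (wd u 1 1) (h / \<rho>) (A (i, j) $ 1 $ 1) (A (i, j) $ 1 $ 2)
    (xs M i) (xs M (Suc i)) (ys M j) (ys M (Suc j))"
proof -
  have "I1 i j = A (i, j) $ 1 $ 1 * xy.pair (wd u 2 0) (ix i) (iy j) + A (i, j) $ 1 $ 2 * xy.pair (wd u 1 1) (ix i) (iy j)"
    unfolding I1_def by (rule xy.pair_linear_fun[OF wd_L2_high(1,2) ix_limits iy_limits])
  then show ?thesis
    using cell_bounds[OF assms] unfolding \<alpha>_def dx2_def yx.local_mean_def pair_swap
    by (simp add: divide_simps)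
qed

lemma gamma_local_mean:
  assumes "i < nx M" "j < ny M"
  shows "\<gamma> i j = xy.local_mean (wd u 0 2) (wd u 1 1) (h / \<rho>) (A (i, j) $ 2 $ 2) (A (i, j) $ 2 $ 1)
    (ys M j) (ys M (Suc j)) (xs M i) (xs M (Suc i))"
proof -
  have "I2 i j = A (i, j) $ 2 $ 1 * xy.pair (wd u 1 1) (ix i) (iy j) + A (i, j) $ 2 $ 2 * xy.pair (wd u 0 2) (ix i) (iy j)"
    unfolding I2_def by (rule xy.pair_linear_fun[OF wd_L2_high(2,3) ix_limits iy_limits])
  then show ?thesis
    using cell_bounds[OF assms] unfolding \<gamma>_def dy2_def xy.local_mean_def
    by (simp add: divide_simps)
qed

end

lemma sum_square_product_bound:
  fixes p q v w :: real
  assumes "\<bar>k1\<bar> \<le> B" "\<bar>k2\<bar> \<le> B" "v\<^sup>2 \<le> D * E1" "w\<^sup>2 \<le> D * E2" "0 \<le> D" "0 \<le> E1" "0 \<le> E2"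
  shows "(k1 * v + k2 * w)\<^sup>2 \<le> 2 * B\<^sup>2 * D * (E1 + E2)"
proof -
  have kB: "k1\<^sup>2 \<le> B\<^sup>2" "k2\<^sup>2 \<le> B\<^sup>2" using assms(1,2) abs_le_square_iff[of _ B] by auto
  have "(k1 * v)\<^sup>2 \<le> B\<^sup>2 * (D * E1)" "(k2 * w)\<^sup>2 \<le> B\<^sup>2 * (D * E2)"
    unfolding power_mult_distrib using kB assms by (auto intro!: mult_mono)
  then show ?thesis using square_sum2[of "k1 * v" "k2 * w"] by (simp add: algebra_simps)
qed

text \<open>By injectivity each point of Z is met by at most one index, so \<open>card Z\<close>
  bounds the number of special lines on every mesh, however fine.\<close>

lemma sum_bad_indices_le:
  fixes c :: real and \<sigma> :: "nat \<Rightarrow> real"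
  assumes "finite Z" "inj_on \<sigma> {..<n}" "c \<ge> 0"
  shows "(\<Sum>i<n. if \<sigma> i \<in> Z then c else 0) \<le> real (card Z) * c"
proof -
  have "(\<Sum>i<n. if \<sigma> i \<in> Z then c else 0) = real (card {i\<in>{..<n}. \<sigma> i \<in> Z}) * c"
    by (simp add: sum.If_cases Int_def)
  also have "card {i\<in>{..<n}. \<sigma> i \<in> Z} = card (\<sigma> ` {i\<in>{..<n}. \<sigma> i \<in> Z})"
    by (rule card_image[symmetric]) (rule inj_on_subset[OF assms(2)], auto)
  also have "\<dots> \<le> card Z" by (rule card_mono[OF assms(1)]) auto
  finally show ?thesis using assms(3) by (simp add: mult_right_mono)
qed

context wg_estimate
begin

lemma h_pos: "0 < h"
  by (rule mesh_size_pos)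

lemma X_le: "i < nx M \<Longrightarrow> X i \<le> h" and Y_le: "j < ny M \<Longrightarrow> Y j \<le> h"
  using mesh_size_ge(1)[OF _ ny_pos] mesh_size_ge(2)[OF nx_pos] by auto

text \<open>Used with m = 2 for neighbouring cells, where D is the area of their union, and with m =
  1 for strips, where D is twice the width. These are the exponents 4 and 3 of h.\<close>

lemma factor_bound:
  assumes "0 \<le> x" "x \<le> h" "0 \<le> D" "D \<le> 2 * h ^ m" "0 \<le> e" "e \<le> E"
  shows "3 * (x\<^sup>2 + (h / \<rho>)\<^sup>2 * B\<^sup>2) * D * e \<le> CA * h ^ (m + 2) * E"
proof -
  have "x\<^sup>2 + (h / \<rho>)\<^sup>2 * B\<^sup>2 \<le> h\<^sup>2 * (1 + B\<^sup>2 / \<rho>\<^sup>2)"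
    using power_mono[OF assms(2,1), of 2] by (simp add: power_divide algebra_simps)
  then have "3 * (x\<^sup>2 + (h / \<rho>)\<^sup>2 * B\<^sup>2) * D * e \<le> 3 * (h\<^sup>2 * (1 + B\<^sup>2 / \<rho>\<^sup>2)) * (2 * h ^ m) * E"
    using assms h_pos by (intro mult_mono mult_nonneg_nonneg add_nonneg_nonneg) auto
  also have "\<dots> = CA * h ^ (m + 2) * E" by (simp add: CA_def power_add power2_eq_square)
  finally show ?thesis .
qed

lemma two_orders_le: "xy.energy (wd u 2 1) x0 x1 y0 y1 + xy.energy (wd u 1 2) x0 x1 y0 y1 \<le> energy3 x0 x1 y0 y1"
  using energy_le_energy3[of "{(2,1),(1,2)}" x0 x1 y0 y1] by simp

lemma alpha_difference:
  assumes ij: "i < nx M" "Suc j < ny M" "ys M (Suc j) \<notin> Zy"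
  shows "(\<alpha> i j - \<alpha> i (Suc j))\<^sup>2 \<le> CA * h ^ 4 * (N i j + N i (Suc j))"
proof -
  have j: "j < ny M" using ij by simp
  note cb = cell_bounds[OF ij(1) j] and cb' = cell_bounds[OF ij(1,2)]
  have c: "(i, j) \<in> cells M" using ij by (simp add: cells_def)
  have "(\<alpha> i j - \<alpha> i (Suc j))\<^sup>2 \<le> 3 * ((X i)\<^sup>2 + (h / \<rho>)\<^sup>2 * B\<^sup>2) * ((ys M (Suc (Suc j)) - ys M j) * X i) *
      (yx.energy (wd u 2 1) (ys M j) (ys M (Suc (Suc j))) (xs M i) (xs M (Suc i)) +
       yx.energy (wd u 1 2) (ys M j) (ys M (Suc (Suc j))) (xs M i) (xs M (Suc i)))"
    unfolding alpha_local_mean[OF ij(1) j] alpha_local_mean[OF ij(1,2)] Zy[OF ij]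
    by (rule yx.local_mean_difference[OF wd_L2_high(1,5,2,6) derivs3(4,5) B[OF c] B[OF c] cb(4,5) cb'(5,6) cb(1-3)])
  also have "\<dots> \<le> CA * h ^ (2 + 2) * (N i j + N i (Suc j))"
  proof (rule factor_bound)
    show "(ys M (Suc (Suc j)) - ys M j) * X i \<le> 2 * h\<^sup>2"
    proof -
      have "(ys M (Suc (Suc j)) - ys M j) * X i \<le> (2 * h) * h"
        using cb cb' X_le[OF ij(1)] Y_le[OF j] Y_le[OF ij(2)] h_pos by (intro mult_mono) auto
      then show ?thesis by (simp add: power2_eq_square)
    qed
    show "yx.energy (wd u 2 1) (ys M j) (ys M (Suc (Suc j))) (xs M i) (xs M (Suc i)) +
       yx.energy (wd u 1 2) (ys M j) (ys M (Suc (Suc j))) (xs M i) (xs M (Suc i)) \<le> N i j + N i (Suc j)"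
      unfolding yx.energy_combine[OF wd_L2_high(5) cb(5) cb'(5)] yx.energy_combine[OF wd_L2_high(6) cb(5) cb'(5)]
      unfolding energy_swap
      using two_orders_le[of "xs M i" "xs M (Suc i)" "ys M j" "ys M (Suc j)"]
        two_orders_le[of "xs M i" "xs M (Suc i)" "ys M (Suc j)" "ys M (Suc (Suc j))"] by linarith
  qed (use cb cb' X_le[OF ij(1)] yx.energy_nonneg in \<open>auto intro!: mult_nonneg_nonneg add_nonneg_nonneg\<close>)
  finally show ?thesis by simp
qed

lemma gamma_difference:
  assumes ij: "Suc i < nx M" "j < ny M" "xs M (Suc i) \<notin> Zx"
  shows "(\<gamma> i j - \<gamma> (Suc i) j)\<^sup>2 \<le> CA * h ^ 4 * (N i j + N (Suc i) j)"
proof -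
  have i: "i < nx M" using ij by simp
  note cb = cell_bounds[OF i ij(2)] and cb' = cell_bounds[OF ij(1,2)]
  have c: "(i, j) \<in> cells M" using ij by (simp add: cells_def)
  have "(\<gamma> i j - \<gamma> (Suc i) j)\<^sup>2 \<le> 3 * ((Y j)\<^sup>2 + (h / \<rho>)\<^sup>2 * B\<^sup>2) * ((xs M (Suc (Suc i)) - xs M i) * Y j) *
      (xy.energy (wd u 1 2) (xs M i) (xs M (Suc (Suc i))) (ys M j) (ys M (Suc j)) +
       xy.energy (wd u 2 1) (xs M i) (xs M (Suc (Suc i))) (ys M j) (ys M (Suc j)))"
    unfolding gamma_local_mean[OF i ij(2)] gamma_local_mean[OF ij(1,2)] Zx[OF ij]
    by (rule xy.local_mean_difference[OF wd_L2_high(3,6,2,5) derivs3(3,2) B[OF c] B[OF c] cb(1,2) cb'(2,3) cb(4-6)])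
  also have "\<dots> \<le> CA * h ^ (2 + 2) * (N i j + N (Suc i) j)"
  proof (rule factor_bound)
    show "(xs M (Suc (Suc i)) - xs M i) * Y j \<le> 2 * h\<^sup>2"
    proof -
      have "(xs M (Suc (Suc i)) - xs M i) * Y j \<le> (2 * h) * h"
        using cb cb' Y_le[OF ij(2)] X_le[OF i] X_le[OF ij(1)] h_pos by (intro mult_mono) auto
      then show ?thesis by (simp add: power2_eq_square)
    qed
    show "xy.energy (wd u 1 2) (xs M i) (xs M (Suc (Suc i))) (ys M j) (ys M (Suc j)) +
       xy.energy (wd u 2 1) (xs M i) (xs M (Suc (Suc i))) (ys M j) (ys M (Suc j)) \<le> N i j + N (Suc i) j"
      unfolding xy.energy_combine[OF wd_L2_high(5) cb(2) cb'(2)] xy.energy_combine[OF wd_L2_high(6) cb(2) cb'(2)]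
      using two_orders_le[of "xs M i" "xs M (Suc i)" "ys M j" "ys M (Suc j)"]
        two_orders_le[of "xs M (Suc i)" "xs M (Suc (Suc i))" "ys M j" "ys M (Suc j)"] by linarith
  qed (use cb cb' Y_le[OF ij(2)] xy.energy_nonneg in \<open>auto intro!: mult_nonneg_nonneg add_nonneg_nonneg\<close>)
  finally show ?thesis by simp
qed

lemma alpha_strip:
  assumes ij: "i < nx M" "j < ny M"
  shows "(\<alpha> i j)\<^sup>2 \<le> CA * h ^ 3 * energy3 (xs M i) (xs M (Suc i)) 0 1"
proof -
  note cb = cell_bounds[OF ij]
  have c: "(i, j) \<in> cells M" using ij by (simp add: cells_def)
  have "(\<alpha> i j)\<^sup>2 \<le> 3 * ((X i)\<^sup>2 + (h / \<rho>)\<^sup>2 * B\<^sup>2) * (2 * X i) *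
      (yx.energy (wd u 2 0) 0 1 (xs M i) (xs M (Suc i)) + yx.energy (wd u 2 1) 0 1 (xs M i) (xs M (Suc i)) +
      (yx.energy (wd u 1 1) 0 1 (xs M i) (xs M (Suc i)) + yx.energy (wd u 1 2) 0 1 (xs M i) (xs M (Suc i))))"
    unfolding alpha_local_mean[OF ij]
    by (rule yx.local_mean_strip[OF wd_L2_high(1,5,2,6) derivs3(4,5) B[OF c] B[OF c] cb(4-6) cb(1-3)])
  also have "\<dots> \<le> CA * h ^ (1 + 2) * energy3 (xs M i) (xs M (Suc i)) 0 1"
  proof (rule factor_bound)
    show "yx.energy (wd u 2 0) 0 1 (xs M i) (xs M (Suc i)) + yx.energy (wd u 2 1) 0 1 (xs M i) (xs M (Suc i)) +
      (yx.energy (wd u 1 1) 0 1 (xs M i) (xs M (Suc i)) + yx.energy (wd u 1 2) 0 1 (xs M i) (xs M (Suc i)))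
      \<le> energy3 (xs M i) (xs M (Suc i)) 0 1"
      using energy_le_energy3[of "{(2,0),(2,1),(1,1),(1,2)}" "xs M i" "xs M (Suc i)" 0 1] by (simp add: energy_swap)
  qed (use cb X_le[OF ij(1)] yx.energy_nonneg in \<open>auto intro!: add_nonneg_nonneg\<close>)
  finally show ?thesis by (simp add: power3_eq_cube mult.assoc)
qed

lemma gamma_strip:
  assumes ij: "i < nx M" "j < ny M"
  shows "(\<gamma> i j)\<^sup>2 \<le> CA * h ^ 3 * energy3 0 1 (ys M j) (ys M (Suc j))"
proof -
  note cb = cell_bounds[OF ij]
  have c: "(i, j) \<in> cells M" using ij by (simp add: cells_def)
  have "(\<gamma> i j)\<^sup>2 \<le> 3 * ((Y j)\<^sup>2 + (h / \<rho>)\<^sup>2 * B\<^sup>2) * (2 * Y j) *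
      (xy.energy (wd u 0 2) 0 1 (ys M j) (ys M (Suc j)) + xy.energy (wd u 1 2) 0 1 (ys M j) (ys M (Suc j)) +
      (xy.energy (wd u 1 1) 0 1 (ys M j) (ys M (Suc j)) + xy.energy (wd u 2 1) 0 1 (ys M j) (ys M (Suc j))))"
    unfolding gamma_local_mean[OF ij]
    by (rule xy.local_mean_strip[OF wd_L2_high(3,6,2,5) derivs3(3,2) B[OF c] B[OF c] cb(1-3) cb(4-6)])
  also have "\<dots> \<le> CA * h ^ (1 + 2) * energy3 0 1 (ys M j) (ys M (Suc j))"
  proof (rule factor_bound)
    show "xy.energy (wd u 0 2) 0 1 (ys M j) (ys M (Suc j)) + xy.energy (wd u 1 2) 0 1 (ys M j) (ys M (Suc j)) +
      (xy.energy (wd u 1 1) 0 1 (ys M j) (ys M (Suc j)) + xy.energy (wd u 2 1) 0 1 (ys M j) (ys M (Suc j)))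
      \<le> energy3 0 1 (ys M j) (ys M (Suc j))"
      using energy_le_energy3[of "{(0,2),(1,2),(1,1),(2,1)}" 0 1 "ys M j" "ys M (Suc j)"] by simp
  qed (use cb Y_le[OF ij(2)] xy.energy_nonneg in \<open>auto intro!: add_nonneg_nonneg\<close>)
  finally show ?thesis by (simp add: power3_eq_cube mult.assoc)
qed

text \<open>The weight \<open>my\<close> is centred, so a second derivative of \<open>u\<close>
  tested with it passes to a third derivative with a gain of h^2.\<close>

lemma J1_bound:
  assumes ij: "i < nx M" "j < ny M" shows "(J1 i j)\<^sup>2 \<le> 2 * B\<^sup>2 * (h ^ 4 * (X i * Y j)) * N i j"
proof -
  note cb = cell_bounds[OF ij]
  have c: "(i, j) \<in> cells M" using ij by (simp add: cells_def)
  have J: "J1 i j = A (i, j) $ 1 $ 1 * xy.pair (wd u 2 0) (ix i) (my j) + A (i, j) $ 1 $ 2 * xy.pair (wd u 1 1) (ix i) (my j)"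
    unfolding J1_def by (rule xy.pair_linear_fun[OF wd_L2_high(1,2) ix_limits my_limits])
  have h4: "(Y j) ^ 4 * (Y j * X i) * e \<le> h ^ 4 * (X i * Y j) * e" if "0 \<le> e" for e
    unfolding mult.commute[of "Y j" "X i"]
    using cb Y_le[OF ij(2)] that by (intro mult_right_mono power_mono) auto
  have "(xy.pair (wd u 2 0) (ix i) (my j))\<^sup>2 \<le> h ^ 4 * (X i * Y j) * xy.energy (wd u 2 1) (xs M i) (xs M (Suc i)) (ys M j) (ys M (Suc j))"
    using yx.pair_first_moment_bound[OF wd_L2_high(1,5) derivs3(4) cb(4-6) cb(1-3)]
      h4[OF xy.energy_nonneg] unfolding pair_swap energy_swap by (rule order_trans)
  moreover have "(xy.pair (wd u 1 1) (ix i) (my j))\<^sup>2 \<le> h ^ 4 * (X i * Y j) * xy.energy (wd u 1 2) (xs M i) (xs M (Suc i)) (ys M j) (ys M (Suc j))"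
    using yx.pair_first_moment_bound[OF wd_L2_high(2,6) derivs3(5) cb(4-6) cb(1-3)]
      h4[OF xy.energy_nonneg] unfolding pair_swap energy_swap by (rule order_trans)
  ultimately have "(J1 i j)\<^sup>2 \<le> 2 * B\<^sup>2 * (h ^ 4 * (X i * Y j)) *
      (xy.energy (wd u 2 1) (xs M i) (xs M (Suc i)) (ys M j) (ys M (Suc j)) +
       xy.energy (wd u 1 2) (xs M i) (xs M (Suc i)) (ys M j) (ys M (Suc j)))"
    unfolding J using cb h_pos
    by (intro sum_square_product_bound B c xy.energy_nonneg) auto
  also have "\<dots> \<le> 2 * B\<^sup>2 * (h ^ 4 * (X i * Y j)) * N i j"
    using cb h_pos by (intro mult_left_mono two_orders_le) auto
  finally show ?thesis .
qed

lemma J2_bound: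
  assumes ij: "i < nx M" "j < ny M" shows "(J2 i j)\<^sup>2 \<le> 2 * B\<^sup>2 * (h ^ 4 * (X i * Y j)) * N i j"
proof -
  note cb = cell_bounds[OF ij]
  have c: "(i, j) \<in> cells M" using ij by (simp add: cells_def)
  have J: "J2 i j = A (i, j) $ 2 $ 1 * xy.pair (wd u 1 1) (mx i) (iy j) + A (i, j) $ 2 $ 2 * xy.pair (wd u 0 2) (mx i) (iy j)"
    unfolding J2_def by (rule xy.pair_linear_fun[OF wd_L2_high(2,3) mx_limits iy_limits])
  have h4: "(X i) ^ 4 * (X i * Y j) * e \<le> h ^ 4 * (X i * Y j) * e" if "0 \<le> e" for e
    using cb X_le[OF ij(1)] that by (intro mult_right_mono power_mono) auto
  have "(xy.pair (wd u 1 1) (mx i) (iy j))\<^sup>2 \<le> h ^ 4 * (X i * Y j) * xy.energy (wd u 2 1) (xs M i) (xs M (Suc i)) (ys M j) (ys M (Suc j))"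
    using xy.pair_first_moment_bound[OF wd_L2_high(2,5) derivs3(2) cb]
      h4[OF xy.energy_nonneg] by (rule order_trans)
  moreover have "(xy.pair (wd u 0 2) (mx i) (iy j))\<^sup>2 \<le> h ^ 4 * (X i * Y j) * xy.energy (wd u 1 2) (xs M i) (xs M (Suc i)) (ys M j) (ys M (Suc j))"
    using xy.pair_first_moment_bound[OF wd_L2_high(3,6) derivs3(3) cb]
      h4[OF xy.energy_nonneg] by (rule order_trans)
  ultimately have "(J2 i j)\<^sup>2 \<le> 2 * B\<^sup>2 * (h ^ 4 * (X i * Y j)) *
      (xy.energy (wd u 2 1) (xs M i) (xs M (Suc i)) (ys M j) (ys M (Suc j)) +
       xy.energy (wd u 1 2) (xs M i) (xs M (Suc i)) (ys M j) (ys M (Suc j)))"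
    unfolding J using cb h_pos
    by (intro sum_square_product_bound B c xy.energy_nonneg) auto
  also have "\<dots> \<le> 2 * B\<^sup>2 * (h ^ 4 * (X i * Y j)) * N i j"
    using cb h_pos by (intro mult_left_mono two_orders_le) auto
  finally show ?thesis .
qed

subsection \<open>The corrector\<close>

text \<open>The consistency error is \<open>O(h)\<close> in the energy norm, but to leading order it is
  \<open>\<alpha> - \<gamma>\<close>, where \<open>\<alpha>\<close> varies slowly along columns and \<open>\<gamma>\<close> along rows.  It can therefore
  be removed by an edge function with a small weak gradient.\<close>

fun corr :: "edge \<Rightarrow> real" where
  "corr (VEdge i j) = (if xs M i \<in> Zx then 0 else - \<gamma> i j / 2)"
| "corr (HEdge i j) = (if ys M j \<in> Zy then 0 else - \<alpha> i j / 2)"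

lemma corr_boundary: "e \<in> bdry_edges M \<Longrightarrow> corr e = 0"
  using Z ends01 by (auto simp: bdry_edges_def)

text \<open>Deviations of the corrector on the left, right, bottom and top edge from the values -
  \<gamma> / 2 and - \<alpha> / 2 of this very cell. If all four vanished, the slopes of
  \<open>corr\<close> would be 0 and \<open>beta corr\<close> would be \<alpha> - \<gamma>.\<close>

definition "dl i j = corr (VEdge i j) + \<gamma> i j / 2"
definition "dr i j = corr (VEdge (Suc i) j) + \<gamma> i j / 2"
definition "db i j = corr (HEdge i j) + \<alpha> i j / 2"
definition "dt i j = corr (HEdge i (Suc j)) + \<alpha> i j / 2"
definition "defect i j = (dl i j)\<^sup>2 + (dr i j)\<^sup>2 + (db i j)\<^sup>2 + (dt i j)\<^sup>2"

definition strip_x :: "nat \<Rightarrow> real" where "strip_x i = CA / 4 * h ^ 3 * energy3 (xs M i) (xs M (Suc i)) 0 1"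
definition strip_y :: "nat \<Rightarrow> real" where "strip_y j = CA / 4 * h ^ 3 * energy3 0 1 (ys M j) (ys M (Suc j))"

lemma strip_x_nonneg: "0 \<le> strip_x i" and strip_y_nonneg: "0 \<le> strip_y j"
  using CA_nonneg h_pos by (auto simp: strip_x_def strip_y_def energy3_nonneg intro!: mult_nonneg_nonneg)

text \<open>A vertical edge takes \<gamma> from the cell on its right, so off \<open>Zx\<close> the
  left deviation is 0 and only the right one compares neighbouring cells. Bottom and top behave
  likewise.\<close>

lemma dl_bound:
  assumes "i < nx M" "j < ny M" shows "(dl i j)\<^sup>2 \<le> (if xs M i \<in> Zx then strip_y j else 0)"
  using gamma_strip[OF assms] by (simp add: dl_def strip_y_def power_divide)

lemma db_bound:
  assumes "i < nx M" "j < ny M" shows "(db i j)\<^sup>2 \<le> (if ys M j \<in> Zy then strip_x i else 0)"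
  using alpha_strip[OF assms] by (simp add: db_def strip_x_def power_divide)

text \<open>Continuation of \<open>N\<close> by 0 beyond the last cell, so that the index shift to
  the right-hand neighbour can be summed over all cells.\<close>

definition NX :: "nat \<Rightarrow> nat \<Rightarrow> real" where "NX i j = (if i < nx M then N i j else 0)"
definition NY :: "nat \<Rightarrow> nat \<Rightarrow> real" where "NY i j = (if j < ny M then N i j else 0)"

lemma dr_bound:
  assumes ij: "i < nx M" "j < ny M"
  shows "(dr i j)\<^sup>2 \<le> (if xs M (Suc i) \<in> Zx then strip_y j else 0) + CA / 4 * h ^ 4 * (NX i j + NX (Suc i) j)"
proof (cases "xs M (Suc i) \<in> Zx")
  case True
  have "0 \<le> CA / 4 * h ^ 4 * (NX i j + NX (Suc i) j)"
    using CA_nonneg h_pos by (auto simp: NX_def energy3_nonneg intro!: mult_nonneg_nonneg add_nonneg_nonneg)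
  moreover have "(dr i j)\<^sup>2 \<le> strip_y j"
    using True gamma_strip[OF ij] by (simp add: dr_def strip_y_def power_divide)
  ultimately show ?thesis using True by simp
next
  case False
  \<comment> \<open>The last node is 1, an element of \<open>Zx\<close>; a right end off
    \<open>Zx\<close> therefore has another cell behind it.\<close>
  then have i: "Suc i < nx M" using ij(1) Z ends01 by (metis Suc_lessI)
  have "(dr i j)\<^sup>2 = (\<gamma> i j - \<gamma> (Suc i) j)\<^sup>2 / 4"
    using False by (simp add: dr_def power2_eq_square field_simps)
  then show ?thesis using gamma_difference[OF i ij(2) False] False i by (simp add: NX_def)
qed

lemma dt_bound:
  assumes ij: "i < nx M" "j < ny M"
  shows "(dt i j)\<^sup>2 \<le> (if ys M (Suc j) \<in> Zy then strip_x i else 0) + CA / 4 * h ^ 4 * (NY i j + NY i (Suc j))"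
proof (cases "ys M (Suc j) \<in> Zy")
  case True
  have "0 \<le> CA / 4 * h ^ 4 * (NY i j + NY i (Suc j))"
    using CA_nonneg h_pos by (auto simp: NY_def energy3_nonneg intro!: mult_nonneg_nonneg add_nonneg_nonneg)
  moreover have "(dt i j)\<^sup>2 \<le> strip_x i"
    using True alpha_strip[OF ij] by (simp add: dt_def strip_x_def power_divide)
  ultimately show ?thesis using True by simp
next
  case False
  then have j: "Suc j < ny M" using ij(2) Z ends01 by (metis Suc_lessI)
  have "(dt i j)\<^sup>2 = (\<alpha> i j - \<alpha> i (Suc j))\<^sup>2 / 4"
    using False by (simp add: dt_def power2_eq_square field_simps)
  then show ?thesis using alpha_difference[OF ij(1) j False] False j by (simp add: NY_def)
qed

end

subsection \<open>The energy estimate\<close>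

text \<open>A quarter of \<open>CA\<close>, because the deviations are halves of \<alpha> and
  \<gamma>. Each special line is charged from both sides, which gives 2 z. The 8 is 2 for the two
  directions, 2 for the two cells in each difference, and 2 from h^4 <= 2 h^3.\<close>

definition defect_const :: "real \<Rightarrow> real \<Rightarrow> real \<Rightarrow> real" where
  "defect_const B \<rho> z = 6 * (1 + B\<^sup>2 / \<rho>\<^sup>2) / 4 * (2 * z + 8)"

text \<open>The first summand belongs to the error minus the corrector, the second to the corrector
  itself. The outer factors contain the 2 from squaring the sum of these two parts.\<close>

definition error_const :: "real \<Rightarrow> real \<Rightarrow> real \<Rightarrow> real \<Rightarrow> real \<Rightarrow> real" where
  "error_const \<alpha>0 B r \<rho> z =
     4 / \<alpha>0 * ((\<rho> / 2 + 8 * B\<^sup>2 * r / \<alpha>0) * defect_const B \<rho> z + 8 * B\<^sup>2 / \<alpha>0) + 4 * r * defect_const B \<rho> z"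

lemma product_le_weighted:
  fixes x y w :: real assumes "w > 0" shows "x * y \<le> w / 4 * x\<^sup>2 + y\<^sup>2 / w"
proof -
  have "0 \<le> (w / 2 * x - y)\<^sup>2 / w" using assms by simp
  also have "\<dots> = w / 4 * x\<^sup>2 + y\<^sup>2 / w - x * y"
    using assms by (simp add: power2_eq_square field_simps)
  finally show ?thesis by simp
qed

lemma matrix_form_bound:
  fixes A :: "real^2^2" and v w :: "real^2" and \<alpha> B :: real
  assumes "\<alpha> > 0" "\<And>p q. \<bar>A $ p $ q\<bar> \<le> B"
  shows "\<bar>(A *v v) \<bullet> w\<bar> \<le> \<alpha> / 4 * (norm w)\<^sup>2 + 4 * B\<^sup>2 / \<alpha> * (norm v)\<^sup>2"
proof -
  have n: "(norm x)\<^sup>2 = (x $ 1)\<^sup>2 + (x $ 2)\<^sup>2" for x :: "real^2"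
    unfolding power2_norm_eq_inner inner_vec_def sum_2 by (simp add: power2_eq_square)
  let ?v = "\<bar>v $ 1\<bar> + \<bar>v $ 2\<bar>" and ?w = "\<bar>w $ 1\<bar> + \<bar>w $ 2\<bar>"
  have b: "\<bar>A $ p $ q * v $ q * w $ p\<bar> \<le> B * \<bar>v $ q\<bar> * \<bar>w $ p\<bar>" for p q
    unfolding abs_mult by (rule mult_right_mono[OF mult_right_mono[OF assms(2)]]) simp_all
  have "(A *v v) \<bullet> w = A $ 1 $ 1 * v $ 1 * w $ 1 + A $ 1 $ 2 * v $ 2 * w $ 1 +
      (A $ 2 $ 1 * v $ 1 * w $ 2 + A $ 2 $ 2 * v $ 2 * w $ 2)"
    unfolding mult_vec_inner2 by (simp only: distrib_right)
  then have "\<bar>(A *v v) \<bullet> w\<bar> \<le> B * \<bar>v $ 1\<bar> * \<bar>w $ 1\<bar> + B * \<bar>v $ 2\<bar> * \<bar>w $ 1\<bar> +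
      (B * \<bar>v $ 1\<bar> * \<bar>w $ 2\<bar> + B * \<bar>v $ 2\<bar> * \<bar>w $ 2\<bar>)"
    by (simp only:) (intro order_trans[OF abs_triangle_ineq add_mono] b)
  also have "\<dots> = ?w * (B * ?v)" by (simp add: algebra_simps)
  \<comment> \<open>Young's inequality with weight \<alpha> / 2, since replacing the sums of
    absolute values by norms costs another factor 2.\<close>
  also have "\<dots> \<le> (\<alpha> / 2) / 4 * ?w\<^sup>2 + (B * ?v)\<^sup>2 / (\<alpha> / 2)"
    by (rule product_le_weighted) (use assms in simp)
  also have "\<dots> \<le> (\<alpha> / 2) / 4 * (2 * (norm w)\<^sup>2) + B\<^sup>2 * (2 * (norm v)\<^sup>2) / (\<alpha> / 2)"
  proof -
    have "?w\<^sup>2 \<le> 2 * (norm w)\<^sup>2" "?v\<^sup>2 \<le> 2 * (norm v)\<^sup>2"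
      unfolding n using square_sum2[of "\<bar>w $ 1\<bar>" "\<bar>w $ 2\<bar>"] square_sum2[of "\<bar>v $ 1\<bar>" "\<bar>v $ 2\<bar>"] by simp_all
    then show ?thesis unfolding power_mult_distrib using assms(1)
      by (intro add_mono mult_left_mono divide_right_mono) auto
  qed
  also have "\<dots> = \<alpha> / 4 * (norm w)\<^sup>2 + 4 * B\<^sup>2 / \<alpha> * (norm v)\<^sup>2" by simp
  finally show ?thesis .
qed

context wg_estimate
begin

abbreviation total :: real where "total \<equiv> energy3 0 1 0 1"

definition bad :: real where "bad = real (card Zx + card Zy)"

lemma h_le_2: "h \<le> 2"
proof -
  obtain i j where ij: "i < nx M" "j < ny M" "h = sqrt ((X i)\<^sup>2 + (Y j)\<^sup>2)" by (rule mesh_size_attained)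
  have "0 \<le> X i" "X i \<le> 1" "0 \<le> Y j" "Y j \<le> 1" using cell_bounds[OF ij(1,2)] by auto
  then have "(X i)\<^sup>2 \<le> 1" "(Y j)\<^sup>2 \<le> 1" by (auto simp: power_le_one)
  then have "sqrt ((X i)\<^sup>2 + (Y j)\<^sup>2) \<le> 2" by (intro real_le_lsqrt) auto
  then show ?thesis using ij(3) by simp
qed

lemma h4_le: "h ^ 4 \<le> 2 * h ^ 3"
  using mult_right_mono[OF h_le_2, of "h ^ 3"] h_pos by (simp add: eval_nat_numeral)

lemma sum_strip_x: "(\<Sum>i<nx M. strip_x i) \<le> CA / 4 * h ^ 3 * total"
  unfolding strip_x_def sum_distrib_left[symmetric]
  using CA_nonneg h_pos by (intro mult_left_mono sum_rows_energy3) auto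

lemma sum_strip_y: "(\<Sum>j<ny M. strip_y j) \<le> CA / 4 * h ^ 3 * total"
  unfolding strip_y_def sum_distrib_left[symmetric]
  using CA_nonneg h_pos by (intro mult_left_mono sum_columns_energy3) auto

lemma sum_bad_x:
  assumes "inj_on \<sigma> {..<nx M}"
  shows "(\<Sum>(i, j)\<in>cells M. if \<sigma> i \<in> Zx then strip_y j else 0) \<le> real (card Zx) * (CA / 4 * h ^ 3 * total)"
proof -
  have "(\<Sum>(i, j)\<in>cells M. if \<sigma> i \<in> Zx then strip_y j else 0) \<le> (\<Sum>j<ny M. real (card Zx) * strip_y j)"
    unfolding sum_cells_rows by (intro sum_mono sum_bad_indices_le Z assms strip_y_nonneg)
  also have "\<dots> \<le> real (card Zx) * (CA / 4 * h ^ 3 * total)"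
    unfolding sum_distrib_left[symmetric] by (intro mult_left_mono sum_strip_y) auto
  finally show ?thesis .
qed

lemma sum_bad_y:
  assumes "inj_on \<sigma> {..<ny M}"
  shows "(\<Sum>(i, j)\<in>cells M. if \<sigma> j \<in> Zy then strip_x i else 0) \<le> real (card Zy) * (CA / 4 * h ^ 3 * total)"
proof -
  have "(\<Sum>(i, j)\<in>cells M. if \<sigma> j \<in> Zy then strip_x i else 0) \<le> (\<Sum>i<nx M. real (card Zy) * strip_x i)"
    unfolding sum_cells_columns by (intro sum_mono sum_bad_indices_le Z assms strip_x_nonneg)
  also have "\<dots> \<le> real (card Zy) * (CA / 4 * h ^ 3 * total)"
    unfolding sum_distrib_left[symmetric] by (intro mult_left_mono sum_strip_x) auto
  finally show ?thesis .
qed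

lemma shifted_sum_le:
  fixes F :: "nat \<Rightarrow> real"
  assumes "\<And>i. 0 \<le> F i" "F n = 0" shows "(\<Sum>i<n. F (Suc i)) \<le> (\<Sum>i<n. F i)"
proof -
  have "F 0 + (\<Sum>i<n. F (Suc i)) = (\<Sum>i<n. F i) + F n"
    by (metis sum.lessThan_Suc sum.lessThan_Suc_shift)
  then show ?thesis using assms(1)[of 0] assms(2) by simp
qed

lemma sum_NX: "(\<Sum>(i, j)\<in>cells M. NX i j + NX (Suc i) j) \<le> 2 * total"
proof -
  have "(\<Sum>i<nx M. NX i j + NX (Suc i) j) \<le> 2 * (\<Sum>i<nx M. N i j)" for j
  proof -
    have "(\<Sum>i<nx M. NX (Suc i) j) \<le> (\<Sum>i<nx M. NX i j)"
      by (rule shifted_sum_le) (auto simp: NX_def energy3_nonneg)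
    moreover have "(\<Sum>i<nx M. NX i j) = (\<Sum>i<nx M. N i j)" by (simp add: NX_def)
    ultimately show ?thesis by (simp add: sum.distrib)
  qed
  then have "(\<Sum>(i, j)\<in>cells M. NX i j + NX (Suc i) j) \<le> 2 * (\<Sum>(i, j)\<in>cells M. N i j)"
    unfolding sum_cells_rows sum_distrib_left[of 2 _ "{..<ny M}"] by (intro sum_mono)
  then show ?thesis using sum_N by simp
qed

lemma sum_NY: "(\<Sum>(i, j)\<in>cells M. NY i j + NY i (Suc j)) \<le> 2 * total"
proof -
  have "(\<Sum>j<ny M. NY i j + NY i (Suc j)) \<le> 2 * (\<Sum>j<ny M. N i j)" for i
  proof -
    have "(\<Sum>j<ny M. NY i (Suc j)) \<le> (\<Sum>j<ny M. NY i j)"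
      by (rule shifted_sum_le) (auto simp: NY_def energy3_nonneg)
    moreover have "(\<Sum>j<ny M. NY i j) = (\<Sum>j<ny M. N i j)" by (simp add: NY_def)
    ultimately show ?thesis by (simp add: sum.distrib)
  qed
  then have "(\<Sum>(i, j)\<in>cells M. NY i j + NY i (Suc j)) \<le> 2 * (\<Sum>(i, j)\<in>cells M. N i j)"
    unfolding sum_cells_columns sum_distrib_left[of 2 _ "{..<nx M}"] by (intro sum_mono)
  then show ?thesis using sum_N by simp
qed

lemma sum_cells_mono: "(\<And>i j. i < nx M \<Longrightarrow> j < ny M \<Longrightarrow> F i j \<le> G i j) \<Longrightarrow>
    (\<Sum>(i, j)\<in>cells M. F i j) \<le> (\<Sum>(i, j)\<in>cells M. G i j :: real)"
  by (intro sum_mono) (auto simp: cells_def)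

lemma sum_defect: "(\<Sum>(i, j)\<in>cells M. defect i j) \<le> defect_const B \<rho> bad * h ^ 3 * total"
proof -
  define c where "c = CA / 4 * h ^ 3 * total"
  have c4: "CA / 4 * h ^ 4 * total \<le> 2 * c"
  proof -
    have "CA / 4 * h ^ 4 * total \<le> CA / 4 * (2 * h ^ 3) * total"
      using CA_nonneg h4_le energy3_nonneg by (intro mult_right_mono mult_left_mono) auto
    also have "\<dots> = 2 * c" by (simp add: c_def)
    finally show ?thesis .
  qed
  have injs: "inj_on (xs M) {..<nx M}" "inj_on (\<lambda>i. xs M (Suc i)) {..<nx M}"
    "inj_on (ys M) {..<ny M}" "inj_on (\<lambda>j. ys M (Suc j)) {..<ny M}"
    using xs_inj ys_inj by (auto intro!: inj_onI) (metis Suc_leI nat.inject)+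
  have "(\<Sum>(i, j)\<in>cells M. defect i j) =
      (\<Sum>(i, j)\<in>cells M. (dl i j)\<^sup>2) + (\<Sum>(i, j)\<in>cells M. (dr i j)\<^sup>2) +
      (\<Sum>(i, j)\<in>cells M. (db i j)\<^sup>2) + (\<Sum>(i, j)\<in>cells M. (dt i j)\<^sup>2)"
    by (simp add: defect_def sum.distrib split_def)
  moreover have "(\<Sum>(i, j)\<in>cells M. (dl i j)\<^sup>2) \<le> real (card Zx) * c"
    using sum_cells_mono[OF dl_bound] sum_bad_x[OF injs(1)] unfolding c_def by (rule order_trans)
  moreover have "(\<Sum>(i, j)\<in>cells M. (db i j)\<^sup>2) \<le> real (card Zy) * c"
    using sum_cells_mono[OF db_bound] sum_bad_y[OF injs(3)] unfolding c_def by (rule order_trans)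
  moreover have "(\<Sum>(i, j)\<in>cells M. (dr i j)\<^sup>2) \<le> real (card Zx) * c + 4 * c"
  proof -
    have "(\<Sum>(i, j)\<in>cells M. (dr i j)\<^sup>2) \<le>
        (\<Sum>(i, j)\<in>cells M. (if xs M (Suc i) \<in> Zx then strip_y j else 0) + CA / 4 * h ^ 4 * (NX i j + NX (Suc i) j))"
      by (rule sum_cells_mono) (rule dr_bound)
    also have "\<dots> = (\<Sum>(i, j)\<in>cells M. if xs M (Suc i) \<in> Zx then strip_y j else 0) +
        CA / 4 * h ^ 4 * (\<Sum>(i, j)\<in>cells M. NX i j + NX (Suc i) j)"
      by (simp only: split_def sum.distrib sum_distrib_left[symmetric])
    also have "\<dots> \<le> real (card Zx) * c + CA / 4 * h ^ 4 * (2 * total)"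
      unfolding c_def using CA_nonneg h_pos
      by (intro add_mono sum_bad_x[OF injs(2)] mult_left_mono sum_NX) auto
    finally show ?thesis using c4 by (simp add: algebra_simps)
  qed
  moreover have "(\<Sum>(i, j)\<in>cells M. (dt i j)\<^sup>2) \<le> real (card Zy) * c + 4 * c"
  proof -
    have "(\<Sum>(i, j)\<in>cells M. (dt i j)\<^sup>2) \<le>
        (\<Sum>(i, j)\<in>cells M. (if ys M (Suc j) \<in> Zy then strip_x i else 0) + CA / 4 * h ^ 4 * (NY i j + NY i (Suc j)))"
      by (rule sum_cells_mono) (rule dt_bound)
    also have "\<dots> = (\<Sum>(i, j)\<in>cells M. if ys M (Suc j) \<in> Zy then strip_x i else 0) +
        CA / 4 * h ^ 4 * (\<Sum>(i, j)\<in>cells M. NY i j + NY i (Suc j))"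
      by (simp only: split_def sum.distrib sum_distrib_left[symmetric])
    also have "\<dots> \<le> real (card Zy) * c + CA / 4 * h ^ 4 * (2 * total)"
      unfolding c_def using CA_nonneg h_pos
      by (intro add_mono sum_bad_y[OF injs(4)] mult_left_mono sum_NY) auto
    finally show ?thesis using c4 by (simp add: algebra_simps)
  qed
  ultimately have "(\<Sum>(i, j)\<in>cells M. defect i j) \<le> (2 * bad + 8) * c"
    by (simp add: bad_def algebra_simps)
  then show ?thesis by (simp add: c_def CA_def defect_const_def mult_ac)
qed

definition grad_energy :: "(edge \<Rightarrow> real) \<Rightarrow> nat \<Rightarrow> nat \<Rightarrow> real" where
  "grad_energy b i j = X i * Y j * ((gx b i j)\<^sup>2 + (gy b i j)\<^sup>2)"

lemma norm_vec2: "(norm (vector [p, q] :: real^2))\<^sup>2 = p\<^sup>2 + q\<^sup>2"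
  unfolding power2_norm_eq_inner inner_vec_def sum_2 by (simp add: power2_eq_square)

text \<open>Slopes of the corrector are differences of opposite deviations, as the cell values of
  \<gamma> and \<alpha> cancel. The area leaves the ratios Y / X and X / Y, which quasi-uniformity
  bounds.\<close>

lemma corr_gradient:
  assumes ij: "i < nx M" "j < ny M" shows "grad_energy corr i j \<le> 2 * r * defect i j"
proof -
  note cb = cell_bounds[OF ij]
  have ratio: "Y j / X i \<le> r" "X i / Y j \<le> r"
    using r(2)[OF ij(1)] r(3)[OF ij(2)] X_le[OF ij(1)] Y_le[OF ij(2)] cb by (auto simp: divide_le_eq)
  have "grad_energy corr i j = Y j / X i * (dr i j + - dl i j)\<^sup>2 + X i / Y j * (dt i j + - db i j)\<^sup>2"
    using cb unfolding grad_energy_def gx_def gy_def dr_def dl_def dt_def db_def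
    by (simp add: power_divide power2_eq_square distrib_left)
  also have "\<dots> \<le> r * (2 * ((dr i j)\<^sup>2 + (- dl i j)\<^sup>2)) + r * (2 * ((dt i j)\<^sup>2 + (- db i j)\<^sup>2))"
    using ratio cb r(1) by (intro add_mono mult_mono square_sum2) auto
  also have "\<dots> = 2 * r * defect i j" by (simp add: defect_def algebra_simps)
  finally show ?thesis .
qed

lemma kappa_bounds:
  assumes ij: "i < nx M" "j < ny M" shows "0 \<le> kappa i j" "kappa i j \<le> h / 2"
proof -
  note cb = cell_bounds[OF ij]
  show "0 \<le> kappa i j" using cb by (simp add: kappa_def)
  have "X i * Y j \<le> h * (X i + Y j)"
    using cb X_le[OF ij(1)] h_pos mult_mono[of "X i" h "Y j" "X i + Y j"] by simp
  then show "kappa i j \<le> h / 2"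
    using cb by (simp add: kappa_def divide_le_eq algebra_simps)
qed

text \<open>What the corrector fails to remove, \<alpha> - \<gamma> - \<open>beta corr\<close>, is a
  signed sum of the four deviations. The square of \<open>beta\<close> appears with exactly the
  coefficient it has in \<open>form_coercive\<close>, and the gradient with half of its coefficient
  there, so both can be absorbed.\<close>

lemma corrected_cell_bound:
  fixes \<theta> :: "edge \<Rightarrow> real"
  assumes ij: "i < nx M" "j < ny M"
  shows "\<rho> / h * kappa i j * (\<alpha> i j - \<gamma> i j) * beta \<theta> i j + gx \<theta> i j * J2 i j + gy \<theta> i j * J1 i j - form corr \<theta> i j
    \<le> \<rho> / h * kappa i j * (beta \<theta> i j)\<^sup>2 + \<alpha>0 / 2 * grad_energy \<theta> i j +
      ((\<rho> / 2 + 8 * B\<^sup>2 * r / \<alpha>0) * defect i j + 4 * B\<^sup>2 / \<alpha>0 * h ^ 4 * N i j)"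
proof -
  note cb = cell_bounds[OF ij] and kb = kappa_bounds[OF ij]
  have c: "(i, j) \<in> cells M" using ij by (simp add: cells_def)
  define area where "area = X i * Y j"
  have area: "area > 0" using cb by (simp add: area_def)
  have grad_energy: "grad_energy b i j = area * ((gx b i j)\<^sup>2 + (gy b i j)\<^sup>2)" for b
    by (simp add: grad_energy_def area_def)
  define z where "z = \<alpha> i j - \<gamma> i j - beta corr i j"
  define m where "m = \<rho> / h * kappa i j"
  have m0: "0 \<le> m" using kb rho h_pos by (simp add: m_def)
  have m1: "m \<le> \<rho> / 2"
  proof -
    have "\<rho> / h * kappa i j \<le> \<rho> / h * (h / 2)" using kb rho h_pos by (intro mult_left_mono) auto
    then show ?thesis using h_pos by (simp add: m_def)
  qed
  have z: "z = (db i j + dt i j) + - (dl i j + dr i j)"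
    unfolding z_def beta_def dl_def dr_def db_def dt_def by simp
  have z2: "z\<^sup>2 \<le> 4 * defect i j"
  proof -
    have "z\<^sup>2 \<le> 2 * ((db i j + dt i j)\<^sup>2 + (- (dl i j + dr i j))\<^sup>2)" unfolding z by (rule square_sum2)
    also have "\<dots> \<le> 2 * (2 * ((db i j)\<^sup>2 + (dt i j)\<^sup>2) + 2 * ((dl i j)\<^sup>2 + (dr i j)\<^sup>2))"
      unfolding power2_minus by (intro mult_left_mono add_mono square_sum2) simp
    also have "\<dots> = 4 * defect i j" by (simp add: defect_def)
    finally show ?thesis .
  qed
  have t1: "m * z * beta \<theta> i j \<le> m * (beta \<theta> i j)\<^sup>2 + \<rho> / 2 * defect i j"
  proof -
    have "z * beta \<theta> i j \<le> z\<^sup>2 / 4 + (beta \<theta> i j)\<^sup>2"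
      using product_le_weighted[of 1 z "beta \<theta> i j"] by simp
    then have "m * (z * beta \<theta> i j) \<le> m * (z\<^sup>2 / 4 + (beta \<theta> i j)\<^sup>2)" using m0 by (rule mult_left_mono)
    moreover have "m * (z\<^sup>2 / 4) \<le> \<rho> / 2 * defect i j" using m0 m1 z2 by (intro mult_mono) auto
    ultimately show ?thesis by (simp add: algebra_simps)
  qed
  have tJ: "g * J \<le> \<alpha>0 / 4 * (area * g\<^sup>2) + 2 * B\<^sup>2 / \<alpha>0 * h ^ 4 * N i j"
    if J: "J\<^sup>2 \<le> 2 * B\<^sup>2 * (h ^ 4 * area) * N i j" for g J
  proof -
    have "g * J \<le> (\<alpha>0 * area) / 4 * g\<^sup>2 + J\<^sup>2 / (\<alpha>0 * area)"
      by (rule product_le_weighted) (use alpha0(1) area in simp)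
    also have "J\<^sup>2 / (\<alpha>0 * area) \<le> 2 * B\<^sup>2 * (h ^ 4 * area) * N i j / (\<alpha>0 * area)"
      using J alpha0(1) area by (intro divide_right_mono) auto
    also have "\<dots> = 2 * B\<^sup>2 / \<alpha>0 * h ^ 4 * N i j" using area by simp
    finally show ?thesis by (simp add: mult.assoc)
  qed
  have t2: "gx \<theta> i j * J2 i j + gy \<theta> i j * J1 i j \<le> \<alpha>0 / 4 * grad_energy \<theta> i j + 4 * B\<^sup>2 / \<alpha>0 * h ^ 4 * N i j"
    using tJ[of "J2 i j" "gx \<theta> i j"] tJ[of "J1 i j" "gy \<theta> i j"] J1_bound[OF ij] J2_bound[OF ij]
    by (simp add: area_def grad_energy_def algebra_simps)
  let ?v = "vector [gx corr i j, gy corr i j] :: real^2" and ?w = "vector [gx \<theta> i j, gy \<theta> i j] :: real^2"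
  have t3: "- (area * ((A (i, j) *v ?v) \<bullet> ?w)) \<le> \<alpha>0 / 4 * grad_energy \<theta> i j + 8 * B\<^sup>2 * r / \<alpha>0 * defect i j"
  proof -
    have "- ((A (i, j) *v ?v) \<bullet> ?w) \<le> \<alpha>0 / 4 * (norm ?w)\<^sup>2 + 4 * B\<^sup>2 / \<alpha>0 * (norm ?v)\<^sup>2"
      using matrix_form_bound[OF alpha0(1) B[OF c], of ?v ?w] by linarith
    from mult_left_mono[OF this less_imp_le[OF area]]
    have "- (area * ((A (i, j) *v ?v) \<bullet> ?w)) \<le> \<alpha>0 / 4 * grad_energy \<theta> i j + 4 * B\<^sup>2 / \<alpha>0 * grad_energy corr i j"
      unfolding norm_vec2 grad_energy by (simp add: algebra_simps)
    also have "4 * B\<^sup>2 / \<alpha>0 * grad_energy corr i j \<le> 4 * B\<^sup>2 / \<alpha>0 * (2 * r * defect i j)"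
      using corr_gradient[OF ij] alpha0(1) by (intro mult_left_mono) auto
    finally show ?thesis by (simp add: mult_ac)
  qed
  have "\<rho> / h * kappa i j * (\<alpha> i j - \<gamma> i j) * beta \<theta> i j - form corr \<theta> i j =
      m * z * beta \<theta> i j + - (area * ((A (i, j) *v ?v) \<bullet> ?w))"
    unfolding form_def m_def[symmetric] z_def area_def by (simp add: algebra_simps)
  then show ?thesis using t1 t2 t3 unfolding m_def[symmetric] by (simp add: algebra_simps)
qed

lemma form_coercive:
  assumes ij: "i < nx M" "j < ny M"
  shows "\<alpha>0 * grad_energy \<theta> i j + \<rho> / h * kappa i j * (beta \<theta> i j)\<^sup>2 \<le> form \<theta> \<theta> i j"
proof -
  let ?w = "vector [gx \<theta> i j, gy \<theta> i j] :: real^2"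
  have "\<alpha>0 * (norm ?w)\<^sup>2 \<le> (A (i, j) *v ?w) \<bullet> ?w"
    using alpha0(2)[of "(i, j)" ?w] ij by (simp add: cells_def inner_commute)
  then have "X i * Y j * (\<alpha>0 * (norm ?w)\<^sup>2) \<le> X i * Y j * ((A (i, j) *v ?w) \<bullet> ?w)"
    using cell_bounds[OF ij] by (intro mult_left_mono) auto
  then show ?thesis unfolding form_def grad_energy_def norm_vec2 by (simp add: power2_eq_square mult_ac)
qed

text \<open>The error equation is tested with \<theta>, the error minus the corrector, which
  vanishes on the boundary. Coercivity absorbs the terms in \<theta>, leaving the defect and the
  local energies; the corrector is added back with \<open>corr_gradient\<close>.\<close>

lemma error_bound: "(\<Sum>(i, j)\<in>cells M. grad_energy err i j) \<le> error_const \<alpha>0 B r \<rho> bad * h ^ 3 * total"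
proof -
  define \<theta> where "\<theta> e = err e - corr e" for e
  define k where "k = \<rho> / 2 + 8 * B\<^sup>2 * r / \<alpha>0"
  define l where "l = 4 * B\<^sup>2 / \<alpha>0"
  define dc where "dc = defect_const B \<rho> bad"
  let ?S = "\<lambda>F. \<Sum>(i, j)\<in>cells M. F i j"
  have k0: "0 \<le> k" and l0: "0 \<le> l" using rho alpha0(1) r(1) by (auto simp: k_def l_def)
  have th0: "\<forall>e\<in>bdry_edges M. \<theta> e = 0" using err_boundary corr_boundary by (simp add: \<theta>_def)
  have th_form: "form \<theta> \<theta> i j = form err \<theta> i j - form corr \<theta> i j" for i j
    unfolding \<theta>_def[abs_def] form_def gx_diff gy_diff beta_diff mult_vec_inner2 vector_2 by (simp add: algebra_simps)
  have "?S (\<lambda>i j. form \<theta> \<theta> i j) = ?S (\<lambda>i j. form err \<theta> i j) - ?S (\<lambda>i j. form corr \<theta> i j)"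
    unfolding th_form by (simp add: sum_subtractf split_def)
  also have "\<dots> = ?S (\<lambda>i j. \<rho> / h * kappa i j * (\<alpha> i j - \<gamma> i j) * beta \<theta> i j + gx \<theta> i j * J2 i j + gy \<theta> i j * J1 i j -
      form corr \<theta> i j)"
    unfolding error_equation[OF th0] by (simp add: sum_subtractf split_def)
  also have "\<dots> \<le> ?S (\<lambda>i j. \<rho> / h * kappa i j * (beta \<theta> i j)\<^sup>2 + \<alpha>0 / 2 * grad_energy \<theta> i j +
      (k * defect i j + l * h ^ 4 * N i j))"
    unfolding k_def l_def by (rule sum_cells_mono) (rule corrected_cell_bound)
  finally have up: "?S (\<lambda>i j. form \<theta> \<theta> i j) \<le> \<dots>" .
  have "?S (\<lambda>i j. \<alpha>0 * grad_energy \<theta> i j + \<rho> / h * kappa i j * (beta \<theta> i j)\<^sup>2) \<le> ?S (\<lambda>i j. form \<theta> \<theta> i j)"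
    by (rule sum_cells_mono) (rule form_coercive)
  moreover have "?S (\<lambda>i j. \<alpha>0 * grad_energy \<theta> i j + \<rho> / h * kappa i j * (beta \<theta> i j)\<^sup>2) =
      \<alpha>0 * ?S (grad_energy \<theta>) + ?S (\<lambda>i j. \<rho> / h * kappa i j * (beta \<theta> i j)\<^sup>2)"
    unfolding split_def sum.distrib sum_distrib_left ..
  moreover have "?S (\<lambda>i j. \<rho> / h * kappa i j * (beta \<theta> i j)\<^sup>2 + \<alpha>0 / 2 * grad_energy \<theta> i j +
      (k * defect i j + l * h ^ 4 * N i j)) =
      ?S (\<lambda>i j. \<rho> / h * kappa i j * (beta \<theta> i j)\<^sup>2) + \<alpha>0 / 2 * ?S (grad_energy \<theta>) +
      (k * ?S defect + l * h ^ 4 * ?S N)"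
    unfolding split_def sum.distrib sum_distrib_left ..
  ultimately have "\<alpha>0 / 2 * ?S (grad_energy \<theta>) \<le> k * ?S defect + l * h ^ 4 * ?S N"
    using up by linarith
  also have "\<dots> \<le> k * (dc * h ^ 3 * total) + l * (2 * h ^ 3) * total"
    using k0 l0 sum_defect sum_N h4_le h_pos energy3_nonneg
    by (intro add_mono mult_left_mono mult_mono) (auto simp: dc_def intro!: sum_nonneg mult_nonneg_nonneg)
  finally have th: "?S (grad_energy \<theta>) \<le> 2 / \<alpha>0 * ((k * dc + 2 * l) * h ^ 3 * total)"
    using alpha0(1) by (simp add: field_simps)
  have "grad_energy err i j \<le> 2 * grad_energy \<theta> i j + 2 * grad_energy corr i j" if ij: "i < nx M" "j < ny M" for i j
  proof -
    have e: "gx err i j = gx \<theta> i j + gx corr i j" "gy err i j = gy \<theta> i j + gy corr i j"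
      unfolding \<theta>_def[abs_def] gx_diff gy_diff by simp_all
    have "(gx err i j)\<^sup>2 + (gy err i j)\<^sup>2 \<le>
        2 * ((gx \<theta> i j)\<^sup>2 + (gx corr i j)\<^sup>2) + 2 * ((gy \<theta> i j)\<^sup>2 + (gy corr i j)\<^sup>2)"
      unfolding e by (intro add_mono square_sum2)
    then have "X i * Y j * ((gx err i j)\<^sup>2 + (gy err i j)\<^sup>2) \<le>
        X i * Y j * (2 * ((gx \<theta> i j)\<^sup>2 + (gx corr i j)\<^sup>2) + 2 * ((gy \<theta> i j)\<^sup>2 + (gy corr i j)\<^sup>2))"
      using cell_bounds[OF ij] by (intro mult_left_mono) auto
    then show ?thesis unfolding grad_energy_def by (simp add: algebra_simps)
  qed
  then have "?S (grad_energy err) \<le> ?S (\<lambda>i j. 2 * grad_energy \<theta> i j + 2 * (2 * r * defect i j))"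
    using corr_gradient by (intro sum_cells_mono) (smt (verit))
  also have "\<dots> = 2 * ?S (grad_energy \<theta>) + 4 * r * ?S defect"
    by (simp add: sum.distrib sum_distrib_left split_def mult.assoc)
  also have "\<dots> \<le> 2 * (2 / \<alpha>0 * ((k * dc + 2 * l) * h ^ 3 * total)) + 4 * r * (dc * h ^ 3 * total)"
    using th sum_defect r(1) unfolding dc_def by (intro add_mono mult_left_mono) auto
  also have "\<dots> = error_const \<alpha>0 B r \<rho> bad * h ^ 3 * total"
  proof -
    have "error_const \<alpha>0 B r \<rho> bad = 4 / \<alpha>0 * (k * dc + 2 * l) + 4 * r * dc"
      by (simp add: error_const_def k_def l_def dc_def)
    then show ?thesis by (simp add: algebra_simps)
  qed
  finally show ?thesis .
qed

lemma weak_gradient_error: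
  "sqrt (\<Sum>c\<in>cells M. \<integral>z. (norm (wgrad_b M (edge_error M u u_h) c))\<^sup>2 \<partial>lebesgue_on (elem M c))
    \<le> sqrt (error_const \<alpha>0 B r \<rho> bad) * h powr (3/2) * sobolev_norm 3 unit_square u"
proof -
  have "(\<Sum>c\<in>cells M. \<integral>z. (norm (wgrad_b M (edge_error M u u_h) c))\<^sup>2 \<partial>lebesgue_on (elem M c)) =
      (\<Sum>(i, j)\<in>cells M. grad_energy err i j)"
  proof (rule sum.cong[OF refl])
    fix c assume c: "c \<in> cells M"
    obtain i j where ij: "c = (i, j)" "i < nx M" "j < ny M" using c by (cases c) (auto simp: cells_def)
    have "wgrad_b M (edge_error M u u_h) (i, j) = vector [gx err i j, gy err i j]"
      unfolding err_eq wgrad_b_def wgrad_cell[OF ij(2,3)] by simp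
    then have "(\<integral>z. (norm (wgrad_b M (edge_error M u u_h) (i, j)))\<^sup>2 \<partial>lebesgue_on (elem M (i, j))) =
        (\<integral>z. ((gx err i j)\<^sup>2 + (gy err i j)\<^sup>2) * (ix i (fst z) * iy j (snd z)) \<partial>mu)"
      unfolding elem_integral[OF ij(2,3)] by (simp only: norm_vec2)
    also have "\<dots> = ((gx err i j)\<^sup>2 + (gy err i j)\<^sup>2) * (X i * Y j)"
      using xy.integral_rect[of "xs M i" "xs M (Suc i)" "ys M j" "ys M (Suc j)"] cell_bounds[OF ij(2,3)]
      by simp
    finally have "(\<integral>z. (norm (wgrad_b M (edge_error M u u_h) (i, j)))\<^sup>2 \<partial>lebesgue_on (elem M (i, j))) =
        ((gx err i j)\<^sup>2 + (gy err i j)\<^sup>2) * (X i * Y j)" .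
    then show "(\<integral>z. (norm (wgrad_b M (edge_error M u u_h) c))\<^sup>2 \<partial>lebesgue_on (elem M c)) =
        (case c of (i, j) \<Rightarrow> grad_energy err i j)"
      by (simp add: ij(1) grad_energy_def mult.commute)
  qed
  also have "\<dots> \<le> error_const \<alpha>0 B r \<rho> bad * h ^ 3 * (sobolev_norm 3 unit_square u)\<^sup>2"
    using error_bound unfolding energy3_square .
  finally have "sqrt (\<Sum>c\<in>cells M. \<integral>z. (norm (wgrad_b M (edge_error M u u_h) c))\<^sup>2 \<partial>lebesgue_on (elem M c))
      \<le> sqrt (error_const \<alpha>0 B r \<rho> bad * h ^ 3 * (sobolev_norm 3 unit_square u)\<^sup>2)"
    by (rule real_sqrt_le_mono)
  also have "\<dots> = sqrt (error_const \<alpha>0 B r \<rho> bad) * sqrt (h ^ 3) * sobolev_norm 3 unit_square u"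
  proof -
    have "0 \<le> sobolev_norm 3 unit_square u"
      unfolding sobolev_norm_def by (intro real_sqrt_ge_zero sum_nonneg) auto
    then show ?thesis by (simp add: real_sqrt_mult)
  qed
  also have "sqrt (h ^ 3) = h powr (3/2)"
  proof -
    have "h powr (3/2) = (h powr 3) powr (1/2)" by (simp only: powr_powr) simp
    also have "\<dots> = sqrt (h powr 3)" by (rule powr_half_sqrt) simp
    also have "h powr 3 = h ^ 3" using h_pos by (simp add: powr_numeral)
    finally show ?thesis by (rule sym)
  qed
  finally show ?thesis .
qed

end

section \<open>Uniformity of the constants over all meshes\<close>

lemma node_interval:
  fixes s :: "nat \<Rightarrow> real"
  assumes "s 0 < r" "r < s n" "\<forall>i\<le>n. r \<noteq> s i"
  shows "\<exists>i<n. s i < r \<and> r < s (Suc i)"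
  using assms(2,3)
proof (induction n)
  case 0
  then show ?case using assms(1) by simp
next
  case (Suc n)
  show ?case
  proof (cases "r < s n")
    case True
    then show ?thesis using Suc by (meson le_SucI less_SucI)
  next
    case False
    moreover have "r \<noteq> s n" using Suc.prems(2) by simp
    ultimately show ?thesis using Suc.prems(1) by (intro exI[of _ n]) auto
  qed
qed

lemma between_avoiding:
  fixes l r :: real assumes "finite F" "l < r" obtains y where "l < y" "y < r" "y \<notin> F"
proof -
  have "{l<..<r} - F \<noteq> {}"
    using Diff_infinite_finite[OF assms(1)] infinite_Ioo[OF assms(2)] by (metis finite.emptyI)
  then obtain y where "y \<in> {l<..<r} - F" by blast
  then show ?thesis using that[of y] by simp
qed

context rect_mesh
begin

abbreviation x_nodes :: "real set" where "x_nodes \<equiv> xs M ` {..nx M}"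
abbreviation y_nodes :: "real set" where "y_nodes \<equiv> ys M ` {..ny M}"

lemma x_interval:
  assumes "0 < r" "r < 1" "r \<notin> x_nodes" obtains i where "i < nx M" "xs M i < r" "r < xs M (Suc i)"
  using node_interval[of "xs M" r "nx M"] mesh assms by (auto simp: is_mesh_def)

lemma y_interval:
  assumes "0 < r" "r < 1" "r \<notin> y_nodes" obtains j where "j < ny M" "ys M j < r" "r < ys M (Suc j)"
  using node_interval[of "ys M" r "ny M"] mesh assms by (auto simp: is_mesh_def)

text \<open>At a height y off the horizontal lines of \<open>M0\<close>, the point on this vertical
  line is interior to a cell of \<open>M0\<close>, where \<open>a\<close> is constant. That cell
  contains points of both adjacent cells of \<open>M\<close>, so the two matrices agree.\<close>

lemma coefficient_across_vertical:
  assumes M0: "is_mesh M0" "piecewise_const M0 a"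
    and coeff: "\<And>c z. c \<in> cells M \<Longrightarrow> z \<in> interior (elem M c) \<Longrightarrow> a z = A c"
    and i: "Suc i < nx M" and j: "j < ny M" and x: "xs M (Suc i) \<notin> xs M0 ` {..nx M0}"
  shows "A (Suc i, j) = A (i, j)"
proof -
  interpret M0: rect_mesh M0 by unfold_locales (rule M0(1))
  note c1 = cell_bounds[of i j] and c2 = cell_bounds[of "Suc i" j]
  obtain y where y: "ys M j < y" "y < ys M (Suc j)" "y \<notin> ys M0 ` {..ny M0}"
    using between_avoiding[of "ys M0 ` {..ny M0}" "ys M j" "ys M (Suc j)"] ys_less[OF j] by auto
  obtain i0 where i0: "i0 < nx M0" "xs M0 i0 < xs M (Suc i)" "xs M (Suc i) < xs M0 (Suc i0)"
    using M0.x_interval[of "xs M (Suc i)"] x c1 c2 i j by auto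
  obtain j0 where j0: "j0 < ny M0" "ys M0 j0 < y" "y < ys M0 (Suc j0)"
    using M0.y_interval[of y] y c1 i j by auto
  have "(i0, j0) \<in> cells M0" using i0 j0 by (simp add: cells_def)
  then obtain A0 where A0: "\<And>z. z \<in> interior (elem M0 (i0, j0)) \<Longrightarrow> a z = A0"
    using M0(2) unfolding piecewise_const_def by blast
  have "max (xs M i) (xs M0 i0) < xs M (Suc i)" using c1(2) i j i0 by simp
  then obtain x1 where x1: "max (xs M i) (xs M0 i0) < x1" "x1 < xs M (Suc i)" using dense by blast
  have "xs M (Suc i) < min (xs M (Suc (Suc i))) (xs M0 (Suc i0))" using c2(2) i j i0 by simp
  then obtain x2 where x2: "xs M (Suc i) < x2" "x2 < min (xs M (Suc (Suc i))) (xs M0 (Suc i0))"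
    using dense by blast
  have "a (x1, y) = A (i, j)" "a (x2, y) = A (Suc i, j)"
    using x1 x2 y i j by (auto intro!: coeff simp: interior_elem cells_def)
  moreover have "a (x1, y) = A0" "a (x2, y) = A0"
    using x1 x2 i0 j0 by (auto intro!: A0 simp: M0.interior_elem)
  ultimately show ?thesis by simp
qed

lemma coefficient_across_horizontal:
  assumes M0: "is_mesh M0" "piecewise_const M0 a"
    and coeff: "\<And>c z. c \<in> cells M \<Longrightarrow> z \<in> interior (elem M c) \<Longrightarrow> a z = A c"
    and i: "i < nx M" and j: "Suc j < ny M" and y: "ys M (Suc j) \<notin> ys M0 ` {..ny M0}"
  shows "A (i, Suc j) = A (i, j)"
proof -
  interpret M0: rect_mesh M0 by unfold_locales (rule M0(1))
  note c1 = cell_bounds[of i j] and c2 = cell_bounds[of i "Suc j"]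
  obtain x where x: "xs M i < x" "x < xs M (Suc i)" "x \<notin> xs M0 ` {..nx M0}"
    using between_avoiding[of "xs M0 ` {..nx M0}" "xs M i" "xs M (Suc i)"] xs_less[OF i] by auto
  obtain j0 where j0: "j0 < ny M0" "ys M0 j0 < ys M (Suc j)" "ys M (Suc j) < ys M0 (Suc j0)"
    using M0.y_interval[of "ys M (Suc j)"] y c1 c2 i j by auto
  obtain i0 where i0: "i0 < nx M0" "xs M0 i0 < x" "x < xs M0 (Suc i0)"
    using M0.x_interval[of x] x c1 i j by auto
  have "(i0, j0) \<in> cells M0" using i0 j0 by (simp add: cells_def)
  then obtain A0 where A0: "\<And>z. z \<in> interior (elem M0 (i0, j0)) \<Longrightarrow> a z = A0"
    using M0(2) unfolding piecewise_const_def by blast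
  have "max (ys M j) (ys M0 j0) < ys M (Suc j)" using c1(5) i j j0 by simp
  then obtain y1 where y1: "max (ys M j) (ys M0 j0) < y1" "y1 < ys M (Suc j)" using dense by blast
  have "ys M (Suc j) < min (ys M (Suc (Suc j))) (ys M0 (Suc j0))" using c2(5) i j j0 by simp
  then obtain y2 where y2: "ys M (Suc j) < y2" "y2 < min (ys M (Suc (Suc j))) (ys M0 (Suc j0))"
    using dense by blast
  have "a (x, y1) = A (i, j)" "a (x, y2) = A (i, Suc j)"
    using y1 y2 x i j by (auto intro!: coeff simp: interior_elem cells_def)
  moreover have "a (x, y1) = A0" "a (x, y2) = A0"
    using y1 y2 i0 j0 by (auto intro!: A0 simp: M0.interior_elem)
  ultimately show ?thesis by simp
qed

text \<open>Every column crosses every row in a cell. Comparing a largest cell with the cell in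
  which its row or column meets a given column or row makes all widths and heights comparable to the
  mesh size: h <= X + Y <= (1 + \<sigma>) Y there, and Y is at most \<sigma> times the given
  width.\<close>

lemma shape_regular:
  assumes "aspect_bounded \<sigma> M"
  shows "\<sigma> > 0" "\<And>i. i < nx M \<Longrightarrow> mesh_size M \<le> \<sigma> * (1 + \<sigma>) * X i"
    "\<And>j. j < ny M \<Longrightarrow> mesh_size M \<le> \<sigma> * (1 + \<sigma>) * Y j"
proof -
  have asp: "X i \<le> \<sigma> * Y j" "Y j \<le> \<sigma> * X i" if "i < nx M" "j < ny M" for i j
    using assms that by (auto simp: aspect_bounded_def cells_def)
  have "0 < \<sigma> * Y 0" using asp(1)[OF nx_pos ny_pos] xs_less[OF nx_pos] by linarith
  then show \<sigma>: "\<sigma> > 0" using ys_less[OF ny_pos] by (simp add: zero_less_mult_iff)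
  obtain i' j' where c: "i' < nx M" "j' < ny M" "mesh_size M = sqrt ((X i')\<^sup>2 + (Y j')\<^sup>2)"
    by (rule mesh_size_attained)
  have h: "mesh_size M \<le> X i' + Y j'"
    unfolding c(3) using xs_less[OF c(1)] ys_less[OF c(2)] by (intro sqrt_sum_squares_le_sum) auto
  show "mesh_size M \<le> \<sigma> * (1 + \<sigma>) * X i" if i: "i < nx M" for i
  proof -
    have "X i' + Y j' \<le> (1 + \<sigma>) * Y j'" using asp(1)[OF c(1,2)] by (simp add: distrib_right)
    also have "\<dots> \<le> (1 + \<sigma>) * (\<sigma> * X i)" using asp(2)[OF i c(2)] \<sigma> by (intro mult_left_mono) auto
    finally show ?thesis using h by (simp add: mult.commute mult.left_commute)
  qed
  show "mesh_size M \<le> \<sigma> * (1 + \<sigma>) * Y j" if j: "j < ny M" for j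
  proof -
    have "X i' + Y j' \<le> (1 + \<sigma>) * X i'" using asp(2)[OF c(1,2)] by (simp add: distrib_right)
    also have "\<dots> \<le> (1 + \<sigma>) * (\<sigma> * Y j)" using asp(1)[OF c(1) j] \<sigma> by (intro mult_left_mono) auto
    finally show ?thesis using h by (simp add: mult.commute mult.left_commute)
  qed
qed

end

lemma hessian_bdry_norm_nonneg: "0 \<le> hessian_bdry_norm u"
  unfolding hessian_bdry_norm_def seg_integral_def
  by (intro real_sqrt_ge_zero sum_nonneg) (auto intro!: mult_nonneg_nonneg integral_nonneg_AE)

theorem theorem6p7:
  fixes a :: "real \<times> real \<Rightarrow> real^2^2" and \<rho> \<sigma> :: real
  assumes "elliptic_coeff a" and "\<rho> > 0"
  shows "\<exists>C>0. \<forall>M f g u u_h.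
    is_mesh M \<and> aspect_bounded \<sigma> M \<and> piecewise_const M a \<and>
    f \<in> L2 unit_square \<and> u \<in> sobolev 3 unit_square \<and> solves_bvp a f g u \<and>
    is_wg_solution \<rho> M a f g u_h \<longrightarrow>
    sqrt (\<Sum>c\<in>cells M. \<integral>z. (norm (wgrad_b M (edge_error M u u_h) c))\<^sup>2 \<partial>lebesgue_on (elem M c))
      \<le> C * mesh_size M powr (3/2) * (sobolev_norm 3 unit_square u + hessian_bdry_norm u)"
proof (cases "\<exists>M0. is_mesh M0 \<and> piecewise_const M0 a")
  case False
  then show ?thesis by (intro exI[of _ 1]) auto
next
  case True
  \<comment> \<open>Chosen before the mesh \<open>M\<close>, so that the constant may depend on the
    number of lines of \<open>M0\<close>. If no such mesh exists, no \<open>M\<close> satisfies the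
    hypotheses.\<close>
  then obtain M0 where M0: "is_mesh M0" "piecewise_const M0 a" by blast
  obtain B where B: "\<And>z p q. z \<in> unit_square \<Longrightarrow> \<bar>a z $ p $ q\<bar> \<le> B"
    using assms(1) unfolding elliptic_coeff_def by blast
  obtain \<alpha>0 where \<alpha>0: "\<alpha>0 > 0" "\<And>z \<xi>. z \<in> unit_square \<Longrightarrow> \<alpha>0 * (norm \<xi>)\<^sup>2 \<le> \<xi> \<bullet> (a z *v \<xi>)"
    using assms(1) unfolding elliptic_coeff_def by blast
  define Zx Zy where "Zx = xs M0 ` {..nx M0}" and "Zy = ys M0 ` {..ny M0}"
  define r where "r = \<sigma> * (1 + \<sigma>)"
  define k where "k = error_const \<alpha>0 B r \<rho> (real (card Zx + card Zy))"
  show ?thesis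
  \<comment> \<open>The absolute value and the summand 1 give a positive witness without knowing the
    sign of \<open>k\<close>; that \<open>r\<close> is positive follows only once a mesh with aspect
    bound \<sigma> is given.\<close>
  proof (intro exI[of _ "1 + sqrt \<bar>k\<bar>"] conjI allI impI; (elim conjE)?)
    show "0 < 1 + sqrt \<bar>k\<bar>" using real_sqrt_ge_zero[of "\<bar>k\<bar>"] by linarith
  next
    fix M f g u u_h
    assume hyp: "is_mesh M" "aspect_bounded \<sigma> M" "piecewise_const M a" "f \<in> L2 unit_square"
      "u \<in> sobolev 3 unit_square" "solves_bvp a f g u" "is_wg_solution \<rho> M a f g u_h"
    interpret rect_mesh M by unfold_locales (rule hyp(1))
    obtain A where A: "\<And>c z. c \<in> cells M \<Longrightarrow> z \<in> interior (elem M c) \<Longrightarrow> a z = A c"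
      using hyp(3) unfolding piecewise_const_def by metis
    \<comment> \<open>The bounds on \<open>a\<close> hold at points of the open square; evaluating
      at the centre of a cell transfers them to its matrix.\<close>
    have point: "\<exists>z\<in>unit_square. a z = A c" if "c \<in> cells M" for c
    proof -
      obtain i j where c: "c = (i, j)" "i < nx M" "j < ny M" using \<open>c \<in> cells M\<close> by (cases c) (auto simp: cells_def)
      have "((xs M i + xs M (Suc i)) / 2, (ys M j + ys M (Suc j)) / 2) \<in> interior (elem M c)"
        using cell_bounds[OF c(2,3)] by (simp add: c(1) interior_elem)
      then show ?thesis using interior_elem_subset[OF c(2,3)] A[OF that] c(1) by blast
    qed
    interpret wg_estimate M a f g u A \<rho> u_h \<alpha>0 B r Zx Zy
    proof unfold_locales
      show "\<alpha>0 * (norm \<xi>)\<^sup>2 \<le> \<xi> \<bullet> (A c *v \<xi>)" if "c \<in> cells M" for c \<xi>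
        using point[OF that] \<alpha>0(2) by metis
      show "\<bar>A c $ p $ q\<bar> \<le> B" if "c \<in> cells M" for c p q
        using point[OF that] B by metis
      show "r > 0" using shape_regular(1)[OF hyp(2)] by (simp add: r_def)
      show "mesh_size M \<le> r * (xs M (Suc i) - xs M i)" if "i < nx M" for i
        unfolding r_def by (rule shape_regular(2)[OF hyp(2) that])
      show "mesh_size M \<le> r * (ys M (Suc j) - ys M j)" if "j < ny M" for j
        unfolding r_def by (rule shape_regular(3)[OF hyp(2) that])
      show "0 \<in> Zx" "1 \<in> Zx" "0 \<in> Zy" "1 \<in> Zy"
        using M0(1) unfolding is_mesh_def Zx_def Zy_def by (metis atMost_iff imageI le0 order_refl)+
      show "A (Suc i, j) = A (i, j)" if "Suc i < nx M" "j < ny M" "xs M (Suc i) \<notin> Zx" for i j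
        by (rule coefficient_across_vertical[where A = A, OF M0 A that(1,2) that(3)[unfolded Zx_def]])
      show "A (i, Suc j) = A (i, j)" if "i < nx M" "Suc j < ny M" "ys M (Suc j) \<notin> Zy" for i j
        by (rule coefficient_across_horizontal[where A = A, OF M0 A that(1,2) that(3)[unfolded Zy_def]])
    qed (use A hyp assms(2) \<alpha>0(1) in \<open>auto simp: Zx_def Zy_def\<close>)
    let ?N = "sobolev_norm 3 unit_square u"
    have N: "0 \<le> ?N" unfolding sobolev_norm_def by (intro real_sqrt_ge_zero sum_nonneg) auto
    have "sqrt (\<Sum>c\<in>cells M. \<integral>z. (norm (wgrad_b M (edge_error M u u_h) c))\<^sup>2 \<partial>lebesgue_on (elem M c))
        \<le> sqrt k * h powr (3/2) * ?N"
      using weak_gradient_error unfolding k_def bad_def .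
    also have "\<dots> \<le> (1 + sqrt \<bar>k\<bar>) * h powr (3/2) * (?N + hessian_bdry_norm u)"
    proof -
      have "sqrt k \<le> 1 + sqrt \<bar>k\<bar>" using real_sqrt_le_mono[of k "\<bar>k\<bar>"] by linarith
      then have "sqrt k * (h powr (3/2) * ?N) \<le> (1 + sqrt \<bar>k\<bar>) * (h powr (3/2) * ?N)"
        using N by (intro mult_right_mono) auto
      also have "\<dots> \<le> (1 + sqrt \<bar>k\<bar>) * (h powr (3/2) * (?N + hessian_bdry_norm u))"
        using hessian_bdry_norm_nonneg[of u] by (intro mult_left_mono) (auto intro: add_nonneg_nonneg)
      finally show ?thesis by (simp only: mult.assoc)
    qed
    finally show "sqrt (\<Sum>c\<in>cells M. \<integral>z. (norm (wgrad_b M (edge_error M u u_h) c))\<^sup>2 \<partial>lebesgue_on (elem M c))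
        \<le> (1 + sqrt \<bar>k\<bar>) * mesh_size M powr (3/2) * (?N + hessian_bdry_norm u)" .
  qed
qed

end
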